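(* Let $b_1,\dots,b_6$ be complex numbers with $b_1\cdots b_6=q$, such that $b_i/b_j\notin q^{\mathbb Z}$ for $1\le i<j\le 6$ and $b_ib_j\notin q^{\mathbb Z}$ for $1\le i\le j\le 6$, and let $N_1,\dots,N_6$ be integers with $N_1+\dots+N_6=0$. Let $(c_1,\dots,c_6)$ be any permutation of $(b_1q^{N_1},\dots,b_6q^{N_6})$. With $Q_n(\,\cdot\,;\dots)$ Rahman's function defined in the context, let $$Q_n=Q_n\left(\tfrac{z+z^{-1}}2;b_1,b_2,b_3,b_4,b_5,b_6;q\right),\qquad R_n=Q_n\left(\tfrac{z+z^{-1}}2;b_1,b_2,b_3,b_4,b_6,b_5;q\right),$$ $$Q_n'=Q_n\left(\tfrac{z+z^{-1}}2;c_1,c_2,c_3,c_4,c_5,c_6;q\right),\qquad R_n'=Q_n\left(\tfrac{z+z^{-1}}2;c_1,c_2,c_3,c_4,c_6,c_5;q\right),$$ regarded as functions of $(z+z^{-1})/2$. Then, for all non-negative integers $n_1,n_2,m_1,m_2$, $$\sum_{x=-\infty}^\infty\oint\frac{(1-q^x z^2)(1-q^xz^{-2})}{q^xz^{6x}}\prod_{j=1}^6\frac{(q^{1+x/2}/b_jz,\,q^{1-x/2}z/b_j)_\infty}{(q^{N_j+x/2}b_jz,\,q^{N_j-x/2}b_j/z)_\infty}$$ $$\times (Q_{n_1}R_{m_1})\left(\frac{q^{-x/2}z+q^{x/2}z^{-1}}2\right)(Q_{n_2}'R_{m_2}')\left(\frac{q^{x/2}z+q^{-x/2}z^{-1}}2\right)\frac{dz}{2\pi\mathrm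 i z}$$ $$=\delta_{n_1m_1}\delta_{n_2m_2}\,\frac 2{\prod_{j=1}^6q^{\binom{N_j}2} b_j^{N_j}}\prod_{1\leq i<j\leq 6}\frac{(q/b_ib_j)_\infty}{(b_ib_jq^{N_i+N_j})_\infty}$$ $$\times\frac{1-1/b_5b_6}{1-q^{2n_1}/b_5b_6}\,\frac{(q)_{n_1}\prod_{1\leq i<j\leq 4}(b_ib_j)_{n_1}}{q^{n_1}(1/b_5b_6)_{n_1}}\cdot\frac{1-1/c_5c_6}{1-q^{2n_2}/c_5c_6}\,\frac{(q)_{n_2}\prod_{1\leq i<j\leq 4}(c_ic_j)_{n_2}}{q^{n_2}(1/c_5c_6)_{n_2}}.$$
   Context: Throughout, $q$ is a fixed complex number with $0<|q|<1$, with a fixed choice of square root $q^{1/2}$ (the base $q$ is suppressed from the notation). For $k\in\mathbb Z_{\ge 0}$, $(a)_k=(1-a)(1-aq)\cdots(1-aq^{k-1})$; $(a)_\infty=\prod_{j=0}^\infty(1-aq^j)$. Repeated arguments denote products, e.g. $(x,y)_k=(x)_k(y)_k$, also for $k=\infty$. A slash followed by a product means division by the whole product, e.g. $1/b_5b_6=1/(b_5b_6)$, $q^{1+x/2}/b_jz=q^{1+x/2}/(b_jz)$. The very-well-poised series is $${}_{r+1}W_{r}(a;\beta_1,\dots,\beta_{r-2};z)=\sum_{k=0}^\infty\frac{1-aq^{2k}}{1-a}\frac{(a,\beta_1,\dots,\beta_{r-2})_k}{(q,aq/\beta_1,\dots,aq/\beta_{r-2})_k}\,z^k.$$ For parameters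 with $b_1\cdots b_6=q$ and $n\in\mathbb Z_{\ge0}$, Rahman's function is $$Q_n\left(\frac{z+z^{-1}}2;b_1,\dots,b_6;q\right)=\frac{(b_1b_2,b_1b_3,b_1b_4,1/b_1b_6)_n}{(qb_1/b_5)_n}\;{}_{10}W_9\left(\frac{b_1}{b_5};\,b_1z,\ \frac{b_1}{z},\ \frac{q}{b_2b_5},\ \frac{q}{b_3b_5},\ \frac{q}{b_4b_5},\ \frac{q^n}{b_5b_6},\ q^{-n};\,q\right),$$ a rational function of $(z+z^{-1})/2$. For each $x$, the integration is over a positively oriented contour (depending on $x$ and on $n_1,n_2,m_1,m_2$) separating the geometric sequences of poles of the integrand tending to $0$ (inside the contour) from those tending to $\infty$ (outside); that is, poles of the form $z\in b_jq^{-x/2}q^{\mathbb Z}$ are inside and poles of the form $z\in b_j^{-1}q^{-x/2}q^{\mathbb Z}$ are outside. *)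

theory Defs
  imports "HOL-Complex_Analysis.Complex_Analysis" "HOL-Combinatorics.Permutations"
begin

definition qpoch :: "complex \<Rightarrow> complex \<Rightarrow> nat \<Rightarrow> complex" where
  "qpoch q a k = (\<Prod>j<k. 1 - a * q ^ j)"

definition qpoch_inf :: "complex \<Rightarrow> complex \<Rightarrow> complex" where
  "qpoch_inf q a = (\<Prod>j. 1 - a * q ^ j)"

text \<open>The series \<open>W(a; \<beta>\<^sub>1, \<dots>, \<beta>\<^sub>r\<^sub>-\<^sub>2; z)\<close>; its order \<open>r + 1\<close> is the length of the list
  of \<open>\<beta>\<^sub>i\<close> plus 3.\<close>

definition very_well_poised :: "complex \<Rightarrow> complex \<Rightarrow> complex list \<Rightarrow> complex \<Rightarrow> complex" where
  "very_well_poised q a bs z =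
     (\<Sum>k. (1 - a * q ^ (2 * k)) / (1 - a)
        * ((qpoch q a k * (\<Prod>\<beta>\<leftarrow>bs. qpoch q \<beta> k))
           / (qpoch q q k * (\<Prod>\<beta>\<leftarrow>bs. qpoch q (a * q / \<beta>) k)))
        * z ^ k)"

definition rahman_aux ::
  "complex \<Rightarrow> nat \<Rightarrow> complex \<Rightarrow> complex \<Rightarrow> complex \<Rightarrow> complex \<Rightarrow> complex \<Rightarrow> complex \<Rightarrow> complex \<Rightarrow> complex"
where
  "rahman_aux q n b1 b2 b3 b4 b5 b6 z =
     qpoch q (b1 * b2) n * qpoch q (b1 * b3) n * qpoch q (b1 * b4) n * qpoch q (1 / (b1 * b6)) n
       / qpoch q (q * b1 / b5) n
     * very_well_poised q (b1 / b5)
         [b1 * z, b1 / z, q / (b2 * b5), q / (b3 * b5), q / (b4 * b5),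
          q ^ n / (b5 * b6), q powi (- int n)] q"

text \<open>Rahman's function of the variable \<open>y = (z + 1/z) / 2\<close>. The value does not depend on which
  of the two solutions \<open>z\<close> is chosen (\<open>rahman_Q_joukowski\<close> below). At the finitely many poles
  in \<open>y\<close> the value is a meaningless one, caused by \<open>x / 0 = 0\<close>.\<close>

definition rahman_Q ::
  "complex \<Rightarrow> nat \<Rightarrow> complex \<Rightarrow> complex \<Rightarrow> complex \<Rightarrow> complex \<Rightarrow> complex \<Rightarrow> complex \<Rightarrow> complex \<Rightarrow> complex"
where
  "rahman_Q q n b1 b2 b3 b4 b5 b6 y =
     rahman_aux q n b1 b2 b3 b4 b5 b6 (SOME z. z \<noteq> 0 \<and> (z + inverse z) / 2 = y)"

lemma rahman_aux_inverse:
  "rahman_aux q n b1 b2 b3 b4 b5 b6 (inverse z) = rahman_aux q n b1 b2 b3 b4 b5 b6 z"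
  by (simp add: rahman_aux_def very_well_poised_def divide_inverse mult_ac)

lemma rahman_Q_joukowski:
  assumes "z \<noteq> 0"
  shows "rahman_Q q n b1 b2 b3 b4 b5 b6 ((z + inverse z) / 2) = rahman_aux q n b1 b2 b3 b4 b5 b6 z"
proof -
  define w where "w = (SOME w. w \<noteq> 0 \<and> (w + inverse w) / 2 = (z + inverse z) / 2)"
  have w: "w \<noteq> 0 \<and> (w + inverse w) / 2 = (z + inverse z) / 2"
    unfolding w_def by (rule someI[of _ z]) (use assms in simp)
  have "(w - z) * (w * z - 1) = w * z * ((w + inverse w) - (z + inverse z))"
    using w assms by (simp add: field_simps)
  also have "\<dots> = 0"
    using w by (metis divide_cancel_right mult_zero_right right_minus_eq zero_neq_numeral)
  finally have "w = z \<or> w = inverse z"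
    by (auto simp: inverse_unique mult.commute)
  then show ?thesis
    unfolding rahman_Q_def w_def[symmetric] by (auto simp: rahman_aux_inverse)
qed

text \<open>A closed contour (of general shape; positively oriented simple closed curves are included)
  that separates those poles of \<open>f\<close> that lie in \<open>A\<close> (inside) from those that lie in \<open>B\<close> (outside).
  The poles in \<open>A\<close> may accumulate at \<open>0\<close>, which therefore lies inside.\<close>

definition separating_contour ::
  "(complex \<Rightarrow> complex) \<Rightarrow> complex set \<Rightarrow> complex set \<Rightarrow> (real \<Rightarrow> complex) \<Rightarrow> bool"
where
  "separating_contour f A B \<gamma> \<longleftrightarrow>
     valid_path \<gamma> \<and> pathfinish \<gamma> = pathstart \<gamma> \<and>
     0 \<notin> path_image \<gamma> \<and> winding_number \<gamma> 0 = 1 \<and>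
     (\<forall>p. is_pole f p \<longrightarrow> p \<notin> path_image \<gamma>) \<and>
     (\<forall>p\<in>A. is_pole f p \<longrightarrow> winding_number \<gamma> p = 1) \<and>
     (\<forall>p\<in>B. is_pole f p \<longrightarrow> winding_number \<gamma> p = 0)"

text \<open>In the following, \<open>s\<close> is the chosen square root of \<open>q\<close>, so that \<open>s powi x\<close> is
  \<open>q\<^bsup>x/2\<^esup>\<close>. The factor \<open>1 / (2 \<pi> \<i> z)\<close> is part of the integrand.\<close>

definition biorth_integrand ::
  "complex \<Rightarrow> complex \<Rightarrow> (nat \<Rightarrow> complex) \<Rightarrow> (nat \<Rightarrow> int) \<Rightarrow> (nat \<Rightarrow> complex) \<Rightarrow>
   nat \<Rightarrow> nat \<Rightarrow> nat \<Rightarrow> nat \<Rightarrow> int \<Rightarrow> complex \<Rightarrow> complex"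
where
  "biorth_integrand q s b N c n1 m1 n2 m2 x z =
    (let Q = (\<lambda>n. rahman_Q q n (b 1) (b 2) (b 3) (b 4) (b 5) (b 6));
         R = (\<lambda>n. rahman_Q q n (b 1) (b 2) (b 3) (b 4) (b 6) (b 5));
         Q' = (\<lambda>n. rahman_Q q n (c 1) (c 2) (c 3) (c 4) (c 5) (c 6));
         R' = (\<lambda>n. rahman_Q q n (c 1) (c 2) (c 3) (c 4) (c 6) (c 5));
         u = (s powi (- x) * z + s powi x * inverse z) / 2;
         v = (s powi x * z + s powi (- x) * inverse z) / 2
     in (1 - q powi x * z ^ 2) * (1 - q powi x * z powi (- 2)) / (q powi x * z powi (6 * x))
        * (\<Prod>j=1..6.
             (qpoch_inf q (q * s powi x / (b j * z)) * qpoch_inf q (q * s powi (- x) * z / b j))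
             / (qpoch_inf q (q powi N j * s powi x * b j * z)
                * qpoch_inf q (q powi N j * s powi (- x) * b j / z)))
        * (Q n1 u * R m1 u) * (Q' n2 v * R' m2 v)
        * (1 / (2 * of_real pi * \<i> * z)))"

definition norm_factor :: "complex \<Rightarrow> (nat \<Rightarrow> complex) \<Rightarrow> nat \<Rightarrow> complex" where
  "norm_factor q b n =
     (1 - 1 / (b 5 * b 6)) / (1 - q ^ (2 * n) / (b 5 * b 6))
     * ((qpoch q q n * (\<Prod>i\<in>{1..4}. \<Prod>j\<in>{i<..4}. qpoch q (b i * b j) n))
        / (q ^ n * qpoch q (1 / (b 5 * b 6)) n))"

end

theory Submission
  imports Defs
begin

text \<open>
  \<^bold>\<open>Factorisation.\<close> Put \<open>y = q\<^sup>-\<^sup>x\<^sup>/\<^sup>2 z\<close> and \<open>w = q\<^sup>x\<^sup>/\<^sup>2 z = q\<^sup>x y\<close>. Without the Rahman functions, the integrand is,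
  up to a constant, \<open>W\<^sub>b(y) W\<^sub>c(w) E(y) / z\<close>. Here \<open>W\<^sub>b\<close> (\<open>weight\<close>) is a quotient of infinite products that
  vanishes at the origin, and \<open>E\<close> (\<open>ell\<close>) is a quotient of theta functions, elliptic with period \<open>q\<close> because
  \<open>b\<^sub>1 \<cdots> b\<^sub>6 = q\<close>. The factor \<open>q\<^sup>-\<^sup>x z\<^sup>-\<^sup>6\<^sup>x\<close> is what makes the quasi-periods of the theta functions cancel
  (\<open>kernel_eq\<close>). The poles inside the contour are those of \<open>E\<close>, at \<open>b\<^sub>j q\<^sup>k\<close>. As the weights vanish at the
  origin, the integral is the sum of the residues there (\<open>elliptic_contour_integral\<close>), namely a sum over
  \<open>j\<close> and \<open>k\<close> of \<open>\<nu>\<^sub>j W\<^sub>b(b\<^sub>j q\<^sup>k) W\<^sub>c(b\<^sub>j q\<^sup>k\<^sup>+\<^sup>x)\<close>. Summation over \<open>x\<close> decouples the two lattice sums, and what remains is a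
  sum \<open>H(B, C)\<close> of six products \<open>\<nu>\<^sub>j J\<^sub>j(b q\<^sup>B) J\<^sub>j(b q\<^sup>C)\<close> (\<open>hsum\<close>).

  \<^bold>\<open>The total mass.\<close> The lattice sums \<open>J\<^sub>j\<close> satisfy a contiguous relation whose inhomogeneous term is the
  same for all \<open>j\<close> (\<open>jackson_contiguous\<close>). That term drops out, because \<open>\<Sum> \<nu>\<^sub>j J\<^sub>j = 0\<close>
  (\<open>nu_jackson_sum_0\<close>). Hence \<open>H(B, C) = H(0, 0) r(B) r(C) / r(0)\<^sup>2\<close> with an explicit product \<open>r\<close> (\<open>rfac\<close>).
  Consequently \<open>H(0, 0)\<close>, divided by the expected product, is invariant under integer shifts of the parameters. If two
  parameters vary with constant product, it becomes a function on a torus. Its singularities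
  are removable: those at products \<open>b\<^sub>i b\<^sub>j\<close> by invariance under shifts, those at coinciding parameters by
  symmetry. So it is constant, and two parameters of product 1 give its value
  (\<open>hsum_evaluation\<close>).

  \<^bold>\<open>The Rahman functions.\<close> A product \<open>Q\<^sub>n R\<^sub>m\<close>, times \<open>W\<^sub>b\<close>, is a finite combination of the weights for shifted
  parameters. By the formula for \<open>H(B, C)\<close>, only the sum of its coefficients weighted by \<open>r\<close>
  matters, and this separates the two pairs of functions. To compute it, \<open>Q\<^sub>n\<close> is expanded in quotients of
  factorials that transfer powers of \<open>q\<close> from \<open>b\<^sub>5\<close> to \<open>b\<^sub>1\<close>, and \<open>R\<^sub>m\<close> is re-expanded in quotients that transfer
  them from \<open>b\<^sub>6\<close> to \<open>b\<^sub>2\<close>. For each term of \<open>R\<^sub>m\<close> the sum over the terms of \<open>Q\<^sub>n\<close> is a terminating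
  very-well-poised series. Such a series is a divided difference of order \<open>n\<close>; it is applied to a polynomial of
  lower degree if \<open>m < n\<close>, and it can be evaluated if \<open>m = n\<close> (\<open>reweights_rahman\<close>). The case
  \<open>m > n\<close> follows by interchanging \<open>b\<^sub>5\<close> and \<open>b\<^sub>6\<close>.
\<close>

section \<open>Infinite q-shifted factorials and the theta function\<close>

locale nome =
  fixes q :: complex
  assumes q_nz: "q \<noteq> 0" and q_lt1: "norm q < 1"
begin

lemma q_pow_neq_1: "0 < n \<Longrightarrow> q ^ n \<noteq> 1"
  by (metis norm_one norm_power power_less_one_iff norm_ge_zero q_lt1 less_irrefl)

lemma q_powi_eq_1_iff: "q powi k = 1 \<longleftrightarrow> k = 0"
proof
  assume 1: "q powi k = 1"
  show "k = 0"
  proof (rule ccontr)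
    assume "k \<noteq> 0"
    then have "0 < nat \<bar>k\<bar>" by simp
    moreover have "q ^ nat \<bar>k\<bar> = 1"
    proof (cases "0 \<le> k")
      case True
      then show ?thesis using 1 by (simp add: power_int_def)
    next
      case False
      then have "inverse (q ^ nat (-k)) = 1"
        using 1 by (simp add: power_int_def power_inverse)
      then show ?thesis using False by (simp add: inverse_eq_iff_eq[of _ 1, simplified])
    qed
    ultimately show False using q_pow_neq_1 by blast
  qed
qed simp

lemma q_powi_inj: "q powi k = q powi l \<longleftrightarrow> k = l"
proof -
  have "q powi k = q powi l \<longleftrightarrow> q powi (k - l) = 1"
    using q_nz by (simp add: power_int_diff divide_eq_1_iff)
  then show ?thesis by (simp add: q_powi_eq_1_iff)
qed

text \<open>Uniform convergence on bounded sets makes the infinite product an entire function of its argument.\<close>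

lemma uniform_limit_qpoch:
  assumes "compact A"
  shows "uniform_limit A (\<lambda>n x. qpoch q x n) (qpoch_inf q) sequentially"
proof -
  have uc: "uniformly_convergent_on A (\<lambda>N x. \<Prod>n<N. 1 - x * q ^ n)"
  proof (rule uniformly_convergent_on_prod')
    obtain B where B: "\<And>x. x \<in> A \<Longrightarrow> norm x \<le> B"
      using compact_imp_bounded[OF assms] unfolding bounded_iff by blast
    show "uniformly_convergent_on A (\<lambda>N x. \<Sum>n<N. norm (1 - x * q ^ n - 1))"
    proof (rule Weierstrass_m_test')
      show "norm (norm (1 - x * q ^ n - 1)) \<le> B * norm q ^ n" if "x \<in> A" for n x
        using B[OF that] by (simp add: norm_mult norm_power mult_right_mono)
      show "summable (\<lambda>n. B * norm q ^ n)"
        using q_lt1 by (intro summable_mult summable_geometric) simp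
    qed
  qed (use assms in \<open>auto intro!: continuous_intros\<close>)
  have lim: "(\<lambda>n. qpoch q x n) \<longlonglongrightarrow> qpoch_inf q x" for x
  proof -
    have "summable (\<lambda>n. norm x * norm q ^ n)"
      using q_lt1 by (intro summable_mult summable_geometric) simp
    then have "summable (\<lambda>n. norm (- (x * q ^ n)))"
      by (simp add: norm_mult norm_power)
    then have "abs_convergent_prod (\<lambda>n. 1 - x * q ^ n)"
      by (simp add: abs_convergent_prod_conv_summable)
    then have "convergent_prod (\<lambda>n. 1 - x * q ^ n)"
      by (rule abs_convergent_prod_imp_convergent_prod)
    from convergent_prod_LIMSEQ[OF this]
    have "(\<lambda>n. \<Prod>i<Suc n. 1 - x * q ^ i) \<longlonglongrightarrow> qpoch_inf q x"
      by (simp add: qpoch_inf_def lessThan_Suc_atMost)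
    then have "(\<lambda>n. \<Prod>i<n. 1 - x * q ^ i) \<longlonglongrightarrow> qpoch_inf q x"
      by (subst (asm) filterlim_sequentially_Suc)
    then show ?thesis by (simp add: qpoch_def)
  qed
  have "uniform_limit A (\<lambda>n x. qpoch q x n) (\<lambda>x. lim (\<lambda>n. qpoch q x n)) sequentially"
    using uc by (simp add: uniformly_convergent_uniform_limit_iff qpoch_def)
  moreover have "(\<lambda>x. lim (\<lambda>n. qpoch q x n)) = qpoch_inf q"
    using lim by (simp add: limI fun_eq_iff)
  ultimately show ?thesis by simp
qed

lemma qpoch_inf_LIMSEQ: "(\<lambda>n. qpoch q x n) \<longlonglongrightarrow> qpoch_inf q x"
  using uniform_limit_qpoch[of "{x}"] by (simp add: tendsto_uniform_limitI)

lemma holomorphic_qpoch_inf: "qpoch_inf q holomorphic_on S"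
proof -
  have "qpoch_inf q holomorphic_on UNIV"
  proof (rule holomorphic_uniform_sequence[OF open_UNIV])
    show "(\<lambda>x. qpoch q x n) holomorphic_on UNIV" for n
      unfolding qpoch_def by (intro holomorphic_intros)
    show "\<exists>d>0. cball x d \<subseteq> UNIV \<and>
        uniform_limit (cball x d) (\<lambda>n x. qpoch q x n) (qpoch_inf q) sequentially" for x
      by (intro exI[of _ 1]) (auto intro!: uniform_limit_qpoch)
  qed
  then show ?thesis by (rule holomorphic_on_subset) simp
qed

lemma holomorphic_qpoch_inf' [holomorphic_intros]:
  "f holomorphic_on S \<Longrightarrow> (\<lambda>x. qpoch_inf q (f x)) holomorphic_on S"
  using holomorphic_on_compose[OF _ holomorphic_qpoch_inf, of f S] by (simp add: o_def)

lemma analytic_qpoch_inf [analytic_intros]: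
  "f analytic_on S \<Longrightarrow> (\<lambda>x. qpoch_inf q (f x)) analytic_on S"
  using analytic_on_compose[of f S "qpoch_inf q"] holomorphic_qpoch_inf
  by (simp add: o_def analytic_on_open[OF open_UNIV] analytic_on_holomorphic) blast

lemma continuous_on_qpoch_inf [continuous_intros]:
  "continuous_on S f \<Longrightarrow> continuous_on S (\<lambda>x. qpoch_inf q (f x))"
  using continuous_on_compose[OF _ holomorphic_on_imp_continuous_on[OF holomorphic_qpoch_inf], of S f]
  by (simp add: o_def)

lemma tendsto_qpoch_inf [tendsto_intros]:
  "(f \<longlongrightarrow> a) F \<Longrightarrow> ((\<lambda>x. qpoch_inf q (f x)) \<longlongrightarrow> qpoch_inf q a) F"
  by (rule continuous_on_tendsto_compose[OF holomorphic_on_imp_continuous_on[OF holomorphic_qpoch_inf, of UNIV]]) auto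

lemma qpoch_0 [simp]: "qpoch q a 0 = 1"
  by (simp add: qpoch_def)

lemma qpoch_Suc: "qpoch q a (Suc n) = qpoch q a n * (1 - a * q ^ n)"
  by (simp add: qpoch_def)

lemma qpoch_Suc': "qpoch q a (Suc n) = (1 - a) * qpoch q (a * q) n"
  unfolding qpoch_def by (subst prod.lessThan_Suc_shift) (simp add: mult.assoc)

lemma qpoch_add: "qpoch q a (m + n) = qpoch q a m * qpoch q (a * q ^ m) n"
  by (induction n) (simp_all add: qpoch_Suc power_add mult_ac)

lemma qpoch_inf_split: "qpoch_inf q a = qpoch q a n * qpoch_inf q (a * q ^ n)"
proof -
  have "(\<lambda>k. qpoch q a (n + k)) \<longlonglongrightarrow> qpoch_inf q a"
    using LIMSEQ_ignore_initial_segment[OF qpoch_inf_LIMSEQ, of a n] by (simp add: add.commute)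
  moreover have "(\<lambda>k. qpoch q a (n + k)) \<longlonglongrightarrow> qpoch q a n * qpoch_inf q (a * q ^ n)"
    unfolding qpoch_add by (intro tendsto_intros qpoch_inf_LIMSEQ)
  ultimately show ?thesis by (rule LIMSEQ_unique)
qed

lemma qpoch_inf_step: "qpoch_inf q a = (1 - a) * qpoch_inf q (q * a)"
  using qpoch_inf_split[of a 1] by (simp add: qpoch_def mult.commute)

lemma qpoch_inf_0 [simp]: "qpoch_inf q 0 = 1"
  using LIMSEQ_unique[OF qpoch_inf_LIMSEQ[of 0], of 1] by (simp add: qpoch_def)

lemma qpoch_eq_0_iff: "qpoch q a n = 0 \<longleftrightarrow> (\<exists>k<n. a * q ^ k = 1)"
  by (auto simp: qpoch_def)

lemma qpoch_inf_eq_0_iff: "qpoch_inf q a = 0 \<longleftrightarrow> (\<exists>k. a * q ^ k = 1)"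
proof
  assume 0: "qpoch_inf q a = 0"
  have "eventually (\<lambda>n. norm a * norm q ^ n < 1) sequentially"
  proof -
    have "(\<lambda>n. norm a * norm q ^ n) \<longlonglongrightarrow> norm a * 0"
      using q_lt1 by (intro tendsto_intros LIMSEQ_realpow_zero) auto
    then show ?thesis by (auto simp: order_tendsto_iff)
  qed
  have "convergent_prod (\<lambda>n. 1 - a * q ^ n)"
  proof (rule abs_convergent_prod_imp_convergent_prod)
    have "summable (\<lambda>n. norm a * norm q ^ n)"
      using q_lt1 by (intro summable_mult summable_geometric) simp
    then have "summable (\<lambda>n. norm (- (a * q ^ n)))"
      by (simp add: norm_mult norm_power)
    then show "abs_convergent_prod (\<lambda>n. 1 - a * q ^ n)"
      by (simp add: abs_convergent_prod_conv_summable)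
  qed
  from prodinf_nonzero[OF this] 0 have "\<exists>n. 1 - a * q ^ n = 0"
    by (auto simp: qpoch_inf_def)
  then show "\<exists>k. a * q ^ k = 1" by auto
next
  assume "\<exists>k. a * q ^ k = 1"
  then obtain k where "a * q ^ k = 1" by blast
  then have "qpoch q a (Suc k) = 0" by (auto simp: qpoch_eq_0_iff)
  then show "qpoch_inf q a = 0" by (subst qpoch_inf_split[of _ "Suc k"]) simp
qed

lemma qpoch_inf_q_nz: "qpoch_inf q q \<noteq> 0"
proof -
  have "q * q ^ k \<noteq> 1" for k using q_pow_neq_1[of "Suc k"] by simp
  then show ?thesis by (auto simp: qpoch_inf_eq_0_iff)
qed

lemma norm_qpoch_le: "norm (qpoch q a n) \<le> exp (norm a / (1 - norm q))"
proof -
  have "norm (qpoch q a n) \<le> (\<Prod>j<n. exp (norm a * norm q ^ j))"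
    unfolding qpoch_def
  proof (subst prod_norm [symmetric], rule prod_mono, safe)
    fix j
    have "norm (1 - a * q ^ j) \<le> 1 + norm a * norm q ^ j"
      by (metis norm_mult norm_one norm_power norm_triangle_ineq4)
    also have "\<dots> \<le> exp (norm a * norm q ^ j)" by (rule exp_ge_add_one_self)
    finally show "norm (1 - a * q ^ j) \<le> exp (norm a * norm q ^ j)" .
  qed auto
  also have "\<dots> = exp (norm a * (\<Sum>j<n. norm q ^ j))"
    by (simp add: exp_sum sum_distrib_left)
  also have "(\<Sum>j<n. norm q ^ j) \<le> (\<Sum>j. norm q ^ j)"
    using q_lt1 by (intro sum_le_suminf summable_geometric) auto
  then have "exp (norm a * (\<Sum>j<n. norm q ^ j)) \<le> exp (norm a / (1 - norm q))"
    using q_lt1 suminf_geometric[of "norm q"] mult_left_mono[of _ _ "norm a"] by (fastforce simp: divide_inverse)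
  finally show ?thesis .
qed

definition theta :: "complex \<Rightarrow> complex" where
  "theta x = qpoch_inf q x * qpoch_inf q (q / x)"

text \<open>The exceptional values, at which the theta function vanishes.\<close>

definition qZ :: "complex set" where
  "qZ = range (\<lambda>k::int. q powi k)"

lemma qZ_powi [simp]: "q powi k \<in> qZ" by (auto simp: qZ_def)

lemma qZ_1 [simp]: "1 \<in> qZ" using qZ_powi[of 0] by simp

lemma qZ_mult_powi_iff [simp]: "x * q powi k \<in> qZ \<longleftrightarrow> x \<in> qZ"
proof
  assume "x * q powi k \<in> qZ"
  then obtain l where "x * q powi k = q powi l" by (auto simp: qZ_def)
  then have "x = q powi (l - k)" using q_nz by (simp add: power_int_diff field_simps)
  then show "x \<in> qZ" by simp
next
  assume "x \<in> qZ"
  then obtain l where "x = q powi l" by (auto simp: qZ_def)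
  then have "x * q powi k = q powi (l + k)" using q_nz by (simp add: power_int_add)
  then show "x * q powi k \<in> qZ" by simp
qed

lemma qZ_mult: "x \<in> qZ \<Longrightarrow> y \<in> qZ \<Longrightarrow> x * y \<in> qZ"
  using q_nz by (auto simp: qZ_def simp flip: power_int_add)

lemma qZ_inverse: "x \<in> qZ \<Longrightarrow> inverse x \<in> qZ"
  by (auto simp: qZ_def simp flip: power_int_minus)

lemma qZ_divide: "x \<in> qZ \<Longrightarrow> y \<in> qZ \<Longrightarrow> x / y \<in> qZ"
  by (simp add: divide_inverse qZ_mult qZ_inverse)

lemma qZ_nz: "x \<in> qZ \<Longrightarrow> x \<noteq> 0"
  using q_nz by (auto simp: qZ_def)

lemma qpoch_inf_nz: "x \<notin> qZ \<Longrightarrow> qpoch_inf q x \<noteq> 0"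
proof
  assume "x \<notin> qZ" "qpoch_inf q x = 0"
  then obtain k where "x * q ^ k = 1" by (auto simp: qpoch_inf_eq_0_iff)
  then have "x = q powi (- int k)" using q_nz by (simp add: power_int_minus field_simps)
  with \<open>x \<notin> qZ\<close> show False by simp
qed

lemma qpoch_nz: "x \<notin> qZ \<Longrightarrow> qpoch q x n \<noteq> 0"
  using qpoch_inf_nz[of x] qpoch_inf_split[of x n] by auto

lemma qpoch_inf_div_nz: "x \<notin> qZ \<Longrightarrow> qpoch_inf q (q / x) \<noteq> 0"
proof -
  assume x: "x \<notin> qZ"
  have "q / x \<notin> qZ"
  proof
    assume "q / x \<in> qZ"
    from qZ_divide[OF qZ_powi[of 1] this] show False using x q_nz by simp
  qed
  then show ?thesis by (rule qpoch_inf_nz)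
qed

lemma theta_nz: "x \<notin> qZ \<Longrightarrow> theta x \<noteq> 0"
  by (simp add: theta_def qpoch_inf_nz qpoch_inf_div_nz)

lemma theta_q_mult: "x \<noteq> 0 \<Longrightarrow> theta (q * x) = - theta x / x"
proof -
  assume x: "x \<noteq> 0"
  have 1: "theta (q * x) = qpoch_inf q (q * x) * ((1 - 1 / x) * qpoch_inf q (q / x))"
    using qpoch_inf_step[of "1 / x"] q_nz by (simp add: theta_def)
  have 2: "theta x = (1 - x) * qpoch_inf q (q * x) * qpoch_inf q (q / x)"
    using qpoch_inf_step[of x] by (simp add: theta_def)
  show ?thesis unfolding 1 2 using x by (simp add: field_simps)
qed

lemma theta_div_q: "x \<noteq> 0 \<Longrightarrow> theta (x / q) = - (x / q) * theta x"
  using theta_q_mult[of "x / q"] q_nz by (simp add: field_simps)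

lemma theta_inverse: "x \<noteq> 0 \<Longrightarrow> theta (1 / x) = - theta x / x"
  using theta_q_mult[of x] q_nz by (simp add: theta_def mult.commute)

lemma holomorphic_theta [holomorphic_intros]:
  "f holomorphic_on S \<Longrightarrow> (\<And>x. x \<in> S \<Longrightarrow> f x \<noteq> 0) \<Longrightarrow> (\<lambda>x. theta (f x)) holomorphic_on S"
  unfolding theta_def by (intro holomorphic_intros)

lemma analytic_theta [analytic_intros]:
  "f analytic_on S \<Longrightarrow> (\<And>x. x \<in> S \<Longrightarrow> f x \<noteq> 0) \<Longrightarrow> (\<lambda>x. theta (f x)) analytic_on S"
  unfolding theta_def by (intro analytic_intros)

lemma tendsto_theta [tendsto_intros]:
  "(f \<longlongrightarrow> a) F \<Longrightarrow> a \<noteq> 0 \<Longrightarrow> ((\<lambda>x. theta (f x)) \<longlongrightarrow> theta a) F"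
  unfolding theta_def by (intro tendsto_intros)

end

section \<open>Six parameters, their integer shifts, and products over pairs\<close>

text \<open>A constant in place of the interval, so that sums and products over the six indices are not expanded
  unintentionally.\<close>

definition I6 :: "nat set" where "I6 = {1..6}"

lemma finite_I6 [simp, intro]: "finite I6" by (simp add: I6_def)

lemma I6_eq: "I6 = {1, 2, 3, 4, 5, 6}"
  by (auto simp: I6_def)

lemma prod_I6: "(\<Prod>i\<in>I6. f i) = f 1 * f 2 * f 3 * f 4 * f 5 * (f 6 :: 'a :: comm_monoid_mult)"
  by (simp add: I6_eq mult_ac)

definition pair_prod :: "(nat \<Rightarrow> nat \<Rightarrow> 'a) \<Rightarrow> 'a :: comm_monoid_mult" where
  "pair_prod f = (\<Prod>i\<in>I6. \<Prod>j\<in>{i<..6}. f i j)"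

lemma pair_prod_eq: "pair_prod f =
    f 1 2 * f 1 3 * f 1 4 * f 1 5 * f 1 6 * f 2 3 * f 2 4 * f 2 5 * f 2 6
    * f 3 4 * f 3 5 * f 3 6 * f 4 5 * f 4 6 * f 5 6"
proof -
  have "{1<..6} = {2,3,4,5,6::nat}" "{2<..6} = {3,4,5,6::nat}" "{3<..6} = {4,5,6::nat}"
       "{4<..6} = {5,6::nat}" "{5<..6} = {6::nat}" "{6<..6} = ({}::nat set)" by auto
  then show ?thesis by (simp add: pair_prod_def prod_I6 mult_ac)
qed

lemma pair_prod_Sigma: "pair_prod f = (\<Prod>(i,j)\<in>{(i,j). i \<in> I6 \<and> j \<in> I6 \<and> i < j}. f i j)"
proof -
  have "pair_prod f = (\<Prod>(i,j)\<in>(SIGMA i:I6. {i<..6}). f i j)"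
    unfolding pair_prod_def by (subst prod.Sigma) auto
  also have "(SIGMA i:I6. {i<..6}) = {(i,j). i \<in> I6 \<and> j \<in> I6 \<and> i < j}"
    by (auto simp: I6_def)
  finally show ?thesis .
qed

lemma pair_prod_cong:
  "(\<And>i j. i \<in> I6 \<Longrightarrow> j \<in> I6 \<Longrightarrow> i < j \<Longrightarrow> f i j = g i j) \<Longrightarrow> pair_prod f = pair_prod g"
  unfolding pair_prod_Sigma by (rule prod.cong) auto

lemma pair_prod_mult: "pair_prod (\<lambda>i j. f i j * g i j) = pair_prod f * pair_prod g"
  by (simp add: pair_prod_eq mult_ac)

lemma pair_prod_divide:
  "pair_prod (\<lambda>i j. f i j / g i j :: complex) = pair_prod f / pair_prod g"
  by (simp add: pair_prod_def prod_dividef)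

lemma pair_prod_nz:
  "(\<And>i j. i \<in> I6 \<Longrightarrow> j \<in> I6 \<Longrightarrow> i < j \<Longrightarrow> f i j \<noteq> (0::complex)) \<Longrightarrow> pair_prod f \<noteq> 0"
  unfolding pair_prod_Sigma by (subst prod_zero_iff) (auto intro: finite_subset[of _ "I6 \<times> I6"])

text \<open>Reordering the entries only permutes the unordered pairs.\<close>

lemma pair_prod_permutes:
  assumes \<pi>: "\<pi> permutes I6" and sym: "\<And>i j. g i j = g j i"
  shows "pair_prod (\<lambda>i j. g (\<pi> i) (\<pi> j)) = pair_prod g"
  unfolding pair_prod_Sigma
proof (rule prod.reindex_bij_witness[where
      j = "\<lambda>(i,j). (min (\<pi> i) (\<pi> j), max (\<pi> i) (\<pi> j))" and
      i = "\<lambda>(i,j). (min (inv \<pi> i) (inv \<pi> j), max (inv \<pi> i) (inv \<pi> j))"])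
  note \<sigma> = permutes_inv[OF \<pi>]
  note inj = permutes_inj[OF \<pi>] permutes_inj[OF \<sigma>]
  note simps = permutes_inverses[OF \<pi>] permutes_in_image[OF \<pi>] permutes_in_image[OF \<sigma>]
  fix a assume a: "a \<in> {(i,j). i \<in> I6 \<and> j \<in> I6 \<and> i < j}"
  obtain i j where ij: "a = (i,j)" "i \<in> I6" "j \<in> I6" "i < j" using a by auto
  have "\<pi> i \<noteq> \<pi> j" "inv \<pi> i \<noteq> inv \<pi> j" using inj ij by (auto dest: injD)
  then show "(case (case a of (i,j) \<Rightarrow> (min (\<pi> i) (\<pi> j), max (\<pi> i) (\<pi> j))) of
        (i,j) \<Rightarrow> (min (inv \<pi> i) (inv \<pi> j), max (inv \<pi> i) (inv \<pi> j))) = a"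
    "(case a of (i,j) \<Rightarrow> (min (\<pi> i) (\<pi> j), max (\<pi> i) (\<pi> j))) \<in> {(i,j). i \<in> I6 \<and> j \<in> I6 \<and> i < j}"
    "(case (case a of (i,j) \<Rightarrow> (min (inv \<pi> i) (inv \<pi> j), max (inv \<pi> i) (inv \<pi> j))) of
        (i,j) \<Rightarrow> (min (\<pi> i) (\<pi> j), max (\<pi> i) (\<pi> j))) = a"
    "(case a of (i,j) \<Rightarrow> (min (inv \<pi> i) (inv \<pi> j), max (inv \<pi> i) (inv \<pi> j)))
        \<in> {(i,j). i \<in> I6 \<and> j \<in> I6 \<and> i < j}"
    "(case (case a of (i,j) \<Rightarrow> (min (\<pi> i) (\<pi> j), max (\<pi> i) (\<pi> j))) of (i,j) \<Rightarrow> g i j) =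
        (case a of (i,j) \<Rightarrow> g (\<pi> i) (\<pi> j))"
    using ij simps by (auto simp: min_def max_def sym)
qed

text \<open>The pairs that contain a given index \<open>k\<close> are singled out.\<close>

lemma pair_prod_remove:
  assumes "k \<in> I6" and sym: "\<And>i j. g i j = g j i"
  shows "pair_prod g = (\<Prod>j\<in>I6-{k}. g k j) * pair_prod (\<lambda>i j. if i = k \<or> j = k then 1 else g i j)"
proof -
  have s: "g 2 1 = g 1 2" "g 3 1 = g 1 3" "g 4 1 = g 1 4" "g 5 1 = g 1 5" "g 6 1 = g 1 6"
    "g 3 2 = g 2 3" "g 4 2 = g 2 4" "g 5 2 = g 2 5" "g 6 2 = g 2 6" "g 4 3 = g 3 4"
    "g 5 3 = g 3 5" "g 6 3 = g 3 6" "g 5 4 = g 4 5" "g 6 4 = g 4 6" "g 6 5 = g 5 6"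
    by (rule sym)+
  have "I6 - {1} = {2,3,4,5,6}" "I6 - {2} = {1,3,4,5,6}" "I6 - {3} = {1,2,4,5,6}"
     "I6 - {4} = {1,2,3,5,6}" "I6 - {5} = {1,2,3,4,6}" "I6 - {6} = {1,2,3,4,5}"
    by (auto simp: I6_eq)
  moreover have "k = 1 \<or> k = 2 \<or> k = 3 \<or> k = 4 \<or> k = 5 \<or> k = 6"
    using assms(1) by (auto simp: I6_eq)
  ultimately show ?thesis
    by (elim disjE) (simp_all add: pair_prod_eq s[unfolded One_nat_def] mult_ac)
qed

lemma pair_prod_update:
  assumes k: "k \<in> I6" and sym: "\<And>i j. g i j = g j i" "\<And>i j. h i j = h j i"
    and eq: "\<And>i j. i \<in> I6 \<Longrightarrow> j \<in> I6 \<Longrightarrow> i \<noteq> k \<Longrightarrow> j \<noteq> k \<Longrightarrow> h i j = g i j"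
    and upd: "\<And>j. j \<in> I6 \<Longrightarrow> j \<noteq> k \<Longrightarrow> h k j = u j * g k j"
  shows "pair_prod h = (\<Prod>j\<in>I6-{k}. u j) * pair_prod g"
proof -
  have "pair_prod (\<lambda>i j. if i = k \<or> j = k then 1 else h i j) =
        pair_prod (\<lambda>i j. if i = k \<or> j = k then 1 else g i j)"
    by (rule pair_prod_cong) (auto intro: eq)
  moreover have "(\<Prod>j\<in>I6-{k}. h k j) = (\<Prod>j\<in>I6-{k}. u j) * (\<Prod>j\<in>I6-{k}. g k j)"
    unfolding prod.distrib[symmetric] by (rule prod.cong) (auto intro: upd)
  ultimately show ?thesis
    using pair_prod_remove[of k h] pair_prod_remove[of k g] k sym by (simp add: mult_ac)
qed

text \<open>Any integer vector of sum 0 can be brought to 0 by steps that lower one positive entry and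
  raise one negative entry.\<close>

lemma shift_invariant_const:
  fixes f :: "(nat \<Rightarrow> int) \<Rightarrow> 'a"
  assumes cong: "\<And>C C'. (\<And>i. i \<in> I6 \<Longrightarrow> C i = C' i) \<Longrightarrow> f C = f C'"
    and step: "\<And>D i i'. i \<in> I6 \<Longrightarrow> i' \<in> I6 \<Longrightarrow> (\<Sum>j\<in>I6. D j) = -1 \<Longrightarrow>
      f (D(i := D i + 1)) = f (D(i' := D i' + 1))"
    and C: "(\<Sum>j\<in>I6. C j) = 0"
  shows "f C = f (\<lambda>_. 0)"
  using C
proof (induction "nat (\<Sum>j\<in>I6. \<bar>C j\<bar>)" arbitrary: C rule: less_induct)
  case less
  show ?case
  proof (cases "\<forall>j\<in>I6. C j = 0")
    case True
    then show ?thesis by (intro cong) auto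
  next
    case False
    have "\<exists>i\<in>I6. 0 < C i"
    proof (rule ccontr)
      assume "\<not> ?thesis"
      then have "\<forall>j\<in>I6. C j = 0"
        using sum_nonneg_eq_0_iff[of I6 "\<lambda>j. - C j"] less.prems by (auto simp: sum_negf not_less)
      with False show False by blast
    qed
    then obtain i where i: "i \<in> I6" "0 < C i" by blast
    have "\<exists>i\<in>I6. C i < 0"
    proof (rule ccontr)
      assume "\<not> ?thesis"
      then have "\<forall>j\<in>I6. C j = 0"
        using sum_nonneg_eq_0_iff[of I6 C] less.prems by (auto simp: not_less)
      with False show False by blast
    qed
    then obtain i' where i': "i' \<in> I6" "C i' < 0" by blast
    define D where "D = C(i := C i - 1)"
    define C' where "C' = D(i' := D i' + 1)"
    have ne: "i \<noteq> i'" using i i' by auto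
    have sum_upd: "(\<Sum>j\<in>I6. g ((h(k := x)) j)) = (\<Sum>j\<in>I6. g (h j)) - g (h k) + g x"
      if "k \<in> I6" for g :: "int \<Rightarrow> int" and h :: "nat \<Rightarrow> int" and k x
      using that by (simp add: sum.remove[of I6 k])
    have sD: "(\<Sum>j\<in>I6. D j) = -1"
      using sum_upd[OF i(1), of "\<lambda>x. x"] less.prems by (simp add: D_def)
    have sC': "(\<Sum>j\<in>I6. C' j) = 0"
      using sum_upd[OF i'(1), of "\<lambda>x. x" D] sD by (simp add: C'_def)
    have "(\<Sum>j\<in>I6. \<bar>D j\<bar>) = (\<Sum>j\<in>I6. \<bar>C j\<bar>) - 1"
      using sum_upd[OF i(1), of abs] i by (simp add: D_def)
    moreover have "(\<Sum>j\<in>I6. \<bar>C' j\<bar>) = (\<Sum>j\<in>I6. \<bar>D j\<bar>) - 1"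
      using sum_upd[OF i'(1), of abs D] i' ne by (simp add: C'_def D_def)
    moreover have "0 \<le> (\<Sum>j\<in>I6. \<bar>C' j\<bar>)" by (rule sum_nonneg) simp
    ultimately have "f C' = f (\<lambda>_. 0)"
      using sC' by (intro less.hyps) auto
    moreover have "f (D(i := D i + 1)) = f C'"
      unfolding C'_def using i i' sD by (intro step)
    moreover have "D(i := D i + 1) = C" by (auto simp: D_def)
    ultimately show ?thesis by simp
  qed
qed

context nome
begin

definition generic :: "(nat \<Rightarrow> complex) \<Rightarrow> bool" where
  "generic b \<longleftrightarrow> (\<forall>i\<in>I6. b i \<noteq> 0) \<and> (\<forall>i\<in>I6. \<forall>j\<in>I6. i \<noteq> j \<longrightarrow> b i / b j \<notin> qZ) \<and>
     (\<forall>i\<in>I6. \<forall>j\<in>I6. b i * b j \<notin> qZ)"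

definition shift :: "(nat \<Rightarrow> complex) \<Rightarrow> (nat \<Rightarrow> int) \<Rightarrow> nat \<Rightarrow> complex" where
  "shift b C j = b j * q powi C j"

lemma shift_0 [simp]: "shift b (\<lambda>_. 0) = b"
  by (simp add: shift_def fun_eq_iff)

lemma shift_shift: "shift (shift b B) C = shift b (\<lambda>j. B j + C j)"
  using q_nz by (simp add: shift_def fun_eq_iff power_int_add mult_ac)

lemma shift_upd: "shift b (C(i := C i + 1)) = (shift b C)(i := q * shift b C i)"
  using q_nz by (auto simp: shift_def fun_eq_iff power_int_add)

lemma genericD:
  assumes "generic b"
  shows "i \<in> I6 \<Longrightarrow> b i \<noteq> 0" "i \<in> I6 \<Longrightarrow> j \<in> I6 \<Longrightarrow> i \<noteq> j \<Longrightarrow> b i / b j \<notin> qZ"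
    "i \<in> I6 \<Longrightarrow> j \<in> I6 \<Longrightarrow> b i * b j \<notin> qZ"
  using assms by (auto simp: generic_def)

lemma qZ_ratio_shift: "x * q powi k / (y * q powi l) \<in> qZ \<longleftrightarrow> x / y \<in> qZ"
proof -
  have "x * q powi k / (y * q powi l) = x / y * q powi (k - l)"
    using q_nz by (simp add: power_int_diff)
  then show ?thesis by (simp only: qZ_mult_powi_iff)
qed

lemma qZ_prod_shift: "x * q powi k * (y * q powi l) \<in> qZ \<longleftrightarrow> x * y \<in> qZ"
proof -
  have "x * q powi k * (y * q powi l) = x * y * q powi (k + l)"
    using q_nz by (simp add: power_int_add)
  then show ?thesis by (simp only: qZ_mult_powi_iff)
qed

lemma generic_shift [simp]: "generic (shift b C) \<longleftrightarrow> generic b"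
  using q_nz by (simp add: generic_def shift_def qZ_ratio_shift qZ_prod_shift)

lemma prod_shift: "(\<Prod>i\<in>I6. shift b C i) = (\<Prod>i\<in>I6. b i) * q powi (\<Sum>i\<in>I6. C i)"
proof -
  have "(\<Prod>i\<in>A. q powi C i) = q powi (\<Sum>i\<in>A. C i)" for A :: "nat set"
    using q_nz by (induction A rule: infinite_finite_induct) (auto simp: power_int_add)
  then show ?thesis by (simp add: shift_def prod.distrib)
qed

section \<open>The weight and its Jackson integrals\<close>

definition weight_core :: "(nat \<Rightarrow> complex) \<Rightarrow> complex \<Rightarrow> complex" where
  "weight_core b z = (\<Prod>i\<in>I6. qpoch_inf q (q * z / b i) / qpoch_inf q (b i * z))"

text \<open>Up to an elliptic function, the kernel is a product of two such weights. The factor \<open>z\<close> makes a weight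
  vanish at the origin, where the poles of the kernel accumulate.\<close>

definition weight :: "(nat \<Rightarrow> complex) \<Rightarrow> complex \<Rightarrow> complex" where
  "weight b z = z * (1 - z\<^sup>2) * weight_core b z"

definition jackson :: "(nat \<Rightarrow> complex) \<Rightarrow> complex \<Rightarrow> complex" where
  "jackson b p = (\<Sum>\<^sub>\<infinity>k::int. weight b (p * q powi k))"

lemma isCont_weight_core_0: "isCont (weight_core b) 0"
proof -
  have "((\<lambda>z. qpoch_inf q (q / b i * z) / qpoch_inf q (b i * z)) \<longlongrightarrow>
      qpoch_inf q (q / b i * 0) / qpoch_inf q (b i * 0)) (at 0)" for i
    by (intro tendsto_intros) simp
  then show ?thesis
    unfolding isCont_def weight_core_def by (intro tendsto_prod) simp
qed

lemma weight_core_cong: "(\<And>i. i \<in> I6 \<Longrightarrow> b i = c i) \<Longrightarrow> weight_core b z = weight_core c z"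
  unfolding weight_core_def by (rule prod.cong) auto

lemma jackson_cong: "(\<And>i. i \<in> I6 \<Longrightarrow> b i = c i) \<Longrightarrow> jackson b z = jackson c z"
  using weight_core_cong[of b c] by (simp add: jackson_def weight_def)

lemma weight_core_eq_0:
  assumes "j \<in> I6" "b j \<noteq> 0" "k < 0"
  shows "weight_core b (b j * q powi k) = 0"
proof -
  obtain n where "k = -1 - int n"
    using zle_iff_zadd[of k "-1"] assms(3) by auto
  then have "q * (b j * q powi k) / b j * q ^ n = 1"
    using assms q_nz by (simp add: power_int_diff)
  then have "qpoch_inf q (q * (b j * q powi k) / b j) = 0"
    by (auto simp: qpoch_inf_eq_0_iff)
  then show ?thesis
    unfolding weight_core_def using assms by (intro prod_zero bexI[of _ j]) auto
qed

lemma has_sum_int_from: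
  fixes f :: "int \<Rightarrow> complex"
  assumes "\<And>k. k < lo \<Longrightarrow> f k = 0" and "summable (\<lambda>n. norm (f (lo + int n)))"
    and "(\<lambda>n. f (lo + int n)) sums S"
  shows "(f has_sum S) UNIV"
proof -
  have "((\<lambda>n. f (lo + int n)) has_sum S) UNIV"
    using assms by (intro norm_summable_imp_has_sum)
  moreover have "bij_betw (\<lambda>n. lo + int n) UNIV {lo..}"
    by (rule bij_betwI[where g = "\<lambda>k. nat (k - lo)"]) auto
  ultimately have "(f has_sum S) {lo..}"
    using has_sum_reindex_bij_betw by metis
  then show ?thesis
    by (subst has_sum_cong_neutral[where T = "{lo..}" and g = f]) (auto simp: assms(1))
qed

lemma summable_on_int_from:
  fixes f :: "int \<Rightarrow> complex"
  assumes "\<And>k. k < lo \<Longrightarrow> f k = 0" and "summable (\<lambda>n. norm (f (lo + int n)))"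
  shows "f summable_on UNIV" "infsum f UNIV = (\<Sum>n. f (lo + int n))"
  using has_sum_int_from[OF assms summable_sums[OF summable_norm_cancel[OF assms(2)]]]
  by (auto simp: summable_on_def infsumI)

lemma q_powi_add_nat: "q powi (k + int n) = q powi k * q ^ n"
  using q_nz by (simp add: power_int_add)

lemma lattice_tendsto_0: "(\<lambda>n. p * q powi (k + int n)) \<longlonglongrightarrow> 0"
proof -
  have "(\<lambda>n. p * q powi k * q ^ n) \<longlonglongrightarrow> p * q powi k * 0"
    by (intro tendsto_intros LIMSEQ_power_zero) (use q_lt1 in auto)
  then show ?thesis by (simp add: q_powi_add_nat mult_ac)
qed

lemma lattice_summable:
  assumes g: "isCont g 0"
  shows "summable (\<lambda>n. norm (p * q powi (k + int n) * g (p * q powi (k + int n))))"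
proof -
  have "(\<lambda>n. g (p * q powi (k + int n))) \<longlonglongrightarrow> g 0"
    by (rule isCont_tendsto_compose[OF g lattice_tendsto_0])
  then have "Bseq (\<lambda>n. g (p * q powi (k + int n)))"
    by (intro convergent_imp_Bseq convergentI)
  then obtain B where B: "\<And>n. norm (g (p * q powi (k + int n))) \<le> B"
    by (auto simp: Bseq_def)
  show ?thesis
  proof (rule summable_comparison_test')
    show "summable (\<lambda>n. norm (p * q powi k) * B * norm q ^ n)"
      using q_lt1 by (intro summable_mult summable_geometric) simp
    show "norm (norm (p * q powi (k + int n) * g (p * q powi (k + int n)))) \<le>
        norm (p * q powi k) * B * norm q ^ n" for n
      using mult_left_mono[OF B[of n], of "norm (p * q powi k) * norm q ^ n"]
      by (simp add: q_powi_add_nat norm_mult norm_power mult_ac)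
  qed
qed

text \<open>On a lattice \<open>b\<^sub>j q\<^sup>\<int>\<close> the core vanishes beyond a certain point, so that all sums that occur
  are one-sided geometric ones.\<close>

lemma lattice_has_sum:
  assumes "j \<in> I6" "b j \<noteq> 0" "p = b j * q powi m" and g: "isCont g 0"
  shows "(\<lambda>k. p * q powi k * (g (p * q powi k) * weight_core b (p * q powi k))) summable_on UNIV"
proof (rule summable_on_int_from(1)[where lo = "-m"])
  show "p * q powi k * (g (p * q powi k) * weight_core b (p * q powi k)) = 0" if "k < - m" for k
    using weight_core_eq_0[of j b "m + k"] assms that q_nz by (simp add: power_int_add mult_ac)
  show "summable (\<lambda>n. norm (p * q powi (- m + int n) * (g (p * q powi (- m + int n)) *
      weight_core b (p * q powi (- m + int n)))))"
    by (rule lattice_summable) (intro continuous_intros g isCont_weight_core_0)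
qed

lemma weight_mult_summable:
  assumes "j \<in> I6" "b j \<noteq> 0" "p = b j * q powi m" and g: "isCont g 0"
  shows "(\<lambda>k. weight b (p * q powi k) * g (p * q powi k)) summable_on UNIV"
proof -
  have "isCont (\<lambda>z. (1 - z\<^sup>2) * g z) 0" by (intro continuous_intros g)
  from lattice_has_sum[where j = j and b = b and p = p and m = m, OF assms(1-3) this]
  show ?thesis unfolding weight_def by (simp only: mult_ac)
qed

lemma weight_summable:
  assumes "j \<in> I6" "b j \<noteq> 0" "p = b j * q powi m"
  shows "(\<lambda>k. weight b (p * q powi k)) summable_on UNIV"
  using weight_mult_summable[where g = "\<lambda>_. 1" and j = j and b = b and p = p and m = m] assms
  by simp

lemma jackson_powi [simp]: "jackson b (p * q powi m) = jackson b p"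
proof -
  have "bij_betw (\<lambda>k::int. m + k) UNIV UNIV"
    by (rule bij_betwI[where g = "\<lambda>k. k - m"]) auto
  then show ?thesis
    unfolding jackson_def
    using infsum_reindex_bij_betw[of "\<lambda>k. m + k" UNIV UNIV "\<lambda>k. weight b (p * q powi k)"] q_nz
    by (simp add: power_int_add mult_ac)
qed

definition kappa :: "(nat \<Rightarrow> complex) \<Rightarrow> nat \<Rightarrow> complex" where
  "kappa d i = (\<Prod>m\<in>I6-{i}. 1 - d i * d m) / (d i)\<^sup>2"

text \<open>Since \<open>\<Prod> d i = 1\<close>, each of the two products is the reversal of the other. Their difference is
  therefore antisymmetric under reversal, has a zero at \<open>0\<close> and at \<open>\<plusminus> 1\<close>, and the cofactor is palindromic.\<close>

lemma six_parameter_identity: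
  fixes d :: "nat \<Rightarrow> complex"
  assumes "(\<Prod>i\<in>I6. d i) = 1"
  obtains \<alpha> \<beta> where "\<And>z. (\<Prod>i\<in>I6. 1 - d i * z) - (\<Prod>i\<in>I6. 1 - z / d i) =
     z * (1 - z\<^sup>2) * (\<alpha> * z + \<beta> * (1 + z\<^sup>2))"
proof -
  define a b c e f g where "a = d 1" and "b = d 2" and "c = d 3" and "e = d 4" and "f = d 5" and "g = d 6"
  note defs = a_def b_def c_def e_def f_def g_def
  have 1: "a * b * c * e * f * g = 1"
    using assms by (simp add: prod_I6 defs)
  have nz: "d i \<noteq> 0" if "i \<in> I6" for i using assms that prod_zero[of I6 d] by auto
  have quot: "(\<Prod>i\<in>I6. 1 - z / d i) = (a - z) * (b - z) * (c - z) * (e - z) * (f - z) * (g - z)" for z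
  proof -
    have "(\<Prod>i\<in>I6. 1 - z / d i) = (\<Prod>i\<in>I6. (d i - z) / d i)"
      by (rule prod.cong) (auto simp: nz diff_divide_distrib)
    also have "\<dots> = (\<Prod>i\<in>I6. d i - z)" using assms by (simp add: prod_dividef)
    finally show ?thesis by (simp add: prod_I6 defs)
  qed
  define s1 s2 p1 where "s1 = a + b + c" and "s2 = a * b + a * c + b * c" and "p1 = a * b * c"
  define t1 t2 p2 where "t1 = e + f + g" and "t2 = e * f + e * g + f * g" and "p2 = e * f * g"
  have pp: "p1 * p2 = 1" using 1 by (simp add: p1_def p2_def mult_ac)
  have A: "(1 - a * z) * (1 - b * z) * (1 - c * z) = 1 - s1 * z + s2 * z^2 - p1 * z^3" for z
    by (simp add: s1_def s2_def p1_def algebra_simps power2_eq_square power3_eq_cube)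
  have B: "(1 - e * z) * (1 - f * z) * (1 - g * z) = 1 - t1 * z + t2 * z^2 - p2 * z^3" for z
    by (simp add: t1_def t2_def p2_def algebra_simps power2_eq_square power3_eq_cube)
  have C: "(a - z) * (b - z) * (c - z) = p1 - s2 * z + s1 * z^2 - z^3" for z
    by (simp add: s1_def s2_def p1_def algebra_simps power2_eq_square power3_eq_cube)
  have D: "(e - z) * (f - z) * (g - z) = p2 - t2 * z + t1 * z^2 - z^3" for z
    by (simp add: t1_def t2_def p2_def algebra_simps power2_eq_square power3_eq_cube)
  define \<alpha> where "\<alpha> = (t2 + s1 * t1 + s2) - (s1 * p2 + s2 * t2 + p1 * t1)"
  define \<beta> where "\<beta> = (s2 * p2 + p1 * t2) - (s1 + t1)"
  have "(\<Prod>i\<in>I6. 1 - d i * z) - (\<Prod>i\<in>I6. 1 - z / d i) =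
     z * (1 - z\<^sup>2) * (\<alpha> * z + \<beta> * (1 + z\<^sup>2))" for z
  proof -
    have "(\<Prod>i\<in>I6. 1 - d i * z) =
       ((1 - a * z) * (1 - b * z) * (1 - c * z)) * ((1 - e * z) * (1 - f * z) * (1 - g * z))"
      by (simp add: prod_I6 defs)
    moreover have "(\<Prod>i\<in>I6. 1 - z / d i) =
       ((a - z) * (b - z) * (c - z)) * ((e - z) * (f - z) * (g - z))"
      by (simp add: quot)
    ultimately have "(\<Prod>i\<in>I6. 1 - d i * z) - (\<Prod>i\<in>I6. 1 - z / d i) =
      (1 - s1 * z + s2 * z^2 - p1 * z^3) * (1 - t1 * z + t2 * z^2 - p2 * z^3)
      - (p1 - s2 * z + s1 * z^2 - z^3) * (p2 - t2 * z + t1 * z^2 - z^3)"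
      by (simp only: A B C D)
    also have "\<dots> = z * (1 - z\<^sup>2) * (\<alpha> * z + \<beta> * (1 + z\<^sup>2)) + (1 - p1 * p2) * (1 - z^6)"
      unfolding \<alpha>_def \<beta>_def by algebra
    finally show ?thesis by (simp add: pp)
  qed
  then show ?thesis by (rule that)
qed

text \<open>The identity is evaluated where one of its two products vanishes.\<close>

lemma kappa_eq:
  assumes eq: "\<And>z. (\<Prod>i\<in>I6. 1 - d i * z) - (\<Prod>i\<in>I6. 1 - z / d i) =
     z * (1 - z\<^sup>2) * (\<alpha> * z + \<beta> * (1 + z\<^sup>2))"
    and d: "generic d" and i: "i \<in> I6"
  shows "kappa d i = \<alpha> + \<beta> * (d i + 1 / d i)"
proof -
  have nz: "d i \<noteq> 0" and sq: "d i * d i \<noteq> 1"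
    using genericD[OF d] i qZ_1 by metis+
  have P0: "(\<Prod>m\<in>I6. 1 - d i / d m) = 0"
    using i nz by (intro prod_zero bexI[of _ i]) auto
  have "(\<Prod>m\<in>I6. 1 - d m * d i) = (1 - d i * d i) * (\<Prod>m\<in>I6-{i}. 1 - d i * d m)"
    using i by (simp add: prod.remove mult.commute)
  then have "(1 - d i * d i) * (\<Prod>m\<in>I6-{i}. 1 - d i * d m) =
      (1 - d i * d i) * (d i * (\<alpha> * d i + \<beta> * (1 + d i * d i)))"
    using eq[of "d i"] unfolding P0 by (simp add: power2_eq_square mult_ac)
  then have "(\<Prod>m\<in>I6-{i}. 1 - d i * d m) = d i * (\<alpha> * d i + \<beta> * (1 + d i * d i))"
    using sq by (subst (asm) mult_cancel_left) simp
  then show ?thesis using nz by (simp add: kappa_def field_simps power2_eq_square)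
qed

lemma weight_upd:
  assumes "i \<in> I6" "d i \<noteq> 0" "d i * z \<notin> qZ"
  shows "weight (d(i := q * d i)) z = weight d z * ((1 - z / d i) * (1 - d i * z))"
proof -
  have "qpoch_inf q (q * z / (q * d i)) / qpoch_inf q (q * d i * z) =
     qpoch_inf q (q * z / d i) / qpoch_inf q (d i * z) * ((1 - z / d i) * (1 - d i * z))"
    using qpoch_inf_step[of "z / d i"] qpoch_inf_step[of "d i * z"] qpoch_inf_nz[OF assms(3)] q_nz
    by (simp add: divide_simps mult.assoc)
  then show ?thesis
    using assms by (simp add: weight_def weight_core_def prod.remove[of I6 i] mult_ac)
qed

text \<open>A function whose \<open>q\<close>-difference is a multiple of the weight sums to the same constant over each of
  the six lattices, because it tends to 1 at the origin and vanishes at the other end.\<close>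

lemma telescope_weight:
  assumes d: "generic d" and eq: "\<And>z. (\<Prod>i\<in>I6. 1 - d i * z) - (\<Prod>i\<in>I6. 1 - z / d i) =
     z * (1 - z\<^sup>2) * (\<alpha> * z + \<beta> * (1 + z\<^sup>2))"
    and j: "j \<in> I6" and p: "p = d j * q powi m"
  shows "((\<lambda>k. weight d (p * q powi k) * (\<alpha> * (p * q powi k) + \<beta> * (1 + (p * q powi k)\<^sup>2))) has_sum 1) UNIV"
proof -
  define K where "K z = (\<Prod>i\<in>I6. qpoch_inf q (z / d i) / qpoch_inf q (d i * z))" for z
  have K1: "K z = weight_core d z * (\<Prod>i\<in>I6. 1 - z / d i)" for z
    unfolding K_def weight_core_def prod.distrib[symmetric]
    using qpoch_inf_step[of "z / d _"] by (intro prod.cong refl) (simp add: mult_ac)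
  have K2: "K (q * z) = weight_core d z * (\<Prod>i\<in>I6. 1 - d i * z)" if "\<And>i. i \<in> I6 \<Longrightarrow> d i * z \<notin> qZ" for z
    unfolding K_def weight_core_def prod.distrib[symmetric]
  proof (rule prod.cong)
    fix i assume i: "i \<in> I6"
    have "qpoch_inf q (d i * (q * z)) = qpoch_inf q (q * (d i * z))" by (simp add: mult_ac)
    moreover have "d i * z \<noteq> 1" "qpoch_inf q (d i * z) \<noteq> 0"
      using that[OF i] qZ_1 qpoch_inf_nz by metis+
    ultimately show "qpoch_inf q (q * z / d i) / qpoch_inf q (d i * (q * z)) =
       qpoch_inf q (q * z / d i) / qpoch_inf q (d i * z) * (1 - d i * z)"
      using qpoch_inf_step[of "d i * z"] by (simp add: divide_simps)
  qed simp
  define z where "z k = p * q powi k" for k :: int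
  have zq: "z (k + 1) = q * z k" for k using q_nz by (simp add: z_def power_int_add)
  have dz: "d i * z k \<notin> qZ" if "i \<in> I6" for i k
  proof -
    have "d i * z k = d i * d j * q powi (m + k)" using q_nz by (simp add: z_def p power_int_add)
    then show ?thesis using genericD(3)[OF d that j] by (simp only: qZ_mult_powi_iff not_False_eq_True)
  qed
  have diff: "weight d (z k) * (\<alpha> * z k + \<beta> * (1 + (z k)\<^sup>2)) = K (z (k + 1)) - K (z k)" for k
    unfolding zq using K1[of "z k"] K2[OF dz, of k] eq[of "z k"]
    by (simp add: weight_def mult_ac flip: right_diff_distrib)
  have nz: "d j \<noteq> 0" using genericD(1)[OF d j] .
  show ?thesis unfolding z_def[symmetric]
  proof (rule has_sum_int_from[where lo = "-m"])
    show "weight d (z k) * (\<alpha> * z k + \<beta> * (1 + (z k)\<^sup>2)) = 0" if "k < - m" for k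
      using weight_core_eq_0[OF j, of d "m + k"] nz that q_nz
      by (simp add: weight_def z_def p power_int_add mult_ac)
    have "summable (\<lambda>n. norm (p * q powi (- m + int n) * ((\<lambda>z. (1 - z\<^sup>2) * weight_core d z *
        (\<alpha> * z + \<beta> * (1 + z\<^sup>2))) (p * q powi (- m + int n)))))"
      by (rule lattice_summable) (intro continuous_intros isCont_weight_core_0)
    then show "summable (\<lambda>n. norm (weight d (z (- m + int n)) *
        (\<alpha> * z (- m + int n) + \<beta> * (1 + (z (- m + int n))\<^sup>2))))"
      by (simp add: weight_def z_def mult_ac)
    have K0: "K (z (- m)) = 0"
    proof -
      have "z (- m) = d j" using q_nz by (simp add: z_def p power_int_minus)
      then have "(\<Prod>i\<in>I6. 1 - z (- m) / d i) = 0"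
        using j nz by (intro prod_zero bexI[of _ j]) auto
      then show ?thesis using K1 by simp
    qed
    have "isCont K 0"
      unfolding K1[abs_def] by (intro continuous_intros isCont_weight_core_0)
         (use genericD(1)[OF d] in auto)
    from isCont_tendsto_compose[OF this lattice_tendsto_0[of p "-m"]]
    have "(\<lambda>n. K (z (- m + int n))) \<longlonglongrightarrow> 1"
      by (simp add: z_def K_def)
    from telescope_sums[OF this]
    show "(\<lambda>n. weight d (z (- m + int n)) * (\<alpha> * z (- m + int n) + \<beta> * (1 + (z (- m + int n))\<^sup>2))) sums 1"
      unfolding diff by (simp add: K0 algebra_simps)
  qed
qed

text \<open>Raising one parameter multiplies the weight by a linear function of \<open>z + 1/z\<close>. In the combination on the
  left the multiplier becomes the one of \<open>telescope_weight\<close>, because \<open>kappa\<close> is affine in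
  \<open>d i + 1 / d i\<close>. The right-hand side does not depend on the lattice.\<close>

lemma jackson_contiguous:
  assumes d: "generic d" and prod: "(\<Prod>i\<in>I6. d i) = 1" and ij: "i \<in> I6" "i' \<in> I6" "j \<in> I6"
    and p: "p = d j * q powi m"
  shows "kappa d i' * jackson (d(i := q * d i)) p - kappa d i * jackson (d(i' := q * d i')) p =
    (d i' + 1 / d i') - (d i + 1 / d i)"
proof -
  obtain \<alpha> \<beta> where eq: "\<And>z. (\<Prod>i\<in>I6. 1 - d i * z) - (\<Prod>i\<in>I6. 1 - z / d i) =
     z * (1 - z\<^sup>2) * (\<alpha> * z + \<beta> * (1 + z\<^sup>2))"
    using six_parameter_identity[OF prod] by blast
  define z where "z k = p * q powi k" for k :: int
  have nz: "d j \<noteq> 0" using genericD(1)[OF d ij(3)] .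
  define X where "X = (\<Sum>\<^sub>\<infinity>k. weight d (z k) * z k)"
  define Z where "Z = (\<Sum>\<^sub>\<infinity>k. weight d (z k) * (1 + (z k)\<^sup>2))"
  have X: "((\<lambda>k. weight d (z k) * z k) has_sum X) UNIV"
    unfolding X_def z_def
    by (rule has_sum_infsum, rule weight_mult_summable[where j = j and m = m]) (use ij(3) nz p in auto)
  have Z: "((\<lambda>k. weight d (z k) * (1 + (z k)\<^sup>2)) has_sum Z) UNIV"
    unfolding Z_def z_def
    by (rule has_sum_infsum, rule weight_mult_summable[where j = j and m = m])
       (use ij(3) nz p in \<open>auto intro!: continuous_intros\<close>)
  have "((\<lambda>k. \<alpha> * (weight d (z k) * z k) + \<beta> * (weight d (z k) * (1 + (z k)\<^sup>2))) has_sum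
      (\<alpha> * X + \<beta> * Z)) UNIV"
    by (intro has_sum_add has_sum_cmult_right X Z)
  moreover have "(\<lambda>k. \<alpha> * (weight d (z k) * z k) + \<beta> * (weight d (z k) * (1 + (z k)\<^sup>2))) =
      (\<lambda>k. weight d (z k) * (\<alpha> * z k + \<beta> * (1 + (z k)\<^sup>2)))"
    by (simp add: algebra_simps)
  ultimately have one: "\<alpha> * X + \<beta> * Z = 1"
    using has_sum_unique[OF _ telescope_weight[OF d eq ij(3) p]] by (simp only: z_def)
  have J: "jackson (d(i := q * d i)) p = Z - (d i + 1 / d i) * X" if i: "i \<in> I6" for i
  proof -
    have di: "d i \<noteq> 0" using genericD(1)[OF d i] .
    have "weight (d(i := q * d i)) (z k) =
        weight d (z k) * (1 + (z k)\<^sup>2) - (d i + 1 / d i) * (weight d (z k) * z k)" for k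
    proof -
      have "d i * z k = d i * d j * q powi (m + k)" using q_nz by (simp add: z_def p power_int_add)
      then have "d i * z k \<notin> qZ"
        using genericD(3)[OF d i ij(3)] by (simp only: qZ_mult_powi_iff not_False_eq_True)
      from weight_upd[where i = i and d = d and z = "z k", OF i di this]
      have "weight (d(i := q * d i)) (z k) = weight d (z k) * ((1 - z k / d i) * (1 - d i * z k))" .
      also have "(1 - z k / d i) * (1 - d i * z k) = 1 + (z k)\<^sup>2 - (d i + 1 / d i) * z k"
        using di by (simp add: field_simps power2_eq_square)
      finally show ?thesis by (simp only: right_diff_distrib mult.commute mult.left_commute)
    qed
    moreover have "((\<lambda>k. weight d (z k) * (1 + (z k)\<^sup>2) + - (d i + 1 / d i) * (weight d (z k) * z k))
        has_sum (Z + - (d i + 1 / d i) * X)) UNIV"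
      by (intro has_sum_add has_sum_cmult_right X Z)
    then have "((\<lambda>k. weight d (z k) * (1 + (z k)\<^sup>2) - (d i + 1 / d i) * (weight d (z k) * z k))
        has_sum (Z - (d i + 1 / d i) * X)) UNIV"
      by (simp only: mult_minus_left diff_conv_add_uminus)
    ultimately have "((\<lambda>k. weight (d(i := q * d i)) (z k)) has_sum (Z - (d i + 1 / d i) * X)) UNIV"
      by (simp only:)
    from infsumI[OF this] show ?thesis by (simp only: jackson_def z_def)
  qed
  have K: "kappa d i = \<alpha> + \<beta> * (d i + 1 / d i)" if "i \<in> I6" for i
    by (rule kappa_eq[OF eq d that])
  define Yi Yi' where "Yi = d i + 1 / d i" and "Yi' = d i' + 1 / d i'"
  have "(\<alpha> + \<beta> * Yi') * (Z - Yi * X) - (\<alpha> + \<beta> * Yi) * (Z - Yi' * X) = (Yi' - Yi) * (\<alpha> * X + \<beta> * Z)"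
    by algebra
  then show ?thesis
    by (simp only: J[OF ij(1)] J[OF ij(2)] K[OF ij(1)] K[OF ij(2)] one Yi_def Yi'_def mult_1_right)
qed

lemma kappa_nz:
  assumes "generic d" "i \<in> I6"
  shows "kappa d i \<noteq> 0"
proof -
  have "1 - d i * d m \<noteq> 0" if "m \<in> I6" for m
    using genericD(3)[OF assms(1,2) that] qZ_1 by fastforce
  then show ?thesis using genericD(1)[OF assms] by (auto simp: kappa_def)
qed

section \<open>The coefficients of the six lattices\<close>

definition nu :: "(nat \<Rightarrow> complex) \<Rightarrow> nat \<Rightarrow> complex" where
  "nu d j = (\<Prod>i\<in>I6. theta (d i * d j)) / (d j ^ 4 * (\<Prod>i\<in>I6-{j}. theta (d i / d j)))"

text \<open>By the quasi-periodicity of the theta function each factor acquires a monomial. As the parameters have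
  product 1, these monomials combine to the same one whichever parameter is raised.\<close>

lemma nu_step:
  assumes prod: "(\<Prod>i\<in>I6. d i) = 1" and i: "i \<in> I6" and j: "j \<in> I6"
  shows "nu (d(i := q * d i)) j = nu d j / (d j)\<^sup>2"
proof -
  have nz: "d k \<noteq> 0" if "k \<in> I6" for k using prod that prod_zero[of I6 d] by auto
  show ?thesis
  proof (cases "i = j")
    case False
    have "theta (q * d i * d j) = - theta (d i * d j) / (d i * d j)"
      using theta_q_mult[of "d i * d j"] nz i j by (simp add: mult.assoc)
    moreover have "theta (q * d i / d j) = - theta (d i / d j) / (d i / d j)"
      using theta_q_mult[of "d i / d j"] nz i j by simp
    moreover have "(\<Prod>k\<in>I6-{j}. g k) = g i * (\<Prod>k\<in>I6-{j}-{i}. g k)" for g :: "nat \<Rightarrow> complex"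
      using i False by (intro prod.remove) auto
    moreover define A where "A = (\<Prod>k\<in>I6-{i}. theta (d k * d j))"
    moreover define B where "B = (\<Prod>k\<in>I6-{j}-{i}. theta (d k / d j))"
    moreover define x y where "x = theta (d i * d j)" and "y = theta (d i / d j)"
    ultimately have "nu (d(i := q * d i)) j =
         (- x / (d i * d j) * A) / (d j ^ 4 * ((- y / (d i / d j)) * B))"
      and *: "nu d j = (x * A) / (d j ^ 4 * (y * B))"
      using False i by (auto simp: nu_def prod.remove[of I6 i])
    then have "nu (d(i := q * d i)) j = (x * A) / (d j ^ 4 * (y * B)) / (d j)\<^sup>2"
      using nz[OF i] nz[OF j] by (cases "y * B = 0") (auto simp: field_simps power2_eq_square)
    then show ?thesis by (simp only: *)
  next
    case True
    define n1 where "n1 = (\<Prod>k\<in>I6-{j}. theta (d k * d j))"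
    define n2 where "n2 = (\<Prod>k\<in>I6-{j}. theta (d k / d j))"
    have card: "card (I6 - {j}) = 5" using j by (simp add: I6_def)
    have pj: "d j * (\<Prod>k\<in>I6-{j}. d k) = 1" using prod j by (simp add: prod.remove)
    define P where "P = (\<Prod>k\<in>I6-{j}. d k)"
    have Pnz: "P \<noteq> 0" using pj unfolding P_def by (metis mult_zero_right zero_neq_one)
    have "theta (q * d j * (q * d j)) = - theta (q * (d j * d j)) / (q * (d j * d j))"
      using theta_q_mult[of "q * (d j * d j)"] nz j q_nz by (simp add: mult_ac)
    also have "\<dots> = theta (d j * d j) / (q * d j ^ 4)"
      using theta_q_mult[of "d j * d j"] nz j q_nz by (simp add: field_simps power4_eq_xxxx)
    finally have 1: "theta (q * d j * (q * d j)) = theta (d j * d j) / (q * d j ^ 4)" .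
    have "(\<Prod>k\<in>I6-{j}. theta (d k * (q * d j))) = (\<Prod>k\<in>I6-{j}. theta (d k * d j) * (- 1 / (d j * d k)))"
    proof (rule prod.cong)
      fix k assume "k \<in> I6 - {j}"
      then show "theta (d k * (q * d j)) = theta (d k * d j) * (- 1 / (d j * d k))"
        using theta_q_mult[of "d k * d j"] nz j by (simp add: mult_ac)
    qed simp
    also have "\<dots> = n1 * (- 1 / (d j ^ 5 * P))"
      by (simp only: prod.distrib prod_dividef n1_def P_def prod_constant card power_minus_odd) simp
    finally have 2: "(\<Prod>k\<in>I6-{j}. theta (d k * (q * d j))) = - n1 / (d j ^ 5 * P)" by simp
    have "(\<Prod>k\<in>I6-{j}. theta (d k / (q * d j))) = (\<Prod>k\<in>I6-{j}. theta (d k / d j) * (- d k / (q * d j)))"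
    proof (rule prod.cong)
      fix k assume "k \<in> I6 - {j}"
      then show "theta (d k / (q * d j)) = theta (d k / d j) * (- d k / (q * d j))"
        using theta_div_q[of "d k / d j"] nz j by (simp add: mult_ac)
    qed simp
    also have "\<dots> = n2 * (\<Prod>k\<in>I6-{j}. - d k / (q * d j))"
      by (simp only: prod.distrib n2_def)
    also have "(\<Prod>k\<in>I6-{j}. - d k / (q * d j)) = (\<Prod>k\<in>I6-{j}. (- 1 / (q * d j)) * d k)"
      by (rule prod.cong) auto
    also have "\<dots> = (- 1 / (q * d j)) ^ 5 * P"
      by (simp only: prod.distrib prod_constant card P_def)
    finally have 3: "(\<Prod>k\<in>I6-{j}. theta (d k / (q * d j))) = - n2 * P / (q * d j) ^ 5"
      by (simp add: power_divide)
    have "nu (d(j := q * d j)) j =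
        theta (q * d j * (q * d j)) * (\<Prod>k\<in>I6-{j}. theta (d k * (q * d j)))
        / ((q * d j) ^ 4 * (\<Prod>k\<in>I6-{j}. theta (d k / (q * d j))))"
      using j by (simp add: nu_def prod.remove[of I6 j])
    also have "\<dots> = theta (d j * d j) / (q * d j ^ 4) * (- n1 / (d j ^ 5 * P))
       / ((q * d j) ^ 4 * (- n2 * P / (q * d j) ^ 5))"
      by (simp only: 1 2 3)
    also have "\<dots> = theta (d j * d j) * n1 / (d j ^ 4 * n2) / (d j * (d j * P) ^ 2) / d j ^ 1"
      using nz[OF j] q_nz Pnz by (cases "n2 = 0") (simp_all add: field_simps power_numeral_reduce)
    also have "\<dots> = nu d j / (d j)\<^sup>2"
      using j pj by (simp add: nu_def prod.remove[of I6 j] n1_def n2_def P_def power2_eq_square)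
    finally show ?thesis using True by simp
  qed
qed

lemma nu_shift:
  assumes prod: "(\<Prod>i\<in>I6. b i) = q" and "j \<in> I6" and C: "(\<Sum>i\<in>I6. C i) = 0"
  shows "nu (shift b C) j = nu b j"
proof -
  have "nu (shift b C) j = nu (shift b (\<lambda>_. 0)) j"
  proof (rule shift_invariant_const[where f = "\<lambda>C. nu (shift b C) j", OF _ _ C])
    show "nu (shift b C) j = nu (shift b C') j" if "\<And>i. i \<in> I6 \<Longrightarrow> C i = C' i" for C C'
      using that \<open>j \<in> I6\<close> by (simp add: nu_def shift_def)
    fix D :: "nat \<Rightarrow> int" and i i' assume *: "i \<in> I6" "i' \<in> I6" "(\<Sum>j\<in>I6. D j) = -1"
    have "(\<Prod>i\<in>I6. shift b D i) = 1"
      using q_nz by (simp add: prod_shift prod * power_int_minus)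
    from nu_step[OF this *(1) assms(2)] nu_step[OF this *(2) assms(2)]
    show "nu (shift b (D(i := D i + 1))) j = nu (shift b (D(i' := D i' + 1))) j"
      by (simp add: shift_upd)
  qed
  then show ?thesis by simp
qed

text \<open>The solution of the recurrence that the contiguous relation imposes on the bilinear sums below.\<close>

definition rfac :: "(nat \<Rightarrow> complex) \<Rightarrow> (nat \<Rightarrow> int) \<Rightarrow> complex" where
  "rfac b C = 1 / ((\<Prod>j\<in>I6. b j powi (2 * C j) * q powi (C j * (C j - 1)))
      * pair_prod (\<lambda>i j. qpoch_inf q (shift b C i * shift b C j)))"

lemma rfac_nz: "generic b \<Longrightarrow> rfac b C \<noteq> 0"
proof -
  assume b: "generic b"
  have "generic (shift b C)" using b by simp
  then have "pair_prod (\<lambda>i j. qpoch_inf q (shift b C i * shift b C j)) \<noteq> 0"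
    by (intro pair_prod_nz qpoch_inf_nz genericD(3))
  moreover have "(\<Prod>j\<in>I6. b j powi (2 * C j) * q powi (C j * (C j - 1))) \<noteq> 0"
    using genericD(1)[OF b] q_nz by simp
  ultimately show ?thesis unfolding rfac_def by simp
qed

lemma rfac_cong:
  assumes "\<And>i. i \<in> I6 \<Longrightarrow> C i = C' i"
  shows "rfac b C = rfac b C'"
proof -
  have 1: "(\<Prod>j\<in>I6. b j powi (2 * C j) * q powi (C j * (C j - 1))) =
      (\<Prod>j\<in>I6. b j powi (2 * C' j) * q powi (C' j * (C' j - 1)))"
    by (rule prod.cong) (simp_all add: assms)
  have 2: "pair_prod (\<lambda>i j. qpoch_inf q (shift b C i * shift b C j)) =
      pair_prod (\<lambda>i j. qpoch_inf q (shift b C' i * shift b C' j))"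
    by (rule pair_prod_cong) (simp add: assms shift_def)
  show ?thesis unfolding rfac_def 1 2 ..
qed

lemma rfac_step:
  assumes b: "generic b" and i: "i \<in> I6"
  shows "rfac b (D(i := D i + 1)) = rfac b D * kappa (shift b D) i"
proof -
  define d where "d = shift b D"
  have d: "generic d" using b by (simp add: d_def)
  have bi: "b i \<noteq> 0" using genericD(1)[OF b i] .
  have 1: "1 - d i * d j \<noteq> 0" if "j \<in> I6" for j
    using genericD(3)[OF d i that] qZ_1 by fastforce
  define u where "u j = 1 / (1 - d i * d j)" for j
  have "pair_prod (\<lambda>k l. qpoch_inf q ((d(i := q * d i)) k * (d(i := q * d i)) l)) =
      (\<Prod>j\<in>I6-{i}. u j) * pair_prod (\<lambda>k l. qpoch_inf q (d k * d l))"
  proof (rule pair_prod_update[OF i])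
    fix j assume "j \<in> I6" "j \<noteq> i"
    then show "qpoch_inf q ((d(i := q * d i)) i * (d(i := q * d i)) j) = u j * qpoch_inf q (d i * d j)"
      using qpoch_inf_step[of "d i * d j"] 1[of j] by (simp add: u_def mult.assoc)
  next
    fix k l show "qpoch_inf q ((d(i := q * d i)) k * (d(i := q * d i)) l) = qpoch_inf q ((d(i := q * d i)) l * (d(i := q * d i)) k)"
      by (simp only: mult.commute)
    show "qpoch_inf q (d k * d l) = qpoch_inf q (d l * d k)" by (simp only: mult.commute)
  qed simp
  moreover have "(\<Prod>j\<in>I6. b j powi (2 * (D(i := D i + 1)) j) * q powi ((D(i := D i + 1)) j * ((D(i := D i + 1)) j - 1)))
      = (d i)\<^sup>2 * (\<Prod>j\<in>I6. b j powi (2 * D j) * q powi (D j * (D j - 1)))"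
  proof -
    have e: "(D i + 1) * (D i + 1 - 1) = D i * (D i - 1) + D i + D i"
      and e': "2 * (D i + 1) = 2 * D i + 1 + 1" by (simp_all add: algebra_simps)
    have add: "x powi (k + l) = x powi k * x powi l" if "x \<noteq> 0" for x :: complex and k l
      using that by (rule power_int_add[OF disjI1])
    have "b i powi (2 * (D i + 1)) * q powi ((D i + 1) * (D i + 1 - 1)) =
        (d i)\<^sup>2 * (b i powi (2 * D i) * q powi (D i * (D i - 1)))"
      unfolding e e' add[OF bi] add[OF q_nz] power_int_1_right
      by (simp only: d_def shift_def power2_eq_square mult_ac)
    moreover have "(\<Prod>j\<in>I6-{i}. b j powi (2 * (D(i := D i + 1)) j) * q powi ((D(i := D i + 1)) j * ((D(i := D i + 1)) j - 1)))
      = (\<Prod>j\<in>I6-{i}. b j powi (2 * D j) * q powi (D j * (D j - 1)))"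
      by (rule prod.cong) auto
    ultimately show ?thesis
      by (subst (1 2) prod.remove[OF finite_I6 i]) (simp only: fun_upd_same mult.assoc)
  qed
  moreover have "kappa d i = 1 / ((d i)\<^sup>2 * (\<Prod>j\<in>I6-{i}. u j))"
    by (simp add: kappa_def u_def prod_dividef)
  ultimately show ?thesis
    unfolding rfac_def shift_upd d_def[symmetric] by (simp only:) simp
qed

text \<open>The form that the summed contour integrals take after evaluation by residues: one product of two lattice
  sums for each of the six lattices of poles.\<close>

definition hsum :: "(nat \<Rightarrow> complex) \<Rightarrow> (nat \<Rightarrow> int) \<Rightarrow> (nat \<Rightarrow> int) \<Rightarrow> complex" where
  "hsum b B C = (\<Sum>j\<in>I6. nu b j * jackson (shift b B) (b j) * jackson (shift b C) (b j))"

lemma hsum_commute: "hsum b B C = hsum b C B"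
  by (simp add: hsum_def mult_ac)

text \<open>Once the lattice sums of one weight cancel against \<open>nu\<close>, the inhomogeneous term of the contiguous
  relation, which is the same for all lattices, drops out.\<close>

lemma hsum_right:
  assumes b: "generic b" and prod: "(\<Prod>i\<in>I6. b i) = q"
    and S: "(\<Sum>j\<in>I6. nu b j * jackson (shift b B) (b j)) = 0"
    and C: "(\<Sum>i\<in>I6. C i) = 0"
  shows "hsum b B C / rfac b C = hsum b B (\<lambda>_. 0) / rfac b (\<lambda>_. 0)"
proof (rule shift_invariant_const[where f = "\<lambda>C. hsum b B C / rfac b C", OF _ _ C])
  show "hsum b B C / rfac b C = hsum b B C' / rfac b C'" if "\<And>i. i \<in> I6 \<Longrightarrow> C i = C' i" for C C'
    using rfac_cong[of C C' b] jackson_cong[of "shift b C" "shift b C'"] that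
    by (simp add: hsum_def shift_def)
  fix D :: "nat \<Rightarrow> int" and i i' assume *: "i \<in> I6" "i' \<in> I6" "(\<Sum>j\<in>I6. D j) = -1"
  define d where "d = shift b D"
  have d: "generic d" using b by (simp add: d_def)
  have pd: "(\<Prod>i\<in>I6. d i) = 1"
    using q_nz by (simp add: d_def prod_shift prod * power_int_minus)
  define x where "x = (d i' + 1 / d i') - (d i + 1 / d i)"
  have J: "kappa d i' * jackson (d(i := q * d i)) (b j) - kappa d i * jackson (d(i' := q * d i')) (b j) = x"
    if "j \<in> I6" for j
  proof -
    have "b j = d j * q powi (- D j)" using q_nz by (simp add: d_def shift_def power_int_minus)
    from jackson_contiguous[OF d pd *(1,2) that this] show ?thesis by (simp only: x_def)
  qed
  have "kappa d i' * hsum b B (D(i := D i + 1)) - kappa d i * hsum b B (D(i' := D i' + 1)) =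
     (\<Sum>j\<in>I6. nu b j * jackson (shift b B) (b j) *
       (kappa d i' * jackson (d(i := q * d i)) (b j) - kappa d i * jackson (d(i' := q * d i')) (b j)))"
    by (simp add: hsum_def shift_upd d_def sum_distrib_left right_diff_distrib sum_subtractf mult_ac)
  also have "\<dots> = (\<Sum>j\<in>I6. nu b j * jackson (shift b B) (b j)) * x"
    unfolding sum_distrib_right by (rule sum.cong) (auto simp: J)
  finally have "kappa d i' * hsum b B (D(i := D i + 1)) = kappa d i * hsum b B (D(i' := D i' + 1))"
    by (simp add: S)
  then show "hsum b B (D(i := D i + 1)) / rfac b (D(i := D i + 1)) =
      hsum b B (D(i' := D i' + 1)) / rfac b (D(i' := D i' + 1))"
    using kappa_nz[OF d *(1)] kappa_nz[OF d *(2)] rfac_nz[OF b, of D]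
    unfolding rfac_step[OF b *(1)] rfac_step[OF b *(2)] d_def[symmetric]
    by (simp add: divide_simps mult_ac)
qed

end

section \<open>Contour integrals as sums of residues\<close>

lemma countable_if_isolated_real:
  fixes S :: "real set"
  assumes "\<And>t. t \<in> S \<Longrightarrow> \<exists>e>0. \<forall>s\<in>S. s \<noteq> t \<longrightarrow> e \<le> \<bar>s - t\<bar>"
  shows "countable S"
proof -
  obtain e where e: "\<And>t. t \<in> S \<Longrightarrow> e t > 0" "\<And>s t. t \<in> S \<Longrightarrow> s \<in> S \<Longrightarrow> s \<noteq> t \<Longrightarrow> e t \<le> \<bar>s - t\<bar>"
    using assms by metis
  have "\<exists>r\<in>\<rat>. t < r \<and> r < t + e t" if "t \<in> S" for t
    using Rats_dense_in_real[of t "t + e t"] e(1)[OF that] by auto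
  then obtain r where r: "\<And>t. t \<in> S \<Longrightarrow> r t \<in> \<rat> \<and> t < r t \<and> r t < t + e t" by metis
  have "inj_on r S"
  proof (rule inj_onI)
    fix s t assume st: "s \<in> S" "t \<in> S" "r s = r t"
    show "s = t"
      using e(2)[OF st(1,2)] e(2)[OF st(2,1)] r[OF st(1)] r[OF st(2)] st(3) by (cases s t rule: linorder_cases) auto
  qed
  moreover have "countable (r ` S)"
    using r by (intro countable_subset[OF _ countable_rat]) auto
  ultimately show ?thesis by (simp add: countable_image_inj_eq)
qed

text \<open>A path may dwell on a point for a set of times of positive measure, but its velocity vanishes there
  at all but countably many of these times. Values of the integrand at finitely many points are
  therefore irrelevant.\<close>

lemma contour_integral_spike:
  assumes g: "valid_path \<gamma>" and P: "finite P"
    and eq: "\<And>z. z \<in> path_image \<gamma> \<Longrightarrow> z \<notin> P \<Longrightarrow> f z = F z"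
    and F: "(F has_contour_integral I) \<gamma>"
  shows "(f has_contour_integral I) \<gamma>"
proof -
  obtain K where K: "finite K" "\<gamma> C1_differentiable_on ({0..1} - K)"
    using g by (auto simp: valid_path_def piecewise_C1_differentiable_on_def)
  define v where "v t = vector_derivative \<gamma> (at t within {0..1})" for t
  define N where "N p = {t\<in>{0..1} - K. \<gamma> t = p \<and> v t \<noteq> 0}" for p
  have cN: "countable (N p)" for p
  proof (rule countable_if_isolated_real)
    fix t assume t: "t \<in> N p"
    then have t01: "t \<in> {0..1}" "t \<notin> K" by (auto simp: N_def)
    have "\<gamma> differentiable at t"
      using K(2) t01 by (auto simp: C1_differentiable_on_eq)
    then have "\<gamma> differentiable at t within {0..1}"
      by (rule differentiable_at_withinI)
    then have "(\<gamma> has_vector_derivative v t) (at t within {0..1})"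
      unfolding v_def by (simp add: vector_derivative_works)
    then have "((\<lambda>s. norm (\<gamma> s - \<gamma> t - (s - t) *\<^sub>R v t) / norm (s - t)) \<longlongrightarrow> 0) (at t within {0..1})"
      by (simp add: has_vector_derivative_def has_derivative_iff_norm)
    then have "eventually (\<lambda>s. norm (\<gamma> s - \<gamma> t - (s - t) *\<^sub>R v t) / norm (s - t) < norm (v t)) (at t within {0..1})"
      using t by (intro order_tendstoD) (auto simp: N_def)
    then obtain e where e: "e > 0" and *: "\<And>s. s \<in> {0..1} \<Longrightarrow> s \<noteq> t \<Longrightarrow> \<bar>s - t\<bar> < e \<Longrightarrow>
      norm (\<gamma> s - \<gamma> t - (s - t) *\<^sub>R v t) / norm (s - t) < norm (v t)"
      by (auto simp: eventually_at dist_real_def)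
    have "e \<le> \<bar>s - t\<bar>" if s: "s \<in> N p" "s \<noteq> t" for s
    proof (rule ccontr)
      assume "\<not> ?thesis"
      with *[of s] s t have "norm ((s - t) *\<^sub>R v t) / norm (s - t) < norm (v t)"
        by (auto simp: N_def)
      then show False using s by simp
    qed
    with e show "\<exists>e>0. \<forall>s\<in>N p. s \<noteq> t \<longrightarrow> e \<le> \<bar>s - t\<bar>" by blast
  qed
  have "countable (K \<union> (\<Union>p\<in>P. N p))"
    using K(1) P cN by (intro countable_Un countable_UN) (auto intro: countable_finite)
  then have "negligible (\<Union>((\<lambda>t. {t}) ` (K \<union> (\<Union>p\<in>P. N p))))"
    by (intro negligible_countable_Union) auto
  then have "negligible (K \<union> (\<Union>p\<in>P. N p))" by simp
  moreover have "f (\<gamma> t) * v t = F (\<gamma> t) * v t" if "t \<in> {0..1} - (K \<union> (\<Union>p\<in>P. N p))" for t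
    using that eq[of "\<gamma> t"] by (cases "v t = 0") (auto simp: N_def path_image_def)
  ultimately show ?thesis
    using F has_integral_spike unfolding has_contour_integral_def v_def by (metis (no_types, lifting))
qed

lemma residue_0_if_not_pole:
  assumes "isolated_singularity_at f z" "not_essential f z" "\<not> is_pole f z"
  shows "residue f z = 0"
proof -
  obtain c where "f \<midarrow>z\<rightarrow> c" using assms(2,3) by (auto simp: not_essential_def)
  from remove_sings_analytic_at[OF assms(1) this]
  have "residue (remove_sings f) z = 0"
    by (metis analytic_at residue_holo)
  then show ?thesis using assms(1) by simp
qed

text \<open>The poles inside the contour may accumulate at the origin. A small circle is joined to the contour by a
  path, run through in both directions, which leaves an annulus with finitely many poles.\<close>

lemma contour_minus_circle_residues:
  assumes g: "valid_path \<gamma>" "pathfinish \<gamma> = pathstart \<gamma>"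
    and r: "0 < r" and img: "path_image \<gamma> \<subseteq> {z. r < norm z \<and> norm z < R}"
    and wn: "\<And>z. norm z \<le> r \<Longrightarrow> winding_number \<gamma> z = 1"
    and pts: "finite pts" "\<And>z. z \<in> pts \<Longrightarrow> norm z \<noteq> r" "\<And>z. z \<in> pts \<Longrightarrow> z \<notin> path_image \<gamma>"
    and hol: "F holomorphic_on {z. r / 2 < norm z \<and> norm z < R} - pts"
    and sub: "pts \<subseteq> {z. r / 2 < norm z \<and> norm z < R}"
  shows "contour_integral \<gamma> F - contour_integral (circlepath 0 r) F =
    2 * pi * \<i> * (\<Sum>p | p \<in> pts \<and> r < norm p. winding_number \<gamma> p * residue F p) \<and>
    F contour_integrable_on \<gamma>"
proof -
  define S where "S = {z::complex. r / 2 < norm z \<and> norm z < R}"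
  have oS: "open S" unfolding S_def by (intro open_Collect_conj open_Collect_less continuous_intros)
  have cS: "connected S"
    using connected_annulus(1)[where 'N = complex, of "r/2" 0 R] by (simp add: S_def)
  have R: "r < R" using img pathstart_in_path_image[of \<gamma>] by auto
  define c where "c = circlepath 0 r"
  have c_img: "path_image c = {z. norm z = r}"
    using r by (auto simp: c_def sphere_def)
  have c_S: "path_image c \<subseteq> S - pts" using r R pts(2) by (auto simp: c_img S_def)
  have g_S: "path_image \<gamma> \<subseteq> S - pts"
    using img r pts(3) by (fastforce simp: S_def)
  have op: "open (S - pts)" using oS pts(1) by (simp add: open_Diff finite_imp_closed)
  have con: "connected (S - pts)"
    by (rule connected_open_delete_finite[OF oS cS _ pts(1)]) simp
  have "pathstart \<gamma> \<in> S - pts" "pathstart c \<in> S - pts"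
    using g_S c_S pathstart_in_path_image by blast+
  then obtain p where p: "polynomial_function p" "path_image p \<subseteq> S - pts"
     "pathstart p = pathstart \<gamma>" "pathfinish p = pathstart c"
    using connected_open_polynomial_connected[OF op con] by blast
  have vp: "valid_path p" using p(1) by (rule valid_path_polynomial_function)
  have vc: "valid_path c" by (simp add: c_def)
  have ci: "F contour_integrable_on h" if "valid_path h" "path_image h \<subseteq> S - pts" for h
    using contour_integrable_holomorphic_simple[OF _ op that] hol by (simp add: S_def)
  have int_\<gamma>: "F contour_integrable_on \<gamma>" using ci g g_S by blast
  define q2 where "q2 = reversepath c +++ reversepath p"
  define q1 where "q1 = p +++ q2"
  define h where "h = \<gamma> +++ q1"
  have cl: "pathfinish c = pathstart c" by (simp add: c_def)
  have v2: "valid_path q2" unfolding q2_def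
    using vp vc p cl by (intro valid_path_join) auto
  have v1: "valid_path q1" unfolding q1_def
    using vp v2 p cl by (intro valid_path_join) (auto simp: q2_def)
  have vh: "valid_path h" unfolding h_def
    using g v1 p cl by (intro valid_path_join) (auto simp: q1_def)
  have i2: "path_image q2 \<subseteq> S - pts" unfolding q2_def
    using p c_S cl by (subst path_image_join) auto
  have i1: "path_image q1 \<subseteq> S - pts" unfolding q1_def
    using p i2 cl by (subst path_image_join) (auto simp: q2_def)
  have ih: "path_image h \<subseteq> S - pts" unfolding h_def
    using g_S i1 p cl g(2) by (subst path_image_join) (auto simp: q1_def)
  have loop: "pathfinish h = pathstart h" using p by (simp add: h_def q1_def q2_def)
  have int: "contour_integral h F = contour_integral \<gamma> F - contour_integral c F"
    using g v1 v2 vp vc ci[OF g(1) g_S] ci[OF v1 i1] ci[OF v2 i2] ci[OF vp p(2)] ci[OF vc c_S]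
    by (simp add: h_def q1_def q2_def contour_integral_join contour_integrable_reversepath
        contour_integral_reversepath)
  have win: "winding_number h z = winding_number \<gamma> z - winding_number c z" if z: "z \<notin> S - pts" for z
  proof -
    have n: "z \<notin> path_image \<gamma>" "z \<notin> path_image p" "z \<notin> path_image c" "z \<notin> path_image q1" "z \<notin> path_image q2"
      using z g_S p(2) c_S i1 i2 by blast+
    note pt = valid_path_imp_path[OF g(1)] valid_path_imp_path[OF vp] valid_path_imp_path[OF vc]
      valid_path_imp_path[OF v1] valid_path_imp_path[OF v2]
    have "winding_number h z = winding_number \<gamma> z + winding_number q1 z"
      unfolding h_def using n pt p g(2) by (intro winding_number_join) (auto simp: q1_def)
    also have "winding_number q1 z = winding_number p z + winding_number q2 z"
      unfolding q1_def using n pt p cl by (intro winding_number_join) (auto simp: q2_def)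
    also have "winding_number q2 z = winding_number (reversepath c) z + winding_number (reversepath p) z"
      unfolding q2_def using n pt p cl by (intro winding_number_join) auto
    finally show ?thesis using n pt by (simp add: winding_number_reversepath)
  qed
  have wc1: "winding_number c z = 1" if "norm z < r" for z
    unfolding c_def using that by (intro winding_number_circlepath) simp
  have wc0: "winding_number c z = 0" if "norm z > r" for z
    using that r vc cl valid_path_imp_path
    by (intro winding_number_zero_outside[of _ "cball 0 r"]) (auto simp: c_img)
  have "contour_integral h F = 2 * pi * \<i> * (\<Sum>p\<in>pts. winding_number h p * residue F p)"
  proof (rule Residue_theorem[OF oS cS pts(1) _ vh loop ih])
    show "F holomorphic_on S - pts" using hol by (simp add: S_def)
    show "\<forall>z. z \<notin> S \<longrightarrow> winding_number h z = 0"
    proof safe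
      fix z assume z: "z \<notin> S"
      show "winding_number h z = 0"
      proof (cases "norm z \<le> r / 2")
        case True
        then show ?thesis using z r by (subst win) (auto simp: wn wc1)
      next
        case False
        then have "R \<le> norm z" using z by (auto simp: S_def)
        moreover have "winding_number \<gamma> z = 0"
          using calculation img g valid_path_imp_path
          by (intro winding_number_zero_outside[of _ "ball 0 R"]) auto
        ultimately show ?thesis using z R by (subst win) (auto simp: wc0)
      qed
    qed
  qed
  also have "(\<Sum>p\<in>pts. winding_number h p * residue F p) =
      (\<Sum>p | p \<in> pts \<and> r < norm p. winding_number \<gamma> p * residue F p)"
  proof (rule sum.mono_neutral_cong_right)
    show "\<forall>i\<in>pts - {p \<in> pts. r < norm p}. winding_number h i * residue F i = 0"
      using pts(2) by (auto simp: win wn wc1 not_less order_le_less)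
    show "winding_number h x * residue F x = winding_number \<gamma> x * residue F x"
      if "x \<in> {p \<in> pts. r < norm p}" for x
      using that by (simp add: win wc0)
  qed (use pts in auto)
  finally show ?thesis
    using int int_\<gamma> by (simp add: c_def)
qed

lemma has_sum_LIMSEQ_exhaust:
  fixes f :: "'a \<Rightarrow> complex"
  assumes f: "(f has_sum S) A" and X: "\<And>n. finite (X n)" "\<And>n. X n \<subseteq> A"
    and ev: "\<And>a. a \<in> A \<Longrightarrow> f a \<noteq> 0 \<Longrightarrow> eventually (\<lambda>n. a \<in> X n) sequentially"
  shows "(\<lambda>n. \<Sum>a\<in>X n. f a) \<longlonglongrightarrow> S"
proof -
  define A' where "A' = {a\<in>A. f a \<noteq> 0}"
  have f': "(f has_sum S) A'"
    using f by (subst has_sum_cong_neutral[where T = A and g = f]) (auto simp: A'_def)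
  have "filterlim (\<lambda>n. X n \<inter> A') (finite_subsets_at_top A') sequentially"
    unfolding filterlim_finite_subsets_at_top
  proof safe
    fix Y assume Y: "finite Y" "Y \<subseteq> A'"
    have "eventually (\<lambda>n. \<forall>a\<in>Y. a \<in> X n) sequentially"
      using Y ev by (intro eventually_ball_finite) (auto simp: A'_def)
    then show "eventually (\<lambda>n. finite (X n \<inter> A') \<and> Y \<subseteq> X n \<inter> A' \<and> X n \<inter> A' \<subseteq> A') sequentially"
      by eventually_elim (use X Y in auto)
  qed
  from filterlim_compose[OF _ this] f'
  have "(\<lambda>n. \<Sum>a\<in>X n \<inter> A'. f a) \<longlonglongrightarrow> S"
    unfolding has_sum_def by (auto simp: o_def)
  moreover have "(\<Sum>a\<in>X n \<inter> A'. f a) = (\<Sum>a\<in>X n. f a)" for n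
    using X by (intro sum.mono_neutral_left) (auto simp: A'_def)
  ultimately show ?thesis by simp
qed

text \<open>The values of \<open>f\<close> at its removable singularities are arbitrary, so that \<open>f\<close> is compared with a
  meromorphic \<open>F\<close> off the candidate poles, and with the repaired function \<open>F'\<close> on the contour, which may
  pass through removable singularities. The circles of radius \<open>r n\<close> avoid all candidates and cut off the
  accumulation of poles at the origin.\<close>

lemma separating_contour_residues:
  assumes sep: "separating_contour f A B \<gamma>"
    and mero: "F meromorphic_on -{0}" and ana: "F analytic_on -({0} \<union> A \<union> B)"
    and fin: "\<And>\<epsilon> R. 0 < \<epsilon> \<Longrightarrow> finite {p \<in> A \<union> B. \<epsilon> \<le> norm p \<and> norm p \<le> R}"
    and nz: "0 \<notin> A \<union> B"
    and eq: "\<And>z. z \<noteq> 0 \<Longrightarrow> z \<notin> A \<union> B \<Longrightarrow> f z = F z"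
    and r: "\<And>n. 0 < r n" "r \<longlonglongrightarrow> 0" "\<And>n p. p \<in> A \<union> B \<Longrightarrow> norm p \<noteq> r n"
    and circ: "(\<lambda>n. contour_integral (circlepath 0 (r n)) F) \<longlonglongrightarrow> 0"
    and summ: "((\<lambda>p. residue F p) has_sum T) A"
  shows "f contour_integrable_on \<gamma>" "contour_integral \<gamma> f = 2 * pi * \<i> * T"
proof -
  have g: "valid_path \<gamma>" "pathfinish \<gamma> = pathstart \<gamma>" "0 \<notin> path_image \<gamma>" "winding_number \<gamma> 0 = 1"
    using sep by (auto simp: separating_contour_def)
  note pg = valid_path_imp_path[OF g(1)]
  have near: "eventually (\<lambda>w. w \<noteq> 0 \<and> w \<notin> A \<union> B) (at z)" if z: "z \<noteq> 0" for z
  proof -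
    define X where "X = {p \<in> A \<union> B. norm z / 2 \<le> norm p \<and> norm p \<le> 2 * norm z}"
    have "finite X" unfolding X_def using z by (intro fin) simp
    then have "open ({w. norm z / 2 < norm w \<and> norm w < 2 * norm z} - (X - {z}))"
      by (intro open_Diff finite_imp_closed open_Collect_conj open_Collect_less continuous_intros) auto
    then have "eventually (\<lambda>w. w \<in> {w. norm z / 2 < norm w \<and> norm w < 2 * norm z} - (X - {z}) - {z}) (at z)"
      using z by (intro eventually_at_in_open) auto
    then show ?thesis by eventually_elim (auto simp: X_def)
  qed
  have pole_iff: "is_pole f z \<longleftrightarrow> is_pole F z" if "z \<noteq> 0" for z
    by (rule is_pole_cong[OF eventually_mono[OF near[OF that]]]) (auto simp: eq)
  have iso: "isolated_singularity_at F z" and ness: "not_essential F z" if "z \<noteq> 0" for z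
    using that meromorphic_on_subset[OF mero, of "{z}"]
    by (auto intro: meromorphic_on_isolated_singularity meromorphic_on_not_essential)
  define Pol where "Pol = {z. z \<noteq> 0 \<and> is_pole F z}"
  have Pol_sub: "Pol \<subseteq> A \<union> B"
  proof
    fix z assume z: "z \<in> Pol"
    show "z \<in> A \<union> B"
    proof (rule ccontr)
      assume "z \<notin> A \<union> B"
      then have "F analytic_on {z}" using z by (intro analytic_on_subset[OF ana]) (auto simp: Pol_def)
      then have "\<not> is_pole F z" using not_is_pole_holomorphic analytic_at by blast
      then show False using z by (simp add: Pol_def)
    qed
  qed
  define F' where "F' = remove_sings F"
  have F'_ana: "F' analytic_on {z}" if "z \<noteq> 0" "z \<notin> Pol" for z
    using that iso[of z] ness[of z] remove_sings_analytic_at[of F z]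
    unfolding F'_def Pol_def not_essential_def by auto
  have F'_eq: "F' z = F z" if "z \<noteq> 0" "z \<notin> A \<union> B" for z
    unfolding F'_def by (rule remove_sings_at_analytic, rule analytic_on_subset[OF ana]) (use that in auto)
  have res_F': "residue F' z = residue F z" if "z \<noteq> 0" for z
    unfolding F'_def using iso[OF that] by simp
  have res0: "residue F z = 0" if "z \<noteq> 0" "z \<notin> Pol" for z
    using residue_0_if_not_pole[OF iso ness] that by (auto simp: Pol_def)
  have cl: "closed (path_image \<gamma>)" using pg by (simp add: closed_path_image)
  obtain \<delta> where \<delta>: "\<delta> > 0" "ball 0 \<delta> \<inter> path_image \<gamma> = {}"
    using cl g(3) open_contains_ball[of "- path_image \<gamma>"] by (auto simp: open_Compl disjoint_eq_subset_Compl)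
  have wn1: "winding_number \<gamma> z = 1" if "norm z < \<delta>" for z
    using winding_number_eq[OF pg g(2), of z "ball 0 \<delta>" 0] that \<delta> g(4) by auto
  obtain R where R: "path_image \<gamma> \<subseteq> ball 0 R"
    using bounded_subset_ballD[OF bounded_path_image[OF pg]] by blast
  have wnR: "winding_number \<gamma> z = 0" if "R \<le> norm z" for z
    using that R pg g(2) by (intro winding_number_zero_outside[of _ "ball 0 R"]) auto
  define pts where "pts n = {z \<in> Pol. r n / 2 < norm z \<and> norm z < R}" for n
  have fpts: "finite (pts n)" for n
    by (rule finite_subset[OF _ fin[of "r n / 2" R]]) (use Pol_sub r(1)[of n] in \<open>auto simp: pts_def\<close>)
  have main: "contour_integral \<gamma> F' - contour_integral (circlepath 0 (r n)) F' =
      2 * pi * \<i> * (\<Sum>p | p \<in> pts n \<and> r n < norm p. winding_number \<gamma> p * residue F' p) \<and>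
      F' contour_integrable_on \<gamma>" if n: "r n < \<delta>" for n
  proof (rule contour_minus_circle_residues[where R = R and r = "r n" and pts = "pts n"])
    show "path_image \<gamma> \<subseteq> {z. r n < norm z \<and> norm z < R}"
    proof
      fix z assume z: "z \<in> path_image \<gamma>"
      then have "norm z < R" "\<not> norm z < \<delta>" using R \<delta>(2) by auto
      then show "z \<in> {z. r n < norm z \<and> norm z < R}" using n by simp
    qed
    show "F' holomorphic_on {z. r n / 2 < norm z \<and> norm z < R} - pts n"
    proof (rule analytic_imp_holomorphic, subst analytic_on_analytic_at, safe)
      fix z assume "z \<notin> pts n" "r n / 2 < norm z" "norm z < R"
      then show "F' analytic_on {z}"
        using r(1)[of n] by (intro F'_ana) (auto simp: pts_def)
    qed
    show "z \<notin> path_image \<gamma>" if "z \<in> pts n" for z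
      using that sep pole_iff by (auto simp: pts_def Pol_def separating_contour_def)
    show "norm z \<noteq> r n" if "z \<in> pts n" for z
      using that Pol_sub r(3) by (auto simp: pts_def)
  qed (use g r(1) fpts wn1 n in \<open>auto simp: pts_def\<close>)
  have sum_eq: "(\<Sum>p | p \<in> pts n \<and> r n < norm p. winding_number \<gamma> p * residue F' p) =
     (\<Sum>p | p \<in> pts n \<and> p \<in> A \<and> r n < norm p. residue F p)" for n
  proof (rule sum.mono_neutral_cong_right)
    show "\<forall>i\<in>{p \<in> pts n. r n < norm p} - {p \<in> pts n. p \<in> A \<and> r n < norm p}.
        winding_number \<gamma> i * residue F' i = 0"
    proof
      fix i assume i: "i \<in> {p \<in> pts n. r n < norm p} - {p \<in> pts n. p \<in> A \<and> r n < norm p}"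
      then have "i \<in> B" "is_pole f i" using Pol_sub pole_iff by (auto simp: pts_def Pol_def)
      then have "winding_number \<gamma> i = 0" using sep by (auto simp: separating_contour_def)
      then show "winding_number \<gamma> i * residue F' i = 0" by simp
    qed
    show "winding_number \<gamma> x * residue F' x = residue F x"
      if "x \<in> {p \<in> pts n. p \<in> A \<and> r n < norm p}" for x
    proof -
      have "is_pole f x" "x \<noteq> 0" using that pole_iff by (auto simp: pts_def Pol_def)
      then have "winding_number \<gamma> x = 1" using that sep by (auto simp: separating_contour_def)
      then show ?thesis using res_F' \<open>x \<noteq> 0\<close> by simp
    qed
  qed (use fpts[of n] in auto)
  have lim1: "(\<lambda>n. \<Sum>p | p \<in> pts n \<and> p \<in> A \<and> r n < norm p. residue F p) \<longlonglongrightarrow> T"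
  proof (rule has_sum_LIMSEQ_exhaust[OF summ])
    fix a assume a: "a \<in> A" "residue F a \<noteq> 0"
    have a0: "a \<noteq> 0" using nz a by auto
    have aP: "a \<in> Pol" using res0 a a0 by blast
    have "winding_number \<gamma> a = 1" using sep a aP pole_iff by (auto simp: separating_contour_def Pol_def)
    then have aR: "norm a < R" using wnR[of a] by (cases "R \<le> norm a") auto
    have "eventually (\<lambda>n. r n < norm a) sequentially"
      using r(2) a0 by (auto simp: order_tendsto_iff)
    then show "eventually (\<lambda>n. a \<in> {p. p \<in> pts n \<and> p \<in> A \<and> r n < norm p}) sequentially"
    proof (elim eventually_mono)
      fix n assume "r n < norm a"
      moreover have "r n / 2 < norm a" using r(1)[of n] \<open>r n < norm a\<close> by linarith
      ultimately show "a \<in> {p. p \<in> pts n \<and> p \<in> A \<and> r n < norm p}"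
        using aP a aR by (simp add: pts_def)
    qed
  qed (use fpts in auto)
  have ev: "eventually (\<lambda>n. r n < \<delta>) sequentially" using r(2) \<delta>(1) by (auto simp: order_tendsto_iff)
  have "contour_integral (circlepath 0 (r n)) F' = contour_integral (circlepath 0 (r n)) F" for n
  proof (rule contour_integral_cong)
    fix x assume "x \<in> path_image (circlepath 0 (r n))"
    then have "norm x = r n" using r(1)[of n] by simp
    then show "F' x = F x" using r(1)[of n] r(3)[of x n] by (intro F'_eq) auto
  qed simp
  then have "(\<lambda>n. contour_integral (circlepath 0 (r n)) F'
       + 2 * pi * \<i> * (\<Sum>p | p \<in> pts n \<and> p \<in> A \<and> r n < norm p. residue F p)) \<longlonglongrightarrow> 0 + 2 * pi * \<i> * T"
    using circ by (intro tendsto_intros lim1) simp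
  moreover have "eventually (\<lambda>n. contour_integral (circlepath 0 (r n)) F'
       + 2 * pi * \<i> * (\<Sum>p | p \<in> pts n \<and> p \<in> A \<and> r n < norm p. residue F p) = contour_integral \<gamma> F') sequentially"
    using ev by eventually_elim (use main sum_eq in \<open>simp add: algebra_simps\<close>)
  ultimately have "(\<lambda>n. contour_integral \<gamma> F') \<longlonglongrightarrow> 0 + 2 * pi * \<i> * T"
    by (rule Lim_transform_eventually)
  then have val: "contour_integral \<gamma> F' = 2 * pi * \<i> * T"
    by (simp add: LIMSEQ_const_iff)
  obtain n where "r n < \<delta>" using ev by (auto simp: eventually_sequentially)
  then have "(F' has_contour_integral (2 * pi * \<i> * T)) \<gamma>"
    using main val has_contour_integral_integral by metis
  then have "(f has_contour_integral (2 * pi * \<i> * T)) \<gamma>"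
  proof (rule contour_integral_spike[rotated -1])
    show "finite {p \<in> A \<union> B. \<delta> \<le> norm p \<and> norm p \<le> R}" by (rule fin[OF \<delta>(1)])
    fix z assume z: "z \<in> path_image \<gamma>" "z \<notin> {p \<in> A \<union> B. \<delta> \<le> norm p \<and> norm p \<le> R}"
    have "z \<in> ball 0 R" "z \<notin> ball 0 \<delta>" using R \<delta>(2) z(1) by blast+
    then have "\<delta> \<le> norm z" "norm z \<le> R" by auto
    then have "z \<noteq> 0" "z \<notin> A \<union> B" using z \<delta>(1) by auto
    then show "f z = F' z" by (simp add: eq F'_eq)
  qed (rule g)
  then show "f contour_integrable_on \<gamma>" "contour_integral \<gamma> f = 2 * pi * \<i> * T"
    by (auto simp: contour_integrable_on_def intro: contour_integral_unique)
qed

lemma has_sum_finite_UN_disjoint: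
  fixes f :: "'a \<Rightarrow> complex"
  assumes "finite J" "\<And>j. j \<in> J \<Longrightarrow> (f has_sum S j) (X j)"
    and "\<And>i j. i \<in> J \<Longrightarrow> j \<in> J \<Longrightarrow> i \<noteq> j \<Longrightarrow> X i \<inter> X j = {}"
  shows "(f has_sum (\<Sum>j\<in>J. S j)) (\<Union>j\<in>J. X j)"
  using assms
proof (induction J)
  case (insert j J)
  have "(f has_sum (S j + (\<Sum>j\<in>J. S j))) (X j \<union> (\<Union>j\<in>J. X j))"
  proof (rule has_sum_Un_disjoint)
    show "(f has_sum S j) (X j)" using insert.prems(1) by simp
    show "(f has_sum (\<Sum>j\<in>J. S j)) (\<Union>j\<in>J. X j)" using insert by simp
    show "X j \<inter> (\<Union>j\<in>J. X j) = {}" using insert.prems(2)[of j] insert.hyps by fastforce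
  qed
  then show ?case using insert.hyps by simp
qed simp

context nome
begin

section \<open>Integrals against an elliptic function\<close>

text \<open>If \<open>\<Prod> b i = q\<close>, this is an elliptic function with multiplicative period \<open>q\<close>, whose poles lie on the
  six lattices \<open>b\<^sub>j q\<^sup>\<int>\<close>.\<close>

definition ell :: "(nat \<Rightarrow> complex) \<Rightarrow> complex \<Rightarrow> complex" where
  "ell b z = (\<Prod>i\<in>I6. theta (b i * z)) / (z ^ 4 * (\<Prod>i\<in>I6. theta (b i / z)))"

lemma ell_q:
  assumes prod: "(\<Prod>i\<in>I6. b i) = q" and z: "z \<noteq> 0"
  shows "ell b (q * z) = ell b z"
proof -
  have nz: "b i \<noteq> 0" if "i \<in> I6" for i using prod that prod_zero[of I6 b] q_nz by auto
  have card: "card I6 = 6" by (simp add: I6_def)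
  have "(\<Prod>i\<in>I6. theta (b i * (q * z))) = (\<Prod>i\<in>I6. theta (b i * z) / b i * (- 1 / z))"
  proof (rule prod.cong)
    fix i assume "i \<in> I6"
    then show "theta (b i * (q * z)) = theta (b i * z) / b i * (- 1 / z)"
      using theta_q_mult[of "b i * z"] nz z by (simp add: mult_ac)
  qed simp
  also have "\<dots> = (\<Prod>i\<in>I6. theta (b i * z)) / (q * z ^ 6)"
    by (simp only: prod.distrib prod_dividef prod prod_constant card) (simp add: power_divide)
  finally have 1: "(\<Prod>i\<in>I6. theta (b i * (q * z))) = (\<Prod>i\<in>I6. theta (b i * z)) / (q * z ^ 6)" .
  have "(\<Prod>i\<in>I6. theta (b i / (q * z))) = (\<Prod>i\<in>I6. theta (b i / z) * b i * (- 1 / (q * z)))"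
  proof (rule prod.cong)
    fix i assume "i \<in> I6"
    then show "theta (b i / (q * z)) = theta (b i / z) * b i * (- 1 / (q * z))"
      using theta_div_q[of "b i / z"] nz z by (simp add: mult_ac)
  qed simp
  also have "\<dots> = (\<Prod>i\<in>I6. theta (b i / z)) * q / (q * z) ^ 6"
    by (simp only: prod.distrib prod prod_constant card) (simp add: power_divide)
  finally have 2: "(\<Prod>i\<in>I6. theta (b i / (q * z))) = (\<Prod>i\<in>I6. theta (b i / z)) * q / (q * z) ^ 6" .
  show ?thesis
    unfolding ell_def 1 2 using q_nz z
    by (cases "(\<Prod>i\<in>I6. theta (b i / z)) = 0") (simp_all add: field_simps power_mult_distrib power_numeral_reduce)
qed

lemma ell_powi:
  assumes prod: "(\<Prod>i\<in>I6. b i) = q" and z: "z \<noteq> 0"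
  shows "ell b (z * q powi k) = ell b z"
proof -
  have *: "ell b (z * q ^ n) = ell b z" if "z \<noteq> 0" for n z
  proof (induction n)
    case (Suc n)
    have "ell b (z * q ^ Suc n) = ell b (q * (z * q ^ n))" by (simp add: mult_ac)
    also have "\<dots> = ell b z" using Suc that q_nz by (subst ell_q[OF prod]) auto
    finally show ?case .
  qed simp
  show ?thesis
  proof (cases "0 \<le> k")
    case True
    then show ?thesis using *[OF z, of "nat k"] by (simp add: power_int_def)
  next
    case False
    have "z * q powi k * q ^ nat (-k) = z"
      using False q_nz by (simp add: power_int_def power_inverse)
    moreover have "z * q powi k \<noteq> 0" using z q_nz by simp
    ultimately show ?thesis using *[of "z * q powi k" "nat (-k)"] by metis
  qed
qed

lemma ell_analytic:
  assumes b: "generic b" and t: "t \<noteq> 0"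
  shows "(\<lambda>z. ell b (t * z)) analytic_on {z. z \<noteq> 0 \<and> (\<forall>i\<in>I6. b i / (t * z) \<notin> qZ)}"
  unfolding ell_def using genericD(1)[OF b] t
  by (intro analytic_intros) (auto simp: theta_nz)

lemma ell_meromorphic:
  assumes b: "generic b" and t: "t \<noteq> 0"
  shows "(\<lambda>z. ell b (t * z)) meromorphic_on -{0}"
  unfolding ell_def using genericD(1)[OF b] t
  by (intro meromorphic_on_divide meromorphic_on_mult analytic_on_imp_meromorphic_on analytic_intros) auto

text \<open>Thus \<open>nu\<close> is, up to a common constant, the residue of \<open>ell b y / y\<close> at \<open>b j\<close>.\<close>

lemma ell_limit:
  assumes b: "generic b" and j: "j \<in> I6"
  shows "((\<lambda>y. (1 - b j / y) * ell b y) \<longlongrightarrow> nu b j / (qpoch_inf q q)\<^sup>2) (at (b j))"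
proof -
  have bj: "b j \<noteq> 0" using genericD(1)[OF b j] .
  have nz: "theta (b i / b j) \<noteq> 0" if "i \<in> I6 - {j}" for i
    using that genericD(2)[OF b _ j] by (intro theta_nz) auto
  note qq = qpoch_inf_q_nz
  have "((\<lambda>y. (\<Prod>i\<in>I6. theta (b i * y)) / (y ^ 4 * (qpoch_inf q (q * (b j / y)) * qpoch_inf q (q / (b j / y)) *
      (\<Prod>i\<in>I6-{j}. theta (b i / y))))) \<longlongrightarrow>
    (\<Prod>i\<in>I6. theta (b i * b j)) / (b j ^ 4 * (qpoch_inf q (q * (b j / b j)) * qpoch_inf q (q / (b j / b j)) *
      (\<Prod>i\<in>I6-{j}. theta (b i / b j))))) (at (b j))"
    using bj nz qq genericD(1)[OF b] by (intro tendsto_intros) auto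
  moreover have "eventually (\<lambda>y. y \<noteq> 0 \<and> y \<noteq> b j) (at (b j))"
  proof -
    have "eventually (\<lambda>y. y \<in> - {0} - {b j}) (at (b j))"
      using bj by (intro eventually_at_in_open) (auto simp: open_Compl)
    then show ?thesis by eventually_elim auto
  qed
  then have "eventually (\<lambda>y. (\<Prod>i\<in>I6. theta (b i * y)) / (y ^ 4 * (qpoch_inf q (q * (b j / y)) * qpoch_inf q (q / (b j / y)) *
      (\<Prod>i\<in>I6-{j}. theta (b i / y)))) = (1 - b j / y) * ell b y) (at (b j))"
  proof eventually_elim
    case (elim y)
    have 1: "1 - b j / y \<noteq> 0" using elim by auto
    have "(\<Prod>i\<in>I6. theta (b i / y)) = theta (b j / y) * (\<Prod>i\<in>I6-{j}. theta (b i / y))"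
      using j by (simp add: prod.remove)
    also have "theta (b j / y) = (1 - b j / y) * (qpoch_inf q (q * (b j / y)) * qpoch_inf q (q / (b j / y)))"
      using qpoch_inf_step[of "b j / y"] by (simp add: theta_def)
    finally have "(\<Prod>i\<in>I6. theta (b i / y)) = (1 - b j / y) * (qpoch_inf q (q * (b j / y)) *
        qpoch_inf q (q / (b j / y)) * (\<Prod>i\<in>I6-{j}. theta (b i / y)))" by (simp only: mult.assoc)
    moreover have "u / (v * w) = x * (u / (v * (x * w)))" if "x \<noteq> 0" for u v w x :: complex
      using that by (simp add: divide_simps)
    ultimately show ?case unfolding ell_def using 1 by metis
  qed
  ultimately have "((\<lambda>y. (1 - b j / y) * ell b y) \<longlongrightarrow>
    (\<Prod>i\<in>I6. theta (b i * b j)) / (b j ^ 4 * (qpoch_inf q (q * (b j / b j)) * qpoch_inf q (q / (b j / b j)) *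
      (\<Prod>i\<in>I6-{j}. theta (b i / b j))))) (at (b j))"
    by (rule Lim_transform_eventually)
  then show ?thesis using bj by (simp add: nu_def power2_eq_square mult_ac)
qed

text \<open>The two families of lattices on which poles can lie, for the variable scaled by \<open>t\<close>.\<close>

definition lat :: "(nat \<Rightarrow> complex) \<Rightarrow> complex \<Rightarrow> complex set" where
  "lat b t = {b j / t * q powi k | j k. j \<in> I6}"

definition dual_lat :: "(nat \<Rightarrow> complex) \<Rightarrow> complex \<Rightarrow> complex set" where
  "dual_lat b t = {1 / (b j * t) * q powi k | j k. j \<in> I6}"

lemma finite_lattice_annulus:
  assumes "a \<noteq> 0" "0 < \<epsilon>"
  shows "finite {p \<in> range (\<lambda>k. a * q powi k). \<epsilon> \<le> norm p \<and> norm p \<le> R}"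
proof -
  have lim: "(\<lambda>n. norm q ^ n) \<longlonglongrightarrow> 0" using q_lt1 by (intro LIMSEQ_realpow_zero) auto
  obtain n1 where n1: "\<And>n. n \<ge> n1 \<Longrightarrow> norm q ^ n < \<epsilon> / norm a"
    using order_tendstoD(2)[OF lim, of "\<epsilon> / norm a"] assms by (auto simp: eventually_sequentially)
  obtain n2 where n2: "\<And>n. n \<ge> n2 \<Longrightarrow> norm q ^ n < norm a / (\<bar>R\<bar> + 1)"
    using order_tendstoD(2)[OF lim, of "norm a / (\<bar>R\<bar> + 1)"] assms by (auto simp: eventually_sequentially)
  have "{p \<in> range (\<lambda>k. a * q powi k). \<epsilon> \<le> norm p \<and> norm p \<le> R} \<subseteq>
      (\<lambda>k. a * q powi k) ` {- int n2..int n1}"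
  proof safe
    fix k :: int assume le: "\<epsilon> \<le> norm (a * q powi k)" "norm (a * q powi k) \<le> R"
    have "k \<le> int n1"
    proof (rule ccontr)
      assume "\<not> ?thesis"
      then have "norm q ^ nat k < \<epsilon> / norm a" by (intro n1) auto
      then show False using le(1) assms \<open>\<not> k \<le> int n1\<close>
        by (simp add: norm_mult power_int_def norm_power field_simps)
    qed
    moreover have "- int n2 \<le> k"
    proof (rule ccontr)
      assume neg: "\<not> ?thesis"
      then have "norm q ^ nat (-k) < norm a / (\<bar>R\<bar> + 1)" by (intro n2) auto
      then have "norm q ^ nat (-k) * (\<bar>R\<bar> + 1) < norm a"
        by (simp add: pos_less_divide_eq)
      moreover have "norm a = norm (a * q powi k) * norm q ^ nat (-k)"
        using neg q_nz by (simp add: norm_mult power_int_def norm_power norm_inverse power_inverse)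
      moreover have "norm (a * q powi k) * norm q ^ nat (-k) \<le> (\<bar>R\<bar> + 1) * norm q ^ nat (-k)"
        using le(2) by (intro mult_right_mono) auto
      ultimately show False by (simp add: mult.commute)
    qed
    ultimately show "a * q powi k \<in> (\<lambda>k. a * q powi k) ` {- int n2..int n1}" by auto
  qed
  then show ?thesis by (rule finite_subset) simp
qed

lemma lat_UN: "lat b t = (\<Union>j\<in>I6. range (\<lambda>k. b j / t * q powi k))"
  "dual_lat b t = (\<Union>j\<in>I6. range (\<lambda>k. 1 / (b j * t) * q powi k))"
  by (auto simp: lat_def dual_lat_def)

lemma finite_lat_annulus:
  assumes b: "generic b" and t: "t \<noteq> 0" and e: "0 < \<epsilon>"
  shows "finite {p \<in> lat b t \<union> dual_lat b t. \<epsilon> \<le> norm p \<and> norm p \<le> R}"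
proof -
  have "{p \<in> lat b t \<union> dual_lat b t. \<epsilon> \<le> norm p \<and> norm p \<le> R} =
     (\<Union>j\<in>I6. {p \<in> range (\<lambda>k. b j / t * q powi k). \<epsilon> \<le> norm p \<and> norm p \<le> R} \<union>
         {p \<in> range (\<lambda>k. 1 / (b j * t) * q powi k). \<epsilon> \<le> norm p \<and> norm p \<le> R})"
    unfolding lat_UN by blast
  moreover have "finite {p \<in> range (\<lambda>k. b j / t * q powi k). \<epsilon> \<le> norm p \<and> norm p \<le> R}"
     "finite {p \<in> range (\<lambda>k. 1 / (b j * t) * q powi k). \<epsilon> \<le> norm p \<and> norm p \<le> R}" if "j \<in> I6" for j
    by (rule finite_lattice_annulus[OF _ e], use genericD(1)[OF b that] t in simp)+
  ultimately show ?thesis by (simp only: finite_UN finite_I6 finite_Un) blast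
qed

lemma mem_lat_iff: "t \<noteq> 0 \<Longrightarrow> z \<noteq> 0 \<Longrightarrow> generic b \<Longrightarrow> z \<in> lat b t \<longleftrightarrow> (\<exists>i\<in>I6. b i / (t * z) \<in> qZ)"
proof -
  assume *: "t \<noteq> 0" "z \<noteq> 0" "generic b"
  have "(\<exists>k. z = b i / t * q powi k) \<longleftrightarrow> b i / (t * z) \<in> qZ" if "i \<in> I6" for i
  proof -
    have bi: "b i \<noteq> 0" using genericD(1)[OF *(3) that] .
    have "b i / (t * z) \<in> qZ \<longleftrightarrow> (\<exists>k. b i / (t * z) = q powi k)" by (auto simp: qZ_def)
    also have "\<dots> \<longleftrightarrow> (\<exists>k. b i / (t * z) = q powi (- k))" by (metis minus_minus)
    also have "\<dots> \<longleftrightarrow> (\<exists>k. z = b i / t * q powi k)"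
      using * bi q_nz by (intro arg_cong[where f = Ex] ext) (auto simp: power_int_minus field_simps)
    finally show ?thesis by simp
  qed
  then show ?thesis unfolding lat_def by blast
qed

lemma mem_dual_lat_iff: "t \<noteq> 0 \<Longrightarrow> generic b \<Longrightarrow> z \<in> dual_lat b t \<longleftrightarrow> (\<exists>i\<in>I6. b i * (t * z) \<in> qZ)"
proof -
  assume *: "t \<noteq> 0" "generic b"
  have "(\<exists>k. z = 1 / (b i * t) * q powi k) \<longleftrightarrow> b i * (t * z) \<in> qZ" if "i \<in> I6" for i
    using genericD(1)[OF *(2) that] * by (auto simp: qZ_def field_simps)
  then show ?thesis unfolding dual_lat_def by blast
qed

lemma lat_dual_disjoint:
  assumes b: "generic b" and t: "t \<noteq> 0"
  shows "lat b t \<inter> dual_lat b t = {}"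
proof -
  have False if z: "z \<in> lat b t" "z \<in> dual_lat b t" for z
  proof -
    have z0: "z \<noteq> 0" using z(1) genericD(1)[OF b] t q_nz by (auto simp: lat_def)
    obtain i j where ij: "i \<in> I6" "b i / (t * z) \<in> qZ" "j \<in> I6" "b j * (t * z) \<in> qZ"
      using z mem_lat_iff[OF t z0 b] mem_dual_lat_iff[OF t b] by auto
    from qZ_mult[OF ij(2,4)] have "b i * b j \<in> qZ" using t z0 by simp
    then show False using genericD(3)[OF b] ij by blast
  qed
  then show ?thesis by blast
qed

lemma exists_good_radius:
  assumes "countable X"
  obtains r :: real where "0 < r" "r < 1" "r \<notin> X"
proof -
  have "uncountable ({0<..<1::real} - X)"
    using assms uncountable_open_interval[of 0 1] by (simp add: uncountable_minus_countable)
  then obtain r where "r \<in> {0<..<1} - X" by (metis countable_empty equals0I)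
  then show ?thesis using that by auto
qed

text \<open>Multiplied by an elliptic function, a function \<open>G\<close> that vanishes at the origin has negligible integrals
  over the circles \<open>\<bar>z\<bar> = r \<bar>q\<bar>\<^sup>n\<close>. What remains are the poles of the elliptic function.\<close>

lemma elliptic_contour_integral:
  assumes b: "generic b" and prod: "(\<Prod>i\<in>I6. b i) = q" and t: "t \<noteq> 0"
    and sep: "separating_contour f (lat b t) (dual_lat b t) \<gamma>"
    and mero: "G meromorphic_on UNIV" and ana: "G analytic_on -({0} \<union> dual_lat b t)"
    and lim: "(G \<longlongrightarrow> 0) (at 0)"
    and eq: "\<And>z. z \<noteq> 0 \<Longrightarrow> z \<notin> lat b t \<union> dual_lat b t \<Longrightarrow> f z = G z * ell b (t * z) / z"
    and summ: "\<And>j. j \<in> I6 \<Longrightarrow> ((\<lambda>k. G (b j / t * q powi k)) has_sum T j) UNIV"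
  shows "f contour_integrable_on \<gamma>"
    "contour_integral \<gamma> f = 2 * pi * \<i> * (\<Sum>j\<in>I6. nu b j * T j) / (qpoch_inf q q)\<^sup>2"
proof -
  define F where "F z = G z * ell b (t * z) / z" for z
  define A where "A = lat b t"
  define B where "B = dual_lat b t"
  have bnz: "b j \<noteq> 0" if "j \<in> I6" for j using genericD(1)[OF b that] .
  have nz: "0 \<notin> A \<union> B" using bnz t q_nz by (auto simp: A_def B_def lat_def dual_lat_def)
  have F_mero: "F meromorphic_on - {0}"
    unfolding F_def by (intro meromorphic_intros meromorphic_on_subset[OF mero] ell_meromorphic b t) auto
  have "{z. z \<noteq> 0 \<and> z \<notin> A} = {z. z \<noteq> 0 \<and> (\<forall>i\<in>I6. b i / (t * z) \<notin> qZ)}"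
    using mem_lat_iff[OF t _ b] by (auto simp: A_def)
  then have ell_ana: "(\<lambda>z. ell b (t * z)) analytic_on {z. z \<noteq> 0 \<and> z \<notin> A}"
    using ell_analytic[OF b t] by simp
  have F_ana: "F analytic_on -({0} \<union> A \<union> B)"
    unfolding F_def
    by (intro analytic_intros analytic_on_subset[OF ana] analytic_on_subset[OF ell_ana]) (auto simp: B_def)
  have fin: "finite {p \<in> A \<union> B. \<epsilon> \<le> norm p \<and> norm p \<le> R}" if "0 < \<epsilon>" for \<epsilon> R
    unfolding A_def B_def by (rule finite_lat_annulus[OF b t that])
  have res: "residue F (b j / t * q powi k) = G (b j / t * q powi k) * (nu b j / (qpoch_inf q q)\<^sup>2)"
    if j: "j \<in> I6" for j k
  proof -
    define p where "p = b j / t * q powi k"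
    have p0: "p \<noteq> 0" using bnz[OF j] t q_nz by (simp add: p_def)
    have pA: "p \<in> A" using j by (auto simp: p_def A_def lat_def)
    have pB: "p \<notin> B" using pA lat_dual_disjoint[OF b t] by (auto simp: A_def B_def)
    define X where "X = {w \<in> A \<union> B. norm p / 2 \<le> norm w \<and> norm w \<le> 2 * norm p}"
    define s where "s = {w. norm p / 2 < norm w \<and> norm w < 2 * norm p} - (X - {p})"
    have os: "open s" unfolding s_def
      using fin[of "norm p / 2" "2 * norm p"] p0
      by (intro open_Diff finite_imp_closed open_Collect_conj open_Collect_less continuous_intros)
         (auto simp: X_def)
    have ps: "p \<in> s" using p0 by (simp add: s_def)
    have hol: "F holomorphic_on s - {p}"
      by (rule analytic_imp_holomorphic, rule analytic_on_subset[OF F_ana]) (auto simp: s_def X_def)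
    have "G analytic_on {p}" using p0 pB by (intro analytic_on_subset[OF ana]) (auto simp: B_def)
    then have "(G \<longlongrightarrow> G p) (at p)" using analytic_at_imp_isCont isCont_def by blast
    moreover have "((\<lambda>z. (1 - b j / (t * z * q powi (-k))) * ell b (t * z * q powi (-k))) \<longlongrightarrow>
        nu b j / (qpoch_inf q q)\<^sup>2) (at p)"
    proof (rule filterlim_compose[OF ell_limit[OF b j]])
      have c: "t * q powi (-k) \<noteq> 0" using t q_nz by simp
      have "((\<lambda>z. t * z * q powi (-k)) \<longlongrightarrow> t * p * q powi (-k)) (at p)" by (intro tendsto_intros)
      moreover have "t * p * q powi (-k) = b j" using t q_nz by (simp add: p_def power_int_minus)
      moreover have "eventually (\<lambda>z. t * z * q powi (-k) \<noteq> b j) (at p)"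
        using eventually_neq_at_within[of p p UNIV]
      proof eventually_elim
        case (elim z)
        have "z = p" if "t * z * q powi (-k) = t * p * q powi (-k)" using that t q_nz by simp
        then show ?case using elim calculation(2) by auto
      qed
      ultimately show "filterlim (\<lambda>z. t * z * q powi (-k)) (at (b j)) (at p)"
        by (simp add: filterlim_at)
    qed
    ultimately have "((\<lambda>z. G z * ((1 - b j / (t * z * q powi (-k))) * ell b (t * z * q powi (-k)))) \<longlongrightarrow>
        G p * (nu b j / (qpoch_inf q q)\<^sup>2)) (at p)" by (intro tendsto_intros)
    moreover have "eventually (\<lambda>z. G z * ((1 - b j / (t * z * q powi (-k))) * ell b (t * z * q powi (-k))) =
        F z * (z - p)) (at p)"
    proof -
      have "eventually (\<lambda>z. z \<in> - {0} - {p}) (at p)"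
        using p0 by (intro eventually_at_in_open) (auto simp: open_Compl)
      then show ?thesis
      proof eventually_elim
        case (elim z)
        have "ell b (t * z * q powi (-k)) = ell b (t * z)" using elim t by (intro ell_powi prod) auto
        moreover have "1 - b j / (t * z * q powi (-k)) = (z - p) / z"
          using elim t q_nz by (simp add: p_def power_int_minus field_simps)
        ultimately show ?case by (simp add: F_def)
      qed
    qed
    ultimately have "((\<lambda>z. F z * (z - p)) \<longlongrightarrow> G p * (nu b j / (qpoch_inf q q)\<^sup>2)) (at p)"
      by (rule Lim_transform_eventually)
    from residue_simple'[OF os ps hol this] show ?thesis by (simp add: p_def)
  qed
  have summA: "((\<lambda>p. residue F p) has_sum (\<Sum>j\<in>I6. T j * (nu b j / (qpoch_inf q q)\<^sup>2))) A"
    unfolding A_def lat_UN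
  proof (rule has_sum_finite_UN_disjoint)
    fix j assume j: "j \<in> I6"
    have inj: "inj (\<lambda>k. b j / t * q powi k)"
      using bnz[OF j] t by (auto intro!: injI simp: q_powi_inj)
    have "((\<lambda>k. G (b j / t * q powi k) * (nu b j / (qpoch_inf q q)\<^sup>2)) has_sum
        (T j * (nu b j / (qpoch_inf q q)\<^sup>2))) UNIV"
      by (intro has_sum_cmult_left summ j)
    then show "(residue F has_sum (T j * (nu b j / (qpoch_inf q q)\<^sup>2))) (range (\<lambda>k. b j / t * q powi k))"
      unfolding has_sum_reindex[OF inj] o_def res[OF j] .
  next
    fix i j assume ij: "i \<in> I6" "j \<in> I6" "i \<noteq> j"
    have False if "b i / t * q powi k = b j / t * q powi l" for k l
    proof -
      have "b i / b j = q powi (l - k)" using that bnz ij t q_nz by (simp add: power_int_diff field_simps)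
      then show False using genericD(2)[OF b ij] by simp
    qed
    then show "range (\<lambda>k. b i / t * q powi k) \<inter> range (\<lambda>k. b j / t * q powi k) = {}" by blast
  qed simp
  have ctbl: "countable ((\<lambda>(p, n). norm p / norm q ^ n) ` ((A \<union> B) \<times> (UNIV :: nat set)))"
    unfolding A_def B_def lat_UN by (intro countable_image countable_SIGMA countable_Un countable_UN) auto
  obtain r0 where r0: "0 < r0" "r0 < 1" "r0 \<notin> (\<lambda>(p, n). norm p / norm q ^ n) ` ((A \<union> B) \<times> (UNIV :: nat set))"
    by (rule exists_good_radius[OF ctbl])
  define r where "r n = r0 * norm q ^ n" for n
  have r_pos: "0 < r n" for n using r0 q_nz by (simp add: r_def)
  have r_lim: "r \<longlonglongrightarrow> 0"
    unfolding r_def using q_lt1 by (auto intro!: tendsto_mult_right_zero LIMSEQ_realpow_zero)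
  have r_ne: "norm p \<noteq> r n" if "p \<in> A \<union> B" for n p
  proof
    assume "norm p = r n"
    then have "r0 = norm p / norm q ^ n" using q_nz by (simp add: r_def)
    then show False using r0(3) that by force
  qed
  have circ: "(\<lambda>n. contour_integral (circlepath 0 (r n)) F) \<longlonglongrightarrow> 0"
  proof -
    have "continuous_on (sphere 0 r0) (\<lambda>z. ell b (t * z))"
      by (intro holomorphic_on_imp_continuous_on analytic_imp_holomorphic analytic_on_subset[OF ell_ana])
         (use r_ne[of _ 0] r0 in \<open>auto simp: r_def\<close>)
    then have "compact ((\<lambda>z. ell b (t * z)) ` sphere 0 r0)" by (intro compact_continuous_image) auto
    then obtain M where M: "\<And>z. norm z = r0 \<Longrightarrow> norm (ell b (t * z)) \<le> M"
      by (fastforce simp: bounded_iff dest!: compact_imp_bounded)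
    have M': "norm (ell b (t * z)) \<le> M" if z: "norm z = r n" for z n
    proof -
      have "norm (ell b (t * (z / q ^ n))) \<le> M"
        using z q_nz by (intro M) (simp add: norm_divide norm_power r_def)
      moreover have "ell b (t * z) = ell b (t * (z / q ^ n) * q powi int n)" using q_nz by simp
      moreover have "\<dots> = ell b (t * (z / q ^ n))"
        using z r_pos[of n] t q_nz by (intro ell_powi prod) auto
      ultimately show ?thesis by simp
    qed
    have M0: "0 \<le> M" using M[of "of_real r0"] r0 by (smt (verit) norm_ge_zero norm_of_real)
    have Fint: "F contour_integrable_on (circlepath 0 (r n))" for n
    proof (rule contour_integrable_continuous_circlepath)
      show "continuous_on (path_image (circlepath 0 (r n))) F"
        by (intro holomorphic_on_imp_continuous_on analytic_imp_holomorphic analytic_on_subset[OF F_ana])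
           (use r_ne[of _ n] r_pos[of n] in \<open>auto simp: A_def\<close>)
    qed
    have bound: "norm (contour_integral (circlepath 0 (r n)) F) \<le> e * M / r n * (2 * pi * r n)"
      if e: "\<And>z. norm z = r n \<Longrightarrow> norm (G z) \<le> e" "0 \<le> e" for e n
    proof (rule has_contour_integral_bound_circlepath[OF has_contour_integral_integral[OF Fint]])
      show "0 \<le> e * M / r n" using e M0 r_pos[of n] by (simp add: less_imp_le)
      show "norm (F z) \<le> e * M / r n" if "cmod (z - 0) = r n" for z
      proof -
        have "norm (G z) * norm (ell b (t * z)) \<le> e * M"
          using that by (intro mult_mono e M') (auto simp: e)
        then show ?thesis using that r_pos[of n] by (simp add: F_def norm_mult norm_divide divide_right_mono)
      qed
    qed (use r_pos in auto)
    show ?thesis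
    proof (rule tendstoI)
      fix \<epsilon> :: real assume \<epsilon>: "0 < \<epsilon>"
      define e where "e = \<epsilon> / (2 * pi * (M + 1))"
      have e: "0 < e" using \<epsilon> M0 by (simp add: e_def)
      have "eventually (\<lambda>z. norm (G z) < e) (at 0)"
        using tendstoD[OF lim e] by simp
      then obtain d where d: "d > 0" "\<And>z. z \<noteq> 0 \<Longrightarrow> norm z < d \<Longrightarrow> norm (G z) < e"
        by (auto simp: eventually_at)
      have "eventually (\<lambda>n. r n < d) sequentially" using r_lim d(1) by (auto simp: order_tendsto_iff)
      then show "eventually (\<lambda>n. dist (contour_integral (circlepath 0 (r n)) F) 0 < \<epsilon>) sequentially"
      proof eventually_elim
        case (elim n)
        have "norm (contour_integral (circlepath 0 (r n)) F) \<le> e * M / r n * (2 * pi * r n)"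
        proof (rule bound)
          fix z :: complex assume z: "norm z = r n"
          then have "z \<noteq> 0" using r_pos[of n] by auto
          then show "norm (G z) \<le> e" using d(2)[of z] z elim by simp
        qed (use e in simp)
        also have "\<dots> = e * M * (2 * pi)" using r_pos[of n] by simp
        also have "\<dots> < e * (M + 1) * (2 * pi)" using e by (intro mult_strict_right_mono) auto
        also have "\<dots> = \<epsilon>" using M0 by (simp add: e_def)
        finally show ?case by simp
      qed
    qed
  qed
  note result = separating_contour_residues[OF sep[folded A_def B_def] F_mero F_ana fin nz _ r_pos r_lim r_ne circ summA]
  show "f contour_integrable_on \<gamma>" using result(1) eq by (simp add: F_def A_def B_def)
  have "contour_integral \<gamma> f = 2 * pi * \<i> * (\<Sum>j\<in>I6. T j * (nu b j / (qpoch_inf q q)\<^sup>2))"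
    using result(2) eq by (simp add: F_def A_def B_def)
  then show "contour_integral \<gamma> f = 2 * pi * \<i> * (\<Sum>j\<in>I6. nu b j * T j) / (qpoch_inf q q)\<^sup>2"
    by (simp only: sum_divide_distrib[symmetric] times_divide_eq_right mult.commute[of "T _"])
qed

lemma weight_core_analytic: "weight_core b analytic_on {z. \<forall>i\<in>I6. b i * z \<notin> qZ}"
proof -
  have "weight_core b = (\<lambda>z. \<Prod>i\<in>I6. qpoch_inf q (q / b i * z) / qpoch_inf q (b i * z))"
    by (simp add: weight_core_def fun_eq_iff)
  then show ?thesis
    by (simp only:) (intro analytic_intros; auto simp: qpoch_inf_nz)
qed

lemma weight_core_meromorphic: "weight_core b meromorphic_on S"
proof -
  have "weight_core b = (\<lambda>z. \<Prod>i\<in>I6. qpoch_inf q (q / b i * z) / qpoch_inf q (b i * z))"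
    by (simp add: weight_core_def fun_eq_iff)
  then show ?thesis
    by (simp only:) (intro meromorphic_intros analytic_on_imp_meromorphic_on analytic_intros)
qed

lemma weight_meromorphic: "weight b meromorphic_on S"
  unfolding weight_def[abs_def]
  by (intro meromorphic_on_mult weight_core_meromorphic meromorphic_intros)

lemma weight_analytic: "weight b analytic_on {z. \<forall>i\<in>I6. b i * z \<notin> qZ}"
  unfolding weight_def[abs_def] by (intro analytic_intros weight_core_analytic)

lemma weight_tendsto_0: "(weight b \<longlongrightarrow> 0) (at 0)"
proof -
  have "((\<lambda>z. z * (1 - z\<^sup>2) * weight_core b z) \<longlongrightarrow> 0 * (1 - 0\<^sup>2) * weight_core b 0) (at 0)"
    using isCont_weight_core_0[of b] unfolding isCont_def by (intro tendsto_intros)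
  then show ?thesis by (simp add: weight_def[abs_def])
qed

lemma weight_has_sum:
  assumes "generic b" "j \<in> I6"
  shows "((\<lambda>k. weight b (b j * q powi k)) has_sum jackson b (b j)) UNIV"
  unfolding jackson_def using genericD(1)[OF assms] assms
  by (intro has_sum_infsum weight_summable[where j = j and m = 0]) auto

text \<open>Times the elliptic function, the weight becomes a function of \<open>1/z\<close> that is holomorphic and vanishes
  to second order at infinity. Hence the sum of all its residues is 0.\<close>

lemma nu_jackson_sum_0:
  assumes b: "generic b" and prod: "(\<Prod>i\<in>I6. b i) = q"
  shows "(\<Sum>j\<in>I6. nu b j * jackson b (b j)) = 0"
proof -
  have bnz: "b j \<noteq> 0" if "j \<in> I6" for j using genericD(1)[OF b that] .
  define h where "h w = (w\<^sup>2 - 1) * (\<Prod>i\<in>I6. qpoch_inf q (q / b i * w) / qpoch_inf q (b i * w))" for w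
  define f where "f z = h (1 / z) / z\<^sup>2" for z
  \<comment> \<open>All poles of \<open>f\<close> lie within the circle of radius \<open>R0\<close>.\<close>
  define R0 where "R0 = 1 + (\<Sum>i\<in>I6. norm (b i))"
  have R0: "1 \<le> R0" unfolding R0_def by (simp add: sum_nonneg)
  have bR0: "norm (b i) < R0" if "i \<in> I6" for i
    using member_le_sum[OF that, of "\<lambda>i. norm (b i)"] by (simp add: R0_def)
  have qp_nz: "qpoch_inf q x \<noteq> 0" if "norm x < 1" for x
  proof -
    have "x * q ^ k \<noteq> 1" for k
    proof
      assume "x * q ^ k = 1"
      then have "norm x * norm q ^ k = 1" by (metis norm_mult norm_one norm_power)
      moreover have "norm x * norm q ^ k \<le> norm x * 1"
        using q_lt1 by (intro mult_left_mono power_le_one) auto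
      ultimately show False using that by simp
    qed
    then show ?thesis by (auto simp: qpoch_inf_eq_0_iff)
  qed
  have small: "norm (b i * w) < 1" if "norm w \<le> 1 / R0" "i \<in> I6" for i w
  proof -
    have "norm (b i) * norm w \<le> norm (b i) * (1 / R0)" using that(1) by (intro mult_left_mono) auto
    also have "\<dots> < 1" using bR0[OF that(2)] R0 by simp
    finally show ?thesis by (simp add: norm_mult)
  qed
  have "continuous_on (cball 0 (1 / R0)) h"
    unfolding h_def using small qp_nz by (intro continuous_intros) auto
  then have "compact (h ` cball 0 (1 / R0))" by (intro compact_continuous_image) auto
  then obtain C where C: "\<And>w. norm w \<le> 1 / R0 \<Longrightarrow> norm (h w) \<le> C"
    by (fastforce simp: bounded_iff dest!: compact_imp_bounded)
  define T where "T = 2 * pi * \<i> * (\<Sum>j\<in>I6. nu b j * jackson b (b j)) / (qpoch_inf q q)\<^sup>2"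
  have int: "(f has_contour_integral T) (circlepath 0 R)" if R: "R0 < R" for R
  proof -
    have R_pos: "0 < R" using R R0 by simp
    have pole: "norm p < R \<and> p \<notin> dual_lat b 1" if p: "is_pole f p" "p \<noteq> 0" for p
    proof -
      have "\<exists>i\<in>I6. qpoch_inf q (b i * (1 / p)) = 0"
      proof (rule ccontr)
        assume *: "\<not> ?thesis"
        have "f analytic_on {p}"
          unfolding f_def h_def using p(2) * by (intro analytic_intros) auto
        then show False using p(1) not_is_pole_holomorphic analytic_at by blast
      qed
      then obtain i k where ik: "i \<in> I6" "b i * (1 / p) * q ^ k = 1"
        by (auto simp: qpoch_inf_eq_0_iff)
      then have pe: "p = b i * q ^ k" using p(2) by (simp add: field_simps)
      have "norm p \<le> norm (b i) * 1"
        unfolding pe norm_mult norm_power using q_lt1 by (intro mult_left_mono power_le_one) auto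
      moreover have "p \<in> lat b 1"
        unfolding lat_def pe using ik(1) by (auto intro!: exI[of _ i] exI[of _ "int k"])
      ultimately show ?thesis using bR0[OF ik(1)] R lat_dual_disjoint[OF b, of 1] by auto
    qed
    have nz: "0 \<notin> lat b 1" "0 \<notin> dual_lat b 1"
      using bnz q_nz by (auto simp: lat_def dual_lat_def)
    have sep: "separating_contour f (lat b 1) (dual_lat b 1) (circlepath 0 R)"
      unfolding separating_contour_def
    proof (intro conjI allI impI ballI)
      show "p \<notin> path_image (circlepath 0 R)" if "is_pole f p" for p
        using pole[OF that] R_pos by (cases "p = 0") auto
      show "winding_number (circlepath 0 R) p = 1" if "p \<in> lat b 1" "is_pole f p" for p
        using pole[OF that(2)] nz that by (intro winding_number_circlepath) auto
      show "winding_number (circlepath 0 R) p = 0" if "p \<in> dual_lat b 1" "is_pole f p" for p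
        using pole[OF that(2)] nz that by auto
    qed (use R_pos in \<open>auto intro!: winding_number_circlepath\<close>)
    have eq: "f z = weight b z * ell b (1 * z) / z" if z: "z \<noteq> 0" "z \<notin> lat b 1 \<union> dual_lat b 1" for z
    proof -
      have nl: "b i / z \<notin> qZ" "b i * z \<notin> qZ" if "i \<in> I6" for i
        using z mem_lat_iff[of 1 z b] mem_dual_lat_iff[of 1 b z] b that by auto
      have *: "qpoch_inf q (q / b i * (1 / z)) / qpoch_inf q (b i * (1 / z)) =
          qpoch_inf q (q * z / b i) / qpoch_inf q (b i * z) * (theta (b i * z) / theta (b i / z))"
        if "i \<in> I6" for i
        using qpoch_inf_nz[OF nl(2)[OF that]] qpoch_inf_div_nz[OF nl(1)[OF that]]
        by (simp add: theta_def divide_simps)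
      have "(\<Prod>i\<in>I6. qpoch_inf q (q / b i * (1 / z)) / qpoch_inf q (b i * (1 / z))) =
          weight_core b z * ((\<Prod>i\<in>I6. theta (b i * z)) / (\<Prod>i\<in>I6. theta (b i / z)))"
        unfolding weight_core_def prod_dividef[symmetric] prod.distrib[symmetric]
        by (rule prod.cong) (use * in \<open>auto simp: prod_dividef\<close>)
      then show ?thesis
      proof -
        have "((1 / z)\<^sup>2 - 1) * (c * (X / Y)) / z\<^sup>2 = z * (1 - z\<^sup>2) * c * (X / (z ^ 4 * Y)) / z"
          for c X Y using z(1) by (cases "Y = 0") (simp_all add: divide_simps power_numeral_reduce algebra_simps)
        moreover assume "(\<Prod>i\<in>I6. qpoch_inf q (q / b i * (1 / z)) / qpoch_inf q (b i * (1 / z))) =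
          weight_core b z * ((\<Prod>i\<in>I6. theta (b i * z)) / (\<Prod>i\<in>I6. theta (b i / z)))"
        ultimately show ?thesis by (simp only: f_def h_def weight_def ell_def mult_1)
      qed
    qed
    have ana: "weight b analytic_on - ({0} \<union> dual_lat b 1)"
      by (rule analytic_on_subset[OF weight_analytic]) (use mem_dual_lat_iff[of 1 b] b in auto)
    have hs: "((\<lambda>k. weight b (b j / 1 * q powi k)) has_sum jackson b (b j)) UNIV" if "j \<in> I6" for j
      using weight_has_sum[OF b that] by simp
    note result = elliptic_contour_integral[OF b prod one_neq_zero sep weight_meromorphic ana weight_tendsto_0 eq hs]
    show ?thesis using result has_contour_integral_integral unfolding T_def by metis
  qed
  have "norm T \<le> 2 * pi * C / R" if R: "R0 < R" for R
  proof -
    have R_pos: "0 < R" using R R0 by simp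
    have C0: "0 \<le> C" using C[of 0] R0 by (smt (verit) norm_ge_zero norm_zero divide_nonneg_nonneg)
    have "norm T \<le> C / R\<^sup>2 * (2 * pi * R)"
    proof (rule has_contour_integral_bound_circlepath[OF int[OF R]])
      show "norm (f z) \<le> C / R\<^sup>2" if "cmod (z - 0) = R" for z
      proof -
        have "norm (h (1 / z)) \<le> C"
          using that R R0 R_pos by (intro C) (simp add: norm_divide divide_simps)
        then show ?thesis
          using that R_pos by (simp add: f_def norm_divide norm_power divide_right_mono)
      qed
    qed (use R_pos C0 in auto)
    then show ?thesis using R_pos by (simp add: power2_eq_square field_simps)
  qed
  moreover have "((\<lambda>R. 2 * pi * C / R) \<longlongrightarrow> 0) at_top" by real_asymp
  ultimately have "norm T \<le> 0"
    by (intro tendsto_lowerbound[of "\<lambda>R. 2 * pi * C / R" 0 at_top])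
       (auto intro!: eventually_mono[OF eventually_gt_at_top[of R0]])
  then have "T = 0" by simp
  then show ?thesis using qpoch_inf_q_nz by (simp add: T_def)
qed

lemma nu_jackson_shift_sum_0:
  assumes b: "generic b" and prod: "(\<Prod>i\<in>I6. b i) = q" and C: "(\<Sum>i\<in>I6. C i) = 0"
  shows "(\<Sum>j\<in>I6. nu b j * jackson (shift b C) (b j)) = 0"
proof -
  have "(\<Prod>i\<in>I6. shift b C i) = q" using prod C by (simp add: prod_shift)
  then have "(\<Sum>j\<in>I6. nu (shift b C) j * jackson (shift b C) (shift b C j)) = 0"
    using b by (intro nu_jackson_sum_0) auto
  then show ?thesis using prod C by (simp add: nu_shift shift_def cong: sum.cong)
qed

text \<open>The two arguments are moved to 0 one after the other.\<close>

lemma hsum_eq: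
  assumes b: "generic b" and prod: "(\<Prod>i\<in>I6. b i) = q"
    and B: "(\<Sum>i\<in>I6. B i) = 0" and C: "(\<Sum>i\<in>I6. C i) = 0"
  shows "hsum b B C = hsum b (\<lambda>_. 0) (\<lambda>_. 0) * (rfac b B / rfac b (\<lambda>_. 0)) * (rfac b C / rfac b (\<lambda>_. 0))"
proof -
  note S = nu_jackson_shift_sum_0[OF b prod]
  have "hsum b B C / rfac b C = hsum b B (\<lambda>_. 0) / rfac b (\<lambda>_. 0)"
    by (rule hsum_right[OF b prod S[OF B] C])
  moreover have "hsum b (\<lambda>_. 0) B / rfac b B = hsum b (\<lambda>_. 0) (\<lambda>_. 0) / rfac b (\<lambda>_. 0)"
    by (rule hsum_right[OF b prod S B]) simp
  moreover have "x = z * (rB / r0) * (rC / r0)" if "x / rC = y / r0" "y / rB = z / r0" "rB \<noteq> 0" "rC \<noteq> 0"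
    for x y z rB rC r0 :: complex
  proof -
    have "x = y / r0 * rC" "y = z / r0 * rB" using that by (simp_all add: divide_eq_eq)
    then show ?thesis by simp
  qed
  ultimately show ?thesis
    using rfac_nz[OF b] hsum_commute[of b B "\<lambda>_. 0"] by metis
qed

section \<open>The total mass as a function on a torus\<close>

text \<open>The lattice sum without its denominator: it is holomorphic in the parameters, also where some
  \<open>b i * b j\<close> lies in \<open>qZ\<close>.\<close>

definition jseries :: "(nat \<Rightarrow> complex) \<Rightarrow> nat \<Rightarrow> complex" where
  "jseries b j = (\<Sum>k. b j * q ^ k * (1 - (b j * q ^ k)\<^sup>2) *
      (\<Prod>i\<in>I6. qpoch_inf q (q * (b j * q ^ k) / b i) * qpoch q (b i * b j) k))"

lemma jackson_eq_jseries:
  assumes b: "generic b" and j: "j \<in> I6"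
  shows "jackson b (b j) = jseries b j / (\<Prod>i\<in>I6. qpoch_inf q (b i * b j))"
proof -
  have bj: "b j \<noteq> 0" using genericD(1)[OF b j] .
  define D where "D = (\<Prod>i\<in>I6. qpoch_inf q (b i * b j))"
  have D: "D \<noteq> 0" using qpoch_inf_nz[OF genericD(3)[OF b _ j]] by (simp add: D_def)
  have eq: "weight b (b j * q powi (0 + int k)) = b j * q ^ k * (1 - (b j * q ^ k)\<^sup>2) *
      (\<Prod>i\<in>I6. qpoch_inf q (q * (b j * q ^ k) / b i) * qpoch q (b i * b j) k) / D" for k
  proof -
    have "weight_core b (b j * q ^ k) =
       (\<Prod>i\<in>I6. qpoch_inf q (q * (b j * q ^ k) / b i) * qpoch q (b i * b j) k / qpoch_inf q (b i * b j))"
      unfolding weight_core_def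
    proof (rule prod.cong)
      fix i assume i: "i \<in> I6"
      have "qpoch_inf q (b i * b j) = qpoch q (b i * b j) k * qpoch_inf q (b i * (b j * q ^ k))"
        using qpoch_inf_split[of "b i * b j" k] by (simp add: mult.assoc)
      moreover have "qpoch_inf q (b i * b j) \<noteq> 0" using qpoch_inf_nz[OF genericD(3)[OF b i j]] .
      ultimately show "qpoch_inf q (q * (b j * q ^ k) / b i) / qpoch_inf q (b i * (b j * q ^ k)) =
          qpoch_inf q (q * (b j * q ^ k) / b i) * qpoch q (b i * b j) k / qpoch_inf q (b i * b j)"
        by (simp add: divide_simps)
    qed simp
    then show ?thesis by (simp add: weight_def prod_dividef D_def)
  qed
  have summ: "summable (\<lambda>k. norm (weight b (b j * q powi (0 + int k))))"
    unfolding weight_def mult.assoc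
    by (rule lattice_summable[where g = "\<lambda>z. (1 - z\<^sup>2) * weight_core b z", unfolded mult.assoc])
       (intro continuous_intros isCont_weight_core_0)
  have "jackson b (b j) = (\<Sum>k. weight b (b j * q powi (0 + int k)))"
    unfolding jackson_def
  proof (rule summable_on_int_from(2)[OF _ summ])
    show "weight b (b j * q powi k) = 0" if "k < 0" for k
      using weight_core_eq_0[of j b k, OF j bj that] by (simp add: weight_def)
  qed
  moreover have "summable (\<lambda>k. weight b (b j * q powi (0 + int k)))"
    by (rule summable_norm_cancel[OF summ])
  then have "summable (\<lambda>k. weight b (b j * q powi (0 + int k)) * D)"
    by (rule summable_mult2)
  then have "summable (\<lambda>k. b j * q ^ k * (1 - (b j * q ^ k)\<^sup>2) *
      (\<Prod>i\<in>I6. qpoch_inf q (q * (b j * q ^ k) / b i) * qpoch q (b i * b j) k))"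
    unfolding eq using D by simp
  ultimately show ?thesis
    unfolding eq jseries_def D_def[symmetric] by (simp only: suminf_divide)
qed

definition hnum :: "(nat \<Rightarrow> complex) \<Rightarrow> nat \<Rightarrow> complex" where
  "hnum b j = (jseries b j)\<^sup>2 / b j ^ 4 * (qpoch_inf q (q / (b j * b j)) / qpoch_inf q (b j * b j)) *
     pair_prod (\<lambda>i m. if i = j \<or> m = j then 1
        else qpoch_inf q (b i * b m) / qpoch_inf q (q / (b i * b m)))"

text \<open>The quotient \<open>hsum b 0 0 / mass b\<close>, in which the factors \<open>qpoch_inf q (b i * b j)\<close> have been cancelled,
  so that it extends to resonant parameters.\<close>

definition hfun :: "(nat \<Rightarrow> complex) \<Rightarrow> complex" where
  "hfun b = (\<Sum>j\<in>I6. hnum b j / (\<Prod>i\<in>I6-{j}. theta (b i / b j)))"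

definition mass :: "(nat \<Rightarrow> complex) \<Rightarrow> complex" where
  "mass b = pair_prod (\<lambda>i j. qpoch_inf q (q / (b i * b j)) / qpoch_inf q (b i * b j))"

lemma mass_nz: "generic b \<Longrightarrow> mass b \<noteq> 0"
  unfolding mass_def
  by (intro pair_prod_nz) (auto simp: qpoch_inf_nz qpoch_inf_div_nz dest: genericD(3))

lemma hsum_eq_hfun:
  assumes b: "generic b"
  shows "hsum b (\<lambda>_. 0) (\<lambda>_. 0) = hfun b * mass b"
proof -
  have "nu b j * jackson b (b j) * jackson b (b j) =
      hnum b j / (\<Prod>i\<in>I6-{j}. theta (b i / b j)) * mass b" if j: "j \<in> I6" for j
  proof -
    define f where "f i m = qpoch_inf q (b i * b m) / qpoch_inf q (q / (b i * b m))" for i m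
    define X where "X = pair_prod (\<lambda>i m. if i = j \<or> m = j then 1 else f i m)"
    define P where "P = (\<Prod>i\<in>I6-{j}. qpoch_inf q (b i * b j))"
    define P' where "P' = (\<Prod>i\<in>I6-{j}. qpoch_inf q (q / (b i * b j)))"
    define T where "T = (\<Prod>i\<in>I6-{j}. theta (b i / b j))"
    have fnz: "f i m \<noteq> 0" if "i \<in> I6" "m \<in> I6" for i m
      using genericD(3)[OF b that] by (simp add: f_def qpoch_inf_nz qpoch_inf_div_nz)
    have Xnz: "X \<noteq> 0" unfolding X_def using fnz by (intro pair_prod_nz) auto
    have Pnz: "P \<noteq> 0" using qpoch_inf_nz[OF genericD(3)[OF b _ j]] by (simp add: P_def)
    have jj: "qpoch_inf q (b j * b j) \<noteq> 0" using qpoch_inf_nz[OF genericD(3)[OF b j j]] .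
    have inv: "pair_prod (\<lambda>i m. if i = j \<or> m = j then 1 else 1 / f i m) = 1 / X"
    proof -
      have "pair_prod (\<lambda>i m. if i = j \<or> m = j then 1 else 1 / f i m) * X = pair_prod (\<lambda>_ _. 1)"
        unfolding X_def pair_prod_mult[symmetric] using fnz by (intro pair_prod_cong) auto
      then show ?thesis using Xnz by (simp add: pair_prod_eq divide_simps)
    qed
    have "mass b = (\<Prod>m\<in>I6-{j}. 1 / f j m) * pair_prod (\<lambda>i m. if i = j \<or> m = j then 1 else 1 / f i m)"
    proof -
      have "mass b = pair_prod (\<lambda>i m. 1 / f i m)" by (simp add: mass_def f_def)
      then show ?thesis
        using pair_prod_remove[OF j, of "\<lambda>i m. 1 / f i m"] by (simp add: f_def mult.commute)
    qed
    also have "(\<Prod>m\<in>I6-{j}. 1 / f j m) = P' / P"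
      by (simp add: f_def P'_def P_def prod_dividef mult.commute)
    finally have m: "mass b = P' / P / X" by (simp add: inv)
    have th: "(\<Prod>i\<in>I6. theta (b i * b j)) = qpoch_inf q (b j * b j) * qpoch_inf q (q / (b j * b j)) * P * P'"
      using j by (simp add: prod.remove[of I6 j] theta_def prod.distrib P_def P'_def)
    have J: "jackson b (b j) = jseries b j / (qpoch_inf q (b j * b j) * P)"
      using jackson_eq_jseries[OF b j] j by (simp add: prod.remove[of I6 j] P_def)
    have h: "hnum b j = (jseries b j)\<^sup>2 / b j ^ 4 * (qpoch_inf q (q / (b j * b j)) / qpoch_inf q (b j * b j)) * X"
      unfolding hnum_def X_def f_def by simp
    have "u / (w * T) * (v / (x * P)) * (v / (x * P)) = v\<^sup>2 / w * (y / x) * X / T * (P' / P / X)"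
      if "u = x * y * P * P'" "x \<noteq> 0" for u v w x y
      using that Pnz Xnz by (simp add: power2_eq_square divide_simps)
    from this[OF th jj] show ?thesis
      unfolding J h m nu_def T_def[symmetric] .
  qed
  then show ?thesis by (simp add: hsum_def hfun_def sum_distrib_right)
qed

lemma mass_step:
  assumes d: "generic d" and prod: "(\<Prod>i\<in>I6. d i) = 1" and i: "i \<in> I6"
  shows "mass (d(i := q * d i)) = - (kappa d i)\<^sup>2 * mass d"
proof -
  have di: "d i \<noteq> 0" using genericD(1)[OF d i] .
  define u where "u j = - ((1 - d i * d j)\<^sup>2 / (d i * d j))" for j
  have "mass (d(i := q * d i)) = (\<Prod>j\<in>I6-{i}. u j) * mass d"
    unfolding mass_def
  proof (rule pair_prod_update[OF i])
    fix j assume j: "j \<in> I6" "j \<noteq> i"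
    have dj: "d j \<noteq> 0" using genericD(1)[OF d j(1)] .
    have "qpoch_inf q (d i * d j) \<noteq> 0" using qpoch_inf_nz[OF genericD(3)[OF d i j(1)]] .
    moreover have "1 - d i * d j \<noteq> 0" using genericD(3)[OF d i j(1)] qZ_1 by fastforce
    moreover have "qpoch_inf q (1 / (d i * d j)) = (1 - 1 / (d i * d j)) * qpoch_inf q (q / (d i * d j))"
      using qpoch_inf_step[of "1 / (d i * d j)"] by simp
    ultimately have "qpoch_inf q (1 / (d i * d j)) / qpoch_inf q (q * (d i * d j)) =
         u j * (qpoch_inf q (q / (d i * d j)) / qpoch_inf q (d i * d j))"
      using qpoch_inf_step[of "d i * d j"] di dj
      by (simp add: u_def divide_simps power2_eq_square) (simp add: algebra_simps)
    then show "qpoch_inf q (q / ((d(i := q * d i)) i * (d(i := q * d i)) j)) /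
           qpoch_inf q ((d(i := q * d i)) i * (d(i := q * d i)) j) =
         u j * (qpoch_inf q (q / (d i * d j)) / qpoch_inf q (d i * d j))"
      using j q_nz by (simp add: mult.assoc)
  next
    fix k l
    show "qpoch_inf q (q / ((d(i := q * d i)) k * (d(i := q * d i)) l)) / qpoch_inf q ((d(i := q * d i)) k * (d(i := q * d i)) l) =
      qpoch_inf q (q / ((d(i := q * d i)) l * (d(i := q * d i)) k)) / qpoch_inf q ((d(i := q * d i)) l * (d(i := q * d i)) k)"
      by (simp only: mult.commute)
    show "qpoch_inf q (q / (d k * d l)) / qpoch_inf q (d k * d l) =
      qpoch_inf q (q / (d l * d k)) / qpoch_inf q (d l * d k)"
      by (simp only: mult.commute)
  qed simp
  also have "(\<Prod>j\<in>I6-{i}. u j) = - (kappa d i)\<^sup>2"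
  proof -
    have card: "card (I6 - {i}) = 5" using i by (simp add: I6_def)
    have P: "d i * (\<Prod>j\<in>I6-{i}. d j) = 1" using prod i by (simp add: prod.remove)
    have "(\<Prod>j\<in>I6-{i}. u j) = (\<Prod>j\<in>I6-{i}. (- 1 / d i) * ((1 - d i * d j) * (1 - d i * d j) / d j))"
      by (rule prod.cong) (auto simp: u_def power2_eq_square)
    also have "\<dots> = (- 1 / d i) ^ 5 * ((\<Prod>j\<in>I6-{i}. 1 - d i * d j)\<^sup>2 / (\<Prod>j\<in>I6-{i}. d j))"
      by (simp only: prod.distrib prod_dividef prod_constant card power2_eq_square power_divide)
    also have "\<dots> = - (kappa d i)\<^sup>2"
    proof -
      have "(\<Prod>j\<in>I6-{i}. d j) = 1 / d i" using P di by (simp add: field_simps)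
      then show ?thesis using di by (simp add: kappa_def power_divide field_simps power_numeral_reduce)
    qed
    finally show ?thesis .
  qed
  finally show ?thesis .
qed

lemma mass_shift:
  assumes b: "generic b" and prod: "(\<Prod>i\<in>I6. b i) = q" and C: "(\<Sum>i\<in>I6. C i) = 0"
  shows "mass (shift b C) = mass b * (rfac b C / rfac b (\<lambda>_. 0))\<^sup>2"
proof -
  have "mass (shift b C) / (rfac b C)\<^sup>2 = mass (shift b (\<lambda>_. 0)) / (rfac b (\<lambda>_. 0))\<^sup>2"
  proof (rule shift_invariant_const[where f = "\<lambda>C. mass (shift b C) / (rfac b C)\<^sup>2", OF _ _ C])
    show "mass (shift b C) / (rfac b C)\<^sup>2 = mass (shift b C') / (rfac b C')\<^sup>2"
      if "\<And>i. i \<in> I6 \<Longrightarrow> C i = C' i" for C C'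
    proof -
      have "mass (shift b C) = mass (shift b C')"
        unfolding mass_def by (rule pair_prod_cong) (simp add: shift_def that)
      then show ?thesis using rfac_cong[of C C' b] that by simp
    qed
    fix D :: "nat \<Rightarrow> int" and i i' assume *: "i \<in> I6" "i' \<in> I6" "(\<Sum>j\<in>I6. D j) = -1"
    have d: "generic (shift b D)" using b by simp
    have pd: "(\<Prod>i\<in>I6. shift b D i) = 1"
      using q_nz by (simp add: prod_shift prod * power_int_minus)
    have "mass (shift b (D(i := D i + 1))) / (rfac b (D(i := D i + 1)))\<^sup>2 = - mass (shift b D) / (rfac b D)\<^sup>2"
      if "i \<in> I6" for i
      unfolding rfac_step[OF b that] shift_upd mass_step[OF d pd that]
      using kappa_nz[OF d that] by (simp add: power_mult_distrib divide_simps)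
    then show "mass (shift b (D(i := D i + 1))) / (rfac b (D(i := D i + 1)))\<^sup>2 =
        mass (shift b (D(i' := D i' + 1))) / (rfac b (D(i' := D i' + 1)))\<^sup>2"
      using * by simp
  qed
  then have "mass (shift b C) / (rfac b C)\<^sup>2 = mass b / (rfac b (\<lambda>_. 0))\<^sup>2" by simp
  then show ?thesis using rfac_nz[OF b, of C] rfac_nz[OF b, of "\<lambda>_. 0"]
    by (simp add: power_divide divide_simps mult_ac)
qed

text \<open>By \<open>hsum_eq\<close> and \<open>mass_shift\<close>, numerator and denominator change by the same factor.\<close>

lemma hfun_shift:
  assumes b: "generic b" and prod: "(\<Prod>i\<in>I6. b i) = q" and C: "(\<Sum>i\<in>I6. C i) = 0"
  shows "hfun (shift b C) = hfun b"
proof -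
  have g: "generic (shift b C)" using b by simp
  have "hsum (shift b C) (\<lambda>_. 0) (\<lambda>_. 0) = hsum b C C"
    unfolding hsum_def using nu_shift[OF prod _ C] by (auto simp: shift_def intro!: sum.cong)
  then have "hfun (shift b C) * mass (shift b C) = hfun b * mass b * (rfac b C / rfac b (\<lambda>_. 0))\<^sup>2"
    using hsum_eq_hfun[OF g] hsum_eq_hfun[OF b] hsum_eq[OF b prod C C] by (simp add: power2_eq_square)
  then have "hfun (shift b C) * mass (shift b C) = hfun b * mass (shift b C)"
    unfolding mass_shift[OF b prod C] by simp
  then show ?thesis using mass_nz[OF g] by simp
qed

lemma jseries_permutes:
  assumes \<pi>: "\<pi> permutes I6"
  shows "jseries (b \<circ> \<pi>) j = jseries b (\<pi> j)"
proof -
  have "(\<Prod>i\<in>I6. g (\<pi> i)) = (\<Prod>i\<in>I6. g i)" for g :: "nat \<Rightarrow> complex"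
    using prod.permute[OF \<pi>, of g] by (simp add: o_def)
  from this[of "\<lambda>i. qpoch_inf q (q * (b (\<pi> j) * q ^ k) / b i) * qpoch q (b i * b (\<pi> j)) k" for k]
  show ?thesis by (simp add: jseries_def o_def)
qed

lemma hnum_permutes:
  assumes \<pi>: "\<pi> permutes I6"
  shows "hnum (b \<circ> \<pi>) j = hnum b (\<pi> j)"
proof -
  have inj: "\<pi> i = \<pi> j \<longleftrightarrow> i = j" for i j using permutes_inj[OF \<pi>] by (auto dest: injD)
  define g where "g i m = (if i = \<pi> j \<or> m = \<pi> j then 1 else qpoch_inf q (b i * b m) / qpoch_inf q (q / (b i * b m)))" for i m
  have "pair_prod (\<lambda>i m. g (\<pi> i) (\<pi> m)) = pair_prod g"
    by (rule pair_prod_permutes[OF \<pi>]) (auto simp: g_def mult.commute)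
  then show ?thesis
    unfolding hnum_def jseries_permutes[OF \<pi>] g_def inj comp_apply by simp
qed

lemma hterm_permutes:
  assumes \<pi>: "\<pi> permutes I6" and j: "j \<in> I6"
  shows "hnum (b \<circ> \<pi>) j / (\<Prod>i\<in>I6-{j}. theta ((b \<circ> \<pi>) i / (b \<circ> \<pi>) j)) =
    hnum b (\<pi> j) / (\<Prod>i\<in>I6-{\<pi> j}. theta (b i / b (\<pi> j)))"
proof -
  have "bij_betw \<pi> (I6 - {j}) (\<pi> ` (I6 - {j}))"
    using permutes_inj[OF \<pi>] by (intro inj_on_imp_bij_betw) (auto intro: inj_on_subset)
  moreover have "\<pi> ` (I6 - {j}) = I6 - {\<pi> j}"
    using permutes_image[OF \<pi>] permutes_inj[OF \<pi>] by (auto simp: image_set_diff)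
  ultimately have "(\<Prod>i\<in>I6-{j}. theta (b (\<pi> i) / b (\<pi> j))) = (\<Prod>i\<in>I6-{\<pi> j}. theta (b i / b (\<pi> j)))"
    by (intro prod.reindex_bij_betw) simp
  then show ?thesis by (simp add: hnum_permutes[OF \<pi>])
qed

section \<open>Holomorphic dependence on the parameters\<close>

lemma norm_qpoch_inf_le: "norm (qpoch_inf q a) \<le> exp (norm a / (1 - norm q))"
proof (rule tendsto_upperbound)
  show "(\<lambda>n. norm (qpoch q a n)) \<longlonglongrightarrow> norm (qpoch_inf q a)"
    by (intro tendsto_intros qpoch_inf_LIMSEQ)
  show "eventually (\<lambda>n. norm (qpoch q a n) \<le> exp (norm a / (1 - norm q))) sequentially"
    using norm_qpoch_le by simp
qed simp

lemma jseries_holomorphic: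
  assumes S: "open S" and hol: "\<And>i. i \<in> I6 \<Longrightarrow> (\<lambda>t. c t i) holomorphic_on S"
    and nz: "\<And>t i. t \<in> S \<Longrightarrow> i \<in> I6 \<Longrightarrow> c t i \<noteq> 0" and j: "j \<in> I6"
  shows "(\<lambda>t. jseries (c t) j) holomorphic_on S"
proof -
  define f where "f k t = c t j * q ^ k * (1 - (c t j * q ^ k)\<^sup>2) *
      (\<Prod>i\<in>I6. qpoch_inf q (q * (c t j * q ^ k) / c t i) * qpoch q (c t i * c t j) k)" for k t
  have f_hol: "f k holomorphic_on S" for k
    unfolding f_def qpoch_def using nz by (intro holomorphic_intros hol j) auto
  show ?thesis
  proof (rule holomorphic_uniform_sequence[OF S])
    show "(\<lambda>t. \<Sum>k<n. f k t) holomorphic_on S" for n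
      by (intro holomorphic_intros f_hol)
    fix t0 assume "t0 \<in> S"
    then obtain d where d: "d > 0" "cball t0 d \<subseteq> S" using S open_contains_cball by blast
    have "\<exists>M. \<forall>t\<in>cball t0 d. norm (c t i) \<le> M \<and> norm (inverse (c t i)) \<le> M" if i: "i \<in> I6" for i
    proof -
      have "continuous_on (cball t0 d) (\<lambda>t. c t i)"
        using hol[OF i] d holomorphic_on_imp_continuous_on holomorphic_on_subset by blast
      moreover from this have "continuous_on (cball t0 d) (\<lambda>t. inverse (c t i))"
        using d nz i by (intro continuous_intros) auto
      ultimately have "bounded ((\<lambda>t. c t i) ` cball t0 d)" "bounded ((\<lambda>t. inverse (c t i)) ` cball t0 d)"
        by (auto intro!: compact_imp_bounded compact_continuous_image)
      then obtain M1 M2 where "\<forall>t\<in>cball t0 d. norm (c t i) \<le> M1" "\<forall>t\<in>cball t0 d. norm (inverse (c t i)) \<le> M2"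
        by (auto simp: bounded_iff)
      then show ?thesis by (intro exI[of _ "max M1 M2"]) (auto simp: le_max_iff_disj)
    qed
    then obtain M where M: "\<And>i t. i \<in> I6 \<Longrightarrow> t \<in> cball t0 d \<Longrightarrow> norm (c t i) \<le> M i \<and> norm (inverse (c t i)) \<le> M i"
      by metis
    define B where "B = (\<Sum>i\<in>I6. \<bar>M i\<bar>)"
    have MB: "M i \<le> B" if "i \<in> I6" for i
      using member_le_sum[OF that, of "\<lambda>i. \<bar>M i\<bar>"] unfolding B_def by fastforce
    have B0: "0 \<le> B" by (simp add: B_def sum_nonneg)
    have cB: "norm (c t i) \<le> B" "norm (inverse (c t i)) \<le> B" if "i \<in> I6" "t \<in> cball t0 d" for i t
      using M[OF that] MB[OF that(1)] by auto
    define E where "E = exp (B * B / (1 - norm q))"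
    have E1: "0 \<le> E" by (simp add: E_def)
    have q1: "0 < 1 - norm q" using q_lt1 by simp
    have qp_B: "norm (qpoch_inf q x) \<le> E" "norm (qpoch q x k) \<le> E" if "norm x \<le> B * B" for x k
    proof -
      have "exp (norm x / (1 - norm q)) \<le> E"
        unfolding E_def using that q1 by (simp add: divide_right_mono)
      then show "norm (qpoch_inf q x) \<le> E" "norm (qpoch q x k) \<le> E"
        using norm_qpoch_inf_le[of x] norm_qpoch_le[of x k] by linarith+
    qed
    have bound: "norm (f k t) \<le> B * (1 + B * B) * (E * E) ^ 6 * norm q ^ k" if t: "t \<in> cball t0 d" for k t
    proof -
      have qk: "norm q ^ k \<le> 1" for k using q_lt1 by (intro power_le_one) auto
      have cq: "norm (c t j * q ^ k) \<le> B"
        using mult_mono[OF cB(1)[OF j t] qk[of k] B0] by (simp add: norm_mult norm_power)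
      have "norm (\<Prod>i\<in>I6. qpoch_inf q (q * (c t j * q ^ k) / c t i) * qpoch q (c t i * c t j) k) \<le> (\<Prod>i\<in>I6. E * E)"
        unfolding prod_norm[symmetric]
      proof (intro prod_mono conjI)
        fix i assume i: "i \<in> I6"
        have "norm (q * (c t j * q ^ k) / c t i) = norm q * norm (c t j * q ^ k) * norm (inverse (c t i))"
          by (simp add: norm_mult norm_divide norm_inverse divide_inverse)
        also have "\<dots> \<le> 1 * B * B"
          using q_lt1 cq cB(2)[OF i t] B0 by (intro mult_mono) auto
        finally have 1: "norm (q * (c t j * q ^ k) / c t i) \<le> B * B" by simp
        have 2: "norm (c t i * c t j) \<le> B * B"
          unfolding norm_mult using cB(1)[OF i t] cB(1)[OF j t] B0 by (intro mult_mono) auto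
        show "norm (qpoch_inf q (q * (c t j * q ^ k) / c t i) * qpoch q (c t i * c t j) k) \<le> E * E"
          unfolding norm_mult using qp_B(1)[OF 1] qp_B(2)[OF 2] E1 by (intro mult_mono) auto
      qed simp
      also have "(\<Prod>i\<in>I6. E * E) = (E * E) ^ 6" by (simp add: I6_def)
      finally have 3: "norm (\<Prod>i\<in>I6. qpoch_inf q (q * (c t j * q ^ k) / c t i) * qpoch q (c t i * c t j) k) \<le> (E * E) ^ 6" .
      have 4: "norm (1 - (c t j * q ^ k)\<^sup>2) \<le> 1 + B * B"
      proof -
        have "norm (1 - (c t j * q ^ k)\<^sup>2) \<le> norm (1::complex) + norm ((c t j * q ^ k)\<^sup>2)" by (rule norm_triangle_ineq4)
        also have "norm ((c t j * q ^ k)\<^sup>2) \<le> B * B"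
          unfolding power2_eq_square norm_mult[of "c t j * q ^ k"] using cq B0 by (intro mult_mono) auto
        finally show ?thesis by simp
      qed
      have "norm (f k t) = norm (c t j) * norm q ^ k * norm (1 - (c t j * q ^ k)\<^sup>2) *
         norm (\<Prod>i\<in>I6. qpoch_inf q (q * (c t j * q ^ k) / c t i) * qpoch q (c t i * c t j) k)"
        by (simp add: f_def norm_mult norm_power)
      also have "\<dots> \<le> B * norm q ^ k * (1 + B * B) * (E * E) ^ 6"
        using cB(1)[OF j t] 3 4 B0 by (intro mult_mono mult_nonneg_nonneg) auto
      finally show ?thesis by (simp add: mult_ac)
    qed
    have "uniform_limit (cball t0 d) (\<lambda>n t. \<Sum>k<n. f k t) (\<lambda>t. \<Sum>k. f k t) sequentially"
      by (rule Weierstrass_m_test[OF bound]) (use q_lt1 in \<open>auto intro!: summable_mult summable_geometric\<close>)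
    then show "\<exists>d>0. cball t0 d \<subseteq> S \<and> uniform_limit (cball t0 d) (\<lambda>n t. \<Sum>k<n. f k t) (\<lambda>t. jseries (c t) j) sequentially"
      using d by (intro exI[of _ d]) (simp add: jseries_def f_def)
  qed
qed

text \<open>The numerators of \<open>hfun\<close> are regular under this condition, the denominators are nonzero under the next
  one. Both are weaker than \<open>generic\<close>.\<close>

definition reg_prod :: "(nat \<Rightarrow> complex) \<Rightarrow> bool" where
  "reg_prod b \<longleftrightarrow> (\<forall>j\<in>I6. b j \<noteq> 0 \<and> qpoch_inf q (b j * b j) \<noteq> 0) \<and>
     (\<forall>i\<in>I6. \<forall>m\<in>I6. i < m \<longrightarrow> qpoch_inf q (q / (b i * b m)) \<noteq> 0)"

definition reg_quot :: "(nat \<Rightarrow> complex) \<Rightarrow> bool" where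
  "reg_quot b \<longleftrightarrow> (\<forall>i\<in>I6. \<forall>j\<in>I6. i \<noteq> j \<longrightarrow> theta (b i / b j) \<noteq> 0)"

lemma hnum_holomorphic:
  assumes S: "open S" and hol: "\<And>i. i \<in> I6 \<Longrightarrow> (\<lambda>t. c t i) holomorphic_on S"
    and reg: "\<And>t. t \<in> S \<Longrightarrow> reg_prod (c t)" and j: "j \<in> I6"
  shows "(\<lambda>t. hnum (c t) j) holomorphic_on S"
proof -
  have nz: "c t i \<noteq> 0" "qpoch_inf q (c t i * c t i) \<noteq> 0" if "t \<in> S" "i \<in> I6" for t i
    using reg[OF that(1)] that(2) by (auto simp: reg_prod_def)
  have *: "(\<lambda>t. pair_prod (\<lambda>i m. if i = j \<or> m = j then 1
        else qpoch_inf q (c t i * c t m) / qpoch_inf q (q / (c t i * c t m)))) holomorphic_on S"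
    unfolding pair_prod_Sigma case_prod_unfold
  proof (rule holomorphic_on_prod)
    fix p assume "p \<in> {p. fst p \<in> I6 \<and> snd p \<in> I6 \<and> fst p < snd p}"
    then have p: "fst p \<in> I6" "snd p \<in> I6" "fst p < snd p" by auto
    have "(\<lambda>t. qpoch_inf q (c t (fst p) * c t (snd p)) / qpoch_inf q (q / (c t (fst p) * c t (snd p)))) holomorphic_on S"
    proof (intro holomorphic_intros hol p)
      fix t assume t: "t \<in> S"
      show "c t (fst p) * c t (snd p) \<noteq> 0" using nz(1) t p by simp
      show "qpoch_inf q (q / (c t (fst p) * c t (snd p))) \<noteq> 0"
        using reg[OF t] p by (auto simp: reg_prod_def)
    qed
    then show "(\<lambda>t. if fst p = j \<or> snd p = j then 1
        else qpoch_inf q (c t (fst p) * c t (snd p)) / qpoch_inf q (q / (c t (fst p) * c t (snd p)))) holomorphic_on S"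
      by (cases "fst p = j \<or> snd p = j") simp_all
  qed
  show ?thesis
    unfolding hnum_def
    by (intro holomorphic_on_mult holomorphic_on_divide holomorphic_on_power holomorphic_qpoch_inf'
        jseries_holomorphic[OF S hol nz(1) j] hol[OF j] holomorphic_on_const *)
       (use nz j in auto)
qed

lemma hfun_holomorphic:
  assumes S: "open S" and hol: "\<And>i. i \<in> I6 \<Longrightarrow> (\<lambda>t. c t i) holomorphic_on S"
    and reg: "\<And>t. t \<in> S \<Longrightarrow> reg_prod (c t) \<and> reg_quot (c t)"
  shows "(\<lambda>t. hfun (c t)) holomorphic_on S"
proof -
  have nz: "c t i \<noteq> 0" if "t \<in> S" "i \<in> I6" for t i
    using reg[OF that(1)] that(2) by (auto simp: reg_prod_def)
  show ?thesis
    unfolding hfun_def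
    by (intro holomorphic_on_sum holomorphic_on_divide holomorphic_on_prod holomorphic_theta hol
         hnum_holomorphic[OF S hol])
       (use nz reg in \<open>auto simp: reg_quot_def\<close>)
qed

lemma open_reg_prod:
  assumes S: "open S" and hol: "\<And>i. i \<in> I6 \<Longrightarrow> (\<lambda>t. c t i) holomorphic_on S"
    and nz: "\<And>t i. t \<in> S \<Longrightarrow> i \<in> I6 \<Longrightarrow> c t i \<noteq> 0"
  shows "open {t \<in> S. reg_prod (c t)}"
proof -
  define P where "P t = (\<Prod>j\<in>I6. qpoch_inf q (c t j * c t j)) *
     (\<Prod>p\<in>{(i,j). i \<in> I6 \<and> j \<in> I6 \<and> i < j}. qpoch_inf q (q / (c t (fst p) * c t (snd p))))" for t
  have "continuous_on S P"
    unfolding P_def using nz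
    by (intro holomorphic_on_imp_continuous_on holomorphic_intros hol) auto
  then have "open (S \<inter> P -` (- {0}))" using S by (intro continuous_open_preimage) auto
  moreover have "finite {(i,j). i \<in> I6 \<and> j \<in> I6 \<and> i < j}"
    by (rule finite_subset[of _ "I6 \<times> I6"]) auto
  then have "S \<inter> P -` (- {0}) = {t \<in> S. reg_prod (c t)}"
    using nz by (auto simp: P_def reg_prod_def prod_zero_iff)
  ultimately show ?thesis by simp
qed

lemma open_reg:
  assumes S: "open S" and hol: "\<And>i. i \<in> I6 \<Longrightarrow> (\<lambda>t. c t i) holomorphic_on S"
    and nz: "\<And>t i. t \<in> S \<Longrightarrow> i \<in> I6 \<Longrightarrow> c t i \<noteq> 0"
  shows "open {t \<in> S. reg_prod (c t) \<and> reg_quot (c t)}"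
proof -
  define P where "P t = (\<Prod>p\<in>{(i,j). i \<in> I6 \<and> j \<in> I6 \<and> i \<noteq> j}. theta (c t (fst p) / c t (snd p)))" for t
  have "continuous_on S P"
    unfolding P_def using nz
    by (intro holomorphic_on_imp_continuous_on holomorphic_intros hol) auto
  then have "open (S \<inter> P -` (- {0}))" using S by (intro continuous_open_preimage) auto
  moreover have fin: "finite {(i,j). i \<in> I6 \<and> j \<in> I6 \<and> i \<noteq> j}"
    by (rule finite_subset[of _ "I6 \<times> I6"]) auto
  have "P t = 0 \<longleftrightarrow> (\<exists>i\<in>I6. \<exists>j\<in>I6. i \<noteq> j \<and> theta (c t i / c t j) = 0)" for t
    unfolding P_def prod_zero_iff[OF fin] by auto
  then have "S \<inter> P -` (- {0}) = {t \<in> S. reg_quot (c t)}"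
    unfolding reg_quot_def by blast
  ultimately have "open ({t \<in> S. reg_prod (c t)} \<inter> {t \<in> S. reg_quot (c t)})"
    using open_reg_prod[OF assms] by auto
  then show ?thesis by (simp add: Int_def conj_ac)
qed

lemma hfun_analytic_at:
  assumes S: "open S" and hol: "\<And>i. i \<in> I6 \<Longrightarrow> (\<lambda>t. c t i) holomorphic_on S"
    and nz: "\<And>t i. t \<in> S \<Longrightarrow> i \<in> I6 \<Longrightarrow> c t i \<noteq> 0"
    and t: "t \<in> S" "reg_prod (c t)" "reg_quot (c t)"
  shows "(\<lambda>t. hfun (c t)) analytic_on {t}"
proof -
  define U where "U = {t \<in> S. reg_prod (c t) \<and> reg_quot (c t)}"
  have "open U" unfolding U_def by (rule open_reg[OF S hol nz])
  moreover have "(\<lambda>t. hfun (c t)) holomorphic_on U"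
    by (rule hfun_holomorphic[OF \<open>open U\<close>]) (auto simp: U_def intro: holomorphic_on_subset[OF hol])
  ultimately show ?thesis using t by (auto simp: analytic_at U_def intro!: exI[of _ U])
qed

lemma generic_reg: "generic b \<Longrightarrow> reg_prod b \<and> reg_quot b"
  by (auto simp: reg_prod_def reg_quot_def qpoch_inf_nz qpoch_inf_div_nz theta_nz genericD)

text \<open>Where two parameters meet, the two terms with a pole are interchanged by the symmetry of the function,
  and the theta function is odd, so that the poles cancel.\<close>

lemma hfun_pair_cancel:
  assumes S: "open S" and hol: "\<And>i. i \<in> I6 \<Longrightarrow> (\<lambda>t. c t i) holomorphic_on S"
    and nz: "\<And>t i. t \<in> S \<Longrightarrow> i \<in> I6 \<Longrightarrow> c t i \<noteq> 0"
    and t: "t0 \<in> S" "reg_prod (c t0)"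
    and ij: "i \<in> I6" "j \<in> I6" "i \<noteq> j" "c t0 i = c t0 j"
    and other: "\<And>k l. k \<in> I6 \<Longrightarrow> l \<in> I6 \<Longrightarrow> k \<noteq> l \<Longrightarrow> {k,l} \<noteq> {i,j} \<Longrightarrow> theta (c t0 k / c t0 l) \<noteq> 0"
    and deriv: "((\<lambda>t. c t i / c t j) has_field_derivative D) (at t0)" "D \<noteq> 0"
    and gen: "eventually (\<lambda>t. theta (c t i / c t j) \<noteq> 0) (at t0)"
  shows "((\<lambda>t. (t - t0) * hfun (c t)) \<longlongrightarrow> 0) (at t0)"
proof -
  define U where "U = {t \<in> S. reg_prod (c t)}"
  have oU: "open U" unfolding U_def by (rule open_reg_prod[OF S hol nz])
  have tU: "t0 \<in> U" using t by (simp add: U_def)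
  have num_hol: "(\<lambda>t. hnum (c t) k) holomorphic_on U" if "k \<in> I6" for k
    by (rule hnum_holomorphic[OF oU]) (use that in \<open>auto simp: U_def intro: holomorphic_on_subset[OF hol]\<close>)
  have num: "((\<lambda>t. hnum (c t) k) \<longlongrightarrow> hnum (c t0) k) (at t0)" if "k \<in> I6" for k
    using holomorphic_on_imp_continuous_on[OF num_hol[OF that]] oU tU
    by (simp add: continuous_on_eq_continuous_at isCont_def)
  have cc: "((\<lambda>t. c t k) \<longlongrightarrow> c t0 k) (at t0)" if "k \<in> I6" for k
    using holomorphic_on_imp_continuous_on[OF hol[OF that]] S t(1)
    by (simp add: continuous_on_eq_continuous_at isCont_def)
  have cnz: "c t0 k \<noteq> 0" if "k \<in> I6" for k using nz t(1) that by blast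
  have th: "((\<lambda>t. theta (c t k / c t l)) \<longlongrightarrow> theta (c t0 k / c t0 l)) (at t0)" if "k \<in> I6" "l \<in> I6" for k l
    using cnz that by (intro tendsto_intros cc) auto
  define R where "R k t = hnum (c t) k / (\<Prod>l\<in>I6-{i,j}-{k}. theta (c t l / c t k))" for k t
  have R: "((\<lambda>t. R k t) \<longlongrightarrow> R k t0) (at t0)" if "k \<in> {i, j}" for k
  proof -
    have "theta (c t0 l / c t0 k) \<noteq> 0" if "l \<in> I6 - {i,j} - {k}" for l
      using that \<open>k \<in> {i, j}\<close> ij by (intro other) (auto simp: doubleton_eq_iff)
    then show ?thesis
      unfolding R_def using that ij by (intro tendsto_divide tendsto_prod num th) auto
  qed
  have Rij: "R i t0 = R j t0"
  proof -
    define b where "b = c t0"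
    define \<pi> where "\<pi> = Transposition.transpose i j"
    have \<pi>: "\<pi> permutes I6" unfolding \<pi>_def using ij by (intro permutes_swap_id)
    have "b \<circ> \<pi> = b" using ij(4) by (auto simp: \<pi>_def b_def Transposition.transpose_def fun_eq_iff)
    then have "hnum b i = hnum b j" using hnum_permutes[OF \<pi>, of b i] by (simp add: \<pi>_def)
    moreover have "I6 - {i,j} - {i} = I6 - {i,j} - {j}" by auto
    moreover have "b i = b j" using ij(4) by (simp add: b_def)
    ultimately show ?thesis by (simp add: R_def flip: b_def)
  qed
  define \<rho> where "\<rho> t = c t i / c t j" for t
  have \<rho>0: "\<rho> t0 = 1" using ij cnz by (simp add: \<rho>_def)
  have lim1: "((\<lambda>t. (t - t0) / (1 - \<rho> t)) \<longlongrightarrow> - 1 / D) (at t0)"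
  proof -
    have "((\<lambda>t. (\<rho> t - \<rho> t0) / (t - t0)) \<longlongrightarrow> D) (at t0)"
      using deriv(1) by (simp add: has_field_derivative_iff \<rho>_def)
    then have "((\<lambda>t. - (1 / ((\<rho> t - \<rho> t0) / (t - t0)))) \<longlongrightarrow> - (1 / D)) (at t0)"
      using deriv(2) by (intro tendsto_intros) auto
    moreover have "- (1 / ((\<rho> t - \<rho> t0) / (t - t0))) = (t - t0) / (1 - \<rho> t)" for t
    proof -
      have "(t - t0) / (1 - \<rho> t) = (t - t0) / (- (\<rho> t - 1))" by simp
      also have "\<dots> = - ((t - t0) / (\<rho> t - 1))" by (rule minus_divide_right[symmetric])
      finally show ?thesis by (simp add: \<rho>0)
    qed
    ultimately show ?thesis by simp
  qed
  have \<rho>c: "(\<rho> \<longlongrightarrow> 1) (at t0)"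
  proof -
    have "(\<rho> \<longlongrightarrow> c t0 i / c t0 j) (at t0)" unfolding \<rho>_def using cnz ij by (intro tendsto_intros cc) auto
    then show ?thesis using ij cnz by simp
  qed
  have lim2: "((\<lambda>t. (t - t0) / theta (\<rho> t)) \<longlongrightarrow> - 1 / D * (1 / (qpoch_inf q (q * 1) * qpoch_inf q (q / 1)))) (at t0)"
  proof -
    have "((\<lambda>t. (t - t0) / (1 - \<rho> t) * (1 / (qpoch_inf q (q * \<rho> t) * qpoch_inf q (q / \<rho> t)))) \<longlongrightarrow>
       - 1 / D * (1 / (qpoch_inf q (q * 1) * qpoch_inf q (q / 1)))) (at t0)"
      using qpoch_inf_q_nz by (intro tendsto_intros lim1 \<rho>c) auto
    moreover have "(t - t0) / theta (\<rho> t) = (t - t0) / (1 - \<rho> t) * (1 / (qpoch_inf q (q * \<rho> t) * qpoch_inf q (q / \<rho> t)))" for t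
      using qpoch_inf_step[of "\<rho> t"] by (simp add: theta_def mult.assoc)
    ultimately show ?thesis by (simp only:)
  qed
  have "((\<lambda>t. (t - t0) / theta (\<rho> t) * (R j t - \<rho> t * R i t)) \<longlongrightarrow>
      - 1 / D * (1 / (qpoch_inf q (q * 1) * qpoch_inf q (q / 1))) * (R j t0 - 1 * R i t0)) (at t0)"
    by (intro tendsto_intros lim2 \<rho>c R) auto
  then have L1: "((\<lambda>t. (t - t0) / theta (\<rho> t) * (R j t - \<rho> t * R i t)) \<longlongrightarrow> 0) (at t0)"
    by (simp add: Rij)
  have L2: "((\<lambda>t. (t - t0) * (hnum (c t) k / (\<Prod>l\<in>I6-{k}. theta (c t l / c t k)))) \<longlongrightarrow>
      (t0 - t0) * (hnum (c t0) k / (\<Prod>l\<in>I6-{k}. theta (c t0 l / c t0 k)))) (at t0)" if k: "k \<in> I6 - {i,j}" for k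
  proof (intro tendsto_mult tendsto_diff tendsto_divide tendsto_prod tendsto_ident_at tendsto_const num th)
    have "theta (c t0 l / c t0 k) \<noteq> 0" if "l \<in> I6 - {k}" for l
      using that k ij by (intro other) (auto simp: doubleton_eq_iff)
    then show "(\<Prod>l\<in>I6-{k}. theta (c t0 l / c t0 k)) \<noteq> 0" by simp
  qed (use k in auto)
  have "((\<lambda>t. (t - t0) / theta (\<rho> t) * (R j t - \<rho> t * R i t) +
     (\<Sum>k\<in>I6-{i,j}. (t - t0) * (hnum (c t) k / (\<Prod>l\<in>I6-{k}. theta (c t l / c t k))))) \<longlongrightarrow>
     0 + (\<Sum>k\<in>I6-{i,j}. (t0 - t0) * (hnum (c t0) k / (\<Prod>l\<in>I6-{k}. theta (c t0 l / c t0 k))))) (at t0)"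
    by (intro tendsto_intros tendsto_sum L1 L2)
  then have lim: "((\<lambda>t. (t - t0) / theta (\<rho> t) * (R j t - \<rho> t * R i t) +
     (\<Sum>k\<in>I6-{i,j}. (t - t0) * (hnum (c t) k / (\<Prod>l\<in>I6-{k}. theta (c t l / c t k))))) \<longlongrightarrow> 0) (at t0)"
    by simp
  have "eventually (\<lambda>t. t \<in> S) (at t0)"
    using S t(1) by (rule eventually_at_in_open')
  then have "eventually (\<lambda>t. (t - t0) / theta (\<rho> t) * (R j t - \<rho> t * R i t) +
     (\<Sum>k\<in>I6-{i,j}. (t - t0) * (hnum (c t) k / (\<Prod>l\<in>I6-{k}. theta (c t l / c t k)))) = (t - t0) * hfun (c t)) (at t0)"
    using gen
  proof eventually_elim
    case (elim t)
    have ci: "c t i \<noteq> 0" "c t j \<noteq> 0" using nz elim ij by auto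
    have \<rho>nz: "\<rho> t \<noteq> 0" using ci by (simp add: \<rho>_def)
    have inv: "theta (c t j / c t i) = - theta (\<rho> t) / \<rho> t"
      using theta_inverse[OF \<rho>nz] ci by (simp add: \<rho>_def)
    have *: "I6 - {j} = insert i (I6 - {i,j})" "I6 - {i} = insert j (I6 - {i,j})" using ij by auto
    have **: "I6 - {i,j} - {i} = I6 - {i,j}" "I6 - {i,j} - {j} = I6 - {i,j}" by auto
    have "hnum (c t) i / (\<Prod>l\<in>I6-{i}. theta (c t l / c t i)) = R i t / theta (c t j / c t i)"
       "hnum (c t) j / (\<Prod>l\<in>I6-{j}. theta (c t l / c t j)) = R j t / theta (\<rho> t)"
      unfolding * R_def ** using ij by (simp_all add: \<rho>_def mult.commute)
    moreover have "(\<Sum>k\<in>I6. f k) = f i + (f j + (\<Sum>k\<in>I6-{i,j}. f k))" for f :: "nat \<Rightarrow> complex"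
    proof -
      have "(\<Sum>k\<in>I6. f k) = f i + (\<Sum>k\<in>I6-{i}. f k)" using ij by (intro sum.remove) auto
      also have "(\<Sum>k\<in>I6-{i}. f k) = f j + (\<Sum>k\<in>I6-{i}-{j}. f k)" using ij by (intro sum.remove) auto
      also have "I6 - {i} - {j} = I6 - {i,j}" by blast
      finally show ?thesis .
    qed
    then have "hfun (c t) = hnum (c t) i / (\<Prod>l\<in>I6-{i}. theta (c t l / c t i)) +
       (hnum (c t) j / (\<Prod>l\<in>I6-{j}. theta (c t l / c t j)) +
       (\<Sum>k\<in>I6-{i,j}. hnum (c t) k / (\<Prod>l\<in>I6-{k}. theta (c t l / c t k))))"
      unfolding hfun_def .
    ultimately have "hfun (c t) = (R j t - \<rho> t * R i t) / theta (\<rho> t) +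
       (\<Sum>k\<in>I6-{i,j}. hnum (c t) k / (\<Prod>l\<in>I6-{k}. theta (c t l / c t k)))"
      using elim \<rho>nz by (simp add: inv \<rho>_def[symmetric] diff_divide_distrib)
    then show ?case by (simp add: distrib_left sum_distrib_left)
  qed
  with lim show ?thesis by (rule Lim_transform_eventually)
qed

text \<open>The condition on the limits makes all singularities removable. The resulting function on the punctured
  plane takes all its values on a compact annulus, by periodicity, so that Liouville's theorem applies.\<close>

lemma torus_constant:
  fixes h :: "complex \<Rightarrow> complex" and D :: "complex set"
  assumes D0: "0 \<notin> D" and per: "\<And>t. t \<in> D \<Longrightarrow> q * t \<in> D \<and> t / q \<in> D \<and> h (q * t) = h t"
    and ana: "\<And>t. t \<in> D \<Longrightarrow> h analytic_on {t}"
    and ev: "\<And>t. t \<noteq> 0 \<Longrightarrow> eventually (\<lambda>t. t \<in> D) (at t)"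
    and lim: "\<And>t0. t0 \<noteq> 0 \<Longrightarrow> ((\<lambda>t. (t - t0) * h t) \<longlongrightarrow> 0) (at t0)"
  shows "\<exists>C. \<forall>t. t \<noteq> 0 \<longrightarrow> h analytic_on {t} \<longrightarrow> h t = C"
proof -
  define F where "F = remove_sings h"
  have F_ana: "F analytic_on {t0}" if t0: "t0 \<noteq> 0" for t0
  proof -
    obtain S where S: "open S" "t0 \<in> S" "\<And>t. t \<in> S \<Longrightarrow> t \<noteq> t0 \<Longrightarrow> t \<in> D"
      using ev[OF t0] by (auto simp: eventually_at_topological)
    have hol: "h holomorphic_on S - {t0}"
    proof (rule analytic_imp_holomorphic, subst analytic_on_analytic_at, rule ballI)
      fix z assume "z \<in> S - {t0}"
      then show "h analytic_on {z}" using ana S(3) by blast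
    qed
    obtain g where g: "g holomorphic_on S" "\<And>z. z \<in> S - {t0} \<Longrightarrow> g z = h z"
      using holomorphic_on_extend_lim[OF hol] S lim[OF t0] by (auto simp: interior_open)
    have "(g \<longlongrightarrow> g t0) (at t0)"
      using holomorphic_on_imp_continuous_on[OF g(1)] S(1,2) continuous_on_eq_continuous_at[OF S(1), of g]
      unfolding isCont_def by blast
    moreover have "eventually (\<lambda>t. g t = h t) (at t0)"
      by (rule eventually_mono[OF eventually_at_in_open[OF S(1,2)]]) (rule g(2))
    ultimately have "(h \<longlongrightarrow> g t0) (at t0)" by (rule Lim_transform_eventually)
    moreover have "isolated_singularity_at h t0"
    proof -
      obtain r where "0 < r" "ball t0 r \<subseteq> S" using S open_contains_ball by blast
      then have "h analytic_on ball t0 r - {t0}"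
        using ana S(3) by (subst analytic_on_analytic_at) auto
      then show ?thesis using \<open>0 < r\<close> by (auto simp: isolated_singularity_at_def)
    qed
    ultimately show ?thesis unfolding F_def by (intro remove_sings_analytic_at)
  qed
  have F_eq: "F t = h t" if "h analytic_on {t}" for t
    unfolding F_def using that by simp
  have F_hol: "F holomorphic_on - {0}"
    by (rule analytic_imp_holomorphic, subst analytic_on_analytic_at) (use F_ana in blast)
  define K where "K = {t::complex. norm q \<le> norm t \<and> norm t \<le> 1}"
  have "compact K"
  proof -
    have "closed K" unfolding K_def by (intro closed_Collect_conj closed_Collect_le continuous_intros)
    moreover have "bounded K" by (rule boundedI[of _ 1]) (auto simp: K_def)
    ultimately show ?thesis by (simp add: compact_eq_bounded_closed)
  qed
  moreover have "continuous_on K F"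
    by (rule continuous_on_subset[OF holomorphic_on_imp_continuous_on[OF F_hol]]) (use q_nz in \<open>auto simp: K_def\<close>)
  ultimately have "bounded (F ` K)" by (intro compact_imp_bounded compact_continuous_image)
  then obtain C where C: "\<And>t. t \<in> K \<Longrightarrow> norm (F t) \<le> C" by (auto simp: bounded_iff)
  have pow: "t * q ^ n \<in> D \<and> h (t * q ^ n) = h t \<and> t / q ^ n \<in> D \<and> h (t / q ^ n) = h t" if t: "t \<in> D" for t n
  proof (induction n)
    case (Suc n)
    have e: "t * q ^ Suc n = q * (t * q ^ n)" "t / q ^ Suc n = t / q ^ n / q" by simp_all
    have 1: "h (q * (t * q ^ n)) = h (t * q ^ n)" "q * (t * q ^ n) \<in> D"
      using per[of "t * q ^ n"] Suc by blast+
    have 2: "t / q ^ n / q \<in> D" using per[of "t / q ^ n"] Suc by blast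
    have "q * (t / q ^ n / q) = t / q ^ n" using q_nz by simp
    then have "h (t / q ^ n / q) = h (t / q ^ n)" using per[OF 2] by metis
    then show ?case unfolding e using 1 2 Suc by metis
  qed (use t in simp)
  have F_D: "norm (F t) \<le> C" if t: "t \<in> D" for t
  proof -
    have t0: "t \<noteq> 0" using t D0 by auto
    have "\<exists>t'\<in>K \<inter> D. h t' = h t"
    proof (cases "norm t \<le> 1")
      case True
      define n where "n = (LEAST n. norm t / norm q ^ Suc n > 1)"
      have ex: "\<exists>n. norm t / norm q ^ Suc n > 1"
      proof -
        have "(\<lambda>n. norm q ^ n) \<longlonglongrightarrow> 0" using q_lt1 by (intro LIMSEQ_realpow_zero) auto
        then have "eventually (\<lambda>n. norm q ^ n < norm t) sequentially" using t0 by (auto simp: order_tendsto_iff)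
        then obtain N where "\<And>n. n \<ge> N \<Longrightarrow> norm q ^ n < norm t" unfolding eventually_sequentially by blast
        then have "norm q ^ Suc N < norm t" by (meson le_SucI le_refl)
        then show ?thesis using q_nz by (intro exI[of _ N]) (simp add: divide_simps)
      qed
      have n1: "norm t / norm q ^ Suc n > 1" unfolding n_def by (rule LeastI_ex[OF ex])
      have n2: "norm t / norm q ^ n \<le> 1"
      proof (cases n)
        case (Suc m)
        then have "m < (LEAST n. norm t / norm q ^ Suc n > 1)" by (simp add: n_def)
        from not_less_Least[OF this] show ?thesis unfolding Suc by simp
      qed (use True in simp)
      have "norm q < norm t / norm q ^ n" using n1 q_nz by (simp add: divide_simps mult_ac)
      then have "t / q ^ n \<in> K" using n2 by (simp add: K_def norm_divide norm_power)
      then show ?thesis using pow[OF t, of n] by auto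
    next
      case False
      define n where "n = (LEAST n. norm t * norm q ^ n \<le> 1)"
      have ex: "\<exists>n. norm t * norm q ^ n \<le> 1"
      proof -
        have "(\<lambda>n. norm t * norm q ^ n) \<longlonglongrightarrow> norm t * 0" using q_lt1 by (intro tendsto_intros LIMSEQ_realpow_zero) auto
        then have "eventually (\<lambda>n. norm t * norm q ^ n < 1) sequentially" by (auto simp: order_tendsto_iff)
        then obtain N where "\<And>n. n \<ge> N \<Longrightarrow> norm t * norm q ^ n < 1" unfolding eventually_sequentially by blast
        from this[of N] show ?thesis by (intro exI[of _ N]) simp
      qed
      have n1: "norm t * norm q ^ n \<le> 1" unfolding n_def by (rule LeastI_ex[OF ex])
      then obtain m where m: "n = Suc m" using False by (cases n) auto
      have "\<not> norm t * norm q ^ m \<le> 1"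
        using m not_less_Least[of m "\<lambda>n. norm t * norm q ^ n \<le> 1"] by (simp add: n_def)
      then have "norm q \<le> norm t * norm q ^ n" using m mult_left_mono[of 1 "norm t * norm q ^ m" "norm q"] by (simp add: mult_ac)
      then have "t * q ^ n \<in> K" using n1 by (simp add: K_def norm_mult norm_power)
      then show ?thesis using pow[OF t, of n] by auto
    qed
    then obtain t' where "t' \<in> K" "t' \<in> D" "h t' = h t" by blast
    then show ?thesis using C[of t'] F_eq[OF ana, of t'] F_eq[OF ana, of t] t by simp
  qed
  have F_bd: "norm (F t) \<le> C" if t: "t \<noteq> 0" for t
  proof (rule tendsto_upperbound)
    show "((\<lambda>s. norm (F s)) \<longlongrightarrow> norm (F t)) (at t)"
      using analytic_at_imp_isCont[OF F_ana[OF t]] by (intro tendsto_norm) (simp add: isCont_def)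
    show "eventually (\<lambda>s. norm (F s) \<le> C) (at t)" using ev[OF t] by eventually_elim (rule F_D)
  qed simp
  have hol': "F holomorphic_on UNIV - {0}" using F_hol by (simp add: Compl_eq_Diff_UNIV)
  have "\<exists>B. eventually (\<lambda>z. norm (F z) \<le> B) (at 0)"
    using F_bd by (intro exI[of _ C]) (auto simp: eventually_at intro!: exI[of _ 1])
  then obtain g where g: "g holomorphic_on UNIV" "\<And>z. z \<noteq> 0 \<Longrightarrow> g z = F z"
    using holomorphic_on_extend_bounded[OF hol'] by auto
  have "norm (g z) \<le> max C (norm (g 0))" for z
    using F_bd[of z] g(2)[of z] by (cases "z = 0") (auto simp: le_max_iff_disj)
  then have "bounded (range g)" unfolding bounded_iff by blast
  then obtain C' where C': "\<And>z. g z = C'"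
    using Liouville_theorem[OF g(1)] by (auto simp: constant_on_def)
  show ?thesis
  proof (intro exI[of _ C'] allI impI)
    fix t :: complex assume "t \<noteq> 0" "h analytic_on {t}"
    then have "h t = F t" "F t = g t" using F_eq[of t] g(2)[of t] by auto
    then show "h t = C'" by (simp only: C')
  qed
qed

section \<open>Evaluation of the total mass\<close>

text \<open>Two parameters with product \<open>1\<close>: all but two of the six terms vanish, and the two series terminate
  after their first term.\<close>

lemma hfun_term_resonant:
  assumes nz: "\<And>i. i \<in> I6 \<Longrightarrow> b i \<noteq> 0" and prod: "(\<Prod>i\<in>I6. b i) = q" and b13: "b 1 * b 3 = 1"
    and sq: "b 1 * b 1 \<notin> qZ"
    and quot: "\<And>m. m \<in> {2,4,5,6} \<Longrightarrow> b m / b 1 \<notin> qZ"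
    and prods: "\<And>i m. i \<in> {2,4,5,6} \<Longrightarrow> m \<in> {2,4,5,6} \<Longrightarrow> i < m \<Longrightarrow> b i * b m \<notin> qZ"
  shows "hnum b 1 / (\<Prod>i\<in>I6-{1}. theta (b i / b 1)) = - (qpoch_inf q q)\<^sup>2"
proof -
  define a where "a = b 1"
  have a0: "a \<noteq> 0" using nz[of 1] by (simp add: a_def I6_def)
  have b3: "b 3 = 1 / a" using b13 a0 by (simp add: a_def field_simps)
  have I: "I6 - {1} = {2,3,4,5,6}" by (auto simp: I6_eq)
  have qp0: "qpoch q (b 3 * b 1) (Suc k) = 0" for k
    using b13 by (simp add: qpoch_eq_0_iff mult.commute) (intro exI[of _ 0], simp)
  define e where "e m = qpoch_inf q (q * a / b m)" for m
  have "jseries b 1 = a * (1 - a\<^sup>2) * (\<Prod>i\<in>I6. e i)"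
  proof -
    have z: "b 1 * q ^ k * (1 - (b 1 * q ^ k)\<^sup>2) * (\<Prod>i\<in>I6. qpoch_inf q (q * (b 1 * q ^ k) / b i) * qpoch q (b i * b 1) k) = 0"
      if k: "k \<notin> {0}" for k
    proof -
      obtain k' where "k = Suc k'" using k by (cases k) auto
      then have "(\<Prod>i\<in>I6. qpoch_inf q (q * (b 1 * q ^ k) / b i) * qpoch q (b i * b 1) k) = 0"
        using qp0 by (intro prod_zero bexI[of _ 3]) (auto simp: I6_def)
      then show ?thesis by simp
    qed
    have "jseries b 1 = (\<Sum>k\<in>{0}. b 1 * q ^ k * (1 - (b 1 * q ^ k)\<^sup>2) *
        (\<Prod>i\<in>I6. qpoch_inf q (q * (b 1 * q ^ k) / b i) * qpoch q (b i * b 1) k))"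
      unfolding jseries_def by (rule suminf_finite) (simp, rule z)
    then show ?thesis by (simp add: a_def e_def)
  qed
  then have j: "jseries b 1 = a * (1 - a\<^sup>2) * (e 1 * e 2 * e 3 * e 4 * e 5 * e 6)"
    by (simp only: prod_I6)
  define f where "f i m = qpoch_inf q (b i * b m) / qpoch_inf q (q / (b i * b m))" for i m
  have pp: "pair_prod (\<lambda>i m. if i = 1 \<or> m = 1 then 1 else f i m) =
     f 2 3 * f 2 4 * f 2 5 * f 2 6 * f 3 4 * f 3 5 * f 3 6 * f 4 5 * f 4 6 * f 5 6"
    by (simp add: pair_prod_eq mult_ac)
  have q4: "b 2 * b 4 * b 5 * b 6 = q"
    using prod b13 by (simp add: prod_I6) (metis mult.assoc mult.commute mult.left_commute mult_1)
  have inv: "f i m * f k l = 1" if "{i,m,k,l} = {2,4,5,6}" "i < m" "k < l" "b i * b m * (b k * b l) = q" for i m k l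
  proof -
    have im: "i \<in> {2,4,5,6}" "m \<in> {2,4,5,6}" "k \<in> {2,4,5,6}" "l \<in> {2,4,5,6}"
      unfolding that(1)[symmetric] by simp_all
    have "{2,4,5,6} \<subseteq> I6" by (auto simp: I6_def)
    then have n: "b i * b m \<noteq> 0" "b k * b l \<noteq> 0"
      using im nz by (meson mult_eq_0_iff subsetD)+
    have "q / (b i * b m) = b k * b l" "q / (b k * b l) = b i * b m"
      using that(4) n by (auto simp: field_simps)
    moreover have "qpoch_inf q (b i * b m) \<noteq> 0" "qpoch_inf q (b k * b l) \<noteq> 0"
      using prods im that(2,3) qpoch_inf_nz by auto
    ultimately show ?thesis by (simp add: f_def)
  qed
  have i1: "f 2 4 * f 5 6 = 1" by (rule inv) (use q4 in \<open>auto simp: mult_ac\<close>)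
  have i2: "f 2 5 * f 4 6 = 1" by (rule inv) (use q4 in \<open>auto simp: mult_ac\<close>)
  have i3: "f 2 6 * f 4 5 = 1" by (rule inv) (use q4 in \<open>auto simp: mult_ac\<close>)
  define g where "g m = qpoch_inf q (b m / a)" for m
  have gnz: "g m \<noteq> 0" and enz: "e m \<noteq> 0" if "m \<in> {2,4,5,6}" for m
    using qpoch_inf_nz[OF quot[OF that]] qpoch_inf_div_nz[OF quot[OF that]]
    by (auto simp: g_def e_def a_def)
  have fm: "f 2 3 = g 2 / e 2" "f 3 4 = g 4 / e 4" "f 3 5 = g 5 / e 5" "f 3 6 = g 6 / e 6"
    by (simp_all add: f_def g_def e_def b3)
  have th: "theta (b m / b 1) = g m * e m" for m
    by (simp add: theta_def g_def e_def a_def)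
  have e1: "e 1 = qpoch_inf q q" using a0 by (simp add: e_def a_def)
  have sqa: "a * a \<notin> qZ" using sq by (simp add: a_def)
  have sqa': "1 / (a * a) \<notin> qZ" using sqa qZ_inverse[of "1 / (a * a)"] by auto
  have A: "qpoch_inf q (a * a) = (1 - a * a) * e 3"
    using qpoch_inf_step[of "a * a"] by (simp add: e_def b3 mult_ac)
  have B: "g 3 = (1 - 1 / (a * a)) * qpoch_inf q (q / (a * a))"
    using qpoch_inf_step[of "1 / (a * a)"] by (simp add: g_def b3)
  have e3: "e 3 \<noteq> 0" "1 - a * a \<noteq> 0" using A qpoch_inf_nz[OF sqa] by auto
  have qa: "qpoch_inf q (q / (a * a)) \<noteq> 0" using qpoch_inf_div_nz[OF sqa] .
  have b3': "1 - 1 / (a * a) \<noteq> 0" using e3 a0 by (simp add: field_simps)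
  have "hnum b 1 = (jseries b 1)\<^sup>2 / a ^ 4 * (qpoch_inf q (q / (a * a)) / qpoch_inf q (a * a)) *
      (f 2 3 * f 3 4 * f 3 5 * f 3 6 * (f 2 4 * f 5 6) * (f 2 5 * f 4 6) * (f 2 6 * f 4 5))"
    unfolding hnum_def pp[unfolded f_def] by (simp add: a_def f_def mult_ac)
  also have "\<dots> = (a * (1 - a\<^sup>2) * (e 1 * e 2 * e 3 * e 4 * e 5 * e 6))\<^sup>2 / a ^ 4 *
      (qpoch_inf q (q / (a * a)) / ((1 - a * a) * e 3)) * (g 2 / e 2 * (g 4 / e 4) * (g 5 / e 5) * (g 6 / e 6))"
    by (simp only: i1 i2 i3 fm j A mult_1_right)
  finally have h: "hnum b 1 = (a * (1 - a\<^sup>2) * (e 1 * e 2 * e 3 * e 4 * e 5 * e 6))\<^sup>2 / a ^ 4 *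
      (qpoch_inf q (q / (a * a)) / ((1 - a * a) * e 3)) * (g 2 / e 2 * (g 4 / e 4) * (g 5 / e 5) * (g 6 / e 6))" .
  have P: "(\<Prod>i\<in>I6-{1}. theta (b i / b 1)) =
      (g 2 * e 2) * (((1 - 1 / (a * a)) * qpoch_inf q (q / (a * a))) * e 3) * (g 4 * e 4) * (g 5 * e 5) * (g 6 * e 6)"
    unfolding I th by (simp add: B mult_ac)
  have alg: "(a * (1 - a\<^sup>2) * (E1 * E2 * E3 * E4 * E5 * E6))\<^sup>2 / a ^ 4 * (Q / ((1 - a * a) * E3)) *
      (G2 / E2 * (G4 / E4) * (G5 / E5) * (G6 / E6)) /
      ((G2 * E2) * (((1 - 1 / (a * a)) * Q) * E3) * (G4 * E4) * (G5 * E5) * (G6 * E6)) = - (E1\<^sup>2)"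
    if "E2 \<noteq> 0" "E3 \<noteq> 0" "E4 \<noteq> 0" "E5 \<noteq> 0" "E6 \<noteq> 0" "G2 \<noteq> 0" "G4 \<noteq> 0" "G5 \<noteq> 0" "G6 \<noteq> 0" "Q \<noteq> 0"
    for E1 E2 E3 E4 E5 E6 G2 G4 G5 G6 Q
  proof -
    have "(a * (1 - a\<^sup>2) * (E1 * E2 * E3 * E4 * E5 * E6))\<^sup>2 / a ^ 4 * (Q / ((1 - a * a) * E3)) *
      (G2 / E2 * (G4 / E4) * (G5 / E5) * (G6 / E6)) =
      (a\<^sup>2 * (1 - a * a) / a ^ 4 * E1\<^sup>2) * (Q * E3 * (E2 * G2) * (E4 * G4) * (E5 * G5) * (E6 * G6))"
      using that e3(2) by (simp add: power2_eq_square divide_simps)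
    moreover have "a\<^sup>2 * (1 - a * a) / a ^ 4 = - (1 - 1 / (a * a))"
      using a0 by (simp add: divide_simps power2_eq_square power4_eq_xxxx)
    ultimately have num: "(a * (1 - a\<^sup>2) * (E1 * E2 * E3 * E4 * E5 * E6))\<^sup>2 / a ^ 4 * (Q / ((1 - a * a) * E3)) *
      (G2 / E2 * (G4 / E4) * (G5 / E5) * (G6 / E6)) =
      (- (1 - 1 / (a * a)) * E1\<^sup>2) * (Q * E3 * (E2 * G2) * (E4 * G4) * (E5 * G5) * (E6 * G6))"
      by (simp only:)
    have "(- s * E1\<^sup>2) * (Q * E3 * (E2 * G2) * (E4 * G4) * (E5 * G5) * (E6 * G6)) /
      ((G2 * E2) * ((s * Q) * E3) * (G4 * E4) * (G5 * E5) * (G6 * E6)) = - (E1\<^sup>2)" if "s \<noteq> 0" for s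
      using that \<open>E2 \<noteq> 0\<close> \<open>E3 \<noteq> 0\<close> \<open>E4 \<noteq> 0\<close> \<open>E5 \<noteq> 0\<close> \<open>E6 \<noteq> 0\<close> \<open>G2 \<noteq> 0\<close> \<open>G4 \<noteq> 0\<close> \<open>G5 \<noteq> 0\<close> \<open>G6 \<noteq> 0\<close> \<open>Q \<noteq> 0\<close>
      by (simp add: divide_simps)
    from this[OF b3'] show ?thesis unfolding num .
  qed
  show ?thesis
    unfolding h P e1[symmetric]
    by (rule alg) (use enz gnz e3(1) qa in auto)
qed

lemma hfun_resonant:
  assumes nz: "\<And>i. i \<in> I6 \<Longrightarrow> b i \<noteq> 0" and prod: "(\<Prod>i\<in>I6. b i) = q" and b13: "b 1 * b 3 = 1"
    and sq: "b 1 * b 1 \<notin> qZ"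
    and quot: "\<And>m. m \<in> {2,4,5,6} \<Longrightarrow> b m / b 1 \<notin> qZ"
    and mult: "\<And>m. m \<in> {2,4,5,6} \<Longrightarrow> b m * b 1 \<notin> qZ"
    and prods: "\<And>i m. i \<in> {2,4,5,6} \<Longrightarrow> m \<in> {2,4,5,6} \<Longrightarrow> i < m \<Longrightarrow> b i * b m \<notin> qZ"
  shows "hfun b = - 2 * (qpoch_inf q q)\<^sup>2"
proof -
  have b1: "b 1 \<noteq> 0" using nz[of 1] by (simp add: I6_def)
  have b3: "b 3 = 1 / b 1" using b13 b1 by (simp add: field_simps)
  have t1: "hnum b 1 / (\<Prod>i\<in>I6-{1}. theta (b i / b 1)) = - (qpoch_inf q q)\<^sup>2"
    by (rule hfun_term_resonant[OF nz prod b13 sq quot prods])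
  define \<pi> :: "nat \<Rightarrow> nat" where "\<pi> = Transposition.transpose 1 3"
  have \<pi>: "\<pi> permutes I6" unfolding \<pi>_def by (intro permutes_swap_id) (auto simp: I6_def)
  have \<pi>_eq: "\<pi> 1 = 3" "\<pi> 3 = 1" "\<And>m. m \<in> {2,4,5,6} \<Longrightarrow> \<pi> m = m"
    by (auto simp: \<pi>_def Transposition.transpose_def)
  have "hnum (b \<circ> \<pi>) 1 / (\<Prod>i\<in>I6-{1}. theta ((b \<circ> \<pi>) i / (b \<circ> \<pi>) 1)) = - (qpoch_inf q q)\<^sup>2"
  proof (rule hfun_term_resonant)
    show "(b \<circ> \<pi>) i \<noteq> 0" if "i \<in> I6" for i using nz permutes_in_image[OF \<pi>] that by simp
    show "(\<Prod>i\<in>I6. (b \<circ> \<pi>) i) = q" using prod.permute[OF \<pi>, of b] prod by simp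
    show "(b \<circ> \<pi>) 1 * (b \<circ> \<pi>) 3 = 1" using b13 \<pi>_eq by (simp add: mult.commute)
    show "(b \<circ> \<pi>) 1 * (b \<circ> \<pi>) 1 \<notin> qZ"
      using sq qZ_inverse[of "1 / (b 1 * b 1)"] \<pi>_eq b3 by auto
    show "(b \<circ> \<pi>) m / (b \<circ> \<pi>) 1 \<notin> qZ" if "m \<in> {2,4,5,6}" for m
      using mult[OF that] \<pi>_eq(1) \<pi>_eq(3)[OF that] b3 by simp
    show "(b \<circ> \<pi>) i * (b \<circ> \<pi>) m \<notin> qZ" if "i \<in> {2,4,5,6}" "m \<in> {2,4,5,6}" "i < m" for i m
      using prods[OF that] \<pi>_eq(3)[OF that(1)] \<pi>_eq(3)[OF that(2)] by simp
  qed
  moreover have "(1::nat) \<in> I6" by (simp add: I6_def)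
  ultimately have t3: "hnum b 3 / (\<Prod>i\<in>I6-{3}. theta (b i / b 3)) = - (qpoch_inf q q)\<^sup>2"
    using hterm_permutes[OF \<pi>, of 1 b] \<pi>_eq(1) by simp
  have t0: "hnum b j / (\<Prod>i\<in>I6-{j}. theta (b i / b j)) = 0" if j: "j \<in> {2,4,5,6}" for j
  proof -
    have "qpoch_inf q (b 1 * b 3) = 0"
      unfolding b13 qpoch_inf_eq_0_iff by (intro exI[of _ 0]) simp
    moreover have "j \<noteq> 1" "j \<noteq> 3" using j by auto
    ultimately have "pair_prod (\<lambda>i m. if i = j \<or> m = j then 1
        else qpoch_inf q (b i * b m) / qpoch_inf q (q / (b i * b m))) = 0"
      by (simp add: pair_prod_eq)
    then show ?thesis by (simp add: hnum_def)
  qed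
  have "hfun b = (\<Sum>j\<in>{1,3} \<union> {2,4,5,6}. hnum b j / (\<Prod>i\<in>I6-{j}. theta (b i / b j)))"
    unfolding hfun_def by (rule sum.cong) (auto simp: I6_eq)
  also have "\<dots> = (\<Sum>j\<in>{1,3}. hnum b j / (\<Prod>i\<in>I6-{j}. theta (b i / b j)))"
    by (rule sum.mono_neutral_right) (use t0 in auto)
  also have "\<dots> = - 2 * (qpoch_inf q q)\<^sup>2" using t1 t3 by simp
  finally show ?thesis .
qed

section \<open>The total mass is constant\<close>

text \<open>The product of the first two parameters is kept, and replacing \<open>t\<close> by \<open>q t\<close> is an integer shift of sum 0.
  Hence \<open>hfun\<close> is a function on a torus along the curve.\<close>

definition curve :: "(nat \<Rightarrow> complex) \<Rightarrow> complex \<Rightarrow> nat \<Rightarrow> complex" where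
  "curve b t = b(1 := t, 2 := b 1 * b 2 / t)"

definition J4 :: "nat set" where "J4 = {3, 4, 5, 6}"

lemma I6_J4: "I6 = insert 1 (insert 2 J4)" "J4 \<subseteq> I6" "1 \<notin> J4" "2 \<notin> J4" "3 \<in> J4" "1 \<in> I6" "2 \<in> I6"
  by (auto simp: I6_eq J4_def)

text \<open>As \<open>b\<^sub>1 = t\<close> and \<open>b\<^sub>2 = const / t\<close> vary, different resonances may collide. This does not happen under
  the following condition on the remaining parameters.\<close>

text \<open>As \<open>b\<^sub>1 = t\<close> and \<open>b\<^sub>2 = const / t\<close> vary, different resonances may collide. This does not happen under
  the following condition on the remaining parameters.\<close>

definition no_collision :: "(nat \<Rightarrow> complex) \<Rightarrow> bool" where
  "no_collision b \<longleftrightarrow> (\<forall>i\<in>J4. \<forall>j\<in>J4. \<forall>\<sigma>\<in>{-1,0,1}. \<forall>\<tau>\<in>{-1,0,1}.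
      (b 1 * b 2 * b i powi \<sigma> * b j powi \<tau>)\<^sup>2 \<notin> qZ)"

text \<open>What is used about a point of such a curve; symmetric in the two distinguished indices.\<close>

definition semigeneric :: "nat \<Rightarrow> nat \<Rightarrow> (nat \<Rightarrow> complex) \<Rightarrow> bool" where
  "semigeneric u v w \<longleftrightarrow> I6 = insert u (insert v J4) \<and> u \<noteq> v \<and> u \<notin> J4 \<and> v \<notin> J4 \<and>
     (\<forall>i\<in>I6. w i \<noteq> 0) \<and> (\<forall>i\<in>J4. \<forall>j\<in>J4. i \<noteq> j \<longrightarrow> w i / w j \<notin> qZ) \<and>
     (\<forall>i\<in>J4. \<forall>j\<in>J4. w i * w j \<notin> qZ) \<and> w u * w v \<notin> qZ \<and>
     (\<forall>i\<in>J4. \<forall>j\<in>J4. \<forall>\<sigma>\<in>{-1,0,1}. \<forall>\<tau>\<in>{-1,0,1}. (w u * w v * w i powi \<sigma> * w j powi \<tau>)\<^sup>2 \<notin> qZ)"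

lemma semigeneric_swap: "semigeneric u v w \<Longrightarrow> semigeneric v u w"
  by (auto simp: semigeneric_def insert_commute mult.commute)

lemma qZ_power2: "x \<in> qZ \<Longrightarrow> x\<^sup>2 \<in> qZ"
  by (simp add: power2_eq_square qZ_mult)

lemma qZ_flip: "x \<in> qZ \<longleftrightarrow> 1 / x \<in> qZ"
  using qZ_inverse[of x] qZ_inverse[of "1 / x"] by (auto simp: inverse_eq_divide)

lemma semigenericD:
  assumes "semigeneric u v w"
  shows "I6 = insert u (insert v J4)" "u \<noteq> v" "u \<notin> J4" "v \<notin> J4" "u \<in> I6" "v \<in> I6"
    "\<And>i. i \<in> I6 \<Longrightarrow> w i \<noteq> 0"
    "\<And>i j. i \<in> J4 \<Longrightarrow> j \<in> J4 \<Longrightarrow> i \<noteq> j \<Longrightarrow> w i / w j \<notin> qZ"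
    "\<And>i j. i \<in> J4 \<Longrightarrow> j \<in> J4 \<Longrightarrow> w i * w j \<notin> qZ" "w u * w v \<notin> qZ"
    "\<And>i j. i \<in> J4 \<Longrightarrow> j \<in> J4 \<Longrightarrow> w u * w v * w i * w j \<notin> qZ"
    "\<And>i j. i \<in> J4 \<Longrightarrow> j \<in> J4 \<Longrightarrow> w u * w v * w i / w j \<notin> qZ"
    "\<And>i j. i \<in> J4 \<Longrightarrow> j \<in> J4 \<Longrightarrow> w u * w v / (w i * w j) \<notin> qZ"
    "\<And>i. i \<in> J4 \<Longrightarrow> (w u * w v * w i)\<^sup>2 \<notin> qZ"
    "\<And>i. i \<in> J4 \<Longrightarrow> (w u * w v / w i)\<^sup>2 \<notin> qZ"
    "(w u * w v)\<^sup>2 \<notin> qZ"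
proof -
  note s = assms[unfolded semigeneric_def]
  show "I6 = insert u (insert v J4)" "u \<noteq> v" "u \<notin> J4" "v \<notin> J4" "u \<in> I6" "v \<in> I6"
    "\<And>i. i \<in> I6 \<Longrightarrow> w i \<noteq> 0"
    "\<And>i j. i \<in> J4 \<Longrightarrow> j \<in> J4 \<Longrightarrow> i \<noteq> j \<Longrightarrow> w i / w j \<notin> qZ"
    "\<And>i j. i \<in> J4 \<Longrightarrow> j \<in> J4 \<Longrightarrow> w i * w j \<notin> qZ" "w u * w v \<notin> qZ"
    using s by blast+
  have vg: "(w u * w v * w i powi \<sigma> * w j powi \<tau>)\<^sup>2 \<notin> qZ"
    if "i \<in> J4" "j \<in> J4" "\<sigma> \<in> {-1,0,1}" "\<tau> \<in> {-1,0,1}" for i j \<sigma> \<tau>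
    using s that by blast
  show "w u * w v * w i * w j \<notin> qZ" "w u * w v * w i / w j \<notin> qZ" "w u * w v / (w i * w j) \<notin> qZ"
    if "i \<in> J4" "j \<in> J4" for i j
    using vg[OF that, of 1 1] vg[OF that, of 1 "-1"] vg[OF that, of "-1" "-1"] qZ_power2
    by (auto simp: power_int_minus divide_inverse mult_ac)
  show "(w u * w v * w i)\<^sup>2 \<notin> qZ" "(w u * w v / w i)\<^sup>2 \<notin> qZ" if "i \<in> J4" for i
    using vg[OF that that, of 1 0] vg[OF that that, of "-1" 0]
    by (auto simp: power_int_minus divide_inverse mult_ac)
  show "(w u * w v)\<^sup>2 \<notin> qZ"
    using vg[of 3 3 0 0] I6_J4(5) by auto
qed

text \<open>Two simultaneous coincidences would combine to a relation that does not involve the moving parameters, and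
  \<open>semigeneric\<close> excludes all such relations. Here a moving parameter meets a fixed one.\<close>

lemma resonance_outer:
  assumes sg: "semigeneric u v w" and i: "i \<in> J4" and res: "w u / w i \<in> qZ"
  shows "\<And>k l. k \<in> I6 \<Longrightarrow> l \<in> I6 \<Longrightarrow> w k * w l \<notin> qZ"
    "\<And>k l. k \<in> I6 \<Longrightarrow> l \<in> I6 \<Longrightarrow> k \<noteq> l \<Longrightarrow> {k,l} \<noteq> {u,i} \<Longrightarrow> w k / w l \<notin> qZ"
proof -
  note s = semigenericD[OF sg]
  define B where "B = w u * w v"
  have J: "j \<in> I6" if "j \<in> J4" for j using s(1) that by blast
  have nz: "w u \<noteq> 0" "w v \<noteq> 0" "w i \<noteq> 0" using s i J by auto
  obtain m where m: "w u / w i = q powi m" using res by (auto simp: qZ_def)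
  have u: "w u = w i * q powi m" using m nz by (simp add: field_simps)
  have v: "w v = B / w i * q powi (-m)"
    using nz q_nz by (simp add: B_def u power_int_minus field_simps)
  have pr: "w k * w l \<notin> qZ" if "k \<in> insert u (insert v J4)" "l \<in> insert u (insert v J4)" for k l
  proof -
    have uu: "w u * w u \<notin> qZ" using s(9)[OF i i] unfolding u qZ_prod_shift .
    have uv: "w u * w v \<notin> qZ" by (rule s(10))
    have uj: "w u * w j \<notin> qZ" if "j \<in> J4" for j
      using s(9)[OF i that] qZ_prod_shift[of "w i" m "w j" 0] by (simp add: u)
    have vv: "w v * w v \<notin> qZ"
    proof -
      have "B / w i * (B / w i) \<notin> qZ" using s(15)[OF i] by (simp add: B_def power2_eq_square)
      then show ?thesis unfolding v qZ_prod_shift .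
    qed
    have vj: "w v * w j \<notin> qZ" if "j \<in> J4" for j
    proof -
      have "B / w i * w j \<notin> qZ" using s(12)[OF that i] by (simp add: B_def)
      then show ?thesis unfolding v using qZ_prod_shift[of "B / w i" "-m" "w j" 0] by simp
    qed
    show ?thesis using that uu uv uj vv vj s(9) by (auto simp: mult.commute)
  qed
  then show "\<And>k l. k \<in> I6 \<Longrightarrow> l \<in> I6 \<Longrightarrow> w k * w l \<notin> qZ" using s(1) by blast
  have qu: "w k / w l \<notin> qZ" if "k \<in> insert u (insert v J4)" "l \<in> insert u (insert v J4)" "k \<noteq> l" "{k,l} \<noteq> {u,i}" for k l
  proof -
    have uj: "w u / w j \<notin> qZ" if "j \<in> J4" "j \<noteq> i" for j
      using s(8)[OF i that(1)] that(2) qZ_ratio_shift[of "w i" m "w j" 0] by (simp add: u)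
    have vj: "w v / w j \<notin> qZ" if "j \<in> J4" for j
    proof -
      have "B / w i / w j \<notin> qZ" using s(13)[OF i that] by (simp add: B_def)
      then show ?thesis unfolding v using qZ_ratio_shift[of "B / w i" "-m" "w j" 0] by simp
    qed
    have vu: "w v / w u \<notin> qZ"
    proof -
      have "B / w i / w i \<notin> qZ" using s(13)[OF i i] by (simp add: B_def)
      then show ?thesis unfolding v unfolding u qZ_ratio_shift .
    qed
    have fl: "w a / w c \<in> qZ \<longleftrightarrow> w c / w a \<in> qZ" for a c using qZ_flip[of "w a / w c"] by simp
    have N': "w j / w v \<notin> qZ" "w u / w v \<notin> qZ" if "j \<in> J4" for j
      using vj[OF that] vu fl[of j v] fl[of u v] by blast+
    have N'': "w j / w u \<notin> qZ" if "j \<in> J4" "j \<noteq> i" for j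
      using uj[OF that] fl[of j u] by blast
    have "{k, l} = {u, i} \<longleftrightarrow> k = u \<and> l = i \<or> k = i \<and> l = u" by (auto simp: doubleton_eq_iff)
    with that uj vj vu N'(1) N'(2)[OF i] N'' s(8) show ?thesis by blast
  qed
  then show "\<And>k l. k \<in> I6 \<Longrightarrow> l \<in> I6 \<Longrightarrow> k \<noteq> l \<Longrightarrow> {k,l} \<noteq> {u,i} \<Longrightarrow> w k / w l \<notin> qZ"
    using s(1) by blast
qed

text \<open>The same, where the two moving parameters meet: the square of a moving parameter is then their constant
  product, up to a power of \<open>q\<close>. For this reason the relations in \<open>semigeneric\<close> are squared.\<close>

lemma resonance_inner:
  assumes sg: "semigeneric u v w" and res: "w u / w v \<in> qZ"
  shows "\<And>k l. k \<in> I6 \<Longrightarrow> l \<in> I6 \<Longrightarrow> w k * w l \<notin> qZ"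
    "\<And>k l. k \<in> I6 \<Longrightarrow> l \<in> I6 \<Longrightarrow> k \<noteq> l \<Longrightarrow> {k,l} \<noteq> {u,v} \<Longrightarrow> w k / w l \<notin> qZ"
proof -
  note s = semigenericD[OF sg]
  have nz: "w u \<noteq> 0" "w v \<noteq> 0" using s by auto
  have nJ: "w j \<noteq> 0" if "j \<in> J4" for j using s(1,7) that by blast
  obtain m where m: "w u / w v = q powi m" using res by (auto simp: qZ_def)
  have uu: "w u * w u = w u * w v * q powi m" using m nz by (simp add: field_simps)
  have vv: "w v * w v = w u * w v * q powi (-m)" using m nz q_nz by (simp add: power_int_minus field_simps)
  have un: "w u * w u \<notin> qZ" "w v * w v \<notin> qZ" unfolding uu vv using s(10) by simp_all
  have uj: "w k * w j \<notin> qZ \<and> w k / w j \<notin> qZ" if "j \<in> J4" "k = u \<or> k = v" for j k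
  proof -
    have sq: "(w u * w j)\<^sup>2 = w u * w v * w j * w j * q powi m" "(w v * w j)\<^sup>2 = w u * w v * w j * w j * q powi (-m)"
       "(w u / w j)\<^sup>2 = w u * w v / (w j * w j) * q powi m" "(w v / w j)\<^sup>2 = w u * w v / (w j * w j) * q powi (-m)"
      using uu vv nJ[OF that(1)] by (simp_all add: power2_eq_square mult_ac divide_inverse)
    have "(w u * w j)\<^sup>2 \<notin> qZ" "(w v * w j)\<^sup>2 \<notin> qZ" "(w u / w j)\<^sup>2 \<notin> qZ" "(w v / w j)\<^sup>2 \<notin> qZ"
      unfolding sq qZ_mult_powi_iff using s(11)[OF that(1,1)] s(13)[OF that(1,1)] by auto
    then show ?thesis using qZ_power2 that(2) by blast
  qed
  have pr: "w k * w l \<notin> qZ" if "k \<in> insert u (insert v J4)" "l \<in> insert u (insert v J4)" for k l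
    using that un uj s(9,10) by (auto simp: mult.commute)
  then show "\<And>k l. k \<in> I6 \<Longrightarrow> l \<in> I6 \<Longrightarrow> w k * w l \<notin> qZ" using s(1) by blast
  have qu: "w k / w l \<notin> qZ" if "k \<in> insert u (insert v J4)" "l \<in> insert u (insert v J4)" "k \<noteq> l" "{k,l} \<noteq> {u,v}" for k l
  proof -
    have fl: "w a / w c \<in> qZ \<longleftrightarrow> w c / w a \<in> qZ" for a c using qZ_flip[of "w a / w c"] by simp
    have N': "w j / w u \<notin> qZ" "w j / w v \<notin> qZ" if "j \<in> J4" for j
      using uj[OF that] fl[of j u] fl[of j v] by blast+
    have "{k, l} = {u, v} \<longleftrightarrow> k = u \<and> l = v \<or> k = v \<and> l = u" by (auto simp: doubleton_eq_iff)
    with that uj N' s(8) show ?thesis by blast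
  qed
  then show "\<And>k l. k \<in> I6 \<Longrightarrow> l \<in> I6 \<Longrightarrow> k \<noteq> l \<Longrightarrow> {k,l} \<noteq> {u,v} \<Longrightarrow> w k / w l \<notin> qZ"
    using s(1) by blast
qed

text \<open>The zeros of the function are all of the form \<open>q powi (- n)\<close> with a natural number \<open>n\<close>.\<close>

lemma qpoch_inf_large_shift:
  assumes "x \<noteq> 0"
  shows "eventually (\<lambda>K. qpoch_inf q (x * q powi K) \<noteq> 0) at_top"
proof (cases "x \<in> qZ")
  case True
  then obtain m where m: "x = q powi m" by (auto simp: qZ_def)
  have *: "qpoch_inf q (x * q powi K) \<noteq> 0" if "1 - m \<le> K" for K
  proof
    assume "qpoch_inf q (x * q powi K) = 0"
    then obtain n where "x * q powi K * q ^ n = 1" by (auto simp: qpoch_inf_eq_0_iff)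
    then have "q powi (m + K + int n) = 1" using q_nz by (simp add: m power_int_add)
    then show False using that by (simp add: q_powi_eq_1_iff)
  qed
  show ?thesis by (rule eventually_mono[OF eventually_ge_at_top[of "1 - m"]]) (rule *)
next
  case False
  then show ?thesis by (simp add: qpoch_inf_nz)
qed

text \<open>Resonant products can be moved to a harmless place by a large shift, provided that they do not pull in
  opposite directions.\<close>

lemma resonance_products:
  assumes sg: "semigeneric u v w"
    and vj: "\<And>j. j \<in> J4 \<Longrightarrow> w v * w j \<notin> qZ" and uu: "w u * w u \<notin> qZ"
  obtains K where "reg_prod (shift w ((\<lambda>_. 0)(u := - K, v := K)))"
proof -
  note s = semigenericD[OF sg]
  have nJ: "w j \<noteq> 0" if "j \<in> J4" for j using s(1,7) that by blast
  have nz: "w u \<noteq> 0" "w v \<noteq> 0" using s by auto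
  have "eventually (\<lambda>K. qpoch_inf q (w v * w v * q powi (2 * K)) \<noteq> 0) at_top"
  proof -
    have "filterlim (\<lambda>K::int. 2 * K) at_top at_top"
      unfolding filterlim_at_top
    proof
      show "eventually (\<lambda>K::int. Z \<le> 2 * K) at_top" for Z
        by (rule eventually_mono[OF eventually_ge_at_top[of "\<bar>Z\<bar>"]]) auto
    qed
    from this qpoch_inf_large_shift[of "w v * w v"] nz show ?thesis by (auto dest: eventually_compose_filterlim)
  qed
  moreover have "eventually (\<lambda>K. \<forall>j\<in>J4. qpoch_inf q (q / (w u * w j) * q powi K) \<noteq> 0) at_top"
    using nz nJ q_nz by (intro eventually_ball_finite ballI qpoch_inf_large_shift) (auto simp: J4_def)
  ultimately have "eventually (\<lambda>K. qpoch_inf q (w v * w v * q powi (2 * K)) \<noteq> 0 \<and>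
     (\<forall>j\<in>J4. qpoch_inf q (q / (w u * w j) * q powi K) \<noteq> 0)) at_top" by (rule eventually_conj)
  then obtain K where K: "qpoch_inf q (w v * w v * q powi (2 * K)) \<noteq> 0"
     "\<And>j. j \<in> J4 \<Longrightarrow> qpoch_inf q (q / (w u * w j) * q powi K) \<noteq> 0"
    by (auto simp: eventually_at_top_linorder)
  define C where "C = (\<lambda>_. 0)(u := - K, v := K)"
  have C: "C u = - K" "C v = K" "\<And>j. j \<in> J4 \<Longrightarrow> C j = 0" using s(2-4) by (auto simp: C_def)
  have v2: "shift w C v * shift w C v = w v * w v * q powi (2 * K)"
    unfolding shift_def C mult_2 power_int_add[OF disjI1[OF q_nz]] by (simp only: mult_ac)
  have uj: "q / (shift w C u * shift w C j) = q / (w u * w j) * q powi K" if "j \<in> J4" for j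
    using that q_nz by (simp add: shift_def C power_int_minus field_simps)
  have nres: "shift w C k * shift w C l \<notin> qZ \<longleftrightarrow> w k * w l \<notin> qZ" for k l
    by (simp add: shift_def qZ_prod_shift)
  have sq: "qpoch_inf q (shift w C j * shift w C j) \<noteq> 0" if "j \<in> insert u (insert v J4)" for j
    using that K(1) uu s(9) qpoch_inf_nz[of "shift w C j * shift w C j"] by (auto simp: v2 nres)
  have pr: "qpoch_inf q (q / (shift w C k * shift w C l)) \<noteq> 0"
    if "k \<in> insert u (insert v J4)" "l \<in> insert u (insert v J4)" "k \<noteq> l" for k l
  proof -
    have a: "qpoch_inf q (q / (shift w C u * shift w C j)) \<noteq> 0" if "j \<in> J4" for j
      unfolding uj[OF that] by (rule K(2)[OF that])
    have b: "qpoch_inf q (q / (shift w C k * shift w C l)) \<noteq> 0" if "w k * w l \<notin> qZ" for k l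
      using that by (intro qpoch_inf_div_nz) (simp add: nres)
    have c: "q / (shift w C k * shift w C l) = q / (shift w C l * shift w C k)" for k l
      by (simp only: mult.commute)
    show ?thesis
      using that a b[of v] b[of _ v] vj s(9,10) b[of k l] c[of k u] by (auto simp: mult.commute)
  qed
  have "reg_prod (shift w C)"
    unfolding reg_prod_def s(1) using sq pr s(7)[unfolded s(1)] q_nz by (auto simp: shift_def)
  then show ?thesis using that C_def by blast
qed

lemma eventually_not_qZ:
  assumes "x \<noteq> 0" "t0 \<noteq> 0"
  shows "eventually (\<lambda>t. x * t \<notin> qZ) (at t0)"
proof -
  define X where "X = {p \<in> range (\<lambda>k. 1 / x * q powi k). norm t0 / 2 \<le> norm p \<and> norm p \<le> 2 * norm t0}"
  have "finite X" unfolding X_def using assms by (intro finite_lattice_annulus) auto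
  then have "open ({w. norm t0 / 2 < norm w \<and> norm w < 2 * norm t0} - (X - {t0}))"
    by (intro open_Diff finite_imp_closed open_Collect_conj open_Collect_less continuous_intros) auto
  then have "eventually (\<lambda>w. w \<in> {w. norm t0 / 2 < norm w \<and> norm w < 2 * norm t0} - (X - {t0}) - {t0}) (at t0)"
    using assms by (intro eventually_at_in_open) auto
  then show ?thesis
  proof eventually_elim
    case (elim t)
    show ?case
    proof
      assume "x * t \<in> qZ"
      then obtain k where "x * t = q powi k" by (auto simp: qZ_def)
      then have "t = 1 / x * q powi k" using assms by (simp add: field_simps)
      then show False using elim by (auto simp: X_def)
    qed
  qed
qed

lemma eventually_not_qZ_power:
  assumes "x \<noteq> 0" "t0 \<noteq> 0"
  shows "eventually (\<lambda>t. x * t\<^sup>2 \<notin> qZ) (at t0)" "eventually (\<lambda>t. x / t \<notin> qZ) (at t0)"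
    "eventually (\<lambda>t. x / t\<^sup>2 \<notin> qZ) (at t0)"
proof -
  have ev: "eventually (\<lambda>t. t \<in> - {- t0} - {t0}) (at t0)"
    using assms by (intro eventually_at_in_open) (auto simp: open_Compl)
  have "filterlim (\<lambda>t. t\<^sup>2) (at (t0\<^sup>2)) (at t0)"
    unfolding filterlim_at
  proof
    show "((\<lambda>t. t\<^sup>2) \<longlongrightarrow> t0\<^sup>2) (at t0)" by (intro tendsto_intros)
    show "eventually (\<lambda>t. t\<^sup>2 \<in> UNIV \<and> t\<^sup>2 \<noteq> t0\<^sup>2) (at t0)"
      using ev by eventually_elim (auto simp: power2_eq_iff)
  qed
  then have sq: "eventually (\<lambda>t. y * t\<^sup>2 \<notin> qZ) (at t0)" if "y \<noteq> 0" for y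
    using eventually_not_qZ[of y "t0\<^sup>2"] assms that by (auto dest: eventually_compose_filterlim)
  show "eventually (\<lambda>t. x * t\<^sup>2 \<notin> qZ) (at t0)" by (rule sq[OF assms(1)])
  have "eventually (\<lambda>t. 1 / x * t \<notin> qZ) (at t0)" using assms by (intro eventually_not_qZ) auto
  then show "eventually (\<lambda>t. x / t \<notin> qZ) (at t0)" by eventually_elim (subst qZ_flip, simp)
  have "eventually (\<lambda>t. 1 / x * t\<^sup>2 \<notin> qZ) (at t0)" using assms by (intro sq) auto
  then show "eventually (\<lambda>t. x / t\<^sup>2 \<notin> qZ) (at t0)" by eventually_elim (subst qZ_flip, simp)
qed

lemma generic_curve:
  assumes b: "generic b" and t: "t \<noteq> 0"
    and "\<And>i. i \<in> J4 \<Longrightarrow> 1 / b i * t \<notin> qZ" "\<And>i. i \<in> J4 \<Longrightarrow> b 1 * b 2 / b i / t \<notin> qZ"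
    and "\<And>i. i \<in> J4 \<Longrightarrow> b i * t \<notin> qZ" "\<And>i. i \<in> J4 \<Longrightarrow> b 1 * b 2 * b i / t \<notin> qZ"
    and "1 * t\<^sup>2 \<notin> qZ" "(b 1 * b 2)\<^sup>2 / t\<^sup>2 \<notin> qZ" "1 / (b 1 * b 2) * t\<^sup>2 \<notin> qZ"
  shows "generic (curve b t)"
proof -
  note g = genericD[OF b]
  define w where "w = curve b t"
  have w: "w 1 = t" "w 2 = b 1 * b 2 / t" "\<And>i. i \<in> J4 \<Longrightarrow> w i = b i"
    by (auto simp: w_def curve_def J4_def)
  have J: "i \<in> J4 \<Longrightarrow> i \<in> I6" for i using I6_J4 by auto
  have fl: "w a / w c \<in> qZ \<longleftrightarrow> w c / w a \<in> qZ" for a c using qZ_flip[of "w a / w c"] by simp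
  have nz: "w i \<noteq> 0" if "i \<in> insert 1 (insert 2 J4)" for i
  proof -
    have "w 1 \<noteq> 0" "w 2 \<noteq> 0" using g(1)[OF I6_J4(6)] g(1)[OF I6_J4(7)] t unfolding w by auto
    moreover have "w i \<noteq> 0" if "i \<in> J4" for i using g(1)[OF J[OF that]] by (simp add: w(3)[OF that])
    ultimately show ?thesis using that by blast
  qed
  have r: "w 1 / w i \<notin> qZ" "w 2 / w i \<notin> qZ" "w 1 * w i \<notin> qZ" "w 2 * w i \<notin> qZ" if "i \<in> J4" for i
    using assms(3-6)[OF that] unfolding w(1,2) w(3)[OF that] by (simp_all add: mult.commute)
  have r2: "w 1 / w 2 \<notin> qZ" "w 1 * w 1 \<notin> qZ" "w 2 * w 2 \<notin> qZ" "w 1 * w 2 \<notin> qZ"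
    using assms(7-9) g(3)[OF I6_J4(6,7)] t unfolding w(1,2) by (simp_all add: power2_eq_square)
  have JJ: "w i * w j \<notin> qZ" "i \<noteq> j \<Longrightarrow> w i / w j \<notin> qZ" if "i \<in> J4" "j \<in> J4" for i j
    using g(2,3)[OF J[OF that(1)] J[OF that(2)]] unfolding w(3)[OF that(1)] w(3)[OF that(2)] by auto
  have "\<forall>i\<in>insert 1 (insert 2 J4). \<forall>j\<in>insert 1 (insert 2 J4). i \<noteq> j \<longrightarrow> w i / w j \<notin> qZ"
  proof -
    have N': "w i / w 1 \<notin> qZ" "w i / w 2 \<notin> qZ" "w 2 / w 1 \<notin> qZ" if "i \<in> J4" for i
      using r(1,2)[OF that] r2(1) fl[of i 1] fl[of i 2] fl[of 2 1] by blast+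
    from r(1,2) r2(1) JJ(2) N'(1,2) N'(3)[OF I6_J4(5)] show ?thesis by blast
  qed
  moreover have "\<forall>i\<in>insert 1 (insert 2 J4). \<forall>j\<in>insert 1 (insert 2 J4). w i * w j \<notin> qZ"
  proof -
    have N': "w i * w 1 \<notin> qZ" "w i * w 2 \<notin> qZ" "w 2 * w 1 \<notin> qZ" if "i \<in> J4" for i
      using r(3,4)[OF that] r2(4) by (simp_all only: mult.commute not_False_eq_True)
    from r(3,4) r2(2-4) JJ(1) N'(1,2) N'(3)[OF I6_J4(5)] show ?thesis by blast
  qed
  ultimately show ?thesis
    unfolding generic_def I6_J4(1) w_def[symmetric] using nz by blast
qed

lemma eventually_generic_curve:
  assumes b: "generic b" and t0: "t0 \<noteq> 0"
  shows "eventually (\<lambda>t. t \<noteq> 0 \<and> generic (curve b t)) (at t0)"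
proof -
  have J: "finite J4" "\<And>i. i \<in> J4 \<Longrightarrow> b i \<noteq> 0" "b 1 \<noteq> 0" "b 2 \<noteq> 0"
    using genericD(1)[OF b] I6_J4 by (auto simp: J4_def)
  have "eventually (\<lambda>t. \<forall>i\<in>J4. 1 / b i * t \<notin> qZ) (at t0)"
    "eventually (\<lambda>t. \<forall>i\<in>J4. b 1 * b 2 / b i / t \<notin> qZ) (at t0)"
    "eventually (\<lambda>t. \<forall>i\<in>J4. b i * t \<notin> qZ) (at t0)"
    "eventually (\<lambda>t. \<forall>i\<in>J4. b 1 * b 2 * b i / t \<notin> qZ) (at t0)"
    "eventually (\<lambda>t. 1 * t\<^sup>2 \<notin> qZ) (at t0)"
    "eventually (\<lambda>t. (b 1 * b 2)\<^sup>2 / t\<^sup>2 \<notin> qZ) (at t0)"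
    "eventually (\<lambda>t. 1 / (b 1 * b 2) * t\<^sup>2 \<notin> qZ) (at t0)"
    using J t0 by (intro eventually_ball_finite ballI eventually_not_qZ eventually_not_qZ_power; simp)+
  moreover have "eventually (\<lambda>t. t \<in> - {0} - {t0}) (at t0)"
    using t0 by (intro eventually_at_in_open) (auto simp: open_Compl)
  ultimately show ?thesis
    by eventually_elim (use generic_curve[OF b] in auto)
qed

lemma semigeneric_curve:
  assumes b: "generic b" and nc: "no_collision b" and t: "t \<noteq> 0"
  shows "semigeneric 1 2 (curve b t)"
proof -
  have w: "curve b t 1 * curve b t 2 = b 1 * b 2" "\<And>i. i \<in> J4 \<Longrightarrow> curve b t i = b i"
    using t by (auto simp: curve_def J4_def)
  have J: "i \<in> J4 \<Longrightarrow> i \<in> I6" for i using I6_J4 by auto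
  have nz: "curve b t i \<noteq> 0" if "i \<in> I6" for i
    using that genericD(1)[OF b] I6_J4(6,7) t by (auto simp: curve_def)
  show ?thesis
    unfolding semigeneric_def w(1)
    using nz nc genericD(2,3)[OF b J J] genericD(3)[OF b I6_J4(6,7)] I6_J4
    by (simp add: w(2) no_collision_def)
qed

lemma curve_q: "t \<noteq> 0 \<Longrightarrow> curve b (t * q powi m) = shift (curve b t) ((\<lambda>_. 0)(1 := m, 2 := - m))"
  using q_nz by (auto simp: curve_def shift_def fun_eq_iff power_int_minus field_simps)

lemma sum_two: "u \<in> I6 \<Longrightarrow> v \<in> I6 \<Longrightarrow> u \<noteq> v \<Longrightarrow> (\<Sum>i\<in>I6. ((\<lambda>_. 0)(u := x, v := - x)) i) = (0::int)"
  by (simp add: sum.remove[of I6 u] sum.remove[of "I6 - {u}" v])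

lemma prod_curve:
  assumes "(\<Prod>i\<in>I6. b i) = q" "t \<noteq> 0"
  shows "(\<Prod>i\<in>I6. curve b t i) = q"
  using assms by (simp add: prod_I6 curve_def)

lemma curve_holomorphic: "(\<lambda>t. shift (curve b t) C i) holomorphic_on - {0}"
  unfolding shift_def curve_def fun_upd_apply
  by (cases "i = 1"; cases "i = 2") (auto intro!: holomorphic_intros)

text \<open>Along the curve there are three kinds of singularities. Where two parameters meet, the poles cancel by
  \<open>hfun_pair_cancel\<close>. Where a product of two parameters hits \<open>qZ\<close>, a shift of the two moving parameters
  makes all numerators regular.\<close>

lemma hfun_curve_limit:
  assumes b: "generic b" and prod: "(\<Prod>i\<in>I6. b i) = q" and nc: "no_collision b" and t0: "t0 \<noteq> 0"
  shows "((\<lambda>t. (t - t0) * hfun (curve b t)) \<longlongrightarrow> 0) (at t0)"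
proof -
  define w where "w = curve b t0"
  have sg: "semigeneric 1 2 w" unfolding w_def by (rule semigeneric_curve[OF b nc t0])
  have nzc: "shift (curve b t) C i \<noteq> 0" if "t \<in> - {0}" "i \<in> I6" for t C i
  proof -
    have "curve b t i \<noteq> 0" using semigenericD(7)[OF semigeneric_curve[OF b nc] that(2)] that(1) by auto
    then show ?thesis using q_nz by (simp add: shift_def)
  qed
  \<comment> \<open>It suffices to prove the claim after a shift of the parameters.\<close>
  have shifted: "((\<lambda>t. (t - t0) * hfun (curve b t)) \<longlongrightarrow> 0) (at t0)"
    if C: "(\<Sum>i\<in>I6. C i) = 0" and lim: "((\<lambda>t. (t - t0) * hfun (shift (curve b t) C)) \<longlongrightarrow> 0) (at t0)" for C
  proof (rule Lim_transform_eventually[OF lim])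
    show "eventually (\<lambda>t. (t - t0) * hfun (shift (curve b t) C) = (t - t0) * hfun (curve b t)) (at t0)"
      using eventually_generic_curve[OF b t0]
    proof eventually_elim
      case (elim t)
      then show ?case using hfun_shift[of "curve b t" C] prod_curve[OF prod, of t] C by simp
    qed
  qed
  have o: "open (- {0::complex})" by (simp add: open_Compl)
  have regular: ?thesis if C: "(\<Sum>i\<in>I6. C i) = 0" and reg: "reg_prod (shift w C)" "reg_quot (shift w C)" for C
  proof (rule shifted[OF C])
    have "(\<lambda>t. hfun (shift (curve b t) C)) analytic_on {t0}"
      using t0 reg by (intro hfun_analytic_at[OF o curve_holomorphic nzc]) (auto simp: w_def)
    then have "((\<lambda>t. hfun (shift (curve b t) C)) \<longlongrightarrow> hfun (shift (curve b t0) C)) (at t0)"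
      using analytic_at_imp_isCont by (auto simp: isCont_def)
    then have "((\<lambda>t. (t - t0) * hfun (shift (curve b t) C)) \<longlongrightarrow> (t0 - t0) * hfun (shift (curve b t0) C)) (at t0)"
      by (intro tendsto_intros)
    then show "((\<lambda>t. (t - t0) * hfun (shift (curve b t) C)) \<longlongrightarrow> 0) (at t0)" by simp
  qed
  have meeting: ?thesis
    if ij: "i \<in> I6" "j \<in> I6" "i \<noteq> j" and res: "w i / w j \<in> qZ"
      and pr: "\<And>k l. k \<in> I6 \<Longrightarrow> l \<in> I6 \<Longrightarrow> w k * w l \<notin> qZ"
      and qu: "\<And>k l. k \<in> I6 \<Longrightarrow> l \<in> I6 \<Longrightarrow> k \<noteq> l \<Longrightarrow> {k,l} \<noteq> {i,j} \<Longrightarrow> w k / w l \<notin> qZ"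
      and der: "((\<lambda>t. curve b t i / curve b t j) has_field_derivative D) (at t0)" "D \<noteq> 0" for i j D
  proof -
    obtain m where m: "w i / w j = q powi m" using res by (auto simp: qZ_def)
    obtain l where l: "l \<in> I6" "l \<noteq> i" "l \<noteq> j"
    proof -
      have "\<not> I6 \<subseteq> {i, j}"
      proof
        assume "I6 \<subseteq> {i, j}"
        then have "card I6 \<le> card {i, j}" by (intro card_mono) auto
        also have "\<dots> \<le> 2" by (simp add: card_insert_if)
        finally show False by (simp add: I6_def)
      qed
      then show ?thesis using that by blast
    qed
    \<comment> \<open>A shift makes the two parameters equal; a third one compensates for it.\<close>
    define C where "C = (\<lambda>_. 0)(i := - m, l := - (- m))"
    have C: "C i = - m" "C j = 0" using l ij by (auto simp: C_def)
    have sC: "(\<Sum>i\<in>I6. C i) = 0" unfolding C_def using ij(1) l by (intro sum_two) auto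
    have wj: "w j \<noteq> 0" "w i \<noteq> 0" using semigenericD(7)[OF sg] ij by auto
    have d: "(\<lambda>t. shift (curve b t) C i / shift (curve b t) C j) = (\<lambda>t. curve b t i / curve b t j * q powi (- m))"
      by (simp add: shift_def C fun_eq_iff)
    show ?thesis
    proof (rule shifted[OF sC], rule hfun_pair_cancel[OF o curve_holomorphic nzc])
      show "t0 \<in> - {0}" using t0 by simp
      have "shift w C k * shift w C k' \<notin> qZ" if "k \<in> I6" "k' \<in> I6" for k k'
        using pr[OF that] by (simp add: shift_def qZ_prod_shift)
      then show "reg_prod (shift (curve b t0) C)"
        unfolding reg_prod_def w_def[symmetric]
        using nzc[of t0 _ C] t0 by (auto simp: qpoch_inf_nz qpoch_inf_div_nz w_def)
      show "shift (curve b t0) C i = shift (curve b t0) C j"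
        using m wj q_nz by (simp add: shift_def C power_int_minus field_simps flip: w_def)
      show "theta (shift (curve b t0) C k / shift (curve b t0) C k') \<noteq> 0"
        if "k \<in> I6" "k' \<in> I6" "k \<noteq> k'" "{k, k'} \<noteq> {i, j}" for k k'
        using qu[OF that] by (intro theta_nz) (simp add: shift_def qZ_ratio_shift flip: w_def)
      show "((\<lambda>t. shift (curve b t) C i / shift (curve b t) C j) has_field_derivative D * q powi (- m)) (at t0)"
        unfolding d by (rule DERIV_cmult_right[OF der(1)])
      show "D * q powi (- m) \<noteq> 0" using der(2) q_nz by simp
      show "eventually (\<lambda>t. theta (shift (curve b t) C i / shift (curve b t) C j) \<noteq> 0) (at t0)"
        using eventually_generic_curve[OF b t0]
      proof eventually_elim
        case (elim t)
        then have "generic (shift (curve b t) C)" by simp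
        then show ?case using ij by (intro theta_nz genericD(2))
      qed
    qed (use ij in auto)
  qed
  have bnz: "b j \<noteq> 0" if "j \<in> I6" for j using genericD(1)[OF b that] .
  have J: "i \<in> J4 \<Longrightarrow> i \<in> I6 \<and> i \<noteq> 1 \<and> i \<noteq> 2" for i using I6_J4 by (auto simp: J4_def)
  have b12: "b 1 \<noteq> 0" "b 2 \<noteq> 0" using bnz I6_J4 by auto
  consider (A) i where "i \<in> J4" "w 1 / w i \<in> qZ" | (B) i where "i \<in> J4" "w 2 / w i \<in> qZ"
    | (C) "w 1 / w 2 \<in> qZ" | (N) "\<And>i. i \<in> J4 \<Longrightarrow> w 1 / w i \<notin> qZ" "\<And>i. i \<in> J4 \<Longrightarrow> w 2 / w i \<notin> qZ" "w 1 / w 2 \<notin> qZ"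
    by blast
  then show ?thesis
  proof cases
    case A
    have "((\<lambda>t. t / b i) has_field_derivative 1 / b i) (at t0)"
      using bnz J[OF A(1)] by (auto intro!: derivative_eq_intros)
    moreover have "(\<lambda>t. t / b i) = (\<lambda>t. curve b t 1 / curve b t i)"
      using J[OF A(1)] by (auto simp: curve_def)
    ultimately show ?thesis
      using resonance_outer[OF sg A] J[OF A(1)] I6_J4 A(2) bnz
      by (intro meeting[of 1 i "1 / b i"]) auto
  next
    case B
    have sg': "semigeneric 2 1 w" by (rule semigeneric_swap[OF sg])
    have "((\<lambda>t. b 1 * b 2 / t / b i) has_field_derivative - (b 1 * b 2) / t0\<^sup>2 / b i) (at t0)"
      using bnz J[OF B(1)] t0 by (auto intro!: derivative_eq_intros simp: power2_eq_square field_simps)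
    moreover have "(\<lambda>t. b 1 * b 2 / t / b i) = (\<lambda>t. curve b t 2 / curve b t i)"
      using J[OF B(1)] by (auto simp: curve_def)
    ultimately show ?thesis
      using resonance_outer[OF sg' B] J[OF B(1)] I6_J4 B(2) bnz t0 b12
      by (intro meeting[of 2 i "- (b 1 * b 2) / t0\<^sup>2 / b i"]) auto
  next
    case C
    have "((\<lambda>t. t * t / (b 1 * b 2)) has_field_derivative 2 * t0 / (b 1 * b 2)) (at t0)"
      using b12 by (auto intro!: derivative_eq_intros simp: field_simps)
    moreover have "(\<lambda>t. t * t / (b 1 * b 2)) = (\<lambda>t. curve b t 1 / curve b t 2)"
      by (auto simp: curve_def)
    ultimately show ?thesis
      using resonance_inner[OF sg C] I6_J4 C t0 b12
      by (intro meeting[of 1 2 "2 * t0 / (b 1 * b 2)"]) auto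
  next
    case N
    note s = semigenericD[OF sg]
    have fl: "w a / w c \<in> qZ \<longleftrightarrow> w c / w a \<in> qZ" for a c using qZ_flip[of "w a / w c"] by simp
    have "w k / w l \<notin> qZ" if "k \<in> insert 1 (insert 2 J4)" "l \<in> insert 1 (insert 2 J4)" "k \<noteq> l" for k l
    proof -
      have N': "w i / w 1 \<notin> qZ" "w i / w 2 \<notin> qZ" "w 2 / w 1 \<notin> qZ" if "i \<in> J4" for i
        using N(1,2)[OF that] N(3) fl[of i 1] fl[of i 2] fl[of 2 1] by blast+
      have "3 \<in> J4" by (simp add: J4_def)
      from that N N'(1,2) N'(3)[OF this] s(8) show ?thesis by blast
    qed
    then have "shift w C k / shift w C l \<notin> qZ" if "k \<in> I6" "l \<in> I6" "k \<noteq> l" for k l C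
      using that unfolding I6_J4(1) by (simp add: shift_def qZ_ratio_shift)
    then have rq: "reg_quot (shift w C)" for C by (simp add: reg_quot_def theta_nz)
    show ?thesis
    proof (cases "(\<exists>j\<in>J4. w 2 * w j \<in> qZ) \<or> w 1 * w 1 \<in> qZ")
      case False
      then obtain K where "reg_prod (shift w ((\<lambda>_. 0)(1 := - K, 2 := K)))"
        using resonance_products[OF sg] by blast
      then show ?thesis using rq sum_two[of 1 2 "- K"] I6_J4
        by (intro regular[of "(\<lambda>_. 0)(1 := - K, 2 := K)"]) auto
    next
      case True
      have sg': "semigeneric 2 1 w" by (rule semigeneric_swap[OF sg])
      have nz: "w 1 \<noteq> 0" "w 2 \<noteq> 0" "\<And>j. j \<in> J4 \<Longrightarrow> w j \<noteq> 0" using s(7) J I6_J4 by auto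
      have 1: "w 1 * w j \<notin> qZ" if j: "j \<in> J4" for j
      proof
        assume a: "w 1 * w j \<in> qZ"
        from True show False
        proof
          assume "\<exists>i\<in>J4. w 2 * w i \<in> qZ"
          then obtain i where i: "i \<in> J4" "w 2 * w i \<in> qZ" by blast
          from qZ_mult[OF a i(2)] s(11)[OF j i(1)] show False by (simp add: mult_ac)
        next
          assume "w 1 * w 1 \<in> qZ"
          from qZ_divide[OF qZ_power2[OF a] this] s(9)[OF j j] nz show False
            by (simp add: power2_eq_square mult_ac)
        qed
      qed
      have 2: "w 2 * w 2 \<notin> qZ"
      proof
        assume a: "w 2 * w 2 \<in> qZ"
        from True show False
        proof
          assume "\<exists>i\<in>J4. w 2 * w i \<in> qZ"
          then obtain i where i: "i \<in> J4" "w 2 * w i \<in> qZ" by blast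
          from qZ_divide[OF qZ_power2[OF i(2)] a] s(9)[OF i(1,1)] nz show False
            by (simp add: power2_eq_square mult_ac)
        next
          assume "w 1 * w 1 \<in> qZ"
          from qZ_mult[OF this a] s(16) show False by (simp add: power2_eq_square mult_ac)
        qed
      qed
      obtain K where "reg_prod (shift w ((\<lambda>_. 0)(2 := - K, 1 := K)))"
        using resonance_products[OF sg' 1 2] by blast
      then show ?thesis using rq sum_two[of 2 1 "- K"] I6_J4
        by (intro regular[of "(\<lambda>_. 0)(2 := - K, 1 := K)"]) auto
    qed
  qed
qed

declare One_nat_def [simp del]

text \<open>The constant is found at \<open>t = 1 / b 3\<close>, where two parameters have product 1 and the sums reduce to
  single terms.\<close>

lemma hfun_no_collision:
  assumes b: "generic b" and prod: "(\<Prod>i\<in>I6. b i) = q" and nc: "no_collision b"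
  shows "hfun b = - 2 * (qpoch_inf q q)\<^sup>2"
proof -
  have o: "open (- {0::complex})" by (simp add: open_Compl)
  have nzc: "shift (curve b t) C i \<noteq> 0" if "t \<in> - {0}" "i \<in> I6" for t C i
  proof -
    have "curve b t i \<noteq> 0" using semigenericD(7)[OF semigeneric_curve[OF b nc] that(2)] that(1) by auto
    then show ?thesis using q_nz by (simp add: shift_def)
  qed
  have analytic: "(\<lambda>t. hfun (curve b t)) analytic_on {t}" if "t \<noteq> 0" "reg_prod (curve b t)" "reg_quot (curve b t)" for t
  proof -
    have "(\<lambda>t. hfun (shift (curve b t) (\<lambda>_. 0))) analytic_on {t}"
      using that by (intro hfun_analytic_at[OF o curve_holomorphic nzc]) auto
    then show ?thesis by simp
  qed
  define D where "D = {t. t \<noteq> 0 \<and> generic (curve b t)}"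
  have "\<exists>C. \<forall>t. t \<noteq> 0 \<longrightarrow> (\<lambda>t. hfun (curve b t)) analytic_on {t} \<longrightarrow> hfun (curve b t) = C"
  proof (rule torus_constant[where D = D])
    show "0 \<notin> D" by (simp add: D_def)
    show "q * t \<in> D \<and> t / q \<in> D \<and> hfun (curve b (q * t)) = hfun (curve b t)" if "t \<in> D" for t
    proof -
      have t: "t \<noteq> 0" "generic (curve b t)" using that by (auto simp: D_def)
      have e: "q * t = t * q powi 1" "t / q = t * q powi (-1)" by (simp_all add: power_int_minus divide_inverse mult.commute)
      have s: "(\<Sum>i\<in>I6. ((\<lambda>_. 0)(1 := 1, 2 := - 1)) i) = (0::int)"
        using I6_J4 by (intro sum_two) auto
      have "hfun (curve b (q * t)) = hfun (curve b t)"
        unfolding e(1) curve_q[OF t(1)] by (rule hfun_shift[OF t(2) prod_curve[OF prod t(1)] s])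
      moreover have "generic (curve b (q * t))" "generic (curve b (t / q))"
        unfolding e curve_q[OF t(1)] using t(2) by simp_all
      ultimately show ?thesis using t q_nz by (simp add: D_def)
    qed
    show "(\<lambda>t. hfun (curve b t)) analytic_on {t}" if "t \<in> D" for t
      using that generic_reg[of "curve b t"] by (intro analytic) (auto simp: D_def)
    show "eventually (\<lambda>t. t \<in> D) (at t)" if "t \<noteq> 0" for t
      using eventually_generic_curve[OF b that] by (simp add: D_def)
    show "((\<lambda>t. (t - t0) * hfun (curve b t)) \<longlongrightarrow> 0) (at t0)" if "t0 \<noteq> 0" for t0
      by (rule hfun_curve_limit[OF b prod nc that])
  qed
  then obtain C where C: "\<And>t. t \<noteq> 0 \<Longrightarrow> (\<lambda>t. hfun (curve b t)) analytic_on {t} \<Longrightarrow> hfun (curve b t) = C"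
    by blast
  have bnz: "b 1 \<noteq> 0" "b 2 \<noteq> 0" "b 3 \<noteq> 0" using genericD(1)[OF b] by (auto simp: I6_def)
  have self: "curve b (b 1) = b" using bnz by (auto simp: curve_def fun_eq_iff)
  have "hfun (curve b (b 1)) = C"
    using generic_reg[OF b] by (intro C[OF bnz(1)] analytic[OF bnz(1)]) (simp_all only: self)
  then have 1: "hfun b = C" by (simp add: self)
  \<comment> \<open>Here \<open>w 1 * w 3 = 1\<close>, so that the constant can be computed.\<close>
  define w where "w = curve b (1 / b 3)"
  have t0: "1 / b 3 \<noteq> 0" using bnz by simp
  have sg: "semigeneric 1 2 w" unfolding w_def by (rule semigeneric_curve[OF b nc t0])
  note s = semigenericD[OF sg]
  have w13: "w 1 * w 3 = 1" using bnz by (simp add: w_def curve_def)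
  have nz: "w i \<noteq> 0" if "i \<in> I6" for i using s(7)[OF that] .
  have w3: "w 3 \<noteq> 0" "w 1 \<noteq> 0" "w 2 \<noteq> 0" using nz by (auto simp: I6_def)
  have w1: "w 1 = 1 / w 3" using w13 w3 by (simp add: field_simps)
  have J: "3 \<in> J4" "4 \<in> J4" "5 \<in> J4" "6 \<in> J4" by (auto simp: J4_def)
  have B: "w 2 = (w 1 * w 2) * w 3" using w13 by (simp add: mult_ac)
  have p11: "w 1 * w 1 \<notin> qZ" using s(9)[OF J(1,1)] qZ_flip[of "w 3 * w 3"] by (simp add: w1)
  have p1j: "w 1 * w j \<notin> qZ" if "j \<in> J4" "j \<noteq> 3" for j
    using s(8)[OF that(1) J(1) that(2)] by (simp add: w1)
  have p2j: "w 2 * w j \<notin> qZ" if "j \<in> J4" for j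
    using s(11)[OF J(1) that] by (subst B) simp
  have p22: "w 2 * w 2 \<notin> qZ" 
    using s(14)[OF J(1)] by (subst B, subst (2) B) (simp add: power2_eq_square)
  have q1j: "w 1 / w j \<notin> qZ" if "j \<in> J4" for j
    using s(9)[OF J(1) that] qZ_flip[of "w 3 * w j"] by (simp add: w1)
  have q2j: "w 2 / w j \<notin> qZ" if "j \<in> J4" for j
    using s(12)[OF J(1) that] by (subst B) simp
  have q21: "w 2 / w 1 \<notin> qZ"
    using s(11)[OF J(1,1)] w3 by (subst B) (simp add: w1)
  have fl: "w a / w c \<in> qZ \<longleftrightarrow> w c / w a \<in> qZ" for a c using qZ_flip[of "w a / w c"] by simp
  have quot: "w k / w l \<notin> qZ" if "k \<in> insert 1 (insert 2 J4)" "l \<in> insert 1 (insert 2 J4)" "k \<noteq> l" for k l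
  proof -
    have N': "w i / w 1 \<notin> qZ" "w i / w 2 \<notin> qZ" "w 1 / w 2 \<notin> qZ" if "i \<in> J4" for i
      using q1j[OF that] q2j[OF that] q21 fl[of i 1] fl[of i 2] fl[of 1 2] by blast+
    from that q1j q2j q21 N'(1,2) N'(3)[OF J(1)] s(8) show ?thesis by blast
  qed
  then have "theta (w k / w l) \<noteq> 0" if "k \<in> insert 1 (insert 2 J4)" "l \<in> insert 1 (insert 2 J4)" "k \<noteq> l" for k l
    using that by (intro theta_nz)
  then have "reg_quot w" unfolding reg_quot_def I6_J4(1) by blast
  moreover have "reg_prod w"
  proof -
    have sq: "qpoch_inf q (w j * w j) \<noteq> 0" if "j \<in> insert 1 (insert 2 J4)" for j
      using that p11 p22 s(9) by (auto intro!: qpoch_inf_nz)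
    have pr: "qpoch_inf q (q / (w k * w l)) \<noteq> 0" if "k \<in> insert 1 (insert 2 J4)" "l \<in> insert 1 (insert 2 J4)" "k < l" for k l
    proof (cases "k = 1 \<and> l = 3")
      case True
      then show ?thesis using w13 qpoch_inf_q_nz by simp
    next
      case False
      have ge3: "3 \<le> j" if "j \<in> J4" for j using that by (auto simp: J4_def)
      have ne: "\<not> j < 1" "\<not> j < 2" if "j \<in> J4" for j using that by (auto simp: J4_def)
      have "w k * w l \<notin> qZ"
      proof -
        have n: "\<not> (2::nat) < 1" "\<not> (1::nat) < 1" "\<not> (2::nat) < 2" by auto
        from that(1) consider "k = 1" | "k = 2" | "k \<in> J4" by blast
        then show ?thesis
        proof cases
          case 1
          have "l = 2 \<or> l \<in> J4 \<and> l \<noteq> 3" using that(2,3) n(2) False unfolding 1 by auto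
          then show ?thesis unfolding 1 using p1j s(10) by blast
        next
          case 2
          have "l \<in> J4" using that(2,3) n(1,3) unfolding 2 by auto
          then show ?thesis unfolding 2 by (rule p2j)
        next
          case 3
          with that(2,3) ne[OF 3] have "l \<in> J4"
            using ge3[OF 3] by auto
          then show ?thesis using s(9)[OF 3] by blast
        qed
      qed
      then show ?thesis by (rule qpoch_inf_div_nz)
    qed
    show ?thesis unfolding reg_prod_def I6_J4(1)
      by (intro conjI ballI impI sq pr nz[unfolded I6_J4(1)])
  qed
  ultimately have "hfun w = C" unfolding w_def using t0 by (intro C analytic)
  moreover have "hfun w = - 2 * (qpoch_inf q q)\<^sup>2"
  proof (rule hfun_resonant[OF nz])
    show "(\<Prod>i\<in>I6. w i) = q" unfolding w_def by (rule prod_curve[OF prod t0])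
    show "w m / w 1 \<notin> qZ" if "m \<in> {2, 4, 5, 6}" for m
      using that by (intro quot) (auto simp: J4_def)
    show "w m * w 1 \<notin> qZ" if "m \<in> {2, 4, 5, 6}" for m
      using that p1j[of m] s(10) J by (auto simp: mult.commute)
    show "w i * w m \<notin> qZ" if "i \<in> {2, 4, 5, 6}" "m \<in> {2, 4, 5, 6}" "i < m" for i m
      using that p2j s(9) J by auto
  qed (use w13 p11 in auto)
  ultimately show ?thesis using 1 by simp
qed

lemma countable_real_resonance:
  assumes "e \<noteq> 0 \<or> x \<notin> qZ"
  shows "countable {\<tau>::real. 0 < \<tau> \<and> x * of_real \<tau> powi e \<in> qZ}"
proof (cases "e = 0")
  case True
  then show ?thesis using assms by simp
next
  case e: False
  have "countable qZ" by (simp add: qZ_def)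
  moreover have "inj_on (\<lambda>\<tau>::real. x * of_real \<tau> powi e) {\<tau>. 0 < \<tau> \<and> x * of_real \<tau> powi e \<in> qZ}"
  proof (rule inj_onI)
    fix s t :: real
    assume s: "s \<in> {\<tau>. 0 < \<tau> \<and> x * of_real \<tau> powi e \<in> qZ}" and t: "t \<in> {\<tau>. 0 < \<tau> \<and> x * of_real \<tau> powi e \<in> qZ}"
      and eq: "x * complex_of_real s powi e = x * of_real t powi e"
    have "x \<noteq> 0" using s qZ_nz by force
    then have "complex_of_real (s powi e) = of_real (t powi e)" using eq by simp
    then have "s powi e = t powi e" by (simp only: of_real_eq_iff)
    then have "s powr of_int e = t powr of_int e" using s t by (simp add: powr_real_of_int')
    then have "(s powr of_int e) powr (1 / of_int e) = (t powr of_int e) powr (1 / of_int e)" by simp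
    then show "s = t" using s t e by (simp add: powr_powr)
  qed
  moreover have "countable ((\<lambda>\<tau>::real. x * of_real \<tau> powi e) ` {\<tau>. 0 < \<tau> \<and> x * of_real \<tau> powi e \<in> qZ})"
    by (rule countable_subset[OF _ \<open>countable qZ\<close>]) auto
  ultimately show ?thesis by (simp add: countable_image_inj_eq)
qed

text \<open>The restriction on the parameters is removed by continuity, along a curve on which all the
  forbidden relations change.\<close>

lemma hfun_eq:
  assumes b: "generic b" and prod: "(\<Prod>i\<in>I6. b i) = q"
  shows "hfun b = - 2 * (qpoch_inf q q)\<^sup>2"
proof (rule ccontr)
  assume neq: "hfun b \<noteq> - 2 * (qpoch_inf q q)\<^sup>2"
  \<comment> \<open>The exponents add up to 0. In each forbidden relation they add up to a nonzero number, unless the relation is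
    excluded because \<open>b\<close> is generic.\<close>
  define e :: "nat \<Rightarrow> int" where "e = (\<lambda>i. if i = 1 then - 4 else if i = 2 then 0 else 1)"
  define c where "c t i = b i * t powi e i" for t i
  have bnz: "b i \<noteq> 0" if "i \<in> I6" for i using genericD(1)[OF b that] .
  have c1: "c 1 = b" by (simp add: c_def fun_eq_iff)
  have pc: "(\<Prod>i\<in>I6. c t i) = q" if "t \<noteq> 0" for t
    using prod that by (simp add: prod_I6 c_def e_def power_int_minus field_simps power_numeral_reduce)
  have o: "open (- {0::complex})" by (simp add: open_Compl)
  have "(\<lambda>t. hfun (c t)) analytic_on {1}"
    by (rule hfun_analytic_at[OF o])
      (use bnz generic_reg[OF b] in \<open>auto simp: c1 c_def[abs_def] intro!: holomorphic_intros\<close>)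
  then have "isCont (\<lambda>t. hfun (c t)) 1" by (rule analytic_at_imp_isCont)
  then have "((\<lambda>\<tau>::real. hfun (c (of_real \<tau>))) \<longlongrightarrow> hfun (c 1)) (at 1)"
    by (intro isCont_tendsto_compose[of _ "\<lambda>t. hfun (c t)"]) (auto intro!: tendsto_eq_intros)
  then have "eventually (\<lambda>\<tau>::real. hfun (c (of_real \<tau>)) \<noteq> - 2 * (qpoch_inf q q)\<^sup>2) (at 1)"
    using neq by (intro tendsto_imp_eventually_ne) (auto simp: c1)
  then obtain d where d: "0 < d" "\<And>\<tau>::real. \<tau> \<noteq> 1 \<Longrightarrow> \<bar>\<tau> - 1\<bar> < d \<Longrightarrow> hfun (c (of_real \<tau>)) \<noteq> - 2 * (qpoch_inf q q)\<^sup>2"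
    by (auto simp: eventually_at dist_real_def)
  define bad where "bad =
     (\<Union>i\<in>I6. \<Union>j\<in>I6. {\<tau>::real. 0 < \<tau> \<and> b i * b j * of_real \<tau> powi (e i + e j) \<in> qZ}) \<union>
     (\<Union>i\<in>I6. \<Union>j\<in>I6-{i}. {\<tau>::real. 0 < \<tau> \<and> b i / b j * of_real \<tau> powi (e i - e j) \<in> qZ}) \<union>
     (\<Union>i\<in>J4. \<Union>j\<in>J4. \<Union>\<sigma>\<in>{-1,0,1}. \<Union>\<rho>\<in>{-1,0,1}. {\<tau>::real. 0 < \<tau> \<and>
        (b 1 * b 2 * b i powi \<sigma> * b j powi \<rho>)\<^sup>2 * of_real \<tau> powi (2 * (\<sigma> + \<rho> - 4)) \<in> qZ})"
  have "countable bad"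
    unfolding bad_def using genericD(2,3)[OF b]
    by (intro countable_Un countable_UN countable_real_resonance) (auto simp: J4_def countable_finite)
  then have "uncountable ({1<..<1+d} - bad)"
    using uncountable_open_interval[of 1 "1+d"] d(1) by (simp add: uncountable_minus_countable)
  then obtain \<tau> where \<tau>: "\<tau> \<in> {1<..<1+d} - bad" by (metis countable_empty equals0I)
  define t where "t = complex_of_real \<tau>"
  have nb: "\<tau> \<notin> bad" using \<tau> by blast
  have \<tau>0: "0 < \<tau>" and t0: "t \<noteq> 0" using \<tau> by (auto simp: t_def)
  have gen: "generic (c t)"
  proof -
    have "c t i * c t j = b i * b j * t powi (e i + e j)" "c t i / c t j = b i / b j * t powi (e i - e j)" for i j
      using t0 by (simp_all add: c_def power_int_add power_int_diff)
    moreover have "b i * b j * t powi (e i + e j) \<notin> qZ" if "i \<in> I6" "j \<in> I6" for i j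
      using nb \<tau>0 that unfolding bad_def t_def by blast
    moreover have "b i / b j * t powi (e i - e j) \<notin> qZ" if "i \<in> I6" "j \<in> I6" "i \<noteq> j" for i j
      using nb \<tau>0 that unfolding bad_def t_def by blast
    moreover have "c t i \<noteq> 0" if "i \<in> I6" for i using bnz[OF that] t0 by (simp add: c_def)
    ultimately show ?thesis unfolding generic_def by simp
  qed
  have "no_collision (c t)"
  proof -
    have "(c t 1 * c t 2 * c t i powi \<sigma> * c t j powi \<rho>)\<^sup>2 =
        (b 1 * b 2 * b i powi \<sigma> * b j powi \<rho>)\<^sup>2 * t powi (2 * (\<sigma> + \<rho> - 4))" if "i \<in> J4" "j \<in> J4" for i j \<sigma> \<rho>
    proof -
      have ij: "c t i = b i * t" "c t j = b j * t" using that by (auto simp: c_def e_def J4_def)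
      have "t powi (2 * (\<sigma> + \<rho> - 4)) = (t powi (\<sigma> + \<rho> - 4))\<^sup>2"
        using power_int_mult[of t "\<sigma> + \<rho> - 4" 2] by (simp add: mult.commute)
      also have "t powi (\<sigma> + \<rho> - 4) = t powi (-4) * t powi \<sigma> * t powi \<rho>"
        using t0 by (simp add: power_int_diff power_int_add power_int_minus divide_inverse mult_ac)
      finally show ?thesis
        unfolding ij by (simp add: c_def e_def power_int_mult_distrib power_mult_distrib mult_ac)
    qed
    moreover have "(b 1 * b 2 * b i powi \<sigma> * b j powi \<rho>)\<^sup>2 * t powi (2 * (\<sigma> + \<rho> - 4)) \<notin> qZ"
      if "i \<in> J4" "j \<in> J4" "\<sigma> \<in> {-1,0,1}" "\<rho> \<in> {-1,0,1}" for i j \<sigma> \<rho>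
    proof
      assume "(b 1 * b 2 * b i powi \<sigma> * b j powi \<rho>)\<^sup>2 * t powi (2 * (\<sigma> + \<rho> - 4)) \<in> qZ"
      then have "\<tau> \<in> {\<tau>::real. 0 < \<tau> \<and>
        (b 1 * b 2 * b i powi \<sigma> * b j powi \<rho>)\<^sup>2 * of_real \<tau> powi (2 * (\<sigma> + \<rho> - 4)) \<in> qZ}"
        using \<tau>0 by (simp only: t_def mem_Collect_eq simp_thms)
      then have "\<tau> \<in> bad"
        unfolding bad_def by (intro UnI2 UN_I[OF that(1)] UN_I[OF that(2)] UN_I[OF that(3)] UN_I[OF that(4)])
      with nb show False by blast
    qed
    ultimately show ?thesis unfolding no_collision_def by metis
  qed
  from hfun_no_collision[OF gen pc[OF t0] this] d(2)[of \<tau>] \<tau> show False by (auto simp: t_def)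
qed

declare One_nat_def [simp]

text \<open>The evaluation of all the bilinear sums over the six lattices.\<close>

theorem hsum_evaluation:
  assumes b: "generic b" and prod: "(\<Prod>i\<in>I6. b i) = q"
    and B: "(\<Sum>i\<in>I6. B i) = 0" and C: "(\<Sum>i\<in>I6. C i) = 0"
  shows "hsum b B C = - 2 * (qpoch_inf q q)\<^sup>2 * mass b * (rfac b B / rfac b (\<lambda>_. 0)) * (rfac b C / rfac b (\<lambda>_. 0))"
  unfolding hsum_eq[OF b prod B C] hsum_eq_hfun[OF b] hfun_eq[OF b prod] by simp

end

section \<open>Divided differences\<close>

text \<open>The left-hand side is the coefficient of degree \<open>card S - 1\<close> of the Lagrange interpolation polynomial
  of \<open>p\<close>, which is \<open>p\<close> itself.\<close>

lemma divided_difference_eq_0: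
  fixes S :: "complex set"
  assumes S: "finite S" and p: "degree p + 1 < card S"
  shows "(\<Sum>x\<in>S. poly p x / (\<Prod>y\<in>S-{x}. x - y)) = 0"
proof -
  define l where "l x = (\<Prod>y\<in>S-{x}. [:- y, 1:])" for x :: complex
  define c where "c x = poly p x / (\<Prod>y\<in>S-{x}. x - y)" for x
  define L where "L = (\<Sum>x\<in>S. smult (c x) (l x))"
  have deg_l: "degree (l x) = card S - 1" and lead_l: "lead_coeff (l x) = 1" if "x \<in> S" for x
  proof -
    have "degree (l x) = (\<Sum>y\<in>S-{x}. degree [:- y, 1:])"
      unfolding l_def by (rule degree_prod_eq_sum_degree) auto
    then show "degree (l x) = card S - 1" using that S by simp
    show "lead_coeff (l x) = 1" unfolding l_def lead_coeff_prod by simp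
  qed
  have L_at: "poly L z = poly p z" if z: "z \<in> S" for z
  proof -
    have "poly (l x) z = 0" if "x \<in> S" "x \<noteq> z" for x
      unfolding l_def poly_prod using S z that by (intro prod_zero bexI[of _ z]) auto
    moreover have "poly (l z) z = (\<Prod>y\<in>S-{z}. z - y)" by (simp add: l_def poly_prod)
    moreover have "(\<Prod>y\<in>S-{z}. z - y) \<noteq> 0" using S by (auto simp: prod_zero_iff)
    ultimately show ?thesis
      using S z by (simp add: L_def poly_sum sum.remove[of S z] c_def)
  qed
  have "L - p = 0"
  proof (rule ccontr)
    assume nz: "L - p \<noteq> 0"
    have "degree L \<le> card S - 1"
      unfolding L_def using deg_l by (intro degree_sum_le) (auto intro: order.trans[OF degree_smult_le] S)
    then have "degree (L - p) \<le> card S - 1" using p by (intro degree_diff_le) auto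
    moreover have "card S \<le> card {z. poly (L - p) z = 0}"
      using L_at nz by (intro card_mono poly_roots_finite) auto
    moreover have "card {z. poly (L - p) z = 0} \<le> degree (L - p)"
      using nz by (rule card_poly_roots_bound)
    ultimately show False using p by linarith
  qed
  then have "coeff L (card S - 1) = coeff p (card S - 1)" by simp
  also have "\<dots> = 0" using p by (intro coeff_eq_0) linarith
  also have "coeff L (card S - 1) = (\<Sum>x\<in>S. c x)"
    unfolding L_def coeff_sum using deg_l lead_l by (intro sum.cong) (auto simp: coeff_smult)
  finally show ?thesis by (simp add: c_def)
qed

context nome
begin

section \<open>A terminating very-well-poised sum\<close>

lemma mult_power_neq_1:
  assumes "a \<notin> qZ"
  shows "a * q ^ m \<noteq> 1"
proof
  assume "a * q ^ m = 1"
  then have "a = q powi (- int m)" using q_nz by (simp add: power_int_minus field_simps)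
  then show False using assms by simp
qed

lemma qpoch_nz_Suc: "qpoch q q n \<noteq> 0"
  using q_pow_neq_1[of "Suc _"] by (auto simp: qpoch_eq_0_iff)

lemma qpoch_rev: "(\<Prod>i<n. 1 - x / q ^ i) = qpoch q (x * q / q ^ n) n"
proof -
  have "qpoch q (x * q / q ^ n) n = (\<Prod>i<n. 1 - x * q / q ^ n * q ^ (n - Suc i))"
    unfolding qpoch_def using prod.nat_diff_reindex[of "\<lambda>i. 1 - x * q / q ^ n * q ^ i" n] by simp
  also have "\<dots> = (\<Prod>i<n. 1 - x / q ^ i)"
  proof (rule prod.cong)
    fix i assume "i \<in> {..<n}"
    then have "q ^ n = q ^ (n - Suc i) * (q * q ^ i)"
      by (simp flip: power_Suc power_add)
    then show "1 - x * q / q ^ n * q ^ (n - Suc i) = 1 - x / q ^ i"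
      using q_nz by (simp add: divide_simps)
  qed simp
  finally show ?thesis ..
qed

text \<open>The power \<open>q\<close> to the \<open>n (n - 1) / 2\<close>, avoiding a division in the exponent.\<close>

definition tri :: "nat \<Rightarrow> complex" where "tri n = (\<Prod>i<n. q ^ i)"

lemma tri_nz: "tri n \<noteq> 0" using q_nz by (simp add: tri_def)

lemma tri_square: "tri n * tri n * q ^ n = q ^ (n * n)"
  by (induction n) (simp_all add: tri_def power_add mult_ac)

lemma qpoch_flip:
  assumes "x \<noteq> 0"
  shows "qpoch q (1 / x) n = (- 1 / x) ^ n * tri n * qpoch q (x * q / q ^ n) n"
proof -
  have "qpoch q (1 / x) n = (\<Prod>i<n. (- 1 / x) * q ^ i * (1 - x / q ^ i))"
    unfolding qpoch_def using assms q_nz by (intro prod.cong) (auto simp: field_simps)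
  also have "\<dots> = (- 1 / x) ^ n * tri n * (\<Prod>i<n. 1 - x / q ^ i)"
    by (simp only: prod.distrib tri_def prod_constant card_lessThan)
  finally show ?thesis by (simp only: qpoch_rev)
qed

lemma qpoch_flip':
  assumes "x \<noteq> 0"
  shows "qpoch q (q / x) n = (- q / x) ^ n * tri n * qpoch q (x / q ^ n) n"
  using qpoch_flip[of "x / q" n] assms q_nz by simp

text \<open>A function of \<open>q ^ k\<close> that is invariant under \<open>q ^ k \<mapsto> 1 / (a q ^ k)\<close>, the symmetry of
  very-well-poised terms.\<close>

definition node :: "complex \<Rightarrow> nat \<Rightarrow> complex" where
  "node a k = 1 / q ^ k + a * q ^ k"

lemma node_diff: "node a k - node a i = (1 - q ^ k / q ^ i) * (1 - a * q ^ (k + i)) / q ^ k"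
  using q_nz by (simp add: node_def divide_simps power_add) (simp add: algebra_simps)

lemma node_inj:
  assumes "a \<notin> qZ"
  shows "inj (node a)"
proof (rule injI, rule ccontr)
  fix k i assume eq: "node a k = node a i" and ne: "k \<noteq> i"
  have "a * q ^ (k + i) \<noteq> 1" using assms by (rule mult_power_neq_1)
  moreover have "q ^ k / q ^ i \<noteq> 1"
    using ne q_powi_inj[of "int k" "int i"] q_nz by simp
  ultimately show False using eq node_diff[of a k i] q_nz by simp
qed

lemma node_pair:
  assumes "b * c * q ^ j = a * q"
  shows "qpoch q (b * q ^ k) j * qpoch q (c * q ^ k) j =
    q ^ (j * k) * (\<Prod>i<j. node a k - (b * q ^ i + c * q ^ (j - Suc i)))"
proof -
  have "qpoch q (c * q ^ k) j = (\<Prod>i<j. 1 - c * q ^ k * q ^ (j - Suc i))"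
    unfolding qpoch_def using prod.nat_diff_reindex[of "\<lambda>i. 1 - c * q ^ k * q ^ i" j] by simp
  then have "qpoch q (b * q ^ k) j * qpoch q (c * q ^ k) j =
     (\<Prod>i<j. (1 - b * q ^ k * q ^ i) * (1 - c * q ^ k * q ^ (j - Suc i)))"
    by (simp add: qpoch_def prod.distrib)
  also have "\<dots> = (\<Prod>i<j. q ^ k * (node a k - (b * q ^ i + c * q ^ (j - Suc i))))"
  proof (rule prod.cong)
    fix i assume i: "i \<in> {..<j}"
    have "q * (q ^ i * q ^ (j - Suc i)) = q ^ j" using i by (simp flip: power_Suc power_add)
    then have "b * c * (q ^ i * q ^ (j - Suc i)) * q = a * q" using assms by (simp add: mult_ac)
    then have a: "a = b * c * (q ^ i * q ^ (j - Suc i))" using q_nz by simp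
    have "q ^ k * node a k = 1 + a * q ^ k * q ^ k"
      using q_nz by (simp add: node_def distrib_left mult_ac)
    then show "(1 - b * q ^ k * q ^ i) * (1 - c * q ^ k * q ^ (j - Suc i)) =
        q ^ k * (node a k - (b * q ^ i + c * q ^ (j - Suc i)))"
      unfolding right_diff_distrib a by (simp add: algebra_simps)
  qed simp
  also have "\<dots> = q ^ (j * k) * (\<Prod>i<j. node a k - (b * q ^ i + c * q ^ (j - Suc i)))"
    by (simp add: prod.distrib power_mult[symmetric] mult.commute)
  finally show ?thesis .
qed

text \<open>The part that is common to the terms of all the terminating very-well-poised series below.\<close>

definition vwp :: "complex \<Rightarrow> nat \<Rightarrow> nat \<Rightarrow> complex" where
  "vwp a n k = (1 - a * q ^ (2 * k)) / (1 - a) * (qpoch q a k * qpoch q (1 / q ^ n) k /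
      (qpoch q q k * qpoch q (a * q ^ (n + 1)) k)) * q ^ k"

text \<open>So the very-well-poised coefficients are the weights of a divided difference at the nodes.\<close>

lemma vwp_eq:
  assumes a: "a \<notin> qZ" and k: "k \<le> n"
  shows "vwp a n k = qpoch q (1 / q ^ n) n * qpoch q (a * q) n * q ^ k / q ^ (n * k) /
    (\<Prod>i\<in>{..n}-{k}. node a k - node a i)"
proof -
  have a1: "1 - a \<noteq> 0" using a qZ_1 by auto
  have split: "(\<Prod>i\<in>{..n}-{k}. g i) = (\<Prod>i<k. g i) * (\<Prod>m<n-k. g (k + Suc m))" for g :: "nat \<Rightarrow> complex"
  proof -
    have "{..n} - {k} = {..<k} \<union> (\<lambda>m. k + Suc m) ` {..<n-k}"
    proof (intro equalityI subsetI)
      fix x assume "x \<in> {..n} - {k}"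
      then have "x < k \<or> (k < x \<and> x \<le> n)" by auto
      then show "x \<in> {..<k} \<union> (\<lambda>m. k + Suc m) ` {..<n-k}"
        by (auto intro!: image_eqI[of _ _ "x - Suc k"])
    qed (use k in auto)
    moreover have "{..<k} \<inter> (\<lambda>m. k + Suc m) ` {..<n-k} = {}" by auto
    ultimately show ?thesis
      by (simp add: prod.union_disjoint prod.reindex inj_on_def)
  qed
  have P1: "(\<Prod>i<k. 1 - q ^ k / q ^ i) = qpoch q q k"
  proof -
    have "(\<Prod>i<k. 1 - q ^ k / q ^ i) = qpoch q (q ^ k * q / q ^ k) k" by (rule qpoch_rev)
    then show ?thesis using q_nz by simp
  qed
  define M where "M r = (\<Prod>m<r. 1 - 1 / q ^ Suc m)" for r
  have P2: "(\<Prod>m<n-k. 1 - q ^ k / q ^ (k + Suc m)) = M (n - k)"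
    unfolding M_def using q_nz by (intro prod.cong) (auto simp: power_add)
  have Mrev: "M r = qpoch q (1 / q ^ r) r" for r
    using qpoch_rev[of "1 / q" r] q_nz by (simp add: M_def mult.commute)
  have P3: "M n = qpoch q (1 / q ^ n) k * M (n - k)"
  proof -
    have "qpoch q (1 / q ^ n) (k + (n - k)) = qpoch q (1 / q ^ n) k * qpoch q (1 / q ^ n * q ^ k) (n - k)"
      by (rule qpoch_add)
    moreover have "1 / q ^ n * q ^ k = 1 / q ^ (n - k)" using k q_nz by (simp add: power_diff)
    ultimately show ?thesis using k by (simp add: Mrev)
  qed
  have Mnz: "M r \<noteq> 0" for r
    using q_pow_neq_1[of "Suc _"] q_nz by (auto simp: M_def divide_simps simp del: power_Suc)
  have P4: "(\<Prod>i\<in>{..n}-{k}. 1 - a * q ^ (k + i)) * (1 - a * q ^ (2 * k)) = qpoch q (a * q ^ k) (Suc n)"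
  proof -
    have "qpoch q (a * q ^ k) (Suc n) = (\<Prod>i\<le>n. 1 - a * q ^ (k + i))"
      by (simp add: qpoch_def lessThan_Suc_atMost power_add mult_ac)
    also have "\<dots> = (1 - a * q ^ (k + k)) * (\<Prod>i\<in>{..n}-{k}. 1 - a * q ^ (k + i))"
      using k by (intro prod.remove) auto
    finally show ?thesis unfolding mult_2 by (simp only: mult.commute)
  qed
  have P5: "qpoch q a k * qpoch q (a * q ^ k) (Suc n) = (1 - a) * qpoch q (a * q) n * qpoch q (a * q ^ (n + 1)) k"
    using qpoch_add[of a k "Suc n"] qpoch_add[of a "Suc n" k] qpoch_Suc'[of a n]
    by (simp add: add.commute)
  define X where "X = (\<Prod>i\<in>{..n}-{k}. 1 - a * q ^ (k + i))"
  have card: "card ({..n} - {k}) = n" using k by simp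
  have prod_eq: "(\<Prod>i\<in>{..n}-{k}. node a k - node a i) = qpoch q q k * M (n - k) * X / q ^ (n * k)"
  proof -
    have "(\<Prod>i\<in>{..n}-{k}. node a k - node a i) =
       (\<Prod>i\<in>{..n}-{k}. 1 - q ^ k / q ^ i) * X * (\<Prod>i\<in>{..n}-{k}. 1 / q ^ k)"
      unfolding node_diff X_def by (simp only: prod.distrib[symmetric]) (simp add: divide_inverse)
    also have "(\<Prod>i\<in>{..n}-{k}. 1 - q ^ k / q ^ i) = qpoch q q k * M (n - k)"
      unfolding split P1 P2 ..
    also have "(\<Prod>i\<in>{..n}-{k}. 1 / q ^ k) = 1 / q ^ (n * k)"
      by (simp only: prod_constant card) (simp add: power_mult[symmetric] power_divide mult.commute)
    finally show ?thesis by simp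
  qed
  have f_nz: "1 - a * q ^ m \<noteq> 0" for m using mult_power_neq_1[OF a, of m] by simp
  have Xnz: "X \<noteq> 0" using f_nz by (simp add: X_def)
  have Qnz: "qpoch q (a * q ^ (n + 1)) k \<noteq> 0"
    using f_nz by (simp add: qpoch_def power_add mult_ac) (metis (no_types) f_nz mult.left_commute power_Suc power_add mult.commute)
  define A where "A = qpoch q a k"
  define A1 where "A1 = qpoch q (a * q) n"
  define A2 where "A2 = qpoch q (a * q ^ (n + 1)) k"
  define N where "N = qpoch q (1 / q ^ n) k"
  define Mk where "Mk = M (n - k)"
  define Z where "Z = 1 - a * q ^ (2 * k)"
  have e: "A * (X * Z) = (1 - a) * A1 * A2"
    using P5 unfolding P4[symmetric] X_def[symmetric] A_def A1_def A2_def Z_def by simp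
  have Mn: "qpoch q (1 / q ^ n) n = N * Mk" using P3 by (simp add: Mrev[symmetric] N_def Mk_def)
  have "Z / (1 - a) * (A * N / (Qq * A2)) * u = N * Mk * A1 * u / w / (Qq * Mk * X / w)"
    if "Qq \<noteq> 0" "w \<noteq> 0" for Qq u w
  proof -
    have "Z / (1 - a) * (A * N / (Qq * A2)) * u = (A * (X * Z)) * N * u / ((1 - a) * Qq * A2 * X)"
      using Xnz by simp
    also have "\<dots> = A1 * N * u / (Qq * X)" unfolding e using a1 Qnz by (simp add: A2_def)
    also have "\<dots> = N * Mk * A1 * u / w / (Qq * Mk * X / w)" using that Mnz by (simp add: Mk_def)
    finally show ?thesis .
  qed
  from this[of "qpoch q q k" "q ^ (n * k)" "q ^ k"] show ?thesis
    unfolding vwp_def prod_eq Mn Z_def A_def A1_def A2_def N_def Mk_def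
    using qpoch_nz_Suc q_nz by simp
qed

lemma qpoch_quotient:
  assumes "qpoch q b j \<noteq> 0" "qpoch q b k \<noteq> 0"
  shows "qpoch q (b * q ^ j) k / qpoch q b k = qpoch q (b * q ^ k) j / qpoch q b j"
  using qpoch_add[of b j k] qpoch_add[of b k j] assms by (simp add: add.commute divide_simps mult_ac)

lemma qpoch_pair_quotient:
  assumes "b \<notin> qZ" "c \<notin> qZ"
  shows "qpoch q (b * q ^ j) k / qpoch q b k * (qpoch q (c * q ^ j) k / qpoch q c k) =
    qpoch q (b * q ^ k) j * qpoch q (c * q ^ k) j / (qpoch q b j * qpoch q c j)"
  unfolding qpoch_quotient[OF qpoch_nz[OF assms(1)] qpoch_nz[OF assms(1)], of j k]
    qpoch_quotient[OF qpoch_nz[OF assms(2)] qpoch_nz[OF assms(2)], of j k]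
  by simp

lemma degree_prod_linear: "degree (\<Prod>i<j. [:- u i, 1 :: complex:]) = j"
  by (subst degree_prod_eq_sum_degree) auto

text \<open>By \<open>node_pair\<close> the two pairs of quotients are polynomials of degree \<open>j\<close> and \<open>s\<close> in the nodes, up to
  powers of \<open>q ^ k\<close>. The total degree \<open>n - 1\<close> is too small for a divided difference at \<open>n + 1\<close> nodes.\<close>

lemma vwp_sum_eq_0:
  assumes a: "a \<notin> qZ" and bc: "b * c * q ^ j = a * q" and de: "d * e * q ^ s = a * q" and n: "n = j + s + 1"
    and nz: "b \<notin> qZ" "c \<notin> qZ" "d \<notin> qZ" "e \<notin> qZ"
  shows "(\<Sum>k\<le>n. vwp a n k * (qpoch q (b * q ^ j) k / qpoch q b k * (qpoch q (c * q ^ j) k / qpoch q c k) *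
     (qpoch q (d * q ^ s) k / qpoch q d k * (qpoch q (e * q ^ s) k / qpoch q e k)))) = 0"
proof -
  define u where "u i = b * q ^ i + c * q ^ (j - Suc i)" for i
  define v where "v i = d * q ^ i + e * q ^ (s - Suc i)" for i
  define p where "p = (\<Prod>i<j. [:- u i, 1:]) * (\<Prod>i<s. [:- v i, 1:])"
  define K where "K = qpoch q b j * qpoch q c j * (qpoch q d s * qpoch q e s)"
  have K: "K \<noteq> 0" using nz by (simp add: K_def qpoch_nz)
  define M where "M = qpoch q (1 / q ^ n) n * qpoch q (a * q) n"
  have deg: "degree p + 1 < card (node a ` {..n})"
  proof -
    have "degree p \<le> j + s" unfolding p_def
      using degree_mult_le[of "\<Prod>i<j. [:- u i, 1:]" "\<Prod>i<s. [:- v i, 1:]"] by (simp add: degree_prod_linear)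
    moreover have "card (node a ` {..n}) = n + 1"
      using node_inj[OF a] by (subst card_image) (auto intro: inj_on_subset)
    ultimately show ?thesis using n by simp
  qed
  have "vwp a n k * (qpoch q (b * q ^ j) k / qpoch q b k * (qpoch q (c * q ^ j) k / qpoch q c k) *
     (qpoch q (d * q ^ s) k / qpoch q d k * (qpoch q (e * q ^ s) k / qpoch q e k))) =
     M / K * (poly p (node a k) / (\<Prod>y\<in>node a ` {..n} - {node a k}. node a k - y))" if k: "k \<le> n" for k
  proof -
    have "(\<Prod>y\<in>node a ` {..n} - {node a k}. node a k - y) = (\<Prod>i\<in>{..n}-{k}. node a k - node a i)"
    proof -
      have "node a ` {..n} - {node a k} = node a ` ({..n} - {k})"
        using node_inj[OF a] by (auto simp: inj_eq)
      then show ?thesis using node_inj[OF a] by (simp add: prod.reindex inj_on_subset)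
    qed
    moreover have "poly p (node a k) = (\<Prod>i<j. node a k - u i) * (\<Prod>i<s. node a k - v i)"
      by (simp add: p_def poly_prod)
    moreover have "qpoch q (b * q ^ j) k / qpoch q b k * (qpoch q (c * q ^ j) k / qpoch q c k) =
        q ^ (j * k) * (\<Prod>i<j. node a k - u i) / (qpoch q b j * qpoch q c j)"
      unfolding qpoch_pair_quotient[OF nz(1,2)] node_pair[OF bc] u_def ..
    moreover have "qpoch q (d * q ^ s) k / qpoch q d k * (qpoch q (e * q ^ s) k / qpoch q e k) =
        q ^ (s * k) * (\<Prod>i<s. node a k - v i) / (qpoch q d s * qpoch q e s)"
      unfolding qpoch_pair_quotient[OF nz(3,4)] node_pair[OF de] v_def ..
    moreover have "q ^ (n * k) = q ^ (j * k) * q ^ (s * k) * q ^ k"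
      by (simp add: n distrib_right power_add)
    ultimately show ?thesis
      using q_nz by (simp add: vwp_eq[OF a k] M_def K_def mult_ac)
  qed
  then have "(\<Sum>k\<le>n. vwp a n k * (qpoch q (b * q ^ j) k / qpoch q b k * (qpoch q (c * q ^ j) k / qpoch q c k) *
     (qpoch q (d * q ^ s) k / qpoch q d k * (qpoch q (e * q ^ s) k / qpoch q e k)))) =
     M / K * (\<Sum>k\<le>n. poly p (node a k) / (\<Prod>y\<in>node a ` {..n} - {node a k}. node a k - y))"
    unfolding sum_distrib_left by (intro sum.cong) auto
  also have "(\<Sum>k\<le>n. poly p (node a k) / (\<Prod>y\<in>node a ` {..n} - {node a k}. node a k - y)) =
     (\<Sum>x\<in>node a ` {..n}. poly p x / (\<Prod>y\<in>node a ` {..n} - {x}. x - y))"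
    using node_inj[OF a] by (subst sum.reindex) (auto intro: inj_on_subset)
  also have "\<dots> = 0" by (rule divided_difference_eq_0[OF _ deg]) simp
  finally show ?thesis by simp
qed

text \<open>The second pair of quotients is now the reciprocal of a linear function of the nodes, with pole at
  \<open>d + e\<close>. With this pole as an additional node the divided difference vanishes, which leaves the
  contribution of that node.\<close>

lemma vwp_sum_eq:
  assumes a: "a \<notin> qZ" and bc: "b * c * q ^ n = a * q" and de: "d * e = a"
    and nz: "b \<notin> qZ" "c \<notin> qZ" "d \<notin> qZ" "e \<notin> qZ" "d \<noteq> 0"
  shows "(\<Sum>k\<le>n. vwp a n k * (qpoch q (b * q ^ n) k / qpoch q b k * (qpoch q (c * q ^ n) k / qpoch q c k) *
     (qpoch q d k / qpoch q (d * q) k * (qpoch q e k / qpoch q (e * q) k)))) =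
     qpoch q (1 / q ^ n) n * qpoch q (a * q) n * d ^ n * qpoch q (b / d) n * qpoch q (c / d) n * (-1) ^ n * tri n * q ^ n /
      (qpoch q b n * qpoch q c n * qpoch q (d * q) n * qpoch q (e * q) n)"
proof -
  define u where "u i = b * q ^ i + c * q ^ (n - Suc i)" for i
  define v where "v = d + e"
  define p where "p = (\<Prod>i<n. [:- u i, 1:])"
  define K where "K = qpoch q b n * qpoch q c n"
  have K: "K \<noteq> 0" using nz by (simp add: K_def qpoch_nz)
  define M where "M = qpoch q (1 / q ^ n) n * qpoch q (a * q) n"
  have ne1: "1 - x * q ^ m \<noteq> 0" if "x \<notin> qZ" for x m
    using mult_power_neq_1[OF that, of m] by simp
  have nv: "node a k - v = (1 - d * q ^ k) * (1 - e * q ^ k) / q ^ k" for k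
    using q_nz by (simp add: node_def v_def de[symmetric] field_simps)
  have nv0: "node a k - v \<noteq> 0" for k unfolding nv using ne1 nz(3,4) q_nz by simp
  \<comment> \<open>The pole \<open>v\<close> of the second pair is added to the nodes.\<close>
  define S where "S = insert v (node a ` {..n})"
  have vS: "v \<notin> node a ` {..n}" using nv0 by force
  have cardS: "card S = n + 2"
    using node_inj[OF a] vS by (simp add: S_def card_image inj_on_subset)
  have deg: "degree p + 1 < card S" by (simp add: cardS p_def degree_prod_linear)
  have term_eq: "vwp a n k * (qpoch q (b * q ^ n) k / qpoch q b k * (qpoch q (c * q ^ n) k / qpoch q c k) *
     (qpoch q d k / qpoch q (d * q) k * (qpoch q e k / qpoch q (e * q) k))) =
     M / K * (1 - d) * (1 - e) * (poly p (node a k) / (\<Prod>y\<in>S - {node a k}. node a k - y))" if k: "k \<le> n" for k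
  proof -
    have 1: "(\<Prod>y\<in>S - {node a k}. node a k - y) = (node a k - v) * (\<Prod>i\<in>{..n}-{k}. node a k - node a i)"
    proof -
      have "S - {node a k} = insert v (node a ` ({..n} - {k}))"
        using node_inj[OF a] nv0[of k] by (auto simp: inj_eq S_def)
      moreover have "v \<notin> node a ` ({..n} - {k})" using vS by blast
      ultimately show ?thesis using node_inj[OF a] by (simp add: prod.reindex inj_on_subset)
    qed
    have 2: "poly p (node a k) = (\<Prod>i<n. node a k - u i)"
      by (simp add: p_def poly_prod)
    have 3: "qpoch q (b * q ^ n) k / qpoch q b k * (qpoch q (c * q ^ n) k / qpoch q c k) =
        q ^ (n * k) * (\<Prod>i<n. node a k - u i) / K"
      unfolding qpoch_pair_quotient[OF nz(1,2)] node_pair[OF bc] u_def K_def ..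
    have 4: "qpoch q x k / qpoch q (x * q) k = (1 - x) / (1 - x * q ^ k)" if "x \<notin> qZ" for x
    proof -
      have "x * q \<notin> qZ" using that qZ_mult_powi_iff[of x 1] by simp
      then have "qpoch q (x * q) k \<noteq> 0" by (rule qpoch_nz)
      moreover have "qpoch q x k * (1 - x * q ^ k) = (1 - x) * qpoch q (x * q) k"
        using qpoch_Suc[of x k] qpoch_Suc'[of x k] by simp
      ultimately show ?thesis using ne1[OF that] by (simp add: frac_eq_eq)
    qed
    define P where "P = (\<Prod>i\<in>{..n}-{k}. node a k - node a i)"
    have "vwp a n k * (qpoch q (b * q ^ n) k / qpoch q b k * (qpoch q (c * q ^ n) k / qpoch q c k) *
     (qpoch q d k / qpoch q (d * q) k * (qpoch q e k / qpoch q (e * q) k))) =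
       M * q ^ k / q ^ (n * k) / P * (q ^ (n * k) * poly p (node a k) / K *
       ((1 - d) / (1 - d * q ^ k) * ((1 - e) / (1 - e * q ^ k))))"
      by (simp only: vwp_eq[OF a k] M_def[symmetric] P_def[symmetric] 2 3 4[OF nz(3)] 4[OF nz(4)])
    also have "\<dots> = M / K * (1 - d) * (1 - e) * (poly p (node a k) / ((1 - d * q ^ k) * (1 - e * q ^ k) / q ^ k * P))"
      using q_nz by (simp add: mult_ac)
    finally show ?thesis unfolding 1 nv P_def .
  qed
  have DD: "(\<Sum>x\<in>S. poly p x / (\<Prod>y\<in>S-{x}. x - y)) = 0"
    by (rule divided_difference_eq_0[OF _ deg]) (simp add: S_def)
  have "(\<Sum>k\<le>n. poly p (node a k) / (\<Prod>y\<in>S - {node a k}. node a k - y)) =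
     (\<Sum>x\<in>node a ` {..n}. poly p x / (\<Prod>y\<in>S - {x}. x - y))"
    using node_inj[OF a] by (subst sum.reindex) (auto intro: inj_on_subset)
  also have "\<dots> = - (poly p v / (\<Prod>y\<in>S-{v}. v - y))"
    using DD vS by (simp add: S_def eq_neg_iff_add_eq_0 add.commute)
  also have "S - {v} = node a ` {..n}" using vS by (auto simp: S_def)
  also have "(\<Prod>y\<in>node a ` {..n}. v - y) = (\<Prod>k\<le>n. v - node a k)"
    using node_inj[OF a] by (subst prod.reindex) (auto intro: inj_on_subset)
  also have "\<dots> = (\<Prod>k\<le>n. (- 1) * (1 / q ^ k) * (1 - d * q ^ k) * (1 - e * q ^ k))"
  proof (rule prod.cong)
    fix k
    have "v - node a k = - (node a k - v)" by simp
    then show "v - node a k = (- 1) * (1 / q ^ k) * (1 - d * q ^ k) * (1 - e * q ^ k)" unfolding nv by simp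
  qed simp
  also have "\<dots> = (- 1) ^ (n + 1) * (1 / tri (Suc n)) * qpoch q d (Suc n) * qpoch q e (Suc n)"
    by (simp only: prod.distrib prod_constant prod_dividef card_atMost tri_def qpoch_def lessThan_Suc_atMost power_one) simp
  also have "poly p v = d ^ n * qpoch q (b / d) n * qpoch q (c / d) n"
  proof -
    have "poly p v = (\<Prod>i<n. d * (1 - b / d * q ^ i) * (1 - c / d * q ^ (n - Suc i)))"
      unfolding p_def poly_prod
    proof (rule prod.cong)
      fix i assume i: "i \<in> {..<n}"
      have "q * (q ^ i * q ^ (n - Suc i)) = q ^ n" using i by (simp flip: power_Suc power_add)
      then have "b * c * (q ^ i * q ^ (n - Suc i)) * q = d * e * q" using bc de by (simp add: mult_ac)
      then have a: "b * q ^ i * (c * q ^ (n - Suc i)) = d * e" using q_nz by (simp add: mult_ac)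
      have "d * (1 - b / d * q ^ i) * (1 - c / d * q ^ (n - Suc i)) =
         d - b * q ^ i - c * q ^ (n - Suc i) + b * q ^ i * (c * q ^ (n - Suc i)) / d"
        using nz(5) by (simp add: field_simps)
      then show "poly [:- u i, 1:] v = d * (1 - b / d * q ^ i) * (1 - c / d * q ^ (n - Suc i))"
        unfolding a using nz(5) by (simp add: u_def v_def)
    qed simp
    also have "\<dots> = d ^ n * qpoch q (b / d) n * (\<Prod>i<n. 1 - c / d * q ^ (n - Suc i))"
      by (simp only: prod.distrib prod_constant card_lessThan qpoch_def)
    also have "(\<Prod>i<n. 1 - c / d * q ^ (n - Suc i)) = qpoch q (c / d) n"
      unfolding qpoch_def by (rule prod.nat_diff_reindex)
    finally show ?thesis .
  qed
  finally have val: "(\<Sum>k\<le>n. poly p (node a k) / (\<Prod>y\<in>S - {node a k}. node a k - y)) =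
     - (d ^ n * qpoch q (b / d) n * qpoch q (c / d) n /
      ((- 1) ^ (n + 1) * (1 / tri (Suc n)) * qpoch q d (Suc n) * qpoch q e (Suc n)))" .
  have "(\<Sum>k\<le>n. vwp a n k * (qpoch q (b * q ^ n) k / qpoch q b k * (qpoch q (c * q ^ n) k / qpoch q c k) *
     (qpoch q d k / qpoch q (d * q) k * (qpoch q e k / qpoch q (e * q) k)))) =
     M / K * (1 - d) * (1 - e) * (\<Sum>k\<le>n. poly p (node a k) / (\<Prod>y\<in>S - {node a k}. node a k - y))"
    unfolding sum_distrib_left by (intro sum.cong term_eq) auto
  also have "\<dots> = M * d ^ n * qpoch q (b / d) n * qpoch q (c / d) n * (-1) ^ n * tri n * q ^ n /
      (K * qpoch q (d * q) n * qpoch q (e * q) n)"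
  proof -
    have t: "tri (Suc n) = tri n * q ^ n" by (simp add: tri_def)
    have d1: "1 - d \<noteq> 0" "1 - e \<noteq> 0" using ne1[of d 0] ne1[of e 0] nz by auto
    have s: "(- 1 :: complex) ^ (n + 1) = - ((- 1) ^ n)" "(- 1 :: complex) ^ n * (- 1) ^ n = 1"
      by (simp_all flip: power_mult_distrib)
    have "M / K * (1 - d) * (1 - e) * - (B / (- sg * (1 / T) * ((1 - d) * X) * ((1 - e) * Y))) =
        M * B * sg * T / (K * X * Y)" if "sg * sg = 1" for B X Y T sg
    proof -
      have sg: "sg \<noteq> 0" using that by auto
      have "M / K * (1 - d) * (1 - e) * - (B / (- sg * (1 / T) * ((1 - d) * X) * ((1 - e) * Y))) =
         M * B * T / (sg * K * X * Y)" using d1 sg by (simp add: mult_ac)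
      also have "\<dots> = M * B * T * sg / (sg * sg * K * X * Y)" using sg by (simp add: mult_ac)
      finally show ?thesis using that by (simp add: mult_ac)
    qed
    from this[OF s(2)] show ?thesis
      unfolding val qpoch_Suc' s(1) t by (simp only: mult.assoc)
  qed
  finally show ?thesis by (simp only: M_def K_def mult.assoc)
qed

section \<open>Multiplication of the weight by rational functions\<close>

text \<open>At such points the theta functions and the factorials in all denominators below are nonzero.\<close>

definition good :: "(nat \<Rightarrow> complex) \<Rightarrow> complex \<Rightarrow> bool" where
  "good a z \<longleftrightarrow> z \<noteq> 0 \<and> (\<forall>i\<in>I6. a i * z \<notin> qZ \<and> a i / z \<notin> qZ)"

lemma good_shift [simp]: "good (shift a D) z \<longleftrightarrow> good a z"
proof -
  have "shift a D i * z = a i * z * q powi D i" "shift a D i / z = a i / z * q powi D i" for i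
    by (simp_all add: shift_def)
  then show ?thesis unfolding good_def by (simp only: qZ_mult_powi_iff)
qed

text \<open>In the usual notation, \<open>(c z, c / z)\<^sub>k\<close>.\<close>

definition sp :: "complex \<Rightarrow> nat \<Rightarrow> complex \<Rightarrow> complex" where
  "sp c k z = qpoch q (c * z) k * qpoch q (c / z) k"

lemma sp_0 [simp]: "sp c 0 z = 1" by (simp add: sp_def qpoch_def)

lemma sp_Suc: "sp c (Suc k) z = sp c k z * ((1 - c * q ^ k * z) * (1 - c * q ^ k / z))"
  by (simp add: sp_def qpoch_Suc mult_ac)

text \<open>One factor \<open>q\<close> is transferred from parameter \<open>j\<close> to parameter \<open>i\<close>.\<close>

lemma weight_exchange:
  assumes a: "generic a" and ij: "i \<in> I6" "j \<in> I6" "i \<noteq> j" and z: "good a z" and d: "d = shift a D"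
  shows "weight d z * ((1 - d i * z) * (1 - d i / z) / ((1 - q / d j * z) * (1 - q / d j / z))) =
    d i * d j / q * weight (shift a (D(j := D j - 1, i := D i + 1))) z"
proof -
  define E where "E = D(j := D j - 1)"
  define e where "e = shift a E"
  have ei: "e i = d i" and ej: "d j = q * e j"
    using ij q_nz by (auto simp: e_def d E_def shift_def power_int_diff)
  have d_eq: "d = e(j := q * e j)" unfolding e_def shift_upd[symmetric] by (simp add: d E_def)
  have z0: "z \<noteq> 0" using z by (simp add: good_def)
  have gz: "e m * z \<notin> qZ" "e m / z \<notin> qZ" if "m \<in> I6" for m
    using z that good_shift[of a E z] unfolding e_def good_def by auto
  have nz: "e i \<noteq> 0" "e j \<noteq> 0" using genericD(1)[of e] a ij by (auto simp: e_def)
  have w1: "weight d z = weight e z * ((1 - z / e j) * (1 - e j * z))"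
    unfolding d_eq using nz gz ij by (intro weight_upd) auto
  have w2: "weight (shift a (E(i := E i + 1))) z = weight e z * ((1 - z / e i) * (1 - e i * z))"
    unfolding shift_upd e_def[symmetric] using nz gz ij by (intro weight_upd) auto
  have n1: "1 - z / e j \<noteq> 0" and n2: "1 - 1 / (e j * z) \<noteq> 0"
    using gz[OF ij(2)] nz z0 qZ_1 by (auto simp: field_simps)
  have E: "E(i := E i + 1) = D(j := D j - 1, i := D i + 1)" using ij by (simp add: E_def)
  have "X * ((1 - z / u) * (1 - u * z)) * ((1 - v * z) * (1 - v / z) / ((1 - z / u) * (1 - 1 / (u * z)))) =
     v * u * (X * ((1 - z / v) * (1 - v * z)))"
    if "u \<noteq> 0" "v \<noteq> 0" "1 - z / u \<noteq> 0" "1 - 1 / (u * z) \<noteq> 0" for X u v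
  proof -
    have "1 - u * z = - u * z * (1 - 1 / (u * z))" "1 - v / z = - v / z * (1 - z / v)"
      using that z0 by (simp_all add: field_simps)
    then have "X * ((1 - z / u) * (1 - u * z)) * ((1 - v * z) * (1 - v / z) / ((1 - z / u) * (1 - 1 / (u * z)))) =
      X * ((1 - z / u) * (- u * z * (1 - 1 / (u * z)))) * ((1 - v * z) * (- v / z * (1 - z / v)) / ((1 - z / u) * (1 - 1 / (u * z))))"
      by (simp only:)
    also have "\<dots> = (1 - z / u) / (1 - z / u) * ((1 - 1 / (u * z)) / (1 - 1 / (u * z))) * (z / z) *
      (v * u * (X * ((1 - z / v) * (1 - v * z))))"
      by (simp only: divide_inverse inverse_mult_distrib mult_minus_left mult_minus_right minus_minus mult_ac)
    finally show ?thesis using that z0 by simp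
  qed
  from this[OF nz(2,1) n1 n2, of "weight e z"] show ?thesis
    unfolding w1 E[symmetric] w2 using q_nz by (simp add: ei ej mult_ac)
qed

text \<open>As the product of the parameters is \<open>q\<close>, the monomials cancel against the factor that occurs for the
  weight.\<close>

lemma rfac_exchange:
  assumes a: "generic a" and prod: "(\<Prod>m\<in>I6. d m) = q"
    and ij: "i \<in> I6" "j \<in> I6" "i \<noteq> j" and d: "d = shift a D"
  shows "d i * d j / q * rfac a (D(j := D j - 1, i := D i + 1)) =
    rfac a D * (\<Prod>m\<in>I6-{i,j}. (1 - d i * d m) / (1 - q / (d j * d m)))"
proof -
  define E where "E = D(j := D j - 1)"
  define e where "e = shift a E"
  have ei: "e i = d i" and ej: "d j = q * e j" and em: "\<And>m. m \<noteq> j \<Longrightarrow> e m = d m"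
    using ij q_nz by (auto simp: e_def d E_def shift_def power_int_diff)
  have ge: "generic e" and gd: "generic d" using a by (simp_all add: e_def d)
  have nz: "d m \<noteq> 0" if "m \<in> I6" for m using genericD(1)[OF gd that] .
  have ejnz: "e j \<noteq> 0" using genericD(1)[OF ge ij(2)] .
  have E: "E(i := E i + 1) = D(j := D j - 1, i := D i + 1)" "E(j := E j + 1) = D"
    using ij by (simp_all add: E_def)
  have r1: "rfac a D = rfac a E * kappa e j"
    using rfac_step[OF a ij(2), of E] unfolding E e_def .
  have r2: "rfac a (D(j := D j - 1, i := D i + 1)) = rfac a E * kappa e i"
    using rfac_step[OF a ij(1), of E] unfolding E e_def .
  define S where "S = I6 - {i,j}"
  have S: "finite S" "i \<notin> S" "j \<notin> S" "I6 - {i} = insert j S" "I6 - {j} = insert i S" "S \<subseteq> I6"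
    using ij by (auto simp: S_def)
  have cS: "card S = 4"
  proof -
    have "card S = card I6 - card {i,j}" unfolding S_def using ij by (intro card_Diff_subset) auto
    then show ?thesis using ij by (simp add: I6_def)
  qed
  have I6: "I6 = insert i (insert j S)" using ij by (auto simp: S_def)
  have pS: "d i * d j * (\<Prod>m\<in>S. d m) = q"
    using prod S ij unfolding I6 by (simp add: mult.assoc)
  define X where "X = (\<Prod>m\<in>S. 1 - d i * d m)"
  define Y where "Y = (\<Prod>m\<in>S. 1 - q / (d j * d m))"
  have k1: "kappa e i = (1 - d i * e j) * X / (d i)\<^sup>2"
  proof -
    have "(\<Prod>m\<in>S. 1 - d i * e m) = (\<Prod>m\<in>S. 1 - d i * d m)" using S em by (intro prod.cong) auto
    then show ?thesis unfolding kappa_def S(4) X_def ei using S by simp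
  qed
  have k2: "kappa e j = (1 - d i * e j) * (\<Prod>m\<in>S. 1 - e j * d m) / (e j)\<^sup>2"
  proof -
    have "(\<Prod>m\<in>S. 1 - e j * e m) = (\<Prod>m\<in>S. 1 - e j * d m)" using S em by (intro prod.cong) auto
    then show ?thesis unfolding kappa_def S(5) using S ei by (simp add: mult.commute[of "e j" "d i"])
  qed
  have "(\<Prod>m\<in>S. 1 - e j * d m) = (\<Prod>m\<in>S. (- e j) * d m * (1 - q / (d j * d m)))"
    using S(6) nz ejnz q_nz by (intro prod.cong) (auto simp: ej field_simps)
  also have "\<dots> = e j ^ 4 * (\<Prod>m\<in>S. d m) * Y"
    by (simp only: prod.distrib prod_constant cS Y_def) simp
  finally have k3: "(\<Prod>m\<in>S. 1 - e j * d m) = e j ^ 4 * (\<Prod>m\<in>S. d m) * Y" .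
  have Ynz: "Y \<noteq> 0"
  proof -
    have "1 - q / (d j * d m) \<noteq> 0" if "m \<in> S" for m
    proof
      assume "1 - q / (d j * d m) = 0"
      then have "d j * d m = q powi 1" using that S(6) nz ij by (auto simp: field_simps)
      then show False using genericD(3)[OF gd ij(2), of m] that S(6) qZ_powi[of 1] by auto
    qed
    then show ?thesis using S(1) unfolding Y_def by (subst prod_zero_iff) blast+
  qed
  have pS': "(\<Prod>m\<in>S. d m) = 1 / (d i * e j)"
    using pS nz[OF ij(1)] ejnz q_nz by (simp add: ej field_simps)
  have "d i * d j / q * rfac a (D(j := D j - 1, i := D i + 1)) = rfac a E * (1 - d i * e j) * X * e j / d i"
    unfolding r2 k1 using nz[OF ij(1)] q_nz by (simp add: ej power2_eq_square)
  also have "\<dots> = rfac a D * (X / Y)"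
    unfolding r1 k2 k3 pS' using Ynz ejnz nz[OF ij(1)] by (simp add: power2_eq_square power4_eq_xxxx)
  finally show ?thesis by (simp add: X_def Y_def S_def prod_dividef)
qed

text \<open>Multiplication by \<open>\<phi>\<close> turns the weight into a multiple of a shifted one; \<open>v\<close> is the resulting
  factor of the coefficient that \<open>rfac\<close> assigns to the weight.\<close>

definition reweights1 :: "(nat \<Rightarrow> complex) \<Rightarrow> (nat \<Rightarrow> int) \<Rightarrow> (complex \<Rightarrow> complex) \<Rightarrow> complex \<Rightarrow> bool" where
  "reweights1 a D \<phi> v \<longleftrightarrow> (\<exists>c. (\<forall>z. good a z \<longrightarrow> \<phi> z * weight a z = c * weight (shift a D) z) \<and>
     c * rfac a D = v * rfac a (\<lambda>_. 0))"

lemma sum_exchange: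
  assumes "i \<in> I6" "j \<in> I6" "i \<noteq> j"
  shows "(\<Sum>m\<in>I6. (D(j := D j - x, i := D i + x)) m) = (\<Sum>m\<in>I6. D m :: int)"
proof -
  have "(\<Sum>m\<in>I6. f m) = f i + (f j + (\<Sum>m\<in>I6-{i}-{j}. f m))" for f :: "nat \<Rightarrow> int"
    using assms by (simp add: sum.remove)
  moreover have "(\<Sum>m\<in>I6-{i}-{j}. (D(j := D j - x, i := D i + x)) m) = (\<Sum>m\<in>I6-{i}-{j}. D m)"
    by (rule sum.cong) auto
  ultimately show ?thesis using assms by simp
qed

lemma reweights1_step:
  assumes a: "generic a" "(\<Prod>m\<in>I6. a m) = q" and D: "(\<Sum>m\<in>I6. D m) = 0"
    and ij: "i \<in> I6" "j \<in> I6" "i \<noteq> j" and d: "d = shift a D" and r: "reweights1 a D \<phi> v"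
  shows "reweights1 a (D(j := D j - 1, i := D i + 1))
    (\<lambda>z. \<phi> z * ((1 - d i * z) * (1 - d i / z) / ((1 - q / d j * z) * (1 - q / d j / z))))
    (v * (\<Prod>m\<in>I6-{i,j}. (1 - d i * d m) / (1 - q / (d j * d m))))"
proof -
  obtain c where c: "\<And>z. good a z \<Longrightarrow> \<phi> z * weight a z = c * weight d z" "c * rfac a D = v * rfac a (\<lambda>_. 0)"
    using r by (auto simp: reweights1_def d)
  have pd: "(\<Prod>m\<in>I6. d m) = q" using a D by (simp add: d prod_shift)
  show ?thesis unfolding reweights1_def
  proof (intro exI[of _ "c * (d i * d j / q)"] conjI allI impI)
    fix z assume z: "good a z"
    have "\<phi> z * X * weight a z = c * (weight d z * X)" for X using c(1)[OF z] by (simp add: mult_ac)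
    then show "\<phi> z * ((1 - d i * z) * (1 - d i / z) / ((1 - q / d j * z) * (1 - q / d j / z))) * weight a z =
      c * (d i * d j / q) * weight (shift a (D(j := D j - 1, i := D i + 1))) z"
      by (simp only: weight_exchange[OF a(1) ij z d] mult.assoc)
  next
    have "c * (d i * d j / q) * rfac a (D(j := D j - 1, i := D i + 1)) =
      c * rfac a D * (\<Prod>m\<in>I6-{i,j}. (1 - d i * d m) / (1 - q / (d j * d m)))"
      by (simp only: rfac_exchange[OF a(1) pd ij d] mult.assoc)
    also have "\<dots> = v * (\<Prod>m\<in>I6-{i,j}. (1 - d i * d m) / (1 - q / (d j * d m))) * rfac a (\<lambda>_. 0)"
      unfolding c(2) by (simp only: mult_ac)
    finally show "c * (d i * d j / q) * rfac a (D(j := D j - 1, i := D i + 1)) =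
      v * (\<Prod>m\<in>I6-{i,j}. (1 - d i * d m) / (1 - q / (d j * d m))) * rfac a (\<lambda>_. 0)"
      .
  qed
qed

lemma reweights1_steps:
  assumes a: "generic a" "(\<Prod>m\<in>I6. a m) = q" and D: "(\<Sum>m\<in>I6. D m) = 0"
    and ij: "i \<in> I6" "j \<in> I6" "i \<noteq> j" and d: "d = shift a D" and r: "reweights1 a D \<phi> v"
  shows "reweights1 a (D(j := D j - int k, i := D i + int k))
    (\<lambda>z. \<phi> z * (sp (d i) k z / sp (q / d j) k z))
    (v * (\<Prod>m\<in>I6-{i,j}. qpoch q (d i * d m) k / qpoch q (q / (d j * d m)) k))"
proof (induction k)
  case 0
  then show ?case using r by (simp add: qpoch_def)
next
  case (Suc k)
  define Dk where "Dk = D(j := D j - int k, i := D i + int k)"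
  define dk where "dk = shift a Dk"
  have sDk: "(\<Sum>m\<in>I6. Dk m) = 0" unfolding Dk_def sum_exchange[OF ij] by (rule D)
  have dki: "dk i = d i * q ^ k" and dkj: "dk j = d j / q ^ k" and dkm: "\<And>m. m \<in> I6 - {i,j} \<Longrightarrow> dk m = d m"
    using ij q_nz by (auto simp: dk_def Dk_def d shift_def power_int_diff power_int_add)
  have next_eq: "Dk(j := Dk j - 1, i := Dk i + 1) = D(j := D j - int (Suc k), i := D i + int (Suc k))"
    using ij by (simp add: Dk_def fun_eq_iff)
  have phi_eq: "\<phi> z * (sp (d i) k z / sp (q / d j) k z) *
      ((1 - dk i * z) * (1 - dk i / z) / ((1 - q / dk j * z) * (1 - q / dk j / z))) =
      \<phi> z * (sp (d i) (Suc k) z / sp (q / d j) (Suc k) z)" for z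
    unfolding sp_Suc dki dkj by simp
  have v_eq: "v * (\<Prod>m\<in>I6-{i,j}. qpoch q (d i * d m) k / qpoch q (q / (d j * d m)) k) *
      (\<Prod>m\<in>I6-{i,j}. (1 - dk i * dk m) / (1 - q / (dk j * dk m))) =
      v * (\<Prod>m\<in>I6-{i,j}. qpoch q (d i * d m) (Suc k) / qpoch q (q / (d j * d m)) (Suc k))"
  proof -
    have "(1 - dk i * dk m) / (1 - q / (dk j * dk m)) = (1 - d i * d m * q ^ k) / (1 - q / (d j * d m) * q ^ k)"
      if "m \<in> I6 - {i,j}" for m
      by (simp add: dki dkj dkm[OF that] mult_ac)
    then show ?thesis
      unfolding mult.assoc prod.distrib[symmetric] qpoch_Suc by (auto intro!: prod.cong)
  qed
  from reweights1_step[OF a sDk ij dk_def Suc.IH[folded Dk_def]]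
  show ?case unfolding next_eq phi_eq v_eq .
qed

text \<open>Multiplication by \<open>\<phi>\<close> turns the weight into a combination of shifted weights. Since bilinear sums depend
  on the shifts through \<open>rfac\<close> only, \<open>v\<close> is the factor by which they change.\<close>

definition reweights :: "(nat \<Rightarrow> complex) \<Rightarrow> (complex \<Rightarrow> complex) \<Rightarrow> complex \<Rightarrow> bool" where
  "reweights a \<phi> v \<longleftrightarrow> (\<exists>xs. (\<forall>x\<in>set xs. (\<Sum>m\<in>I6. snd x m) = 0) \<and>
     (\<forall>z. good a z \<longrightarrow> \<phi> z * weight a z = (\<Sum>x\<leftarrow>xs. fst x * weight (shift a (snd x)) z)) \<and>
     (\<Sum>x\<leftarrow>xs. fst x * rfac a (snd x)) = v * rfac a (\<lambda>_. 0))"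

lemma reweights_single:
  assumes "reweights1 a D \<phi> v" "(\<Sum>m\<in>I6. D m) = 0"
  shows "reweights a \<phi> v"
proof -
  obtain c where "\<forall>z. good a z \<longrightarrow> \<phi> z * weight a z = c * weight (shift a D) z" "c * rfac a D = v * rfac a (\<lambda>_. 0)"
    using assms(1) by (auto simp: reweights1_def)
  then show ?thesis unfolding reweights_def using assms(2) by (intro exI[of _ "[(c, D)]"]) simp
qed

lemma reweights_zero: "reweights a (\<lambda>_. 0) 0"
  unfolding reweights_def by (intro exI[of _ "[]"]) simp

lemma reweights_add:
  assumes "reweights a \<phi> v" "reweights a \<psi> w"
  shows "reweights a (\<lambda>z. \<phi> z + \<psi> z) (v + w)"
proof -
  obtain xs where xs: "\<forall>x\<in>set xs. (\<Sum>m\<in>I6. snd x m) = 0"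
     "\<And>z. good a z \<Longrightarrow> \<phi> z * weight a z = (\<Sum>x\<leftarrow>xs. fst x * weight (shift a (snd x)) z)"
     "(\<Sum>x\<leftarrow>xs. fst x * rfac a (snd x)) = v * rfac a (\<lambda>_. 0)" using assms(1) by (auto simp: reweights_def)
  obtain ys where ys: "\<forall>x\<in>set ys. (\<Sum>m\<in>I6. snd x m) = 0"
     "\<And>z. good a z \<Longrightarrow> \<psi> z * weight a z = (\<Sum>x\<leftarrow>ys. fst x * weight (shift a (snd x)) z)"
     "(\<Sum>x\<leftarrow>ys. fst x * rfac a (snd x)) = w * rfac a (\<lambda>_. 0)" using assms(2) by (auto simp: reweights_def)
  show ?thesis unfolding reweights_def
    by (intro exI[of _ "xs @ ys"]) (use xs ys in \<open>auto simp: distrib_right\<close>)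
qed

lemma reweights_scale:
  assumes "reweights a \<phi> v"
  shows "reweights a (\<lambda>z. c * \<phi> z) (c * v)"
proof -
  obtain xs where xs: "\<forall>x\<in>set xs. (\<Sum>m\<in>I6. snd x m) = 0"
     "\<And>z. good a z \<Longrightarrow> \<phi> z * weight a z = (\<Sum>x\<leftarrow>xs. fst x * weight (shift a (snd x)) z)"
     "(\<Sum>x\<leftarrow>xs. fst x * rfac a (snd x)) = v * rfac a (\<lambda>_. 0)" using assms(1) by (auto simp: reweights_def)
  show ?thesis unfolding reweights_def
    by (intro exI[of _ "map (\<lambda>x. (c * fst x, snd x)) xs"])
       (use xs in \<open>auto simp: o_def mult.assoc sum_list_const_mult\<close>)
qed

lemma reweights_sum:
  assumes "finite A" "\<And>k. k \<in> A \<Longrightarrow> reweights a (\<phi> k) (v k)"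
  shows "reweights a (\<lambda>z. \<Sum>k\<in>A. \<phi> k z) (\<Sum>k\<in>A. v k)"
  using assms by (induction rule: finite_induct) (auto intro: reweights_zero reweights_add)

lemma reweights_cong:
  assumes "reweights a \<phi> v" "\<And>z. good a z \<Longrightarrow> \<psi> z = \<phi> z"
  shows "reweights a \<psi> v"
  using assms unfolding reweights_def by auto

text \<open>The values of the basis functions of \<open>reweights_basis\<close>, for \<open>k = 0\<close> and for general \<open>k\<close>.\<close>

definition lam0 :: "(nat \<Rightarrow> complex) \<Rightarrow> nat \<Rightarrow> complex" where
  "lam0 a j = qpoch q (a 1 * a 2) j * qpoch q (a 2 * a 3) j * qpoch q (a 2 * a 4) j * qpoch q (a 2 * a 5) j /
    (qpoch q (q / (a 1 * a 6)) j * qpoch q (q / (a 3 * a 6)) j * qpoch q (q / (a 4 * a 6)) j * qpoch q (q / (a 5 * a 6)) j)"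

definition lam :: "(nat \<Rightarrow> complex) \<Rightarrow> nat \<Rightarrow> nat \<Rightarrow> complex" where
  "lam a k j = lam0 a j *
    (qpoch q (a 1 * a 2 * q ^ j) k * qpoch q (a 1 * a 3) k * qpoch q (a 1 * a 4) k * qpoch q (a 1 * a 6 / q ^ j) k /
    (qpoch q (q / (a 2 * a 5) / q ^ j) k * qpoch q (q / (a 3 * a 5)) k * qpoch q (q / (a 4 * a 5)) k * qpoch q (q * q ^ j / (a 5 * a 6)) k))"

text \<open>First \<open>q ^ j\<close> is transferred from parameter 6 to parameter 2, then \<open>q ^ k\<close> from parameter 5 to
  parameter 1.\<close>

lemma reweights_basis:
  assumes a: "generic a" "(\<Prod>m\<in>I6. a m) = q"
  shows "reweights a (\<lambda>z. sp (a 1) k z / sp (q / a 5) k z * (sp (a 2) j z / sp (q / a 6) j z)) (lam a k j)"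
proof -
  have ix: "(1::nat) \<in> I6" "(2::nat) \<in> I6" "(5::nat) \<in> I6" "(6::nat) \<in> I6" by (simp_all add: I6_def)
  have r0: "reweights1 a (\<lambda>_. 0) (\<lambda>_. 1) 1" unfolding reweights1_def by (intro exI[of _ 1]) simp
  define D where "D = (\<lambda>_ :: nat. 0 :: int)(6 := 0 - int j, 2 := 0 + int j)"
  define d where "d = shift a D"
  have sD: "(\<Sum>m\<in>I6. D m) = 0"
    using sum_exchange[OF ix(2,4), of "\<lambda>_. 0" "int j"] unfolding D_def by simp
  have S1: "I6 - {2,6} = {1,3,4,5}" "I6 - {1,5} = {2,3,4,6}" by (auto simp: I6_eq)
  have r1: "reweights1 a D (\<lambda>z. 1 * (sp (a 2) j z / sp (q / a 6) j z)) (1 * lam0 a j)"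
  proof -
    have "(\<Prod>m\<in>I6-{2,6}. qpoch q (a 2 * a m) j / qpoch q (q / (a 6 * a m)) j) = lam0 a j"
      unfolding S1 by (simp add: lam0_def mult_ac)
    then show ?thesis
      using reweights1_steps[OF a _ ix(2,4) _ shift_0[symmetric] r0, of j] unfolding D_def by simp
  qed
  have dv: "d 1 = a 1" "d 5 = a 5" "d 3 = a 3" "d 4 = a 4" "d 2 = a 2 * q ^ j" "d 6 = a 6 / q ^ j"
    using q_nz by (simp_all add: d_def D_def shift_def power_int_minus divide_inverse)
  have "lam0 a j * (\<Prod>m\<in>I6-{1,5}. qpoch q (d 1 * d m) k / qpoch q (q / (d 5 * d m)) k) = lam a k j"
  proof -
    have "(\<Prod>m\<in>{2,3,4,6::nat}. f m) = f 2 * f 3 * f 4 * f 6" for f :: "nat \<Rightarrow> complex"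
      by (simp add: mult_ac)
    then show ?thesis unfolding S1 dv lam_def by (simp add: dv mult_ac)
  qed
  moreover have ne: "(1::nat) \<noteq> 5" by simp
  note reweights1_steps[OF a sD ix(1,3) ne d_def r1, of k]
  ultimately
  have "reweights1 a (D(5 := D 5 - int k, 1 := D 1 + int k))
     (\<lambda>z. sp (a 1) k z / sp (q / a 5) k z * (sp (a 2) j z / sp (q / a 6) j z)) (lam a k j)"
    unfolding dv by (simp only: mult.commute mult_1_left)
  then show ?thesis
    by (rule reweights_single) (simp only: sum_exchange[OF ix(1,3) ne] sD)
qed

section \<open>Change of basis\<close>

text \<open>The function \<open>sp c k\<close> as a polynomial in \<open>z + 1 / z\<close>.\<close>

definition lpoly :: "complex \<Rightarrow> nat \<Rightarrow> complex poly" where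
  "lpoly c k = (\<Prod>i<k. [:1 + (c * q ^ i)\<^sup>2, - (c * q ^ i):])"

lemma lpoly_0 [simp]: "lpoly c 0 = 1" by (simp add: lpoly_def)

lemma lpoly_Suc: "lpoly c (Suc k) = lpoly c k * [:1 + (c * q ^ k)\<^sup>2, - (c * q ^ k):]"
  by (simp add: lpoly_def)

lemma poly_lpoly: "z \<noteq> 0 \<Longrightarrow> poly (lpoly c k) (z + 1 / z) = sp c k z"
  by (induction k) (simp_all add: lpoly_Suc sp_Suc field_simps power2_eq_square)

lemma degree_lpoly: "degree (lpoly c k) \<le> k"
proof (induction k)
  case (Suc k)
  have "degree (lpoly c (Suc k)) \<le> degree (lpoly c k) + degree [:1 + (c * q ^ k)\<^sup>2, - (c * q ^ k):]"
    unfolding lpoly_Suc by (rule degree_mult_le)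
  also have "degree [:1 + (c * q ^ k)\<^sup>2, - (c * q ^ k):] \<le> 1" by simp
  finally show ?case using Suc by simp
qed simp

lemma sp_add: "sp c (k + m) z = sp c k z * sp (c * q ^ k) m z"
  using qpoch_add[of "c * z" k m] qpoch_add[of "c / z" k m] by (simp add: sp_def mult_ac)

lemma sp_nz:
  assumes "c * z \<notin> qZ" "c / z \<notin> qZ"
  shows "sp c k z \<noteq> 0"
  using assms by (simp add: sp_def qpoch_nz)

text \<open>All terms but the last have the factor that vanishes at \<open>x = e * q ^ (m - 1)\<close>. This determines the top
  coefficient; the remainder is divisible by that factor, and its degree drops.\<close>

lemma rebase:
  assumes e: "e \<noteq> 0" and ce: "c * e \<notin> qZ" "c / e \<notin> qZ" and P: "degree P \<le> m"
  shows "\<exists>\<rho>. P = (\<Sum>j\<le>m. smult (\<rho> j) (lpoly c j * lpoly (e * q ^ j) (m - j))) \<and>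
     (\<forall>x. x = e * q ^ m / q \<longrightarrow> \<rho> m * sp c m x = poly P (x + 1 / x))"
  using P
proof (induction m arbitrary: P)
  case 0
  then obtain p where "P = [:p:]" by (auto elim: degree_eq_zeroE)
  then show ?case by (intro exI[of _ "\<lambda>_. p"]) simp
next
  case (Suc m)
  define x where "x = e * q ^ m"
  define y where "y = x + 1 / x"
  have x0: "x \<noteq> 0" using e q_nz by (simp add: x_def)
  have "c * x = c * e * q powi int m" "c / x = c / e * q powi (- int m)"
    using q_nz by (simp_all add: x_def power_int_minus divide_inverse)
  then have spnz: "sp c (Suc m) x \<noteq> 0" using ce by (intro sp_nz) (simp_all only: qZ_mult_powi_iff, simp_all)
  define r where "r = poly P y / sp c (Suc m) x"
  have "poly (P - smult r (lpoly c (Suc m))) y = 0"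
    using spnz poly_lpoly[OF x0, of c "Suc m"] by (simp add: r_def y_def)
  then obtain R where R: "P - smult r (lpoly c (Suc m)) = [:- y, 1:] * R"
    unfolding poly_eq_0_iff_dvd by (auto elim: dvdE)
  have degR: "degree R \<le> m"
  proof (cases "R = 0")
    case False
    have "degree (P - smult r (lpoly c (Suc m))) \<le> Suc m"
      using Suc.prems degree_lpoly[of c "Suc m"] by (intro degree_diff_le) (auto intro: order.trans[OF degree_smult_le])
    moreover have "degree ([:- y, 1:] * R) = 1 + degree R" using False by (subst degree_mult_eq) auto
    ultimately show ?thesis using R by simp
  qed simp
  have "degree (smult (- 1 / x) R) \<le> m" using degR by simp
  from Suc.IH[OF this] obtain \<rho> where
    \<rho>: "smult (- 1 / x) R = (\<Sum>j\<le>m. smult (\<rho> j) (lpoly c j * lpoly (e * q ^ j) (m - j)))" by blast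
  have lin: "[:- y, 1:] = smult (- 1 / x) [:1 + x\<^sup>2, - x:]"
    using x0 by (simp add: y_def field_simps power2_eq_square)
  have "P = smult r (lpoly c (Suc m)) + [:1 + x\<^sup>2, - x:] * smult (- 1 / x) R"
  proof -
    have "P = smult r (lpoly c (Suc m)) + [:- y, 1:] * R" unfolding R[symmetric] by simp
    then show ?thesis unfolding lin by (simp only: mult_smult_left mult_smult_right)
  qed
  also have "[:1 + x\<^sup>2, - x:] * smult (- 1 / x) R =
     (\<Sum>j\<le>m. smult (\<rho> j) (lpoly c j * lpoly (e * q ^ j) (Suc m - j)))"
    unfolding \<rho> sum_distrib_left
  proof (rule sum.cong)
    fix j assume "j \<in> {..m}"
    then have 1: "Suc m - j = Suc (m - j)" "e * q ^ j * q ^ (m - j) = x" by (auto simp: x_def simp flip: power_add)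
    show "[:1 + x\<^sup>2, - x:] * smult (\<rho> j) (lpoly c j * lpoly (e * q ^ j) (m - j)) =
        smult (\<rho> j) (lpoly c j * lpoly (e * q ^ j) (Suc m - j))"
      unfolding 1(1) lpoly_Suc 1(2) by (simp only: mult_smult_right mult_ac)
  qed simp
  finally have "P = (\<Sum>j\<le>Suc m. smult ((\<rho>(Suc m := r)) j) (lpoly c j * lpoly (e * q ^ j) (Suc m - j)))"
    by (simp add: add.commute)
  moreover have "(\<rho>(Suc m := r)) (Suc m) * sp c (Suc m) x = poly P (x + 1 / x)"
    using spnz by (simp add: r_def y_def)
  moreover have "e * q ^ Suc m / q = x" using q_nz by (simp add: x_def)
  ultimately show ?case by (intro exI[of _ "\<rho>(Suc m := r)"]) metis
qed

section \<open>Orthogonality for a single weight\<close>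

text \<open>Rahman's functions are written with explicit parameters, because the last two are interchanged below.\<close>

definition rahman_pref :: "nat \<Rightarrow> complex \<Rightarrow> complex \<Rightarrow> complex \<Rightarrow> complex \<Rightarrow> complex \<Rightarrow> complex \<Rightarrow> complex" where
  "rahman_pref n b1 b2 b3 b4 b5 b6 =
     qpoch q (b1 * b2) n * qpoch q (b1 * b3) n * qpoch q (b1 * b4) n * qpoch q (1 / (b1 * b6)) n / qpoch q (q * b1 / b5) n"

definition rahman_coef :: "nat \<Rightarrow> complex \<Rightarrow> complex \<Rightarrow> complex \<Rightarrow> complex \<Rightarrow> complex \<Rightarrow> complex \<Rightarrow> nat \<Rightarrow> complex" where
  "rahman_coef n b1 b2 b3 b4 b5 b6 k = vwp (b1 / b5) n k *
     (qpoch q (q / (b2 * b5)) k * qpoch q (q / (b3 * b5)) k * qpoch q (q / (b4 * b5)) k * qpoch q (q ^ n / (b5 * b6)) k /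
      (qpoch q (b1 * b2) k * qpoch q (b1 * b3) k * qpoch q (b1 * b4) k * qpoch q (b1 * b6 * q / q ^ n) k))"

lemma rahman_aux_eq:
  assumes nz: "b1 \<noteq> 0" "b2 \<noteq> 0" "b3 \<noteq> 0" "b4 \<noteq> 0" "b5 \<noteq> 0" "b6 \<noteq> 0" "z \<noteq> 0"
  shows "rahman_aux q n b1 b2 b3 b4 b5 b6 z =
    rahman_pref n b1 b2 b3 b4 b5 b6 * (\<Sum>k\<le>n. rahman_coef n b1 b2 b3 b4 b5 b6 k * (sp b1 k z / sp (q / b5) k z))"
proof -
  define F where "F k = (1 - b1 / b5 * q ^ (2 * k)) / (1 - b1 / b5)
        * ((qpoch q (b1 / b5) k * (\<Prod>\<beta>\<leftarrow>[b1 * z, b1 / z, q / (b2 * b5), q / (b3 * b5), q / (b4 * b5),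
          q ^ n / (b5 * b6), q powi (- int n)]. qpoch q \<beta> k))
           / (qpoch q q k * (\<Prod>\<beta>\<leftarrow>[b1 * z, b1 / z, q / (b2 * b5), q / (b3 * b5), q / (b4 * b5),
          q ^ n / (b5 * b6), q powi (- int n)]. qpoch q (b1 / b5 * q / \<beta>) k)))
        * q ^ k" for k
  have p: "q powi (- int n) = 1 / q ^ n" by (simp add: power_int_minus divide_inverse)
  have F0: "F k = 0" if "k \<notin> {..n}" for k
  proof -
    have "qpoch q (1 / q ^ n) k = 0" using that q_nz by (auto simp: qpoch_eq_0_iff intro!: exI[of _ n])
    then show ?thesis by (simp add: F_def p)
  qed
  have eqs: "b1 / b5 * q / (b1 * z) = q / b5 / z" "b1 / b5 * q / (b1 / z) = q / b5 * z"
    "b1 / b5 * q / (q / (b2 * b5)) = b1 * b2" "b1 / b5 * q / (q / (b3 * b5)) = b1 * b3"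
    "b1 / b5 * q / (q / (b4 * b5)) = b1 * b4" "b1 / b5 * q / (q ^ n / (b5 * b6)) = b1 * b6 * q / q ^ n"
    "b1 / b5 * q / (1 / q ^ n) = b1 / b5 * q ^ (n + 1)"
    using nz q_nz by (simp_all add: mult_ac)
  have F: "F k = rahman_coef n b1 b2 b3 b4 b5 b6 k * (sp b1 k z / sp (q / b5) k z)" for k
    unfolding F_def p list.map prod_list.Cons prod_list.Nil eqs rahman_coef_def vwp_def sp_def
    by (simp add: mult_ac)
  have "very_well_poised q (b1 / b5) [b1 * z, b1 / z, q / (b2 * b5), q / (b3 * b5), q / (b4 * b5),
          q ^ n / (b5 * b6), q powi (- int n)] q = (\<Sum>k. F k)"
    unfolding very_well_poised_def F_def ..
  also have "\<dots> = (\<Sum>k\<le>n. F k)" using F0 by (intro suminf_finite) auto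
  finally show ?thesis unfolding rahman_aux_def rahman_pref_def F by simp
qed

lemma qZ_cases [simp]: "q / x \<in> qZ \<longleftrightarrow> x \<in> qZ" "x * q ^ k \<in> qZ \<longleftrightarrow> x \<in> qZ" "x / q ^ k \<in> qZ \<longleftrightarrow> x \<in> qZ"
    "q ^ k / x \<in> qZ \<longleftrightarrow> x \<in> qZ" "x * q \<in> qZ \<longleftrightarrow> x \<in> qZ" "1 / x \<in> qZ \<longleftrightarrow> x \<in> qZ"
proof -
  have inv: "inverse x \<in> qZ \<longleftrightarrow> x \<in> qZ" for x using qZ_inverse[of x] qZ_inverse[of "inverse x"] by auto
  have 1: "x * q ^ k \<in> qZ \<longleftrightarrow> x \<in> qZ" for x k using qZ_mult_powi_iff[of x "int k"] by simp
  have 2: "x / q ^ k \<in> qZ \<longleftrightarrow> x \<in> qZ" for x k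
    using qZ_mult_powi_iff[of x "- int k"] by (simp add: power_int_minus divide_inverse)
  have 3: "q ^ k / x \<in> qZ \<longleftrightarrow> x \<in> qZ" for x k using 1[of "inverse x" k] inv[of x] by (simp add: field_simps)
  show "x * q ^ k \<in> qZ \<longleftrightarrow> x \<in> qZ" "x / q ^ k \<in> qZ \<longleftrightarrow> x \<in> qZ" "q ^ k / x \<in> qZ \<longleftrightarrow> x \<in> qZ" by (fact 1 2 3)+
  show "q / x \<in> qZ \<longleftrightarrow> x \<in> qZ" "x * q \<in> qZ \<longleftrightarrow> x \<in> qZ" "1 / x \<in> qZ \<longleftrightarrow> x \<in> qZ"
    using 3[of 1 x] 1[of x 1] 3[of 0 x] by simp_all
qed

abbreviation rpref :: "nat \<Rightarrow> (nat \<Rightarrow> complex) \<Rightarrow> complex" where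
  "rpref n a \<equiv> rahman_pref n (a 1) (a 2) (a 3) (a 4) (a 5) (a 6)"

abbreviation rcoef :: "nat \<Rightarrow> (nat \<Rightarrow> complex) \<Rightarrow> nat \<Rightarrow> complex" where
  "rcoef n a k \<equiv> rahman_coef n (a 1) (a 2) (a 3) (a 4) (a 5) (a 6) k"

text \<open>The value of the very-well-poised sum of \<open>vwp_sum_eq\<close> for the parameters of \<open>rahman_lam_sum\<close>.\<close>

definition top_value :: "nat \<Rightarrow> (nat \<Rightarrow> complex) \<Rightarrow> complex" where
  "top_value n a = qpoch q (1 / q ^ n) n * qpoch q (a 1 / a 5 * q) n * (a 1 * a 6 / q ^ n) ^ n *
      qpoch q (a 3 * a 4) n * qpoch q (a 2 * q ^ n / a 6) n * (-1) ^ n * tri n * q ^ n /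
      (qpoch q (q / (a 2 * a 5) / q ^ n) n * qpoch q (a 1 * a 2) n * qpoch q (a 1 * a 6 / q ^ n * q) n *
       qpoch q (q ^ n / (a 5 * a 6) * q) n)"

text \<open>The factor \<open>lam\<close> shifts the parameters of the very-well-poised series in such a way that the quotients
  pair up, as polynomials in the nodes of total degree \<open>n - 1\<close> if \<open>j < n\<close>.\<close>

lemma rahman_lam_sum:
  assumes a: "generic a" "(\<Prod>m\<in>I6. a m) = q" and j: "j \<le> n"
  shows "(\<Sum>k\<le>n. rcoef n a k * lam a k j) = (if j < n then 0 else lam0 a j * top_value n a)"
proof -
  define A where "A = a 1 / a 5"
  have ix: "(1::nat) \<in> I6" "(2::nat) \<in> I6" "(3::nat) \<in> I6" "(4::nat) \<in> I6" "(5::nat) \<in> I6" "(6::nat) \<in> I6"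
    by (simp_all add: I6_def)
  have nz: "a 1 \<noteq> 0" "a 2 \<noteq> 0" "a 3 \<noteq> 0" "a 4 \<noteq> 0" "a 5 \<noteq> 0" "a 6 \<noteq> 0"
    using genericD(1)[OF a(1)] ix by auto
  have pr: "a 1 * a 2 * a 3 * a 4 * a 5 * a 6 = q" using a(2) by (simp only: prod_I6)
  have m: "a 1 * a 2 \<notin> qZ" "a 1 * a 3 \<notin> qZ" "a 1 * a 4 \<notin> qZ" "a 1 * a 6 \<notin> qZ" "a 2 * a 5 \<notin> qZ"
     "a 3 * a 5 \<notin> qZ" "a 4 * a 5 \<notin> qZ" "a 5 * a 6 \<notin> qZ" using genericD(3)[OF a(1)] ix by blast+
  have An: "A \<notin> qZ" unfolding A_def using genericD(2)[OF a(1) ix(1,5)] by simp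
  define b where "b = q / (a 2 * a 5) / q ^ j"
  define c where "c = a 1 * a 2"
  define U where "U k = qpoch q (b * q ^ j) k / qpoch q b k * (qpoch q (c * q ^ j) k / qpoch q c k)" for k
  have bq: "b * q ^ j = q / (a 2 * a 5)" using q_nz by (simp add: b_def)
  have bc: "b * c * q ^ j = A * q" using nz q_nz by (simp add: b_def c_def A_def)
  have bn: "b \<notin> qZ" and cn: "c \<notin> qZ" using m by (simp_all add: b_def c_def)
  have term_eq: "rcoef n a k * lam a k j = lam0 a j * (vwp A n k * (U k *
      (qpoch q (a 1 * a 6 / q ^ j) k / qpoch q (a 1 * a 6 * q / q ^ n) k *
       (qpoch q (q ^ n / (a 5 * a 6)) k / qpoch q (q * q ^ j / (a 5 * a 6)) k))))" for k
  proof -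
    have nn: "qpoch q (q / (a 3 * a 5)) k \<noteq> 0" "qpoch q (q / (a 4 * a 5)) k \<noteq> 0"
      "qpoch q (a 1 * a 3) k \<noteq> 0" "qpoch q (a 1 * a 4) k \<noteq> 0" using m by (simp_all add: qpoch_nz)
    have "V * (p1 * x * y * p4 / (r1 * w * t * r4)) * (L * (s1 * w * t * s4 / (u1 * x * y * u4))) =
       L * (V * (p1 / u1 * (s1 / r1) * (s4 / r4 * (p4 / u4))))"
      if "x \<noteq> 0" "y \<noteq> 0" "w \<noteq> 0" "t \<noteq> 0" for V p1 x y p4 r1 w t r4 L s1 s4 u1 u4 :: complex
      using that by (simp add: mult_ac)
    from this[OF nn] show ?thesis
      unfolding rahman_coef_def lam_def U_def bq A_def[symmetric] unfolding b_def c_def .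
  qed
  have sum_eq: "(\<Sum>k\<le>n. rcoef n a k * lam a k j) = lam0 a j * (\<Sum>k\<le>n. vwp A n k * (U k *
      (qpoch q (a 1 * a 6 / q ^ j) k / qpoch q (a 1 * a 6 * q / q ^ n) k *
       (qpoch q (q ^ n / (a 5 * a 6)) k / qpoch q (q * q ^ j / (a 5 * a 6)) k))))"
    unfolding term_eq sum_distrib_left ..
  show ?thesis
  proof (cases "j < n")
    case True
    then obtain s where s: "n = j + s + 1" by (metis less_imp_Suc_add add_Suc_right Suc_eq_plus1)
    define d where "d = a 1 * a 6 * q / q ^ n"
    define e where "e = q * q ^ j / (a 5 * a 6)"
    have qn: "q ^ n = q ^ j * q ^ s * q" by (simp add: s power_add)
    have dq: "d * q ^ s = a 1 * a 6 / q ^ j" and eq: "e * q ^ s = q ^ n / (a 5 * a 6)"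
      using q_nz by (simp_all add: d_def e_def qn)
    have de: "d * e * q ^ s = A * q" using q_nz nz by (simp add: d_def e_def qn A_def)
    have "d \<notin> qZ" "e \<notin> qZ"
    proof -
      show "d \<notin> qZ" using m by (simp add: d_def)
      have "e = q ^ Suc j / (a 5 * a 6)" by (simp add: e_def)
      then show "e \<notin> qZ" using m by (simp only: qZ_cases not_False_eq_True)
    qed
    from vwp_sum_eq_0[OF An bc de s bn cn this]
    show ?thesis using True unfolding sum_eq U_def dq eq unfolding d_def e_def by simp
  next
    case False
    then have jn: "j = n" using j by simp
    define d where "d = a 1 * a 6 / q ^ n"
    define e where "e = q ^ n / (a 5 * a 6)"
    have de: "d * e = A" using q_nz nz by (simp add: d_def e_def A_def)
    have dn: "d \<notin> qZ" "e \<notin> qZ" using m by (simp_all add: d_def e_def)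
    have d0: "d \<noteq> 0" using nz q_nz by (simp add: d_def)
    have x: "a 1 * a 6 * q / q ^ n = d * q" "q * q ^ n / (a 5 * a 6) = e * q" by (simp_all add: d_def e_def)
    have bd: "b / d = a 3 * a 4"
    proof -
      have "b / d = a 1 * a 2 * a 3 * a 4 * a 5 * a 6 / (a 2 * a 5 * a 1 * a 6)"
        unfolding pr b_def d_def jn using q_nz by (simp add: mult_ac)
      then show ?thesis using nz by simp
    qed
    have cd: "c / d = a 2 * q ^ n / a 6" using nz by (simp add: c_def d_def)
    from vwp_sum_eq[OF An bc[unfolded jn] de bn cn dn d0]
    have "(\<Sum>k\<le>n. vwp A n k * (U k *
      (qpoch q (a 1 * a 6 / q ^ j) k / qpoch q (a 1 * a 6 * q / q ^ n) k *
       (qpoch q (q ^ n / (a 5 * a 6)) k / qpoch q (q * q ^ j / (a 5 * a 6)) k)))) = top_value n a"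
      unfolding U_def jn x d_def[symmetric] e_def[symmetric] bd cd top_value_def A_def[symmetric] c_def[symmetric]
      unfolding b_def jn by simp
    then show ?thesis using jn unfolding sum_eq by simp
  qed
qed

text \<open>The expansion of the second function along the shifts of \<open>a 2\<close> and \<open>a 6\<close>.\<close>

text \<open>The natural expansion of this function uses parameters 1 and 6. It is rewritten in terms of parameters 2
  and 6, which can be combined with the expansion of the other function in terms of 1 and 5. Only the top
  coefficient enters the norm; it is read off at a zero of the other terms.\<close>

lemma rahman_rebased:
  assumes a: "generic a"
  obtains \<rho> where
    "\<And>z. good a z \<Longrightarrow> rahman_aux q m (a 1) (a 2) (a 3) (a 4) (a 6) (a 5) z =
       (\<Sum>j\<le>m. \<rho> j * (sp (a 2) j z / sp (q / a 6) j z))"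
    "\<rho> m * sp (a 2) m (q ^ m / a 6) = rahman_pref m (a 1) (a 2) (a 3) (a 4) (a 6) (a 5) *
       (rahman_coef m (a 1) (a 2) (a 3) (a 4) (a 6) (a 5) m * sp (a 1) m (q ^ m / a 6))"
proof -
  have ix: "(1::nat) \<in> I6" "(2::nat) \<in> I6" "(3::nat) \<in> I6" "(4::nat) \<in> I6" "(5::nat) \<in> I6" "(6::nat) \<in> I6"
    by (simp_all add: I6_def)
  have nz: "a 1 \<noteq> 0" "a 2 \<noteq> 0" "a 3 \<noteq> 0" "a 4 \<noteq> 0" "a 5 \<noteq> 0" "a 6 \<noteq> 0"
    using genericD(1)[OF a] ix by auto
  define e where "e = q / a 6"
  define K where "K = rahman_pref m (a 1) (a 2) (a 3) (a 4) (a 6) (a 5)"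
  define cf where "cf = rahman_coef m (a 1) (a 2) (a 3) (a 4) (a 6) (a 5)"
  define P where "P = (\<Sum>k\<le>m. smult (K * cf k) (lpoly (a 1) k * lpoly (e * q ^ k) (m - k)))"
  have e0: "e \<noteq> 0" using nz q_nz by (simp add: e_def)
  have ce: "a 2 * e \<notin> qZ" "a 2 / e \<notin> qZ"
  proof -
    have "a 2 * e = a 2 / a 6 * q" "a 2 / e = a 2 * a 6 / q ^ 1" by (simp_all add: e_def)
    moreover have "a 2 / a 6 \<notin> qZ" "a 2 * a 6 \<notin> qZ"
      using genericD(2)[OF a ix(2,6)] genericD(3)[OF a ix(2,6)] by simp_all
    ultimately show "a 2 * e \<notin> qZ" "a 2 / e \<notin> qZ" by (simp_all only: qZ_cases not_False_eq_True)
  qed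
  have "degree P \<le> m"
    unfolding P_def
  proof (rule degree_sum_le)
    fix k assume "k \<in> {..m}"
    then show "degree (smult (K * cf k) (lpoly (a 1) k * lpoly (e * q ^ k) (m - k))) \<le> m"
      using degree_mult_le[of "lpoly (a 1) k" "lpoly (e * q ^ k) (m - k)"] degree_lpoly[of "a 1" k]
        degree_lpoly[of "e * q ^ k" "m - k"] degree_smult_le[of "K * cf k" "lpoly (a 1) k * lpoly (e * q ^ k) (m - k)"]
      by simp
  qed simp
  from rebase[OF e0 ce this] obtain \<rho> where
    \<rho>: "P = (\<Sum>j\<le>m. smult (\<rho> j) (lpoly (a 2) j * lpoly (e * q ^ j) (m - j)))" and
    top: "\<And>x. x = e * q ^ m / q \<Longrightarrow> \<rho> m * sp (a 2) m x = poly P (x + 1 / x)" by blast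
  have div: "sp (e * q ^ k) (m - k) z = sp e m z / sp e k z" if "k \<le> m" "sp e k z \<noteq> 0" for k z
    using sp_add[of e k "m - k" z] that by simp
  have PP: "poly P (z + 1 / z) = (\<Sum>k\<le>m. K * cf k * (sp (a 1) k z * sp (e * q ^ k) (m - k) z))" if "z \<noteq> 0" for z
    unfolding P_def by (simp add: poly_sum poly_lpoly that)
  show ?thesis
  proof (rule that)
    fix z assume z: "good a z"
    then have z0: "z \<noteq> 0" by (simp add: good_def)
    have spe: "sp e k z \<noteq> 0" for k
    proof (rule sp_nz)
      have "e * z = q / (a 6 / z)" "e / z = q / (a 6 * z)" by (simp_all add: e_def)
      moreover have "a 6 / z \<notin> qZ" "a 6 * z \<notin> qZ" using z ix by (simp_all add: good_def)
      ultimately show "e * z \<notin> qZ" "e / z \<notin> qZ" by (simp_all only: qZ_cases not_False_eq_True)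
    qed
    have "sp e m z * rahman_aux q m (a 1) (a 2) (a 3) (a 4) (a 6) (a 5) z = poly P (z + 1 / z)"
      unfolding PP[OF z0] rahman_aux_eq[OF nz(1-4) nz(6) nz(5) z0] K_def[symmetric] cf_def[symmetric]
        e_def[symmetric] sum_distrib_left
      by (intro sum.cong) (simp_all add: div spe)
    also have "\<dots> = sp e m z * (\<Sum>j\<le>m. \<rho> j * (sp (a 2) j z / sp e j z))"
      unfolding \<rho> sum_distrib_left by (simp add: poly_sum poly_lpoly z0) (intro sum.cong, simp_all add: div spe)
    finally show "rahman_aux q m (a 1) (a 2) (a 3) (a 4) (a 6) (a 5) z =
       (\<Sum>j\<le>m. \<rho> j * (sp (a 2) j z / sp (q / a 6) j z))"
      using spe unfolding e_def by simp
  next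
    define x where "x = q ^ m / a 6"
    have x: "x = e * q ^ m / q" "x \<noteq> 0" using q_nz nz by (simp_all add: x_def e_def)
    have "sp (e * q ^ k) (m - k) x = 0" if "k < m" for k
    proof -
      have "e * q ^ k / x * q ^ (m - k - 1) = 1"
      proof -
        have "q ^ m = q * q ^ k * q ^ (m - k - 1)" using that by (simp flip: power_Suc power_add)
        then show ?thesis using q_nz nz by (simp add: x_def e_def)
      qed
      then have "qpoch q (e * q ^ k / x) (m - k) = 0"
        using that by (auto simp: qpoch_eq_0_iff intro!: exI[of _ "m - k - 1"])
      then show ?thesis by (simp add: sp_def)
    qed
    then have "poly P (x + 1 / x) = (\<Sum>k\<le>m. if k = m then K * cf m * sp (a 1) m x else 0)"
      unfolding PP[OF x(2)] by (intro sum.cong) auto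
    then show "\<rho> m * sp (a 2) m (q ^ m / a 6) = rahman_pref m (a 1) (a 2) (a 3) (a 4) (a 6) (a 5) *
       (rahman_coef m (a 1) (a 2) (a 3) (a 4) (a 6) (a 5) m * sp (a 1) m (q ^ m / a 6))"
      unfolding x_def[symmetric] top[OF x(1)] by (simp add: K_def cf_def)
  qed
qed

lemma weight_permutes:
  assumes "\<pi> permutes I6"
  shows "weight (\<lambda>i. a (\<pi> i)) z = weight a z"
  unfolding weight_def weight_core_def
  using prod.permute[OF assms, of "\<lambda>i. qpoch_inf q (q * z / a i) / qpoch_inf q (a i * z)"] by (simp add: o_def)

lemma rfac_permutes:
  assumes "\<pi> permutes I6"
  shows "rfac (\<lambda>i. a (\<pi> i)) (\<lambda>i. D (\<pi> i)) = rfac a D"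
proof -
  have "pair_prod (\<lambda>i j. qpoch_inf q (shift (\<lambda>i. a (\<pi> i)) (\<lambda>i. D (\<pi> i)) i * shift (\<lambda>i. a (\<pi> i)) (\<lambda>i. D (\<pi> i)) j)) =
     pair_prod (\<lambda>i j. qpoch_inf q (shift a D i * shift a D j))"
    using pair_prod_permutes[OF assms, of "\<lambda>i j. qpoch_inf q (shift a D i * shift a D j)"]
    by (simp add: shift_def mult.commute)
  moreover have "(\<Prod>j\<in>I6. a (\<pi> j) powi (2 * D (\<pi> j)) * q powi (D (\<pi> j) * (D (\<pi> j) - 1))) =
     (\<Prod>j\<in>I6. a j powi (2 * D j) * q powi (D j * (D j - 1)))"
    using prod.permute[OF assms, of "\<lambda>j. a j powi (2 * D j) * q powi (D j * (D j - 1))"] by (simp add: o_def)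
  ultimately show ?thesis unfolding rfac_def by simp
qed

lemma good_permutes:
  assumes "\<pi> permutes I6"
  shows "good (\<lambda>i. a (\<pi> i)) z \<longleftrightarrow> good a z"
proof -
  have "(\<forall>i\<in>I6. P (\<pi> i)) \<longleftrightarrow> (\<forall>i\<in>I6. P i)" for P
    using permutes_image[OF assms] by (metis (no_types, lifting) image_iff)
  from this[of "\<lambda>i. a i * z \<notin> qZ \<and> a i / z \<notin> qZ"] show ?thesis unfolding good_def by simp
qed

lemma generic_permutes:
  assumes "\<pi> permutes I6" "generic a"
  shows "generic (\<lambda>i. a (\<pi> i))"
  using genericD[OF assms(2)] permutes_in_image[OF assms(1)] permutes_inj[OF assms(1)]
  unfolding generic_def by (auto simp: inj_eq)

lemma reweights_permutes:
  assumes \<pi>: "\<pi> permutes I6" and r: "reweights (\<lambda>i. a (\<pi> i)) \<phi> v"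
  shows "reweights a \<phi> v"
proof -
  obtain xs where xs: "\<forall>x\<in>set xs. (\<Sum>m\<in>I6. snd x m) = 0"
     "\<And>z. good a z \<Longrightarrow> \<phi> z * weight a z = (\<Sum>x\<leftarrow>xs. fst x * weight (shift (\<lambda>i. a (\<pi> i)) (snd x)) z)"
     "(\<Sum>x\<leftarrow>xs. fst x * rfac (\<lambda>i. a (\<pi> i)) (snd x)) = v * rfac (\<lambda>i. a (\<pi> i)) (\<lambda>_. 0)"
    using r unfolding reweights_def good_permutes[OF \<pi>] weight_permutes[OF \<pi>] by auto
  have ii: "inv \<pi> (\<pi> i) = i" for i using permutes_inverses(2)[OF \<pi>] by simp
  have w: "weight (shift (\<lambda>i. a (\<pi> i)) D) z = weight (shift a (\<lambda>i. D (inv \<pi> i))) z" for D z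
  proof -
    have "shift (\<lambda>i. a (\<pi> i)) D = (\<lambda>i. shift a (\<lambda>i. D (inv \<pi> i)) (\<pi> i))"
      by (simp add: shift_def ii fun_eq_iff)
    then show ?thesis by (simp only: weight_permutes[OF \<pi>])
  qed
  have f: "rfac (\<lambda>i. a (\<pi> i)) D = rfac a (\<lambda>i. D (inv \<pi> i))" for D
    using rfac_permutes[OF \<pi>, of a "\<lambda>i. D (inv \<pi> i)"] by (simp add: ii)
  have s: "(\<Sum>m\<in>I6. D (inv \<pi> m)) = (\<Sum>m\<in>I6. D m :: int)" for D
    using sum.permute[OF permutes_inv[OF \<pi>], of D] by (simp add: o_def)
  show ?thesis unfolding reweights_def
    by (intro exI[of _ "map (\<lambda>x. (fst x, \<lambda>i. snd x (inv \<pi> i))) xs"])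
       (use xs in \<open>auto simp: o_def w f s\<close>)
qed

lemma reweights_rahman_le:
  assumes a: "generic a" "(\<Prod>m\<in>I6. a m) = q" and mn: "m \<le> n"
  shows "\<exists>\<rho>. \<rho> * sp (a 2) m (q ^ m / a 6) = rahman_pref m (a 1) (a 2) (a 3) (a 4) (a 6) (a 5) *
       (rahman_coef m (a 1) (a 2) (a 3) (a 4) (a 6) (a 5) m * sp (a 1) m (q ^ m / a 6)) \<and>
     reweights a (\<lambda>z. rahman_aux q n (a 1) (a 2) (a 3) (a 4) (a 5) (a 6) z *
       rahman_aux q m (a 1) (a 2) (a 3) (a 4) (a 6) (a 5) z)
       (if m = n then rpref n a * (\<rho> * (lam0 a n * top_value n a)) else 0)"
proof -
  have ix: "(1::nat) \<in> I6" "(2::nat) \<in> I6" "(3::nat) \<in> I6" "(4::nat) \<in> I6" "(5::nat) \<in> I6" "(6::nat) \<in> I6"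
    by (simp_all add: I6_def)
  have nz: "a 1 \<noteq> 0" "a 2 \<noteq> 0" "a 3 \<noteq> 0" "a 4 \<noteq> 0" "a 5 \<noteq> 0" "a 6 \<noteq> 0"
    using genericD(1)[OF a(1)] ix by auto
  obtain \<rho> where \<rho>: "\<And>z. good a z \<Longrightarrow> rahman_aux q m (a 1) (a 2) (a 3) (a 4) (a 6) (a 5) z =
       (\<Sum>j\<le>m. \<rho> j * (sp (a 2) j z / sp (q / a 6) j z))"
    "\<rho> m * sp (a 2) m (q ^ m / a 6) = rahman_pref m (a 1) (a 2) (a 3) (a 4) (a 6) (a 5) *
       (rahman_coef m (a 1) (a 2) (a 3) (a 4) (a 6) (a 5) m * sp (a 1) m (q ^ m / a 6))"
    by (rule rahman_rebased[OF a(1), where m = m]) blast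
  have r: "reweights a (\<lambda>z. rpref n a * (\<Sum>j\<le>m. \<rho> j * (\<Sum>k\<le>n. rcoef n a k *
      (sp (a 1) k z / sp (q / a 5) k z * (sp (a 2) j z / sp (q / a 6) j z)))))
    (rpref n a * (\<Sum>j\<le>m. \<rho> j * (\<Sum>k\<le>n. rcoef n a k * lam a k j)))"
    by (intro reweights_scale reweights_sum reweights_basis a) auto
  have v: "rpref n a * (\<Sum>j\<le>m. \<rho> j * (\<Sum>k\<le>n. rcoef n a k * lam a k j)) =
     (if m = n then rpref n a * (\<rho> m * (lam0 a n * top_value n a)) else 0)"
  proof -
    have "(\<Sum>j\<le>m. \<rho> j * (\<Sum>k\<le>n. rcoef n a k * lam a k j)) =
       (\<Sum>j\<le>m. if j = n then \<rho> n * (lam0 a n * top_value n a) else 0)"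
    proof (rule sum.cong)
      fix j assume "j \<in> {..m}"
      then have "j \<le> n" using mn by simp
      then show "\<rho> j * (\<Sum>k\<le>n. rcoef n a k * lam a k j) = (if j = n then \<rho> n * (lam0 a n * top_value n a) else 0)"
        unfolding rahman_lam_sum[OF a \<open>j \<le> n\<close>] by auto
    qed simp
    then show ?thesis using mn by auto
  qed
  have "reweights a (\<lambda>z. rahman_aux q n (a 1) (a 2) (a 3) (a 4) (a 5) (a 6) z *
       rahman_aux q m (a 1) (a 2) (a 3) (a 4) (a 6) (a 5) z)
     (if m = n then rpref n a * (\<rho> m * (lam0 a n * top_value n a)) else 0)"
    using r unfolding v
  proof (rule reweights_cong)
    fix z assume z: "good a z"
    then have z0: "z \<noteq> 0" by (simp add: good_def)
    have "\<rho> j * (\<Sum>k\<le>n. f k * (g k * h)) = (\<Sum>k\<le>n. f k * g k) * (\<rho> j * h)" for j f g h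
      by (simp add: sum_distrib_left sum_distrib_right mult_ac)
    then show "rahman_aux q n (a 1) (a 2) (a 3) (a 4) (a 5) (a 6) z *
       rahman_aux q m (a 1) (a 2) (a 3) (a 4) (a 6) (a 5) z = rpref n a * (\<Sum>j\<le>m. \<rho> j * (\<Sum>k\<le>n. rcoef n a k *
      (sp (a 1) k z / sp (q / a 5) k z * (sp (a 2) j z / sp (q / a 6) j z))))"
      unfolding \<rho>(1)[OF z] rahman_aux_eq[OF nz z0] by (simp only: sum_distrib_left[symmetric] mult.assoc)
  qed
  then show ?thesis using \<rho>(2) by blast
qed

text \<open>After reflection of the factorials that contain \<open>q ^ (- n)\<close>, everything cancels but the six factorials
  of the norm, a factor in \<open>1 / (a 5 * a 6)\<close>, and monomials that combine to \<open>q ^ (- n)\<close>.\<close>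

lemma norm_value:
  assumes a: "generic a" "(\<Prod>m\<in>I6. a m) = q"
    and \<rho>: "\<rho> * sp (a 2) n (q ^ n / a 6) = rahman_pref n (a 1) (a 2) (a 3) (a 4) (a 6) (a 5) *
       (rahman_coef n (a 1) (a 2) (a 3) (a 4) (a 6) (a 5) n * sp (a 1) n (q ^ n / a 6))"
  shows "rpref n a * (\<rho> * (lam0 a n * top_value n a)) = norm_factor q a n"
proof -
  have ix: "(1::nat) \<in> I6" "(2::nat) \<in> I6" "(3::nat) \<in> I6" "(4::nat) \<in> I6" "(5::nat) \<in> I6" "(6::nat) \<in> I6"
    by (simp_all add: I6_def)
  have nz: "a 1 \<noteq> 0" "a 2 \<noteq> 0" "a 3 \<noteq> 0" "a 4 \<noteq> 0" "a 5 \<noteq> 0" "a 6 \<noteq> 0"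
    using genericD(1)[OF a(1)] ix by auto
  have m: "a 1 * a 2 \<notin> qZ" "a 1 * a 3 \<notin> qZ" "a 1 * a 4 \<notin> qZ" "a 1 * a 5 \<notin> qZ" "a 1 * a 6 \<notin> qZ" "a 2 * a 5 \<notin> qZ"
     "a 2 * a 6 \<notin> qZ" "a 3 * a 6 \<notin> qZ" "a 4 * a 6 \<notin> qZ" "a 5 * a 6 \<notin> qZ"
    using genericD(3)[OF a(1)] ix by blast+
  have rn: "a 1 / a 5 \<notin> qZ" "a 1 / a 6 \<notin> qZ" "a 2 / a 6 \<notin> qZ" using genericD(2)[OF a(1)] ix by simp_all
  define T where "T = tri n"
  define Q where "Q = qpoch q q n"
  define p12 where "p12 = qpoch q (a 1 * a 2) n"
  define p13 where "p13 = qpoch q (a 1 * a 3) n"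
  define p14 where "p14 = qpoch q (a 1 * a 4) n"
  define p23 where "p23 = qpoch q (a 2 * a 3) n"
  define p24 where "p24 = qpoch q (a 2 * a 4) n"
  define p34 where "p34 = qpoch q (a 3 * a 4) n"
  define p25 where "p25 = qpoch q (a 2 * a 5) n"
  define f16 where "f16 = qpoch q (1 / (a 1 * a 6)) n"
  define g16 where "g16 = qpoch q (a 1 * a 6 * q / q ^ n) n"
  define f15 where "f15 = qpoch q (1 / (a 1 * a 5)) n"
  define g15 where "g15 = qpoch q (a 1 * a 5 * q / q ^ n) n"
  define u where "u = qpoch q (1 / q ^ n) n"
  define \<beta> where "\<beta> = qpoch q (q / (a 2 * a 5) / q ^ n) n"
  define h16 where "h16 = qpoch q (q / (a 1 * a 6)) n"
  define w16 where "w16 = qpoch q (a 1 * a 6 / q ^ n) n"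
  define h26 where "h26 = qpoch q (q / (a 2 * a 6)) n"
  define w26 where "w26 = qpoch q (a 2 * a 6 / q ^ n) n"
  define h36 where "h36 = qpoch q (q / (a 3 * a 6)) n"
  define h46 where "h46 = qpoch q (q / (a 4 * a 6)) n"
  define w2 where "w2 = qpoch q (a 2 * q ^ n / a 6) n"
  define w1 where "w1 = qpoch q (a 1 * q ^ n / a 6) n"
  define A1 where "A1 = qpoch q (q * a 1 / a 5) n"
  define B1 where "B1 = qpoch q (q * a 1 / a 6) n"
  define V where "V = vwp (a 1 / a 6) n n"
  define h where "h = 1 / (a 5 * a 6)"
  define \<eta>0 where "\<eta>0 = qpoch q (h * q ^ n) n"
  define \<eta>1 where "\<eta>1 = qpoch q (h * q ^ n * q) n"
  define h56 where "h56 = qpoch q (h * q) n"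
  define D where "D = (a 1 * a 6 / q ^ n) ^ n"
  define m16 where "m16 = (- 1 / (a 1 * a 6)) ^ n * T"
  define m15 where "m15 = (- 1 / (a 1 * a 5)) ^ n * T"
  define mu where "mu = (- 1 / q ^ n) ^ n * T"
  define m\<beta> where "m\<beta> = (- q / (a 2 * a 5 * q ^ n)) ^ n * T"
  define k16 where "k16 = (- q / (a 1 * a 6)) ^ n * T"
  define k26 where "k26 = (- q / (a 2 * a 6)) ^ n * T"
  have qn: "q ^ n \<noteq> 0" using q_nz by simp
  have Tnz: "T \<noteq> 0" by (simp add: T_def tri_nz)
  have e1: "f16 = m16 * g16" unfolding f16_def m16_def g16_def T_def using nz by (intro qpoch_flip) simp
  have e2: "f15 = m15 * g15" unfolding f15_def m15_def g15_def T_def using nz by (intro qpoch_flip) simp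
  have e3: "u = mu * Q" unfolding u_def mu_def Q_def T_def using qpoch_flip[of "q ^ n" n] q_nz by simp
  have e4: "\<beta> = m\<beta> * p25"
    unfolding \<beta>_def m\<beta>_def p25_def T_def using qpoch_flip'[of "a 2 * a 5 * q ^ n" n] nz q_nz by simp
  have e5: "h16 = k16 * w16" unfolding h16_def k16_def w16_def T_def using nz by (intro qpoch_flip') simp
  have e6: "h26 = k26 * w26" unfolding h26_def k26_def w26_def T_def using nz by (intro qpoch_flip') simp
  have N: "g16 \<noteq> 0" "g15 \<noteq> 0" "p25 \<noteq> 0" "w16 \<noteq> 0" "w26 \<noteq> 0" "h36 \<noteq> 0" "h46 \<noteq> 0" "p12 \<noteq> 0" "p13 \<noteq> 0" "p14 \<noteq> 0"
    unfolding g16_def g15_def p25_def w16_def w26_def h36_def h46_def p12_def p13_def p14_def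
    using m by (simp_all add: qpoch_nz)
  have N2: "A1 \<noteq> 0" "B1 \<noteq> 0" "w2 \<noteq> 0"
  proof -
    have "q * a 1 / a 5 = a 1 / a 5 * q" "q * a 1 / a 6 = a 1 / a 6 * q" "a 2 * q ^ n / a 6 = a 2 / a 6 * q ^ n" by simp_all
    then show "A1 \<noteq> 0" "B1 \<noteq> 0" "w2 \<noteq> 0"
      unfolding A1_def B1_def w2_def using rn by (simp_all only: qpoch_nz qZ_cases not_False_eq_True)
  qed
  have hn: "h \<notin> qZ" unfolding h_def using m by simp
  have N3: "\<eta>1 \<noteq> 0" "h56 \<noteq> 0" unfolding \<eta>1_def h56_def using hn by (simp_all add: qpoch_nz)
  have Qnz: "Q \<noteq> 0" by (simp add: Q_def qpoch_nz_Suc)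
  have mnz: "m\<beta> \<noteq> 0" "k16 \<noteq> 0" using nz q_nz Tnz by (simp_all add: m\<beta>_def k16_def)
  have V: "V * w1 = u * q ^ n * B1 / Q"
  proof -
    define A where "A = a 1 / a 6"
    have An: "A \<notin> qZ" using rn by (simp add: A_def)
    have nz2: "1 - A \<noteq> 0" "qpoch q (A * q ^ (n + 1)) n \<noteq> 0"
      using mult_power_neq_1[OF An, of 0] An by (simp_all add: qpoch_nz del: power_Suc)
    have w1A: "w1 = qpoch q (A * q ^ n) n" "B1 = qpoch q (A * q) n" by (simp_all add: w1_def B1_def A_def mult_ac)
    have "(qpoch q A n * qpoch q (A * q ^ n) n) * (1 - A * q ^ (2 * n)) = qpoch q A (Suc (n + n))"
      unfolding qpoch_Suc qpoch_add by (simp add: mult_2)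
    also have "\<dots> = (1 - A) * (qpoch q (A * q) n * qpoch q (A * q ^ (n + 1)) n)"
      unfolding qpoch_Suc' qpoch_add by (simp add: mult_ac)
    finally have 1: "qpoch q A n * w1 * (1 - A * q ^ (2 * n)) = (1 - A) * (B1 * qpoch q (A * q ^ (n + 1)) n)"
      unfolding w1A .
    have "V * w1 = (qpoch q A n * w1 * (1 - A * q ^ (2 * n))) * u * q ^ n / ((1 - A) * Q * qpoch q (A * q ^ (n + 1)) n)"
      unfolding V_def vwp_def A_def[symmetric] u_def[symmetric] Q_def[symmetric] by (simp add: mult_ac)
    then show ?thesis unfolding 1 using nz2 by simp
  qed
  have \<rho>': "\<rho> = f15 * u * q ^ n * h26 * h36 * h46 * \<eta>0 * w16 / (Q * g15 * w2 * w26)"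
  proof -
    have s2: "sp (a 2) n (q ^ n / a 6) = w2 * w26" and s1: "sp (a 1) n (q ^ n / a 6) = w1 * w16"
      unfolding sp_def w2_def w26_def w1_def w16_def by (simp_all add: mult_ac)
    have c: "rahman_coef n (a 1) (a 2) (a 3) (a 4) (a 6) (a 5) n =
        V * (h26 * h36 * h46 * \<eta>0 / (p12 * p13 * p14 * g15))"
    proof -
      have "q ^ n / (a 6 * a 5) = h * q ^ n" by (simp add: h_def mult_ac)
      then show ?thesis
        unfolding rahman_coef_def V_def h26_def h36_def h46_def \<eta>0_def p12_def p13_def p14_def g15_def by simp
    qed
    have pf: "rahman_pref n (a 1) (a 2) (a 3) (a 4) (a 6) (a 5) = p12 * p13 * p14 * f15 / B1"
      unfolding rahman_pref_def p12_def p13_def p14_def f15_def B1_def ..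
    have "\<rho> * (w2 * w26) = f15 / B1 * (h26 * h36 * h46 * \<eta>0 / g15) * w16 * (V * w1)"
      using \<rho> N unfolding s1 s2 c pf by (simp add: mult_ac)
    then have "\<rho> * (w2 * w26) = f15 * u * q ^ n * h26 * h36 * h46 * \<eta>0 * w16 / (Q * g15)"
      unfolding V using N2 by (simp add: mult_ac)
    then have "\<rho> * (w2 * w26) / (w2 * w26) = f15 * u * q ^ n * h26 * h36 * h46 * \<eta>0 * w16 / (Q * g15) / (w2 * w26)"
      by (simp only:)
    then show ?thesis using N N2 by (simp add: mult_ac)
  qed
  have L: "lam0 a n = p12 * p23 * p24 * p25 / (h16 * h36 * h46 * h56)"
    unfolding lam0_def p12_def p23_def p24_def p25_def h16_def h36_def h46_def h56_def h_def by simp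
  have P: "rpref n a = p12 * p13 * p14 * f16 / A1"
    unfolding rahman_pref_def p12_def p13_def p14_def f16_def A1_def ..
  have Tv: "top_value n a = u * A1 * D * p34 * w2 * (-1) ^ n * T * q ^ n / (\<beta> * p12 * g16 * \<eta>1)"
  proof -
    have r: "a 1 / a 5 * q = q * a 1 / a 5" "a 1 * a 6 / q ^ n * q = a 1 * a 6 * q / q ^ n"
      "q ^ n / (a 5 * a 6) * q = h * q ^ n * q" by (simp_all add: h_def)
    show ?thesis
      unfolding top_value_def r u_def A1_def D_def p34_def w2_def T_def \<beta>_def p12_def g16_def \<eta>1_def ..
  qed
  \<comment> \<open>The six factors \<open>T\<close> and the powers of \<open>q ^ n\<close> are balanced by \<open>tri_square\<close>.\<close>
  have mono: "m16 * m15 * mu * mu * k26 * D * (-1) ^ n * T * (q ^ n * q ^ n) = 1 / q ^ n * (m\<beta> * k16)"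
  proof -
    define B where "B = q * q / (a 2 * a 5 * a 1 * a 6 * q ^ n)"
    have "m16 * m15 * mu * mu * k26 * D * (-1) ^ n * T * (q ^ n * q ^ n) =
      ((- 1 / (a 1 * a 6)) * (- 1 / (a 1 * a 5)) * (- 1 / q ^ n) * (- 1 / q ^ n) * (- q / (a 2 * a 6)) *
       (a 1 * a 6 / q ^ n) * (-1) * (q * q)) ^ n * (T * T * T * T * T * T)"
      unfolding m16_def m15_def mu_def k26_def D_def power_mult_distrib by (simp only: mult_ac)
    also have "(- 1 / (a 1 * a 6)) * (- 1 / (a 1 * a 5)) * (- 1 / q ^ n) * (- 1 / q ^ n) * (- q / (a 2 * a 6)) *
       (a 1 * a 6 / q ^ n) * (-1) * (q * q) = B * q / (q ^ n * q ^ n)"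
      using nz by (simp add: B_def mult_ac)
    also have "(B * q / (q ^ n * q ^ n)) ^ n * (T * T * T * T * T * T) =
      B ^ n * q ^ n / (q ^ (n * n) * q ^ (n * n)) * (T * T * T * T * T * T)"
      by (simp add: power_mult_distrib power_divide power_mult)
    also have "\<dots> = B ^ n * (T * T) / q ^ n"
      using Tnz qn unfolding tri_square[symmetric] T_def[symmetric] by simp
    also have "B ^ n * (T * T) = m\<beta> * k16"
    proof -
      have Beq: "B = (- q / (a 2 * a 5 * q ^ n)) * (- q / (a 1 * a 6))" by (simp add: B_def mult_ac)
      show ?thesis unfolding m\<beta>_def k16_def Beq power_mult_distrib by (simp only: mult_ac)
    qed
    finally show ?thesis by simp
  qed
  have eta: "\<eta>0 / (\<eta>1 * h56) = (1 - h) / ((1 - h * q ^ (2 * n)) * qpoch q h n)"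
  proof -
    have 1: "\<eta>0 * (1 - h * q ^ (2 * n)) = (1 - h * q ^ n) * \<eta>1"
      using qpoch_Suc[of "h * q ^ n" n] qpoch_Suc'[of "h * q ^ n" n]
      by (simp add: \<eta>0_def \<eta>1_def mult_2 power_add mult.assoc)
    have 2: "qpoch q h n * (1 - h * q ^ n) = (1 - h) * h56"
      using qpoch_Suc[of h n] qpoch_Suc'[of h n] by (simp add: h56_def)
    have nn: "1 - h * q ^ (2 * n) \<noteq> 0" "1 - h * q ^ n \<noteq> 0" "qpoch q h n \<noteq> 0"
      using mult_power_neq_1[OF hn, of "2 * n"] mult_power_neq_1[OF hn, of n] hn by (simp_all add: qpoch_nz)
    have "\<eta>0 * ((1 - h * q ^ (2 * n)) * qpoch q h n) = \<eta>1 * (qpoch q h n * (1 - h * q ^ n))"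
      using 1 by (simp add: mult_ac)
    also have "\<dots> = (1 - h) * (\<eta>1 * h56)" unfolding 2 by simp
    finally show ?thesis using nn N3 by (simp add: frac_eq_eq)
  qed
  have "rpref n a * (\<rho> * (lam0 a n * top_value n a)) =
     p12 * p13 * p14 * p23 * p24 * p34 * Q *
       ((m16 * m15 * mu * mu * k26 * D * (-1) ^ n * T * (q ^ n * q ^ n)) / (m\<beta> * k16)) * (\<eta>0 / (\<eta>1 * h56))"
  proof -
    have "p12 * p13 * p14 * (m16 * g16) / A1 * ((m15 * g15) * (mu * Q) * x * (k26 * w26) * h36 * h46 * \<eta>0 * w16 / (Q * g15 * w2 * w26) *
      (p12 * p23 * p24 * p25 / ((k16 * w16) * h36 * h46 * h56) *
       ((mu * Q) * A1 * D * p34 * w2 * sg * T * x / ((m\<beta> * p25) * p12 * g16 * \<eta>1)))) =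
     p12 * p13 * p14 * p23 * p24 * p34 * Q *
       ((m16 * m15 * mu * mu * k26 * D * sg * T * (x * x)) / (m\<beta> * k16)) * (\<eta>0 / (\<eta>1 * h56))" for x sg
      using N N2 Qnz by (simp add: mult_ac)
    then show ?thesis unfolding P \<rho>' L Tv e1 e2 e3 e4 e5 e6 .
  qed
  also have "\<dots> = p12 * p13 * p14 * p23 * p24 * p34 * Q / q ^ n * ((1 - h) / ((1 - h * q ^ (2 * n)) * qpoch q h n))"
    unfolding mono eta using mnz by simp
  also have "\<dots> = norm_factor q a n"
  proof -
    have s: "{1..4} = {1,2,3,4::nat}" "{1<..4} = {2,3,4::nat}" "{2<..4} = {3,4::nat}" "{3<..4} = {4::nat}" "{4<..4} = ({}::nat set)"
      by auto
    have "(\<Prod>i\<in>{1..4}. \<Prod>j\<in>{i<..4}. f i j) = f 1 2 * f 1 3 * f 1 4 * f 2 3 * f 2 4 * f 3 4"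
      for f :: "nat \<Rightarrow> nat \<Rightarrow> complex"
    proof -
      have "(\<Prod>i\<in>{1..4}. \<Prod>j\<in>{i<..4}. f i j) =
        (\<Prod>j\<in>{1<..4}. f 1 j) * ((\<Prod>j\<in>{2<..4}. f 2 j) * ((\<Prod>j\<in>{3<..4}. f 3 j) * (\<Prod>j\<in>{4<..4}. f 4 j)))"
        unfolding s(1) by simp
      then show ?thesis unfolding s by (simp add: mult_ac)
    qed
    then have "(\<Prod>i\<in>{1..4}. \<Prod>j\<in>{i<..4}. qpoch q (a i * a j) n) = p12 * p13 * p14 * p23 * p24 * p34"
      by (simp only: p12_def p13_def p14_def p23_def p24_def p34_def)
    moreover have "q ^ (2 * n) / (a 5 * a 6) = h * q ^ (2 * n)" by (simp add: h_def)
    ultimately show ?thesis unfolding norm_factor_def Q_def[symmetric] h_def[symmetric] by (simp add: mult_ac)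
  qed
  finally show ?thesis .
qed

text \<open>If the second function has the higher degree, the roles of parameters 5 and 6 are interchanged.\<close>

lemma reweights_rahman:
  assumes a: "generic a" "(\<Prod>m\<in>I6. a m) = q"
  shows "reweights a (\<lambda>z. rahman_aux q n (a 1) (a 2) (a 3) (a 4) (a 5) (a 6) z *
       rahman_aux q m (a 1) (a 2) (a 3) (a 4) (a 6) (a 5) z) (of_bool (n = m) * norm_factor q a n)"
proof (cases "m \<le> n")
  case True
  from reweights_rahman_le[OF a True] obtain \<rho> where
    1: "\<rho> * sp (a 2) m (q ^ m / a 6) = rahman_pref m (a 1) (a 2) (a 3) (a 4) (a 6) (a 5) *
       (rahman_coef m (a 1) (a 2) (a 3) (a 4) (a 6) (a 5) m * sp (a 1) m (q ^ m / a 6))" and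
    2: "reweights a (\<lambda>z. rahman_aux q n (a 1) (a 2) (a 3) (a 4) (a 5) (a 6) z *
       rahman_aux q m (a 1) (a 2) (a 3) (a 4) (a 6) (a 5) z)
       (if m = n then rpref n a * (\<rho> * (lam0 a n * top_value n a)) else 0)" by blast
  have "(if m = n then rpref n a * (\<rho> * (lam0 a n * top_value n a)) else 0) = of_bool (n = m) * norm_factor q a n"
    using norm_value[OF a, of \<rho> n] 1 by auto
  with 2 show ?thesis by (simp only:)
next
  case False
  then have nm: "n \<le> m" "n \<noteq> m" by auto
  define \<pi> where "\<pi> = Transposition.transpose (5::nat) 6"
  have \<pi>: "\<pi> permutes I6" unfolding \<pi>_def by (rule permutes_swap_id) (simp_all add: I6_def)
  define a' where "a' = (\<lambda>i. a (\<pi> i))"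
  have v: "a' 1 = a 1" "a' 2 = a 2" "a' 3 = a 3" "a' 4 = a 4" "a' 5 = a 6" "a' 6 = a 5"
    by (simp_all add: a'_def \<pi>_def Transposition.transpose_def)
  have "generic a'" unfolding a'_def by (rule generic_permutes[OF \<pi> a(1)])
  moreover have "(\<Prod>m\<in>I6. a' m) = q" using prod.permute[OF \<pi>, of a] a(2) by (simp add: a'_def o_def)
  ultimately have "reweights a' (\<lambda>z. rahman_aux q m (a' 1) (a' 2) (a' 3) (a' 4) (a' 5) (a' 6) z *
       rahman_aux q n (a' 1) (a' 2) (a' 3) (a' 4) (a' 6) (a' 5) z) 0"
    using reweights_rahman_le[OF _ _ nm(1), of a'] nm(2) by auto
  from reweights_permutes[OF \<pi> this[unfolded v, unfolded a'_def]]
  show ?thesis using nm(2) by (simp add: mult.commute)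
qed

section \<open>The two-variable kernel\<close>

lemma half_product: "(k + 1) * k div 2 = k * (k - 1) div 2 + (k :: int)"
proof -
  have "(k + 1) * k = k * (k - 1) + k * 2" by (simp add: algebra_simps)
  then show ?thesis by simp
qed

text \<open>The general quasi-periodicity, with the multiplier on the left so that it holds for negative exponents
  as well.\<close>

lemma theta_powi:
  assumes u: "u \<noteq> 0"
  shows "theta (u * q powi k) * (q powi (k * (k - 1) div 2) * (- u) powi k) = theta u"
proof -
  have step: "theta (u * q powi (k + 1)) * (q powi ((k + 1) * (k + 1 - 1) div 2) * (- u) powi (k + 1)) =
      theta (u * q powi k) * (q powi (k * (k - 1) div 2) * (- u) powi k)" for k
  proof -
    have "theta (u * q powi (k + 1)) = - theta (u * q powi k) / (u * q powi k)"
      using theta_q_mult[of "u * q powi k"] u q_nz by (simp add: power_int_add mult_ac)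
    moreover have "q powi ((k + 1) * (k + 1 - 1) div 2) = q powi (k * (k - 1) div 2) * q powi k"
      using half_product[of k] q_nz by (simp add: power_int_add)
    moreover have "(- u) powi (k + 1) = (- u) powi k * (- u)" using u by (simp add: power_int_add)
    ultimately show ?thesis using u q_nz by simp
  qed
  show ?thesis
  proof (induction k rule: int_induct[where k = 0])
    case base
    show ?case by simp
  next
    case (step1 i)
    then show ?case using step[of i] by simp
  next
    case (step2 i)
    then show ?case using step[of "i - 1"] by simp
  qed
qed

definition shift_factor :: "(nat \<Rightarrow> complex) \<Rightarrow> (nat \<Rightarrow> int) \<Rightarrow> complex" where
  "shift_factor b N = (\<Prod>j\<in>I6. q powi (N j * (N j - 1) div 2) * b j powi N j)"

lemma powi_sum: "x \<noteq> 0 \<Longrightarrow> (\<Prod>j\<in>A. x powi f j) = (x :: complex) powi (\<Sum>j\<in>A. f j)"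
  by (induction A rule: infinite_finite_induct) (auto simp: power_int_add)

lemma prod_powi: "(\<Prod>j\<in>A. f j powi k) = (\<Prod>j\<in>A. f j :: complex) powi k"
  by (induction A rule: infinite_finite_induct) (auto simp: power_int_mult_distrib)

text \<open>The condition on \<open>N\<close> makes the powers of \<open>y\<close> and the signs depend on \<open>x\<close> only.\<close>

lemma theta_prod_shift:
  assumes b: "generic b" "(\<Prod>i\<in>I6. b i) = q" and N: "(\<Sum>i\<in>I6. N i) = 0" and y: "y \<noteq> 0"
  shows "(\<Prod>i\<in>I6. theta (shift b N i / (q powi x * y))) * (shift_factor b N * q powi (3 * x * x + 2 * x) * y powi (6 * x)) =
    (\<Prod>i\<in>I6. theta (b i / y))"
proof -
  have nz: "b i \<noteq> 0" if "i \<in> I6" for i using genericD(1)[OF b(1) that] .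
  have card: "card I6 = 6" by (simp add: I6_def)
  have "(\<Prod>i\<in>I6. theta (b i / y)) = (\<Prod>i\<in>I6. theta (shift b N i / (q powi x * y)) *
      (q powi ((N i - x) * (N i - x - 1) div 2) * ((-1) powi (N i - x) * (b i powi (N i - x) * y powi (x - N i)))))"
  proof (rule prod.cong)
    fix i assume i: "i \<in> I6"
    have "theta (b i / y * q powi (N i - x)) * (q powi ((N i - x) * (N i - x - 1) div 2) * (- (b i / y)) powi (N i - x)) =
       theta (b i / y)" using nz[OF i] y by (intro theta_powi) simp
    moreover have "b i / y * q powi (N i - x) = shift b N i / (q powi x * y)"
      using q_nz y by (simp add: shift_def power_int_diff)
    moreover have "(- (b i / y)) powi (N i - x) = (-1) powi (N i - x) * (b i powi (N i - x) * y powi (x - N i))"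
    proof -
      have "(- (b i / y)) powi (N i - x) = ((-1) * (b i * inverse y)) powi (N i - x)" by (simp add: divide_inverse)
      also have "\<dots> = (-1) powi (N i - x) * (b i powi (N i - x) * inverse y powi (N i - x))"
        unfolding power_int_mult_distrib ..
      also have "inverse y powi (N i - x) = y powi (x - N i)"
        by (metis power_int_inverse power_int_minus minus_diff_eq)
      finally show ?thesis .
    qed
    ultimately show "theta (b i / y) = theta (shift b N i / (q powi x * y)) *
      (q powi ((N i - x) * (N i - x - 1) div 2) * ((-1) powi (N i - x) * (b i powi (N i - x) * y powi (x - N i))))"
      by simp
  qed simp
  also have "\<dots> = (\<Prod>i\<in>I6. theta (shift b N i / (q powi x * y))) *
     ((\<Prod>i\<in>I6. q powi ((N i - x) * (N i - x - 1) div 2)) * ((\<Prod>i\<in>I6. (-1) powi (N i - x)) *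
      ((\<Prod>i\<in>I6. b i powi (N i - x)) * (\<Prod>i\<in>I6. y powi (x - N i)))))"
    by (simp only: prod.distrib)
  also have "(\<Prod>i\<in>I6. (-1 :: complex) powi (N i - x)) = 1"
  proof -
    have "(\<Sum>i\<in>I6. N i - x) = 2 * (- 3 * x)" using N card by (simp add: sum_subtractf)
    moreover have "(\<Prod>i\<in>I6. (-1 :: complex) powi (N i - x)) = (-1) powi (\<Sum>i\<in>I6. N i - x)"
      by (rule powi_sum) simp
    ultimately show ?thesis by (simp only: power_int_mult) simp
  qed
  also have "(\<Prod>i\<in>I6. y powi (x - N i)) = y powi (6 * x)"
    using N card y by (simp add: powi_sum sum_subtractf)
  also have "(\<Prod>i\<in>I6. b i powi (N i - x)) = (\<Prod>i\<in>I6. b i powi N i) * q powi (- x)"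
  proof -
    have "(\<Prod>i\<in>I6. b i powi (N i - x)) = (\<Prod>i\<in>I6. b i powi N i * b i powi (- x))"
      using nz by (intro prod.cong) (auto simp: power_int_add[symmetric])
    then show ?thesis by (simp only: prod.distrib prod_powi b(2))
  qed
  also have "(\<Prod>i\<in>I6. q powi ((N i - x) * (N i - x - 1) div 2)) =
      (\<Prod>i\<in>I6. q powi (N i * (N i - 1) div 2)) * q powi (3 * x * x + 3 * x)"
  proof -
    have h: "(N i - x) * (N i - x - 1) div 2 = N i * (N i - 1) div 2 + (x * (x + 1) div 2 - N i * x)" for i
    proof -
      have e: "even (N i * (N i - 1))" "even (x * (x + 1))" by auto
      have "(N i - x) * (N i - x - 1) = N i * (N i - 1) + (x * (x + 1) - 2 * (N i * x))"
        by (simp add: algebra_simps)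
      moreover obtain k where k: "N i * (N i - 1) = 2 * k" using e(1) by (rule evenE)
      moreover obtain l where l: "x * (x + 1) = 2 * l" using e(2) by (rule evenE)
      ultimately have "(N i - x) * (N i - x - 1) = 2 * (k + (l - N i * x))" by simp
      then show ?thesis unfolding k l by simp
    qed
    have "(\<Sum>i\<in>I6. x * (x + 1) div 2 - N i * x) = 6 * (x * (x + 1) div 2)"
      using N card by (simp add: sum_subtractf sum_distrib_right[symmetric])
    also have "\<dots> = 3 * x * x + 3 * x"
    proof -
      have "even (x * (x + 1))" by auto
      then obtain l where l: "x * (x + 1) = 2 * l" by (rule evenE)
      have "3 * x * x + 3 * x = 3 * (x * (x + 1))" by (simp add: algebra_simps)
      then show ?thesis unfolding l by simp
    qed
    finally have "(\<Sum>i\<in>I6. (N i - x) * (N i - x - 1) div 2) = (\<Sum>i\<in>I6. N i * (N i - 1) div 2) + (3 * x * x + 3 * x)"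
      unfolding h sum.distrib by simp
    then show ?thesis by (simp only: powi_sum[OF q_nz] power_int_add[OF disjI1[OF q_nz]])
  qed
  finally have "(\<Prod>i\<in>I6. theta (b i / y)) = (\<Prod>i\<in>I6. theta (shift b N i / (q powi x * y))) *
     ((\<Prod>i\<in>I6. q powi (N i * (N i - 1) div 2)) * (\<Prod>i\<in>I6. b i powi N i) * (q powi (3 * x * x + 3 * x) * q powi (- x)) * y powi (6 * x))"
    by (simp only: mult_ac mult_1_left)
  also have "q powi (3 * x * x + 3 * x) * q powi (- x) = q powi (3 * x * x + 2 * x)"
    using q_nz power_int_add[of q "3 * x * x + 3 * x" "- x"] by (simp add: add_ac)
  finally show ?thesis by (simp only: shift_factor_def prod.distrib mult_ac)
qed

lemma good_sub: "good b y \<Longrightarrow> good b (q powi x * y)"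
proof -
  assume g: "good b y"
  have e: "b i * (q powi x * y) = b i * y * q powi x" "b i / (q powi x * y) = b i / y * q powi (- x)" for i
    by (simp_all add: power_int_minus divide_inverse mult_ac)
  show ?thesis unfolding good_def e qZ_mult_powi_iff using g q_nz by (simp add: good_def)
qed

text \<open>Two theta functions per parameter are split off, which leaves the two weights. The quasi-periods of those
  with argument \<open>shift b N j / w\<close> produce the monomial in \<open>y\<close>, and the remaining quotient of theta
  functions is elliptic.\<close>

lemma kernel_eq:
  assumes b: "generic b" "(\<Prod>i\<in>I6. b i) = q" and N: "(\<Sum>i\<in>I6. N i) = 0" and y: "good b y"
    and w: "w = q powi x * y"
  shows "(\<Prod>j\<in>I6. (qpoch_inf q (q / (b j * y)) * qpoch_inf q (q * y / b j)) /
      (qpoch_inf q (shift b N j * w) * qpoch_inf q (shift b N j / w))) * ((1 - w\<^sup>2) * (1 - 1 / y\<^sup>2)) =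
    - shift_factor b N * q powi (3 * x * x + x) * y powi (6 * x) * (weight b y * weight (shift b N) w * ell b y)"
proof -
  define c where "c = shift b N"
  have y0: "y \<noteq> 0" using y by (simp add: good_def)
  have gc: "good c w" unfolding c_def good_shift w by (rule good_sub[OF y])
  have nn: "qpoch_inf q (b j * y) \<noteq> 0" "qpoch_inf q (q * w / c j) \<noteq> 0" if "j \<in> I6" for j
  proof -
    show "qpoch_inf q (b j * y) \<noteq> 0" using y that by (intro qpoch_inf_nz) (simp add: good_def)
    have e: "q * w / c j = q / (c j / w)" by simp
    have "q * w / c j \<notin> qZ" unfolding e qZ_cases(1) using gc that by (simp add: good_def)
    then show "qpoch_inf q (q * w / c j) \<noteq> 0" by (rule qpoch_inf_nz)
  qed
  have "(\<Prod>j\<in>I6. (qpoch_inf q (q / (b j * y)) * qpoch_inf q (q * y / b j)) / (qpoch_inf q (c j * w) * qpoch_inf q (c j / w))) =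
     (\<Prod>j\<in>I6. (qpoch_inf q (q * y / b j) / qpoch_inf q (b j * y)) * (qpoch_inf q (q * w / c j) / qpoch_inf q (c j * w)) *
        (theta (b j * y) / theta (c j / w)))"
    using nn by (intro prod.cong) (auto simp: theta_def mult_ac)
  also have "\<dots> = weight_core b y * weight_core c w * ((\<Prod>j\<in>I6. theta (b j * y)) / (\<Prod>j\<in>I6. theta (c j / w)))"
    unfolding weight_core_def by (simp only: prod.distrib prod_dividef)
  finally have 1: "(\<Prod>j\<in>I6. (qpoch_inf q (q / (b j * y)) * qpoch_inf q (q * y / b j)) / (qpoch_inf q (c j * w) * qpoch_inf q (c j / w))) =
     weight_core b y * weight_core c w * ((\<Prod>j\<in>I6. theta (b j * y)) / (\<Prod>j\<in>I6. theta (c j / w)))" .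
  define A where "A = (\<Prod>j\<in>I6. theta (c j / w))"
  define B where "B = (\<Prod>j\<in>I6. theta (b j / y))"
  define C where "C = (\<Prod>j\<in>I6. theta (b j * y))"
  have Bnz: "B \<noteq> 0" using y by (auto simp: B_def good_def theta_nz)
  have AB: "A * (shift_factor b N * q powi (3 * x * x + 2 * x) * y powi (6 * x)) = B"
    using theta_prod_shift[OF b N y0, of x] by (simp only: A_def B_def c_def w)
  have qq: "q powi (3 * x * x + 2 * x) = q powi (3 * x * x + x) * q powi x"
    using q_nz power_int_add[of q "3 * x * x + x" x] by (simp add: add_ac)
  have Anz: "A \<noteq> 0" using AB Bnz by auto
  have "C / A = C * (shift_factor b N * q powi (3 * x * x + 2 * x) * y powi (6 * x)) / B"
    unfolding AB[symmetric] using Anz AB Bnz by auto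
  then have "weight_core b y * weight_core c w * (C / A) * ((1 - w\<^sup>2) * (1 - 1 / y\<^sup>2)) =
     weight_core b y * weight_core c w * (C * (shift_factor b N * (q powi (3 * x * x + x) * q powi x) * y powi (6 * x)) / B) *
       ((1 - w\<^sup>2) * (- (1 - y\<^sup>2) / y\<^sup>2))"
    unfolding qq using y0 by (simp add: diff_divide_distrib)
  also have "\<dots> = - shift_factor b N * q powi (3 * x * x + x) * y powi (6 * x) * 
     ((y * (1 - y\<^sup>2) * weight_core b y) * ((q powi x * y) * (1 - w\<^sup>2) * weight_core c w) * (C / (y ^ 4 * B)))"
  proof -
    have "X * W * (C * (F * (R * p) * r) / B) * (V * (- Y / y\<^sup>2)) =
       - F * R * r * ((y * Y * X) * ((p * y) * V * W) * (C / (y ^ 4 * B)))" for X W F R p r V Y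
      using y0 by (simp add: power2_eq_square power4_eq_xxxx mult_ac)
    then show ?thesis .
  qed
  finally show ?thesis
    unfolding c_def[symmetric] 1 A_def[symmetric] C_def[symmetric] weight_def[of b] weight_def[of c] ell_def
      B_def[symmetric] w[symmetric] .
qed

section \<open>Summation over the shifts\<close>

text \<open>The substitution \<open>l = k + x\<close> decouples the absolutely convergent double sum.\<close>

lemma correlation_has_sum:
  fixes f g :: "int \<Rightarrow> complex"
  assumes f: "(f has_sum F) UNIV" and g: "(g has_sum G) UNIV"
  shows "(\<lambda>k. f k * g (k + x)) summable_on UNIV"
    "((\<lambda>x. \<Sum>\<^sub>\<infinity>k. f k * g (k + x)) has_sum (F * G)) UNIV"
proof -
  have fa: "(\<lambda>k. norm (f k)) summable_on UNIV" and ga: "(\<lambda>k. norm (g k)) summable_on UNIV"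
    using f g has_sum_imp_summable summable_on_iff_abs_summable_on_complex by blast+
  define h where "h = (\<lambda>p. f (fst p) * g (snd p))"
  have "(\<lambda>p. norm (h p)) summable_on (UNIV \<times> UNIV)"
    unfolding Infinite_Sum.abs_summable_on_Sigma_iff
  proof (intro conjI ballI)
    show "(\<lambda>y. norm (h (x, y))) summable_on UNIV" for x
      unfolding h_def norm_mult fst_conv snd_conv by (intro summable_on_cmult_right ga)
    have E: "(\<Sum>\<^sub>\<infinity>y. norm (h (x, y))) = norm (f x) * (\<Sum>\<^sub>\<infinity>y. norm (g y))" for x
      unfolding h_def norm_mult fst_conv snd_conv by (rule infsum_cmult_right) (rule ga)
    show "(\<lambda>x. norm (\<Sum>\<^sub>\<infinity>y. norm (h (x, y)))) summable_on UNIV"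
      unfolding E real_norm_def abs_mult abs_norm_cancel by (intro summable_on_cmult_left fa)
  qed
  then have "h summable_on (UNIV \<times> UNIV)" by (rule Infinite_Sum.abs_summable_summable)
  then obtain S where S: "(h has_sum S) (UNIV \<times> UNIV)" by (auto simp: summable_on_def)
  have "((\<lambda>k. f k * G) has_sum S) UNIV"
  proof (rule has_sum_SigmaD[OF S])
    show "((\<lambda>l. h (k, l)) has_sum f k * G) UNIV" for k
      unfolding h_def fst_conv snd_conv by (rule has_sum_cmult_right[OF g])
  qed
  moreover have "((\<lambda>k. f k * G) has_sum F * G) UNIV" by (rule has_sum_cmult_left[OF f])
  ultimately have SFG: "S = F * G" by (rule has_sum_unique)
  have bij: "bij_betw (\<lambda>p. (snd p, snd p + fst p)) (UNIV \<times> UNIV :: (int \<times> int) set) (UNIV \<times> UNIV)"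
    by (rule bij_betwI[where g = "\<lambda>p. (snd p - fst p, fst p)"]) auto
  have H: "((\<lambda>p. f (snd p) * g (snd p + fst p)) has_sum F * G) (UNIV \<times> UNIV)"
    using has_sum_reindex_bij_betw[OF bij, of h S] S unfolding SFG h_def by simp
  have summ: "(\<lambda>k. f k * g (k + x)) summable_on UNIV" for x
  proof -
    have "(\<lambda>(x, k). f k * g (k + x)) summable_on (UNIV \<times> UNIV)"
      using has_sum_imp_summable[OF H] by (simp add: case_prod_unfold)
    then show ?thesis by (rule summable_on_SigmaD1) simp
  qed
  then show "(\<lambda>k. f k * g (k + x)) summable_on UNIV" .
  show "((\<lambda>x. \<Sum>\<^sub>\<infinity>k. f k * g (k + x)) has_sum (F * G)) UNIV"
  proof (rule has_sum_SigmaD[OF H])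
    show "((\<lambda>k. f (snd (x, k)) * g (snd (x, k) + fst (x, k))) has_sum (\<Sum>\<^sub>\<infinity>k. f k * g (k + x))) UNIV" for x
      using summ[of x] by simp
  qed
qed

definition weight_sum :: "(nat \<Rightarrow> complex) \<Rightarrow> (complex \<times> (nat \<Rightarrow> int)) list \<Rightarrow> complex \<Rightarrow> complex" where
  "weight_sum b xs z = (\<Sum>x\<leftarrow>xs. fst x * weight (shift b (snd x)) z)"

definition jackson_sum :: "(nat \<Rightarrow> complex) \<Rightarrow> (complex \<times> (nat \<Rightarrow> int)) list \<Rightarrow> nat \<Rightarrow> complex" where
  "jackson_sum b xs j = (\<Sum>x\<leftarrow>xs. fst x * jackson (shift b (snd x)) (b j))"

lemma weight_sum_Nil: "weight_sum b [] = (\<lambda>_. 0)" and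
  weight_sum_Cons: "weight_sum b (x # xs) = (\<lambda>z. fst x * weight (shift b (snd x)) z + weight_sum b xs z)"
  by (simp_all add: weight_sum_def fun_eq_iff)

lemma weight_sum_analytic: "weight_sum b xs analytic_on {z. \<forall>i\<in>I6. b i * z \<notin> qZ}"
proof (induction xs)
  case (Cons x xs)
  have "shift b (snd x) i * z \<in> qZ \<longleftrightarrow> b i * z \<in> qZ" for i z
    using qZ_mult_powi_iff[of "b i * z" "snd x i"] by (simp add: shift_def mult_ac)
  then have "weight (shift b (snd x)) analytic_on {z. \<forall>i\<in>I6. b i * z \<notin> qZ}"
    using weight_analytic[of "shift b (snd x)"] by simp
  then show ?case unfolding weight_sum_Cons by (intro analytic_intros Cons)
qed (simp add: weight_sum_Nil)

lemma weight_sum_meromorphic: "weight_sum b xs meromorphic_on S"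
proof (induction xs)
  case (Cons x xs)
  then show ?case unfolding weight_sum_Cons by (intro meromorphic_intros weight_meromorphic)
qed (auto simp: weight_sum_Nil intro: meromorphic_intros)

lemma weight_sum_tendsto_0: "(weight_sum b xs \<longlongrightarrow> 0) (at 0)"
proof (induction xs)
  case (Cons x xs)
  have "((\<lambda>z. fst x * weight (shift b (snd x)) z + weight_sum b xs z) \<longlongrightarrow> fst x * 0 + 0) (at 0)"
    by (intro tendsto_intros weight_tendsto_0 Cons)
  then show ?case unfolding weight_sum_Cons by simp
qed (simp add: weight_sum_Nil)

lemma weight_sum_has_sum:
  assumes b: "generic b" and j: "j \<in> I6"
  shows "((\<lambda>k. weight_sum b xs (b j * q powi k)) has_sum jackson_sum b xs j) UNIV"
proof (induction xs)
  case (Cons x xs)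
  have "((\<lambda>k. weight (shift b (snd x)) (b j * q powi k)) has_sum jackson (shift b (snd x)) (b j)) UNIV"
  proof -
    have "(\<lambda>k. weight (shift b (snd x)) (b j * q powi k)) summable_on UNIV"
    proof (rule weight_summable[where j = j and m = "- snd x j"])
      show "shift b (snd x) j \<noteq> 0" using genericD(1)[OF b j] q_nz by (simp add: shift_def)
      show "b j = shift b (snd x) j * q powi (- snd x j)"
        using q_nz by (simp add: shift_def power_int_minus)
    qed (rule j)
    then show ?thesis unfolding jackson_def by (rule has_sum_infsum)
  qed
  then show ?case unfolding weight_sum_Cons jackson_sum_def list.map sum_list.Cons
    by (intro has_sum_add has_sum_cmult_right Cons[unfolded jackson_sum_def])
qed (simp add: weight_sum_Nil jackson_sum_def)

lemma weight_sum_scaled: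
  assumes "t \<noteq> 0"
  shows "(\<lambda>z. weight_sum b xs (t * z)) analytic_on {z. \<forall>i\<in>I6. b i * (t * z) \<notin> qZ}"
    "(\<lambda>z. weight_sum b xs (t * z)) meromorphic_on UNIV"
    "((\<lambda>z. weight_sum b xs (t * z)) \<longlongrightarrow> 0) (at 0)"
proof -
  show "(\<lambda>z. weight_sum b xs (t * z)) analytic_on {z. \<forall>i\<in>I6. b i * (t * z) \<notin> qZ}"
    using analytic_on_compose_gen[of "\<lambda>z. t * z" "{z. \<forall>i\<in>I6. b i * (t * z) \<notin> qZ}" "weight_sum b xs" "{z. \<forall>i\<in>I6. b i * z \<notin> qZ}"]
    by (auto simp: o_def weight_sum_analytic intro!: analytic_intros)
  show "(\<lambda>z. weight_sum b xs (t * z)) meromorphic_on UNIV"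
    using meromorphic_on_compose[OF weight_sum_meromorphic[of b xs UNIV], of "\<lambda>z. t * z" UNIV]
    by (auto simp: o_def intro!: analytic_intros)
  have "filterlim (\<lambda>z. t * z) (at 0) (at 0)"
    using assms by (intro filterlim_atI) (auto intro!: tendsto_eq_intros simp: eventually_at_filter)
  then show "((\<lambda>z. weight_sum b xs (t * z)) \<longlongrightarrow> 0) (at 0)"
    by (rule filterlim_compose[OF weight_sum_tendsto_0])
qed

lemma has_sum_finite_sum:
  assumes "finite A" "\<And>i. i \<in> A \<Longrightarrow> (f i has_sum S i) B"
  shows "((\<lambda>x. \<Sum>i\<in>A. f i x) has_sum (\<Sum>i\<in>A. S i :: complex)) B"
  using assms by (induction rule: finite_induct) (auto intro: has_sum_add)

text \<open>For each \<open>x\<close> the contour integral is a sum over the poles of the elliptic function, and summation over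
  \<open>x\<close> then decouples the two weights.\<close>

lemma reweighted_contour_sum:
  assumes b: "generic b" "(\<Prod>i\<in>I6. b i) = q" and t: "\<And>x. t x \<noteq> 0"
    and sep: "\<And>x. separating_contour (f x) (lat b (t x)) (dual_lat b (t x)) (\<gamma> x)"
    and f: "\<And>x z. z \<noteq> 0 \<Longrightarrow> z \<notin> lat b (t x) \<union> dual_lat b (t x) \<Longrightarrow>
       f x z = \<alpha> * (weight_sum b xs (t x * z) * weight_sum b ys (q powi x * (t x * z))) * ell b (t x * z) / z"
  shows "f x contour_integrable_on \<gamma> x"
    "((\<lambda>x. contour_integral (\<gamma> x) (f x)) has_sum
       2 * pi * \<i> * (\<Sum>j\<in>I6. nu b j * (\<alpha> * (jackson_sum b xs j * jackson_sum b ys j))) / (qpoch_inf q q)\<^sup>2) UNIV"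
proof -
  define T where "T x j = \<alpha> * (\<Sum>\<^sub>\<infinity>k. weight_sum b xs (b j * q powi k) * weight_sum b ys (b j * q powi (k + x)))" for x j
  define G where "G x z = \<alpha> * (weight_sum b xs (t x * z) * weight_sum b ys (q powi x * t x * z))" for x z
  have main: "f x contour_integrable_on \<gamma> x \<and>
     contour_integral (\<gamma> x) (f x) = 2 * pi * \<i> * (\<Sum>j\<in>I6. nu b j * T x j) / (qpoch_inf q q)\<^sup>2" for x
  proof -
    have t2: "q powi x * t x \<noteq> 0" using t q_nz by simp
    have G_eq: "G x = (\<lambda>z. \<alpha> * (weight_sum b xs (t x * z) * weight_sum b ys (q powi x * t x * z)))"
      by (simp add: G_def fun_eq_iff)
    have mero: "G x meromorphic_on UNIV"
      unfolding G_eq by (intro meromorphic_intros weight_sum_scaled(2) t t2)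
    have sub: "- ({0} \<union> dual_lat b (t x)) \<subseteq> {z. \<forall>i\<in>I6. b i * (t x * z) \<notin> qZ}"
      "- ({0} \<union> dual_lat b (t x)) \<subseteq> {z. \<forall>i\<in>I6. b i * (q powi x * t x * z) \<notin> qZ}"
    proof -
      have "b i * (q powi x * t x * z) \<in> qZ \<longleftrightarrow> b i * (t x * z) \<in> qZ" for i z
        using qZ_mult_powi_iff[of "b i * (t x * z)" x] by (simp add: mult_ac)
      then show "- ({0} \<union> dual_lat b (t x)) \<subseteq> {z. \<forall>i\<in>I6. b i * (t x * z) \<notin> qZ}"
        "- ({0} \<union> dual_lat b (t x)) \<subseteq> {z. \<forall>i\<in>I6. b i * (q powi x * t x * z) \<notin> qZ}"
        using mem_dual_lat_iff[OF t b(1)] by auto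
    qed
    have ana: "G x analytic_on - ({0} \<union> dual_lat b (t x))"
      unfolding G_eq
      by (intro analytic_intros analytic_on_subset[OF weight_sum_scaled(1)[OF t] sub(1)]
          analytic_on_subset[OF weight_sum_scaled(1)[OF t2] sub(2)])
    have "(G x \<longlongrightarrow> \<alpha> * (0 * 0)) (at 0)"
      unfolding G_eq by (intro tendsto_intros weight_sum_scaled(3) t t2)
    then have lim: "(G x \<longlongrightarrow> 0) (at 0)" by simp
    have feq: "f x z = G x z * ell b (t x * z) / z" if "z \<noteq> 0" "z \<notin> lat b (t x) \<union> dual_lat b (t x)" for z
      using f[OF that] by (simp add: G_def mult_ac)
    have summ: "((\<lambda>k. G x (b j / t x * q powi k)) has_sum T x j) UNIV" if j: "j \<in> I6" for j
    proof -
      have arg: "t x * (b j / t x * q powi k) = b j * q powi k" "q powi x * t x * (b j / t x * q powi k) = b j * q powi (k + x)" for k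
        using t[of x] q_nz by (simp_all add: power_int_add mult_ac)
      have "(\<lambda>k. weight_sum b xs (b j * q powi k) * weight_sum b ys (b j * q powi (k + x))) summable_on UNIV"
        by (rule correlation_has_sum(1)[OF weight_sum_has_sum[OF b(1) j] weight_sum_has_sum[OF b(1) j]])
      then show ?thesis unfolding G_def arg T_def by (intro has_sum_cmult_right has_sum_infsum)
    qed
    show ?thesis
      using elliptic_contour_integral[OF b t sep mero ana lim feq summ] by blast
  qed
  then show "f x contour_integrable_on \<gamma> x" by blast
  have "((\<lambda>x. 2 * pi * \<i> / (qpoch_inf q q)\<^sup>2 * (\<Sum>j\<in>I6. nu b j * T x j)) has_sum
     2 * pi * \<i> / (qpoch_inf q q)\<^sup>2 * (\<Sum>j\<in>I6. nu b j * (\<alpha> * (jackson_sum b xs j * jackson_sum b ys j)))) UNIV"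
    unfolding T_def using b(1)
    by (intro has_sum_cmult_right has_sum_finite_sum correlation_has_sum(2) weight_sum_has_sum) auto
  then show "((\<lambda>x. contour_integral (\<gamma> x) (f x)) has_sum
       2 * pi * \<i> * (\<Sum>j\<in>I6. nu b j * (\<alpha> * (jackson_sum b xs j * jackson_sum b ys j))) / (qpoch_inf q q)\<^sup>2) UNIV"
    using main by simp
qed

lemma rfac_add:
  assumes "generic b"
  shows "rfac b (\<lambda>j. N j + D j) * rfac (shift b N) (\<lambda>_. 0) = rfac (shift b N) D * rfac b N"
proof -
  define m where "m a D = (\<Prod>j\<in>I6. a j powi (2 * D j) * q powi (D j * (D j - 1)))" for a :: "nat \<Rightarrow> complex" and D
  define p where "p a = pair_prod (\<lambda>i j. qpoch_inf q (a i * a j))" for a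
  have r: "rfac a D = 1 / (m a D * p (shift a D))" for a D by (simp add: rfac_def m_def p_def)
  have "m b (\<lambda>j. N j + D j) = m b N * m (shift b N) D"
    unfolding m_def prod.distrib[symmetric]
  proof (rule prod.cong)
    fix j assume "j \<in> I6"
    then have bj: "b j \<noteq> 0" by (rule genericD(1)[OF assms])
    have "(N j + D j) * (N j + D j - 1) = N j * (N j - 1) + (N j * (2 * D j) + D j * (D j - 1))"
      by (simp add: algebra_simps)
    then have "q powi ((N j + D j) * (N j + D j - 1)) =
       q powi (N j * (N j - 1)) * ((q powi N j) powi (2 * D j) * q powi (D j * (D j - 1)))"
      using q_nz by (simp only: power_int_add power_int_mult simp_thms)
    moreover have "b j powi (2 * (N j + D j)) = b j powi (2 * N j) * b j powi (2 * D j)"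
      using bj by (simp add: distrib_left power_int_add)
    ultimately show "b j powi (2 * (N j + D j)) * q powi ((N j + D j) * (N j + D j - 1)) =
       b j powi (2 * N j) * q powi (N j * (N j - 1)) * (shift b N j powi (2 * D j) * q powi (D j * (D j - 1)))"
      by (simp add: shift_def power_int_mult_distrib)
  qed simp
  moreover have "m (shift b N) (\<lambda>_. 0) = 1" by (simp add: m_def)
  ultimately show ?thesis unfolding r shift_shift shift_0 by simp
qed

lemma sum_jackson_sum:
  "(\<Sum>j\<in>I6. nu b j * (jackson_sum b xs j * jackson_sum b ys j)) =
    (\<Sum>x\<leftarrow>xs. \<Sum>y\<leftarrow>ys. fst x * (fst y * hsum b (snd x) (snd y)))"
proof -
  have lin: "(\<Sum>j\<in>I6. \<Sum>x\<leftarrow>zs. F j x) = (\<Sum>x\<leftarrow>zs. \<Sum>j\<in>I6. F j x)" for F and zs :: "(complex \<times> (nat \<Rightarrow> int)) list"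
    by (induction zs) (simp_all add: sum.distrib)
  have "nu b j * (jackson_sum b xs j * jackson_sum b ys j) =
     (\<Sum>x\<leftarrow>xs. \<Sum>y\<leftarrow>ys. nu b j * (fst x * jackson (shift b (snd x)) (b j) * (fst y * jackson (shift b (snd y)) (b j))))" for j
    unfolding jackson_sum_def by (simp only: sum_list_const_mult sum_list_mult_const)
  then show ?thesis unfolding hsum_def lin
    by (simp add: lin sum_distrib_left mult_ac)
qed

text \<open>By \<open>hsum_evaluation\<close> each bilinear sum is a product of a factor for either shift. Hence the coefficients
  enter only through the numbers \<open>v\<close> and \<open>w\<close>.\<close>

lemma sum_jackson_sum_value:
  assumes b: "generic b" "(\<Prod>i\<in>I6. b i) = q" and N: "(\<Sum>i\<in>I6. N i) = 0"
    and xs: "\<forall>x\<in>set xs. (\<Sum>m\<in>I6. snd x m) = 0" "(\<Sum>x\<leftarrow>xs. fst x * rfac b (snd x)) = v * rfac b (\<lambda>_. 0)"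
    and ys: "\<forall>y\<in>set ys. (\<Sum>m\<in>I6. snd y m) = 0"
      "(\<Sum>y\<leftarrow>ys. fst y * rfac (shift b N) (snd y)) = w * rfac (shift b N) (\<lambda>_. 0)"
  shows "(\<Sum>j\<in>I6. nu b j * (jackson_sum b xs j * jackson_sum b (map (\<lambda>y. (fst y, \<lambda>i. N i + snd y i)) ys) j)) =
    - 2 * (qpoch_inf q q)\<^sup>2 * mass b * (v * w * (rfac b N / rfac b (\<lambda>_. 0)))"
proof -
  define r0 where "r0 = rfac b (\<lambda>_. 0)"
  define K where "K = - 2 * (qpoch_inf q q)\<^sup>2 * mass b"
  have r0nz: "r0 \<noteq> 0" unfolding r0_def by (rule rfac_nz[OF b(1)])
  have c0nz: "rfac (shift b N) (\<lambda>_. 0) \<noteq> 0" using b(1) by (intro rfac_nz) simp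
  have h: "hsum b (snd x) (\<lambda>i. N i + snd y i) = K * (rfac b (snd x) / r0) * (rfac (shift b N) (snd y) * rfac b N / (rfac (shift b N) (\<lambda>_. 0) * r0))"
    if "x \<in> set xs" "y \<in> set ys" for x y
  proof -
    have "(\<Sum>m\<in>I6. N m + snd y m) = 0" using N ys(1) that by (simp add: sum.distrib)
    then have "hsum b (snd x) (\<lambda>i. N i + snd y i) = K * (rfac b (snd x) / r0) * (rfac b (\<lambda>i. N i + snd y i) / r0)"
      unfolding K_def r0_def using xs(1) that by (intro hsum_evaluation b) auto
    moreover have "rfac b (\<lambda>i. N i + snd y i) = rfac (shift b N) (snd y) * rfac b N / rfac (shift b N) (\<lambda>_. 0)"
      using rfac_add[OF b(1), of N "snd y"] c0nz by (simp add: eq_divide_eq)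
    ultimately show ?thesis by simp
  qed
  have "(\<Sum>j\<in>I6. nu b j * (jackson_sum b xs j * jackson_sum b (map (\<lambda>y. (fst y, \<lambda>i. N i + snd y i)) ys) j)) =
     (\<Sum>x\<leftarrow>xs. \<Sum>y\<leftarrow>ys. fst x * (fst y * hsum b (snd x) (\<lambda>i. N i + snd y i)))"
    unfolding sum_jackson_sum by (simp add: o_def)
  also have "\<dots> = (\<Sum>x\<leftarrow>xs. \<Sum>y\<leftarrow>ys. K * rfac b N / (r0 * r0 * rfac (shift b N) (\<lambda>_. 0)) *
       ((fst x * rfac b (snd x)) * (fst y * rfac (shift b N) (snd y))))"
    by (intro arg_cong[where f = sum_list] map_cong refl) (simp add: h mult_ac)
  also have "\<dots> = K * rfac b N / (r0 * r0 * rfac (shift b N) (\<lambda>_. 0)) *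
      ((\<Sum>x\<leftarrow>xs. fst x * rfac b (snd x)) * (\<Sum>y\<leftarrow>ys. fst y * rfac (shift b N) (snd y)))"
    by (simp only: sum_list_const_mult sum_list_mult_const)
  also have "\<dots> = K * (v * w * (rfac b N / r0))"
    unfolding xs(2) ys(2) r0_def[symmetric] using r0nz c0nz by simp
  finally show ?thesis by (simp only: K_def r0_def)
qed

lemma mass_rfac_shift:
  assumes b: "generic b"
  shows "shift_factor b N * mass b * (rfac b N / rfac b (\<lambda>_. 0)) =
    1 / shift_factor b N * pair_prod (\<lambda>i j. qpoch_inf q (q / (b i * b j)) / qpoch_inf q (b i * b j * q powi (N i + N j)))"
proof -
  have nz: "b i \<noteq> 0" if "i \<in> I6" for i using genericD(1)[OF b that] .
  define M where "M = shift_factor b N"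
  define P where "P = pair_prod (\<lambda>i j. qpoch_inf q (q / (b i * b j)))"
  define p0 where "p0 = pair_prod (\<lambda>i j. qpoch_inf q (b i * b j))"
  define pN where "pN = pair_prod (\<lambda>i j. qpoch_inf q (b i * b j * q powi (N i + N j)))"
  have Mnz: "M \<noteq> 0" using nz q_nz by (auto simp: M_def shift_factor_def)
  have p0nz: "p0 \<noteq> 0" unfolding p0_def by (intro pair_prod_nz qpoch_inf_nz genericD(3)[OF b])
  have "mass b = P / p0" unfolding mass_def P_def p0_def by (rule pair_prod_divide)
  moreover have "rfac b (\<lambda>_. 0) = 1 / p0" by (simp add: rfac_def p0_def)
  moreover have "rfac b N = 1 / (M * M * pN)"
  proof -
    have "(\<Prod>j\<in>I6. b j powi (2 * N j) * q powi (N j * (N j - 1))) = M * M"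
      unfolding M_def shift_factor_def prod.distrib[symmetric]
    proof (rule prod.cong)
      fix j assume j: "j \<in> I6"
      have "2 * (N j * (N j - 1) div 2) = N j * (N j - 1)" by simp
      then have "q powi (N j * (N j - 1)) = q powi (N j * (N j - 1) div 2) * q powi (N j * (N j - 1) div 2)"
        using q_nz by (metis mult_2 power_int_add)
      moreover have "b j powi (2 * N j) = b j powi N j * b j powi N j"
        using nz[OF j] by (metis mult_2 power_int_add)
      ultimately show "b j powi (2 * N j) * q powi (N j * (N j - 1)) =
         q powi (N j * (N j - 1) div 2) * b j powi N j * (q powi (N j * (N j - 1) div 2) * b j powi N j)"
        by simp
    qed simp
    moreover have "shift b N i * shift b N j = b i * b j * q powi (N i + N j)" for i j
      using q_nz by (simp add: shift_def power_int_add mult_ac)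
    ultimately show ?thesis by (simp add: rfac_def pN_def)
  qed
  ultimately show ?thesis
    unfolding M_def[symmetric] pair_prod_divide P_def[symmetric] pN_def[symmetric] using Mnz p0nz by simp
qed

text \<open>With \<open>y\<close> and \<open>w\<close> the arguments of the two pairs of Rahman functions, the kernel factorises.\<close>

lemma biorth_integrand_eq:
  assumes b: "generic b" "(\<Prod>i\<in>I6. b i) = q" and N: "(\<Sum>i\<in>I6. N i) = 0" and s: "s\<^sup>2 = q"
    and y: "y = s powi (- x) * z" and w: "w = q powi x * y" and gy: "good b y"
  shows "biorth_integrand q s b N c n1 m1 n2 m2 x z =
    - shift_factor b N / (2 * of_real pi * \<i>) *
     ((rahman_aux q n1 (b 1) (b 2) (b 3) (b 4) (b 5) (b 6) y * rahman_aux q m1 (b 1) (b 2) (b 3) (b 4) (b 6) (b 5) y * weight b y) *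
      (rahman_aux q n2 (c 1) (c 2) (c 3) (c 4) (c 5) (c 6) w * rahman_aux q m2 (c 1) (c 2) (c 3) (c 4) (c 6) (c 5) w *
        weight (shift b N) w)) * ell b y / z"
proof -
  have s0: "s \<noteq> 0" using s q_nz by auto
  have y0: "y \<noteq> 0" using gy by (simp add: good_def)
  have z0: "z \<noteq> 0" using y0 y by auto
  have w0: "w \<noteq> 0" using y0 q_nz w by simp
  define S where "S = s powi x"
  have S0: "S \<noteq> 0" using s0 by (simp add: S_def)
  have Sm: "s powi (- x) = 1 / S" by (simp add: S_def power_int_minus divide_inverse)
  have SS: "q powi x = S * S"
    unfolding s[symmetric] S_def power2_eq_square by (rule power_int_mult_distrib)
  have yS: "y = z / S" unfolding y Sm by simp
  have wS: "w = S * z" unfolding w SS yS using S0 by simp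
  have e1: "1 - q powi x * z ^ 2 = 1 - w\<^sup>2" unfolding wS SS by (simp add: power2_eq_square mult_ac)
  have e2: "1 - q powi x * z powi (- 2) = 1 - 1 / y\<^sup>2"
    unfolding yS SS using z0 S0 by (simp add: power_int_minus power2_eq_square divide_inverse)
  have e3: "q * s powi x / (b j * z) = q / (b j * y)" "q * s powi (- x) * z / b j = q * y / b j"
    "q powi N j * s powi x * b j * z = shift b N j * w" "q powi N j * s powi (- x) * b j / z = shift b N j / w" for j
    unfolding yS wS Sm shift_def S_def[symmetric] using z0 S0 by (simp_all add: mult_ac)
  have e4: "s powi (- x) * z + s powi x * inverse z = y + inverse y" "s powi x * z + s powi (- x) * inverse z = w + inverse w"
    unfolding yS wS Sm S_def[symmetric] using z0 S0 by (simp_all add: field_simps)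
  have zp: "q powi (3 * x * x + x) * y powi (6 * x) = q powi x * z powi (6 * x)"
  proof -
    have "S powi (6 * x) = (s powi 2) powi (3 * x * x)"
      unfolding S_def power_int_mult[symmetric] by (simp add: mult_ac)
    then have "S powi (6 * x) = q powi (3 * x * x)" using s by simp
    then show ?thesis unfolding yS using q_nz by (simp add: power_int_divide_distrib power_int_add)
  qed
  define K where "K = (\<Prod>j\<in>I6. (qpoch_inf q (q / (b j * y)) * qpoch_inf q (q * y / b j)) /
      (qpoch_inf q (shift b N j * w) * qpoch_inf q (shift b N j / w)))"
  have K: "K * ((1 - w\<^sup>2) * (1 - 1 / y\<^sup>2)) =
     - shift_factor b N * (q powi x * z powi (6 * x)) * (weight b y * weight (shift b N) w * ell b y)"
    unfolding K_def zp[symmetric] using kernel_eq[OF b N gy w] by (simp only: mult.assoc)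
  have den: "q powi x * z powi (6 * x) \<noteq> 0" using q_nz z0 by simp
  have "(1 - w\<^sup>2) * (1 - 1 / y\<^sup>2) / (q powi x * z powi (6 * x)) * K =
     K * ((1 - w\<^sup>2) * (1 - 1 / y\<^sup>2)) / (q powi x * z powi (6 * x))" by simp
  also have "\<dots> = - shift_factor b N * (weight b y * weight (shift b N) w * ell b y)"
  proof -
    have "- M * D * W / D = - M * W" if "D \<noteq> 0" for M D W :: complex using that by simp
    from this[OF den] show ?thesis unfolding K .
  qed
  finally have base: "(1 - w\<^sup>2) * (1 - 1 / y\<^sup>2) / (q powi x * z powi (6 * x)) * K =
     - shift_factor b N * (weight b y * weight (shift b N) w * ell b y)" .
  show ?thesis
    unfolding biorth_integrand_def Let_def e1 e2 e3 e4 rahman_Q_joukowski[OF y0] rahman_Q_joukowski[OF w0]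
      I6_def[symmetric] K_def[symmetric] base
    by simp
qed

text \<open>The points \<open>s powi (- x)\<close> and \<open>s powi x\<close> differ by an integer power of \<open>q\<close>.\<close>

lemma lat_powi:
  assumes "s\<^sup>2 = q"
  shows "{b j * s powi (- x) * q powi k | j k. j \<in> I6} = lat b (s powi (- x))"
    "{inverse (b j) * s powi (- x) * q powi k | j k. j \<in> I6} = dual_lat b (s powi (- x))"
proof -
  have s0: "s \<noteq> 0" using assms q_nz by auto
  have "q powi x = s powi x * s powi x"
    unfolding assms[symmetric] power2_eq_square by (rule power_int_mult_distrib)
  then have e: "a / s powi (- x) * q powi k = a * s powi (- x) * q powi (k + x)" for a k
    using s0 q_nz by (simp add: power_int_minus power_int_add field_simps)
  have eq: "(\<exists>j k. v = a j * s powi (- x) * q powi k \<and> j \<in> I6) \<longleftrightarrow> (\<exists>j k. v = a j / s powi (- x) * q powi k \<and> j \<in> I6)" for v a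
    unfolding e by (metis diff_add_cancel)
  have "1 / (b j * s powi (- x)) = inverse (b j) / s powi (- x)" for j by (simp add: divide_inverse)
  then show "{b j * s powi (- x) * q powi k | j k. j \<in> I6} = lat b (s powi (- x))"
    "{inverse (b j) * s powi (- x) * q powi k | j k. j \<in> I6} = dual_lat b (s powi (- x))"
    unfolding lat_def dual_lat_def using eq[of _ b] eq[of _ "\<lambda>j. inverse (b j)"] by simp_all
qed

lemma biorthogonality:
  assumes b: "generic b" "(\<Prod>i\<in>I6. b i) = q" and N: "(\<Sum>i\<in>I6. N i) = 0" and s: "s\<^sup>2 = q"
    and \<pi>: "\<pi> permutes I6" and c: "\<And>j. j \<in> I6 \<Longrightarrow> c j = shift b N (\<pi> j)"
    and sep: "\<And>x. separating_contour (biorth_integrand q s b N c n1 m1 n2 m2 x)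
       (lat b (s powi (- x))) (dual_lat b (s powi (- x))) (\<gamma> x)"
  shows "biorth_integrand q s b N c n1 m1 n2 m2 x contour_integrable_on \<gamma> x"
    "((\<lambda>x. contour_integral (\<gamma> x) (biorth_integrand q s b N c n1 m1 n2 m2 x)) has_sum
      of_bool (n1 = m1) * of_bool (n2 = m2) * (2 / shift_factor b N) *
      pair_prod (\<lambda>i j. qpoch_inf q (q / (b i * b j)) / qpoch_inf q (b i * b j * q powi (N i + N j))) *
      norm_factor q b n1 * norm_factor q c n2) UNIV"
proof -
  have s0: "s \<noteq> 0" using s q_nz by auto
  define c0 where "c0 = shift b N"
  define c' where "c' = (\<lambda>i. c0 (\<pi> i))"
  have c': "c 1 = c' 1" "c 2 = c' 2" "c 3 = c' 3" "c 4 = c' 4" "c 5 = c' 5" "c 6 = c' 6"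
    using c by (simp_all add: c'_def c0_def I6_def)
  have gc0: "generic c0" using b(1) by (simp add: c0_def)
  have pc0: "(\<Prod>i\<in>I6. c0 i) = q" using b(2) N by (simp add: c0_def prod_shift)
  have gc': "generic c'" unfolding c'_def by (rule generic_permutes[OF \<pi> gc0])
  have pc': "(\<Prod>i\<in>I6. c' i) = q" using prod.permute[OF \<pi>, of c0] pc0 by (simp add: c'_def o_def)
  define \<phi> where "\<phi> z = rahman_aux q n1 (b 1) (b 2) (b 3) (b 4) (b 5) (b 6) z * rahman_aux q m1 (b 1) (b 2) (b 3) (b 4) (b 6) (b 5) z" for z
  define \<psi> where "\<psi> z = rahman_aux q n2 (c 1) (c 2) (c 3) (c 4) (c 5) (c 6) z * rahman_aux q m2 (c 1) (c 2) (c 3) (c 4) (c 6) (c 5) z" for z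
  define v where "v = of_bool (n1 = m1) * norm_factor q b n1"
  define w where "w = of_bool (n2 = m2) * norm_factor q c n2"
  have nf: "norm_factor q c' n2 = norm_factor q c n2"
  proof -
    have "(\<Prod>i\<in>{1..4}. \<Prod>j\<in>{i<..4}. qpoch q (c' i * c' j) n2) = (\<Prod>i\<in>{1..4}. \<Prod>j\<in>{i<..4}. qpoch q (c i * c j) n2)"
      using c by (intro prod.cong) (auto simp: c'_def c0_def I6_def)
    then show ?thesis unfolding norm_factor_def c' by simp
  qed
  have "reweights b \<phi> v"
    using reweights_rahman[OF b, of n1 m1] unfolding \<phi>_def[abs_def] v_def .
  then obtain xs where xs: "\<forall>x\<in>set xs. (\<Sum>m\<in>I6. snd x m) = 0"
     "\<And>z. good b z \<Longrightarrow> \<phi> z * weight b z = weight_sum b xs z"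
     "(\<Sum>x\<leftarrow>xs. fst x * rfac b (snd x)) = v * rfac b (\<lambda>_. 0)" unfolding reweights_def weight_sum_def by blast
  have "reweights c' \<psi> w"
    using reweights_rahman[OF gc' pc', of n2 m2] unfolding \<psi>_def[abs_def] w_def c' nf .
  then have "reweights c0 \<psi> w" unfolding c'_def by (rule reweights_permutes[OF \<pi>])
  then obtain ys where ys: "\<forall>x\<in>set ys. (\<Sum>m\<in>I6. snd x m) = 0"
     "\<And>z. good c0 z \<Longrightarrow> \<psi> z * weight c0 z = weight_sum c0 ys z"
     "(\<Sum>x\<leftarrow>ys. fst x * rfac c0 (snd x)) = w * rfac c0 (\<lambda>_. 0)" unfolding reweights_def weight_sum_def by blast
  \<comment> \<open>Shifts of \<open>shift b N\<close> are regarded as shifts of \<open>b\<close>.\<close>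
  define ys' where "ys' = map (\<lambda>y. (fst y, \<lambda>i. N i + snd y i)) ys"
  have ys': "weight_sum c0 ys z = weight_sum b ys' z" for z
    by (simp add: weight_sum_def ys'_def c0_def shift_shift o_def)
  define \<alpha> where "\<alpha> = - shift_factor b N / (2 * of_real pi * \<i>)"
  have t: "s powi (- x) \<noteq> 0" for x using s0 by simp
  have f: "biorth_integrand q s b N c n1 m1 n2 m2 x z = \<alpha> * (weight_sum b xs (s powi (- x) * z) *
      weight_sum b ys' (q powi x * (s powi (- x) * z))) * ell b (s powi (- x) * z) / z"
    if z: "z \<noteq> 0" "z \<notin> lat b (s powi (- x)) \<union> dual_lat b (s powi (- x))" for x z
  proof -
    define y where "y = s powi (- x) * z"
    have gy: "good b y"
      using z mem_lat_iff[OF t z(1) b(1)] mem_dual_lat_iff[OF t b(1)] t by (auto simp: good_def y_def)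
    have gw: "good c0 (q powi x * y)" unfolding c0_def good_shift by (rule good_sub[OF gy])
    show ?thesis
      unfolding biorth_integrand_eq[OF b N s y_def refl gy] y_def[symmetric] \<phi>_def[symmetric] \<psi>_def[symmetric]
        c0_def[symmetric] xs(2)[OF gy] ys(2)[OF gw] ys' \<alpha>_def[symmetric] ..
  qed
  note main = reweighted_contour_sum[where t = "\<lambda>x. s powi (- x)" and \<gamma> = \<gamma> and \<alpha> = \<alpha> and xs = xs and ys = ys'
      and f = "biorth_integrand q s b N c n1 m1 n2 m2", OF b t sep]
  show "biorth_integrand q s b N c n1 m1 n2 m2 x contour_integrable_on \<gamma> x"
    by (rule main(1)) (rule f)
  have sums: "((\<lambda>x. contour_integral (\<gamma> x) (biorth_integrand q s b N c n1 m1 n2 m2 x)) has_sum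
    2 * pi * \<i> * (\<Sum>j\<in>I6. nu b j * (\<alpha> * (jackson_sum b xs j * jackson_sum b ys' j))) / (qpoch_inf q q)\<^sup>2) UNIV"
    by (rule main(2)) (rule f)
  have "2 * pi * \<i> * (\<Sum>j\<in>I6. nu b j * (\<alpha> * (jackson_sum b xs j * jackson_sum b ys' j))) / (qpoch_inf q q)\<^sup>2 =
     2 * pi * \<i> * \<alpha> * (\<Sum>j\<in>I6. nu b j * (jackson_sum b xs j * jackson_sum b ys' j)) / (qpoch_inf q q)\<^sup>2"
    by (simp add: sum_distrib_left mult_ac)
  also have "\<dots> = 2 * pi * \<i> * \<alpha> * (- 2 * (qpoch_inf q q)\<^sup>2 * mass b * (v * w * (rfac b N / rfac b (\<lambda>_. 0)))) / (qpoch_inf q q)\<^sup>2"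
    unfolding ys'_def using sum_jackson_sum_value[OF b N xs(1,3) ys(1) ys(3)[unfolded c0_def]] by simp
  also have "\<dots> = 2 * v * w * (shift_factor b N * mass b * (rfac b N / rfac b (\<lambda>_. 0)))"
    using qpoch_inf_q_nz by (simp add: \<alpha>_def)
  also have "\<dots> = of_bool (n1 = m1) * of_bool (n2 = m2) * (2 / shift_factor b N) *
      pair_prod (\<lambda>i j. qpoch_inf q (q / (b i * b j)) / qpoch_inf q (b i * b j * q powi (N i + N j))) *
      norm_factor q b n1 * norm_factor q c n2"
    unfolding mass_rfac_shift[OF b(1)] v_def w_def by (simp add: mult_ac)
  finally show "((\<lambda>x. contour_integral (\<gamma> x) (biorth_integrand q s b N c n1 m1 n2 m2 x)) has_sum
      of_bool (n1 = m1) * of_bool (n2 = m2) * (2 / shift_factor b N) *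
      pair_prod (\<lambda>i j. qpoch_inf q (q / (b i * b j)) / qpoch_inf q (b i * b j * q powi (N i + N j))) *
      norm_factor q b n1 * norm_factor q c n2) UNIV"
    using sums by (simp only:)
qed

end

theorem corollary4p2:
  fixes q s :: complex and b c :: "nat \<Rightarrow> complex" and N :: "nat \<Rightarrow> int"
    and n1 n2 m1 m2 :: nat and \<gamma> :: "int \<Rightarrow> real \<Rightarrow> complex"
  assumes q: "0 < norm q" "norm q < 1" and s: "s ^ 2 = q"
    and prod_b: "(\<Prod>j=1..6. b j) = q"
    and quot: "\<And>i j. 1 \<le> i \<Longrightarrow> i < j \<Longrightarrow> j \<le> 6 \<Longrightarrow> b i / b j \<notin> range (\<lambda>k::int. q powi k)"
    and mult: "\<And>i j. 1 \<le> i \<Longrightarrow> i \<le> j \<Longrightarrow> j \<le> 6 \<Longrightarrow> b i * b j \<notin> range (\<lambda>k::int. q powi k)"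
    and sum_N: "(\<Sum>j=1..6. N j) = 0"
    and c: "\<exists>\<pi>. \<pi> permutes {1..6} \<and> (\<forall>j\<in>{1..6}. c j = b (\<pi> j) * q powi N (\<pi> j))"
    and contour: "\<And>x. separating_contour (biorth_integrand q s b N c n1 m1 n2 m2 x)
        {b j * s powi (- x) * q powi k | j k. j \<in> {1..6}}
        {inverse (b j) * s powi (- x) * q powi k | j k. j \<in> {1..6}} (\<gamma> x)"
  shows "(\<forall>x. biorth_integrand q s b N c n1 m1 n2 m2 x contour_integrable_on \<gamma> x) \<and>
    ((\<lambda>x. contour_integral (\<gamma> x) (biorth_integrand q s b N c n1 m1 n2 m2 x)) has_sum
      (of_bool (n1 = m1) * of_bool (n2 = m2)
       * (2 / (\<Prod>j=1..6. q powi ((N j * (N j - 1)) div 2) * b j powi N j))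
       * (\<Prod>i\<in>{1..6}. \<Prod>j\<in>{i<..6}.
            qpoch_inf q (q / (b i * b j)) / qpoch_inf q (b i * b j * q powi (N i + N j)))
       * norm_factor q b n1 * norm_factor q c n2)) UNIV"
proof -
  interpret nome q by unfold_locales (use q in auto)
  have bnz: "b i \<noteq> 0" if "i \<in> I6" for i
    using prod_b q_nz that prod_zero[of "{1..6}" b] by (auto simp: I6_def)
  have generic: "generic b"
    unfolding generic_def
  proof (intro conjI ballI impI)
    fix i j assume ij: "i \<in> I6" "j \<in> I6"
    show "b i * b j \<notin> qZ"
      using mult[of i j] mult[of j i] ij by (cases "i \<le> j") (auto simp: I6_def qZ_def mult.commute)
    assume "i \<noteq> j"
    then consider "i < j" | "j < i" by linarith
    then show "b i / b j \<notin> qZ"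
    proof cases
      case 1
      then show ?thesis using quot[of i j] ij by (auto simp: I6_def qZ_def)
    next
      case 2
      then have "b j / b i \<notin> qZ" using quot[of j i] ij by (auto simp: I6_def qZ_def)
      then show ?thesis using qZ_inverse[of "b i / b j"] by auto
    qed
  qed (use bnz in auto)
  obtain \<pi> where \<pi>: "\<pi> permutes I6" "\<And>j. j \<in> I6 \<Longrightarrow> c j = shift b N (\<pi> j)"
    using c by (auto simp: I6_def shift_def)
  have sep: "separating_contour (biorth_integrand q s b N c n1 m1 n2 m2 x)
      (lat b (s powi (- x))) (dual_lat b (s powi (- x))) (\<gamma> x)" for x
    using contour[of x] unfolding I6_def[symmetric] lat_powi(1)[OF s, of b x] lat_powi(2)[OF s, of b x] .
  note * = biorthogonality[where \<gamma> = \<gamma>, OF generic prod_b[folded I6_def] sum_N[folded I6_def] s \<pi>(1)]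
  show ?thesis
    unfolding I6_def[symmetric] shift_factor_def[symmetric] pair_prod_def[symmetric]
    by (intro conjI allI *) (use \<pi>(2) sep in auto)
qed

end
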